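(* Let $F$ be a totally real number field, $B$ a totally indefinite quaternion $F$-algebra with a positive involution $*$ given by $\alpha^*=\gamma\bar\alpha\gamma^{-1}$ for some $\gamma\in B^\times$ with $\gamma^2\in F$ totally negative, and let $\mathcal{O}$ be a maximal $O_F$-order in $B$ stable under $*$. Let $p$ be a prime satisfying the standing assumption of the context, let $v$ be a place of $F$ above $p$ that is ramified in $B$, and let $L_v$ be an $(\mathcal{O}_v,\mathcal{O}_v)$-bilattice with structural invariant $(r_1,r_2,t_1,t_2)$. Then there exists a perfect hermitian $(\mathcal{O}_v,*,\mathcal{O}_v)$-pairing $\langle\ ,\ \rangle_v$ on $L_v$ if and only if the following condition holds: $$\begin{cases} r_1=r_2, & \text{if } \mathrm{ord}_{B_v}(\gamma)\text{ is odd};\\ 2\mid r_1,\ 2\mid r_2\ \text{and}\ t_1=t_2, & \text{if }\mathrm{ord}_{B_v}(\gamma)\text{ is even}.\end{cases}$$ Moreover, when this condition holds, up to isometry there is a unique self-dual hermitian $(\mathcal{O}_v,*,\mathcal{O}_v)$-bilattice $(L_v,\langle\ ,\ \rangle_v)$ with structural invariant $(r_1,r_2,t_1,t_2)$.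
   Context: $\alpha\mapsto\bar\alpha$ is the canonical involution. Positivity of $*$ means $\mathrm{Tr}_{B/\mathbb{Q}}(\alpha\alpha^* )>0$ for all nonzero $\alpha\in B$. $F_v,B_v,\mathcal{O}_v=\mathcal{O}\otimes_{O_F}O_{F_v}$ denote completions; since $v$ is ramified in $B$, $B_v$ is a division algebra with normalized discrete valuation $\mathrm{ord}_{B_v}:B_v^\times\twoheadrightarrow\mathbb{Z}$, and $\mathcal{O}_v$ is its unique maximal order. Standing assumption of the paper: if $\mathcal{R}$ is a maximal order in the quaternion $\mathbb{Q}$-algebra $D$ ramified exactly at $\{p,\infty\}$ (the endomorphism ring of a fixed supersingular elliptic curve over an algebraically closed field of characteristic $p$), then $\mathcal{R}\otimes_{\mathbb{Z}}O_F$ is a maximal order in $D\otimes_{\mathbb{Q}}F$ (equivalently, all places of $F$ above $p$ are unramified with odd residue degree). Then $\mathcal{R}_p\otimes_{\mathbb{Z}_p}O_{F_v}\simeq\mathcal{O}_v$, and this is used to view bilattices as $(\mathcal{O}_v,\mathcal{O}_v)$-bilattices. An $(\mathcal{O}_v,\mathcal{O}_v)$-bilattice is a finitely generated $O_{F_v}$-torsion-free $(\mathcal{O}_v,\mathcal{O}_v)$-bimodule on which the left and right actions of $O_{F_v}$ agree. A hermitian $(\mathcal{O}_v,*,\mathcal{O}_v)$-pairing on $L_v$ is an $O_{F_v}$-bilinear pairing $\langle\ ,\ \rangle:L_v\times L_v\to B_v$, non-degenerate on $L_v\otimes F_v$, with $\langle x,y\rangle=\overline{\langle y,x\rangle}$,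 $\langle x\alpha,y\beta\rangle=\bar\alpha\langle x,y\rangle\beta$ and $\langle\alpha x,y\rangle=\langle x,\alpha^*y\rangle$ for all $x,y\in L_v$ and $\alpha,\beta\in\mathcal{O}_v$. It is perfect, and $(L_v,\langle\ ,\ \rangle)$ is called self-dual, if $\{x\in L_v\otimes F_v: \langle x,L_v\rangle\subseteq\mathcal{O}_v\}=L_v$. An isometry is a bimodule isomorphism preserving the pairings. Structural invariant: let $K$ be the unramified quadratic extension of $F_v$ with nontrivial automorphism $\sigma$, embedded in $B_v$, and choose a uniformizer $\pi$ of $F_v$ and $\Pi\in\mathcal{O}_v$ with $\mathcal{O}_v=O_K\oplus O_K\Pi$, $\Pi^2=\pi$, $\Pi a=a^\sigma\Pi$ for $a\in O_K$. Let $\mathbb{O}=\mathcal{O}_v$ and $\mathfrak{P}=\Pi\mathcal{O}_v$ with the natural bimodule structures. For $i=1,2$ let $\mathbb{L}_i$ be the right module $\mathcal{O}_v^{\oplus2}$ of column vectors with left action through $\varphi_i:\mathcal{O}_v\hookrightarrow\mathrm{Mat}_2(\mathcal{O}_v)$, where $\varphi_1(\Pi)=\varphi_2(\Pi)=\begin{bmatrix}0&\pi\\1&0\end{bmatrix}$, $\varphi_1(a)=\mathrm{diag}(a,a^\sigma)$, $\varphi_2(a)=\mathrm{diag}(a^\sigma,a)$ for $a\in O_K$. Every $(\mathcal{O}_v,\mathcal{O}_v)$-bilattice is isomorphic to $\mathbb{O}^{\oplus r_1}\oplus\mathfrak{P}^{\oplus r_2}\oplus\mathbb{L}_1^{\oplus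 t_1}\oplus\mathbb{L}_2^{\oplus t_2}$ for a unique $(r_1,r_2,t_1,t_2)\in\mathbb{Z}_{\ge0}^4$, its structural invariant. *)

theory Defs
  imports
    "HOL-Analysis.Analysis"
    "HOL-Computational_Algebra.Computational_Algebra"
    "HOL-Library.Function_Algebras"
begin

section \<open>Algebras over fields\<close>

definition ring_map :: "('a::ring_1 \<Rightarrow> 'b::ring_1) \<Rightarrow> bool" where
  "ring_map f \<longleftrightarrow> f 1 = 1 \<and> (\<forall>x y. f (x + y) = f x + f y) \<and> (\<forall>x y. f (x * y) = f x * f y)"

text \<open>An algebra \<open>A\<close> over a field \<open>K\<close> is given by its structure map \<open>\<iota> : K \<rightarrow> A\<close>; the scalar
  multiplication is \<open>c \<cdot> x = \<iota> c * x\<close>.\<close>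

abbreviation alg_scale :: "('k::field \<Rightarrow> 'a::ring_1) \<Rightarrow> 'k \<Rightarrow> 'a \<Rightarrow> 'a" where
  "alg_scale \<iota> \<equiv> (\<lambda>c x. \<iota> c * x)"

abbreviation alg_basis :: "('k::field \<Rightarrow> 'a::ring_1) \<Rightarrow> 'a set \<Rightarrow> bool" where
  "alg_basis \<iota> \<equiv> finite_dimensional_vector_space (alg_scale \<iota>)"

definition two_sided_ideal :: "'a::ring_1 set \<Rightarrow> bool" where
  "two_sided_ideal I \<longleftrightarrow>
     0 \<in> I \<and> (\<forall>x\<in>I. \<forall>y\<in>I. x + y \<in> I) \<and> (\<forall>x\<in>I. \<forall>a. a * x \<in> I \<and> x * a \<in> I)"

definition quaternion_algebra :: "('k::field \<Rightarrow> 'a::ring_1) \<Rightarrow> bool" where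
  "quaternion_algebra \<iota> \<longleftrightarrow>
     ring_map \<iota> \<and>
     {z. \<forall>x. z * x = x * z} = range \<iota> \<and>
     (\<forall>I::'a set. two_sided_ideal I \<longrightarrow> I = {0} \<or> I = UNIV) \<and>
     (\<exists>X. alg_basis \<iota> X \<and> card X = 4)"

text \<open>In a quaternion algebra there is exactly one map with these properties.\<close>

definition canonical_involution :: "('k::field \<Rightarrow> 'a::ring_1) \<Rightarrow> ('a \<Rightarrow> 'a) \<Rightarrow> bool" where
  "canonical_involution \<iota> cj \<longleftrightarrow>
     (\<forall>x y. cj (x + y) = cj x + cj y) \<and>
     (\<forall>c. cj (\<iota> c) = \<iota> c) \<and>
     (\<forall>x y. cj (x * y) = cj y * cj x) \<and>
     (\<forall>x. cj (cj x) = x) \<and>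
     (\<forall>x. x + cj x \<in> range \<iota> \<and> x * cj x \<in> range \<iota>)"

text \<open>The trace of the \<open>K\<close>-linear map \<open>x \<mapsto> a * x\<close>, computed in some basis.\<close>

definition alg_trace :: "('k::field \<Rightarrow> 'a::ring_1) \<Rightarrow> 'a \<Rightarrow> 'k" where
  "alg_trace \<iota> a =
     (let X = (SOME X. alg_basis \<iota> X)
      in \<Sum>x\<in>X. module.representation (alg_scale \<iota>) X (a * x) x)"

text \<open>\<open>A'\<close>, with the maps \<open>\<iota>' : K' \<rightarrow> A'\<close> and \<open>jA : A \<rightarrow> A'\<close>, is the tensor product of \<open>A\<close> with
  \<open>K'\<close> over \<open>K\<close>, where \<open>K'\<close> is an extension of \<open>K\<close> via \<open>j\<close> and \<open>A\<close> is finite-dimensional over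
  \<open>K\<close>: some, equivalently every, \<open>K\<close>-basis of \<open>A\<close> is carried to a \<open>K'\<close>-basis of \<open>A'\<close>.\<close>

definition base_change ::
  "('k::field \<Rightarrow> 'a::ring_1) \<Rightarrow> ('k \<Rightarrow> 'k2::field) \<Rightarrow> ('k2 \<Rightarrow> 'a2::ring_1) \<Rightarrow> ('a \<Rightarrow> 'a2) \<Rightarrow> bool" where
  "base_change \<iota> j \<iota>' jA \<longleftrightarrow>
     ring_map j \<and> ring_map \<iota>' \<and> ring_map jA \<and>
     (\<forall>c x. \<iota>' c * x = x * \<iota>' c) \<and>
     (\<forall>c. jA (\<iota> c) = \<iota>' (j c)) \<and>
     (\<exists>X. alg_basis \<iota> X \<and> inj_on jA X \<and> alg_basis \<iota>' (jA ` X))"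

section \<open>Orders\<close>

text \<open>The module generated by \<open>Y\<close> over a subring \<open>S\<close> of the scalars.\<close>

definition span_over :: "('c \<Rightarrow> 'm::ab_group_add \<Rightarrow> 'm) \<Rightarrow> 'c set \<Rightarrow> 'm set \<Rightarrow> 'm set" where
  "span_over sc S Y =
     {\<Sum>x\<in>X. sc (c x) x | c X. finite X \<and> X \<subseteq> Y \<and> (\<forall>x\<in>X. c x \<in> S)}"

definition is_order :: "('k::field \<Rightarrow> 'a::ring_1) \<Rightarrow> 'k set \<Rightarrow> 'a set \<Rightarrow> bool" where
  "is_order \<iota> S R \<longleftrightarrow>
     1 \<in> R \<and> (\<forall>x\<in>R. \<forall>y\<in>R. x + y \<in> R \<and> x - y \<in> R \<and> x * y \<in> R) \<and>
     (\<exists>X. finite X \<and> R = span_over (alg_scale \<iota>) S X) \<and>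
     span_over (alg_scale \<iota>) UNIV R = UNIV"

definition maximal_order :: "('k::field \<Rightarrow> 'a::ring_1) \<Rightarrow> 'k set \<Rightarrow> 'a set \<Rightarrow> bool" where
  "maximal_order \<iota> S R \<longleftrightarrow>
     is_order \<iota> S R \<and> (\<forall>R'. is_order \<iota> S R' \<and> R \<subseteq> R' \<longrightarrow> R' = R)"

text \<open>Base change of an order: the image of \<open>R \<otimes> S'\<close> in \<open>A'\<close>. It is used only where
  \<open>R \<otimes> S' \<rightarrow> A'\<close> is injective, by flatness.\<close>

definition order_base_change ::
  "('k2::field \<Rightarrow> 'a2::ring_1) \<Rightarrow> ('a \<Rightarrow> 'a2) \<Rightarrow> 'k2 set \<Rightarrow> 'a set \<Rightarrow> 'a2 set" where
  "order_base_change \<iota>' jA S' R = span_over (alg_scale \<iota>') S' (jA ` R)"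

section \<open>Number fields and places\<close>

definition number_field :: "'f::field_char_0 itself \<Rightarrow> bool" where
  "number_field _ \<longleftrightarrow> (\<exists>X. alg_basis (of_rat :: rat \<Rightarrow> 'f) X)"

definition totally_real :: "'f::field_char_0 itself \<Rightarrow> bool" where
  "totally_real _ \<longleftrightarrow> (\<forall>s :: 'f \<Rightarrow> complex. ring_map s \<longrightarrow> range s \<subseteq> \<real>)"

definition ring_of_integers :: "'f::field_char_0 set" where
  "ring_of_integers = {x. algebraic_int x}"

definition absolute_value :: "('k::field \<Rightarrow> real) \<Rightarrow> bool" where
  "absolute_value w \<longleftrightarrow>
     (\<forall>x. w x \<ge> 0) \<and> (\<forall>x. w x = 0 \<longleftrightarrow> x = 0) \<and>
     (\<forall>x y. w (x * y) = w x * w y) \<and> (\<forall>x y. w (x + y) \<le> w x + w y)"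

text \<open>A place is represented by any absolute value in its class.\<close>

definition place :: "('k::field \<Rightarrow> real) \<Rightarrow> bool" where
  "place w \<longleftrightarrow> absolute_value w \<and> (\<exists>x. x \<noteq> 0 \<and> w x \<noteq> 1)"

definition place_above :: "nat \<Rightarrow> ('k::field \<Rightarrow> real) \<Rightarrow> bool" where
  "place_above p w \<longleftrightarrow> place w \<and> w (of_nat p) < 1"

definition archimedean_place :: "('k::field \<Rightarrow> real) \<Rightarrow> bool" where
  "archimedean_place w \<longleftrightarrow> place w \<and> (\<exists>n::nat. w (of_nat n) > 1)"

definition null_seq :: "('k::field \<Rightarrow> real) \<Rightarrow> (nat \<Rightarrow> 'k) \<Rightarrow> bool" where
  "null_seq w s \<longleftrightarrow> (\<lambda>n. w (s n)) \<longlonglongrightarrow> 0"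

definition cauchy_seq :: "('k::field \<Rightarrow> real) \<Rightarrow> (nat \<Rightarrow> 'k) \<Rightarrow> bool" where
  "cauchy_seq w s \<longleftrightarrow> (\<forall>e>0. \<exists>M. \<forall>m\<ge>M. \<forall>n\<ge>M. w (s m - s n) < e)"

definition field_completion ::
  "('f::field \<Rightarrow> real) \<Rightarrow> ('f \<Rightarrow> 'fv::field) \<Rightarrow> ('fv \<Rightarrow> real) \<Rightarrow> bool" where
  "field_completion w j wv \<longleftrightarrow>
     absolute_value wv \<and> ring_map j \<and> (\<forall>x. wv (j x) = w x) \<and>
     (\<forall>y. \<forall>e>0. \<exists>x. wv (y - j x) < e) \<and>
     (\<forall>s. cauchy_seq wv s \<longrightarrow> (\<exists>l. null_seq wv (\<lambda>n. s n - l)))"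

definition valuation_ring :: "('k::field \<Rightarrow> real) \<Rightarrow> 'k set" where
  "valuation_ring wv = {x. wv x \<le> 1}"

definition uniformizer :: "('k::field \<Rightarrow> real) \<Rightarrow> 'k \<Rightarrow> bool" where
  "uniformizer wv u \<longleftrightarrow> u \<noteq> 0 \<and> wv u < 1 \<and> (\<forall>x. wv x < 1 \<longrightarrow> wv x \<le> wv u)"

text \<open>The completion \<open>A\<^sub>w\<close> of a finite-dimensional \<open>K\<close>-algebra \<open>A\<close> at a place \<open>w\<close> of \<open>K\<close> is the
  ring of Cauchy sequences in \<open>A\<close> modulo null sequences, both taken coordinatewise, that is,
  tested on all linear functionals. The algebra is ramified at \<open>w\<close> if \<open>A\<^sub>w\<close> is a division
  ring. Sequences are used because the completions at all places of \<open>K\<close> cannot be named as types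
  within one formula.\<close>

definition alg_null_seq :: "('k::field \<Rightarrow> 'a::ring_1) \<Rightarrow> ('k \<Rightarrow> real) \<Rightarrow> (nat \<Rightarrow> 'a) \<Rightarrow> bool" where
  "alg_null_seq \<iota> w s \<longleftrightarrow>
     (\<forall>f. Vector_Spaces.linear (alg_scale \<iota>) (*) f \<longrightarrow> null_seq w (\<lambda>n. f (s n)))"

definition alg_cauchy_seq :: "('k::field \<Rightarrow> 'a::ring_1) \<Rightarrow> ('k \<Rightarrow> real) \<Rightarrow> (nat \<Rightarrow> 'a) \<Rightarrow> bool" where
  "alg_cauchy_seq \<iota> w s \<longleftrightarrow>
     (\<forall>f. Vector_Spaces.linear (alg_scale \<iota>) (*) f \<longrightarrow> cauchy_seq w (\<lambda>n. f (s n)))"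

definition ramified_at :: "('k::field \<Rightarrow> 'a::ring_1) \<Rightarrow> ('k \<Rightarrow> real) \<Rightarrow> bool" where
  "ramified_at \<iota> w \<longleftrightarrow>
     (\<forall>x. alg_cauchy_seq \<iota> w x \<and> \<not> alg_null_seq \<iota> w x \<longrightarrow>
        (\<exists>y. alg_cauchy_seq \<iota> w y \<and>
             alg_null_seq \<iota> w (\<lambda>n. x n * y n - 1) \<and>
             alg_null_seq \<iota> w (\<lambda>n. y n * x n - 1)))"

text \<open>The tensor product of \<open>A\<close> with the real numbers along a real embedding \<open>s\<close> of \<open>K\<close> is
  isomorphic to \<open>Mat\<^sub>2\<close> of the reals: the spanning condition makes the induced homomorphism from
  the tensor product surjective, hence bijective because both sides have dimension 4.\<close>

definition split_at_real :: "('k::field \<Rightarrow> 'a::ring_1) \<Rightarrow> ('k \<Rightarrow> real) \<Rightarrow> bool" where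
  "split_at_real \<iota> s \<longleftrightarrow>
     (\<exists>f :: 'a \<Rightarrow> real^2^2.
        f 1 = mat 1 \<and> (\<forall>x y. f (x + y) = f x + f y) \<and> (\<forall>x y. f (x * y) = f x ** f y) \<and>
        (\<forall>c x. f (\<iota> c * x) = s c *\<^sub>R f x) \<and> span (range f) = UNIV)"

definition totally_indefinite :: "('f::field_char_0 \<Rightarrow> 'b::ring_1) \<Rightarrow> bool" where
  "totally_indefinite \<iota> \<longleftrightarrow> (\<forall>s :: 'f \<Rightarrow> real. ring_map s \<longrightarrow> split_at_real \<iota> s)"

definition totally_negative :: "'f::field_char_0 \<Rightarrow> bool" where
  "totally_negative c \<longleftrightarrow> (\<forall>s :: 'f \<Rightarrow> real. ring_map s \<longrightarrow> s c < 0)"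

text \<open>The trace of \<open>B\<close> over the rationals is that of the regular representation, which is twice
  the composite of the reduced trace and the trace of \<open>F\<close>.\<close>

definition positive_involution :: "('f::field_char_0 \<Rightarrow> 'b::ring_1) \<Rightarrow> ('b \<Rightarrow> 'b) \<Rightarrow> bool" where
  "positive_involution \<iota> star \<longleftrightarrow>
     (\<forall>x y. star (x + y) = star x + star y) \<and>
     (\<forall>x y. star (x * y) = star y * star x) \<and>
     (\<forall>x. star (star x) = x) \<and>
     (\<forall>a. a \<noteq> 0 \<longrightarrow> alg_trace (\<lambda>q::rat. \<iota> (of_rat q)) (a * star a) > 0)"

text \<open>\<open>R\<close> is a maximal order in the quaternion algebra \<open>D\<close> over the rationals ramified exactly at
  \<open>p\<close> and infinity, \<open>D'\<close> is the tensor product of \<open>D\<close> with \<open>F\<close>, and the tensor product of \<open>R\<close>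
  with the ring of integers of \<open>F\<close> is a maximal order in \<open>D'\<close>.\<close>

definition standing_assumption ::
  "nat \<Rightarrow> (rat \<Rightarrow> 'd::ring_1) \<Rightarrow> 'd set \<Rightarrow>
   ('f::field_char_0 \<Rightarrow> 'd2::ring_1) \<Rightarrow> ('d \<Rightarrow> 'd2) \<Rightarrow> bool" where
  "standing_assumption p \<iota>D R \<iota>D' jD \<longleftrightarrow>
     quaternion_algebra \<iota>D \<and>
     (\<forall>w. place w \<longrightarrow> (ramified_at \<iota>D w \<longleftrightarrow> place_above p w \<or> archimedean_place w)) \<and>
     maximal_order \<iota>D \<int> R \<and>
     base_change \<iota>D of_rat \<iota>D' jD \<and>
     maximal_order \<iota>D' ring_of_integers (order_base_change \<iota>D' jD ring_of_integers R)"

section \<open>The local quaternion algebra\<close>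

definition normalized_valuation ::
  "('k::field \<Rightarrow> 'a::ring_1) \<Rightarrow> ('k \<Rightarrow> real) \<Rightarrow> ('a \<Rightarrow> int) \<Rightarrow> bool" where
  "normalized_valuation \<iota> wv ord \<longleftrightarrow>
     (\<forall>x y. x \<noteq> 0 \<and> y \<noteq> 0 \<longrightarrow> ord (x * y) = ord x + ord y) \<and>
     (\<forall>x y. x \<noteq> 0 \<and> y \<noteq> 0 \<and> x + y \<noteq> 0 \<longrightarrow> ord (x + y) \<ge> min (ord x) (ord y)) \<and>
     ord ` {x. x \<noteq> 0} = UNIV \<and>
     (\<forall>c. c \<noteq> 0 \<longrightarrow> (ord (\<iota> c) \<ge> 0 \<longleftrightarrow> wv c \<le> 1))"

definition integral_closure :: "('k::field \<Rightarrow> 'a::ring_1) \<Rightarrow> 'k set \<Rightarrow> 'a set \<Rightarrow> 'a set" where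
  "integral_closure \<iota> S K =
     {x \<in> K. \<exists>n c. (\<forall>i<n. c i \<in> S) \<and> x ^ n + (\<Sum>i<n. \<iota> (c i) * x ^ i) = 0}"

definition quadratic_subfield :: "('k::field \<Rightarrow> 'a::ring_1) \<Rightarrow> 'a set \<Rightarrow> bool" where
  "quadratic_subfield \<iota> K \<longleftrightarrow>
     range \<iota> \<subseteq> K \<and>
     (\<forall>x\<in>K. \<forall>y\<in>K. x + y \<in> K \<and> x * y \<in> K \<and> x * y = y * x) \<and>
     (\<forall>x\<in>K. x \<noteq> 0 \<longrightarrow> (\<exists>y\<in>K. x * y = 1)) \<and>
     vector_space.dim (alg_scale \<iota>) K = 2"

text \<open>Unramified means that a uniformizer of the base field still generates the maximal ideal of
  the ring of integers of \<open>K\<close>; residue fields are finite here, so separability is automatic.\<close>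

definition unramified_quadratic ::
  "('k::field \<Rightarrow> 'a::ring_1) \<Rightarrow> ('k \<Rightarrow> real) \<Rightarrow> 'a set \<Rightarrow> bool" where
  "unramified_quadratic \<iota> wv K \<longleftrightarrow>
     quadratic_subfield \<iota> K \<and>
     (let OK = integral_closure \<iota> (valuation_ring wv) K in
      \<forall>u. uniformizer wv u \<longrightarrow>
        (\<forall>x\<in>OK. (\<exists>y\<in>OK. x * y = 1) \<or> (\<exists>y\<in>OK. x = \<iota> u * y)))"

definition nontrivial_automorphism ::
  "('k::field \<Rightarrow> 'a::ring_1) \<Rightarrow> 'a set \<Rightarrow> ('a \<Rightarrow> 'a) \<Rightarrow> bool" where
  "nontrivial_automorphism \<iota> K s \<longleftrightarrow>
     bij_betw s K K \<and>
     (\<forall>x\<in>K. \<forall>y\<in>K. s (x + y) = s x + s y \<and> s (x * y) = s x * s y) \<and>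
     (\<forall>c. s (\<iota> c) = \<iota> c) \<and> (\<exists>x\<in>K. s x \<noteq> x)"

text \<open>\<open>Pu\<close> is the element usually written as a capital pi, which is reserved notation in
  Isabelle. The presentation is \<open>Ov = OK \<oplus> OK Pu\<close>, \<open>Pu\<^sup>2 = \<pi>\<close>, \<open>Pu a = s a Pu\<close>.\<close>

definition local_presentation ::
  "('k::field \<Rightarrow> 'a::ring_1) \<Rightarrow> ('k \<Rightarrow> real) \<Rightarrow> 'a set \<Rightarrow>
   'a set \<Rightarrow> ('a \<Rightarrow> 'a) \<Rightarrow> 'k \<Rightarrow> 'a \<Rightarrow> bool" where
  "local_presentation \<iota> wv Ov K s \<pi> Pu \<longleftrightarrow>
     unramified_quadratic \<iota> wv K \<and> nontrivial_automorphism \<iota> K s \<and> uniformizer wv \<pi> \<and>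
     Pu \<in> Ov \<and> Pu * Pu = \<iota> \<pi> \<and>
     (let OK = integral_closure \<iota> (valuation_ring wv) K in
        Ov = {a + b * Pu | a b. a \<in> OK \<and> b \<in> OK} \<and>
        (\<forall>a\<in>OK. \<forall>b\<in>OK. a + b * Pu = 0 \<longrightarrow> a = 0 \<and> b = 0) \<and>
        (\<forall>a\<in>OK. Pu * a = s a * Pu))"

text \<open>The ring embedding of \<open>Ov\<close> into \<open>Mat\<^sub>2(Ov)\<close> sending \<open>Pu\<close> to the matrix with rows
  \<open>(0, \<pi>)\<close>, \<open>(1, 0)\<close> and \<open>a \<in> OK\<close> to \<open>diag(d1 a, d2 a)\<close>. It is determined by
  these values on \<open>Ov\<close>, and only its values there matter.\<close>

definition matrix_embedding ::
  "('k::field \<Rightarrow> 'a::ring_1) \<Rightarrow> 'a set \<Rightarrow> 'a set \<Rightarrow> 'k \<Rightarrow> 'a \<Rightarrow>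
   ('a \<Rightarrow> 'a) \<Rightarrow> ('a \<Rightarrow> 'a) \<Rightarrow> ('a \<Rightarrow> 'a^2^2) \<Rightarrow> bool" where
  "matrix_embedding \<iota> Ov OK \<pi> Pu d1 d2 \<phi> \<longleftrightarrow>
     \<phi> 1 = mat 1 \<and>
     (\<forall>x\<in>Ov. \<forall>y\<in>Ov. \<phi> (x + y) = \<phi> x + \<phi> y \<and> \<phi> (x * y) = \<phi> x ** \<phi> y) \<and>
     \<phi> Pu = vector [vector [0, \<iota> \<pi>], vector [1, 0]] \<and>
     (\<forall>a\<in>OK. \<phi> a = vector [vector [d1 a, 0], vector [0, d2 a]])"

section \<open>Bilattices\<close>

text \<open>Only the restrictions of the two actions to scalars in the order and vectors in the carrier
  are meaningful; the addition is that of the ambient type.\<close>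

record ('s, 'l) bimodule =
  bcarrier :: "'l set"
  lact :: "'s \<Rightarrow> 'l \<Rightarrow> 'l"
  ract :: "'l \<Rightarrow> 's \<Rightarrow> 'l"

definition is_bimodule :: "'s::ring_1 set \<Rightarrow> ('s, 'l::ab_group_add) bimodule \<Rightarrow> bool" where
  "is_bimodule S M \<longleftrightarrow>
     0 \<in> bcarrier M \<and>
     (\<forall>x\<in>bcarrier M. \<forall>y\<in>bcarrier M. x + y \<in> bcarrier M \<and> x - y \<in> bcarrier M) \<and>
     (\<forall>a\<in>S. \<forall>x\<in>bcarrier M. lact M a x \<in> bcarrier M \<and> ract M x a \<in> bcarrier M) \<and>
     (\<forall>a\<in>S. \<forall>x\<in>bcarrier M. \<forall>y\<in>bcarrier M.
        lact M a (x + y) = lact M a x + lact M a y \<and>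
        ract M (x + y) a = ract M x a + ract M y a) \<and>
     (\<forall>a\<in>S. \<forall>b\<in>S. \<forall>x\<in>bcarrier M.
        lact M (a + b) x = lact M a x + lact M b x \<and>
        ract M x (a + b) = ract M x a + ract M x b \<and>
        lact M (a * b) x = lact M a (lact M b x) \<and>
        ract M x (a * b) = ract M (ract M x a) b \<and>
        lact M a (ract M x b) = ract M (lact M a x) b) \<and>
     (\<forall>x\<in>bcarrier M. lact M 1 x = x \<and> ract M x 1 = x)"

text \<open>In the following, \<open>S\<close> is the ring of integers of the base field and \<open>R\<close> an order over
  it. As \<open>R\<close> is a finite \<open>S\<close>-module, finite generation over \<open>S\<close> and as a bimodule agree.\<close>

definition bilattice ::
  "('k::field \<Rightarrow> 's::ring_1) \<Rightarrow> 'k set \<Rightarrow> 's set \<Rightarrow> ('s, 'l::ab_group_add) bimodule \<Rightarrow> bool" where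
  "bilattice \<iota> S R L \<longleftrightarrow>
     is_bimodule R L \<and>
     (\<forall>c\<in>S. \<forall>x\<in>bcarrier L. lact L (\<iota> c) x = ract L x (\<iota> c)) \<and>
     (\<forall>c\<in>S. \<forall>x\<in>bcarrier L. lact L (\<iota> c) x = 0 \<longrightarrow> c = 0 \<or> x = 0) \<and>
     (\<exists>X. finite X \<and> bcarrier L = span_over (\<lambda>c. lact L (\<iota> c)) S X \<and> X \<subseteq> bcarrier L)"

definition bimodule_iso ::
  "'s set \<Rightarrow> ('s, 'l::ab_group_add) bimodule \<Rightarrow> ('s, 'm::ab_group_add) bimodule \<Rightarrow>
   ('l \<Rightarrow> 'm) \<Rightarrow> bool" where
  "bimodule_iso R L M f \<longleftrightarrow>
     bij_betw f (bcarrier L) (bcarrier M) \<and>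
     (\<forall>x\<in>bcarrier L. \<forall>y\<in>bcarrier L. f (x + y) = f x + f y) \<and>
     (\<forall>a\<in>R. \<forall>x\<in>bcarrier L. f (lact L a x) = lact M a (f x) \<and> f (ract L x a) = ract M (f x) a)"

definition bimodule_sum ::
  "('s, 'l) bimodule \<Rightarrow> ('s, 'm) bimodule \<Rightarrow> ('s, 'l \<times> 'm) bimodule" where
  "bimodule_sum L M =
     \<lparr>bcarrier = bcarrier L \<times> bcarrier M,
      lact = (\<lambda>a (x, y). (lact L a x, lact M a y)),
      ract = (\<lambda>(x, y) a. (ract L x a, ract M y a))\<rparr>"

definition bimodule_power :: "nat \<Rightarrow> ('s, 'l::zero) bimodule \<Rightarrow> ('s, nat \<Rightarrow> 'l) bimodule" where
  "bimodule_power n L =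
     \<lparr>bcarrier = {f. (\<forall>i<n. f i \<in> bcarrier L) \<and> (\<forall>i\<ge>n. f i = 0)},
      lact = (\<lambda>a f i. if i < n then lact L a (f i) else 0),
      ract = (\<lambda>f a i. if i < n then ract L (f i) a else 0)\<rparr>"

text \<open>A subset of the ring, with its multiplication on both sides.\<close>

definition natural_bimodule :: "'s::ring_1 set \<Rightarrow> ('s, 's) bimodule" where
  "natural_bimodule I = \<lparr>bcarrier = I, lact = (*), ract = (*)\<rparr>"

definition column_bimodule :: "'s::ring_1 set \<Rightarrow> ('s \<Rightarrow> 's^2^2) \<Rightarrow> ('s, 's^2) bimodule" where
  "column_bimodule R \<phi> =
     \<lparr>bcarrier = {x. \<forall>i. x $ i \<in> R},
      lact = (\<lambda>a x. \<phi> a *v x),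
      ract = (\<lambda>x a. \<chi> i. x $ i * a)\<rparr>"

definition has_structural_invariant ::
  "('k::field \<Rightarrow> 's::ring_1) \<Rightarrow> ('k \<Rightarrow> real) \<Rightarrow> 's set \<Rightarrow>
   's set \<Rightarrow> ('s \<Rightarrow> 's) \<Rightarrow> 'k \<Rightarrow> 's \<Rightarrow>
   ('s, 'l::ab_group_add) bimodule \<Rightarrow> nat \<times> nat \<times> nat \<times> nat \<Rightarrow> bool" where
  "has_structural_invariant \<iota> wv Ov K s \<pi> Pu L = (\<lambda>(r1, r2, t1, t2).
     (let OK = integral_closure \<iota> (valuation_ring wv) K in
      \<exists>\<phi>1 \<phi>2. matrix_embedding \<iota> Ov OK \<pi> Pu (\<lambda>a. a) s \<phi>1 \<and>
              matrix_embedding \<iota> Ov OK \<pi> Pu s (\<lambda>a. a) \<phi>2 \<and>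
        (\<exists>f. bimodule_iso Ov L
           (bimodule_sum (bimodule_power r1 (natural_bimodule Ov))
           (bimodule_sum (bimodule_power r2 (natural_bimodule ((*) Pu ` Ov)))
           (bimodule_sum (bimodule_power t1 (column_bimodule Ov \<phi>1))
                         (bimodule_power t2 (column_bimodule Ov \<phi>2))))) f)))"

section \<open>Hermitian pairings\<close>

text \<open>For a torsion-free module \<open>L\<close> over a domain \<open>S\<close> with fraction field \<open>K\<close>, the tensor
  product of \<open>L\<close> with \<open>K\<close> is realised as the module of fractions \<open>x/c\<close> with \<open>x \<in> L\<close> and
  \<open>0 \<noteq> c \<in> S\<close>.\<close>

definition fraction_rel ::
  "('k::field \<Rightarrow> 's::ring_1) \<Rightarrow> 'k set \<Rightarrow> ('s, 'l::ab_group_add) bimodule \<Rightarrow>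
   (('l \<times> 'k) \<times> ('l \<times> 'k)) set" where
  "fraction_rel \<iota> S L =
     {((x, c), (y, d)). x \<in> bcarrier L \<and> y \<in> bcarrier L \<and> c \<in> S - {0} \<and> d \<in> S - {0} \<and>
        lact L (\<iota> d) x = lact L (\<iota> c) y}"

definition fraction_module ::
  "('k::field \<Rightarrow> 's::ring_1) \<Rightarrow> 'k set \<Rightarrow> ('s, 'l::ab_group_add) bimodule \<Rightarrow> ('l \<times> 'k) set set" where
  "fraction_module \<iota> S L = (bcarrier L \<times> (S - {0})) // fraction_rel \<iota> S L"

definition to_fraction ::
  "('k::field \<Rightarrow> 's::ring_1) \<Rightarrow> 'k set \<Rightarrow> ('s, 'l::ab_group_add) bimodule \<Rightarrow> 'l \<Rightarrow> ('l \<times> 'k) set" where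
  "to_fraction \<iota> S L x = fraction_rel \<iota> S L `` {(x, 1)}"

text \<open>The extension of a bilinear pairing: \<open>\<langle>x/c, y/d\<rangle> = \<langle>x, y\<rangle>/(c d)\<close>.\<close>

definition extend_pairing ::
  "('k::field \<Rightarrow> 's::ring_1) \<Rightarrow> ('l \<Rightarrow> 'l \<Rightarrow> 's) \<Rightarrow> ('l \<times> 'k) set \<Rightarrow> ('l \<times> 'k) set \<Rightarrow> 's" where
  "extend_pairing \<iota> h X Y =
     (THE z. \<forall>(x, c)\<in>X. \<forall>(y, d)\<in>Y. z = \<iota> (inverse (c * d)) * h x y)"

definition hermitian_pairing ::
  "('k::field \<Rightarrow> 's::ring_1) \<Rightarrow> 'k set \<Rightarrow> 's set \<Rightarrow> ('s \<Rightarrow> 's) \<Rightarrow> ('s \<Rightarrow> 's) \<Rightarrow>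
   ('s, 'l::ab_group_add) bimodule \<Rightarrow> ('l \<Rightarrow> 'l \<Rightarrow> 's) \<Rightarrow> bool" where
  "hermitian_pairing \<iota> S R cj star L h \<longleftrightarrow>
     (\<forall>x\<in>bcarrier L. \<forall>y\<in>bcarrier L. \<forall>z\<in>bcarrier L.
        h (x + y) z = h x z + h y z \<and> h x (y + z) = h x y + h x z) \<and>
     (\<forall>c\<in>S. \<forall>x\<in>bcarrier L. \<forall>y\<in>bcarrier L.
        h (lact L (\<iota> c) x) y = \<iota> c * h x y \<and> h x (lact L (\<iota> c) y) = \<iota> c * h x y) \<and>
     (\<forall>X\<in>fraction_module \<iota> S L.
        (\<forall>Y\<in>fraction_module \<iota> S L. extend_pairing \<iota> h X Y = 0) \<longrightarrow> X = to_fraction \<iota> S L 0) \<and>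
     (\<forall>x\<in>bcarrier L. \<forall>y\<in>bcarrier L. h x y = cj (h y x)) \<and>
     (\<forall>x\<in>bcarrier L. \<forall>y\<in>bcarrier L. \<forall>a\<in>R. \<forall>b\<in>R.
        h (ract L x a) (ract L y b) = cj a * h x y * b) \<and>
     (\<forall>x\<in>bcarrier L. \<forall>y\<in>bcarrier L. \<forall>a\<in>R. h (lact L a x) y = h x (lact L (star a) y))"

definition perfect_hermitian_pairing ::
  "('k::field \<Rightarrow> 's::ring_1) \<Rightarrow> 'k set \<Rightarrow> 's set \<Rightarrow> ('s \<Rightarrow> 's) \<Rightarrow> ('s \<Rightarrow> 's) \<Rightarrow>
   ('s, 'l::ab_group_add) bimodule \<Rightarrow> ('l \<Rightarrow> 'l \<Rightarrow> 's) \<Rightarrow> bool" where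
  "perfect_hermitian_pairing \<iota> S R cj star L h \<longleftrightarrow>
     hermitian_pairing \<iota> S R cj star L h \<and>
     {X \<in> fraction_module \<iota> S L.
        \<forall>y\<in>bcarrier L. extend_pairing \<iota> h X (to_fraction \<iota> S L y) \<in> R} =
     to_fraction \<iota> S L ` bcarrier L"

definition isometric ::
  "'s set \<Rightarrow> ('s, 'l::ab_group_add) bimodule \<Rightarrow> ('l \<Rightarrow> 'l \<Rightarrow> 's) \<Rightarrow>
   ('s, 'm::ab_group_add) bimodule \<Rightarrow> ('m \<Rightarrow> 'm \<Rightarrow> 's) \<Rightarrow> bool" where
  "isometric R L h M k \<longleftrightarrow>
     (\<exists>f. bimodule_iso R L M f \<and> (\<forall>x\<in>bcarrier L. \<forall>y\<in>bcarrier L. k (f x) (f y) = h x y))"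

definition parity_condition :: "int \<Rightarrow> nat \<Rightarrow> nat \<Rightarrow> nat \<Rightarrow> nat \<Rightarrow> bool" where
  "parity_condition n r1 r2 t1 t2 \<longleftrightarrow>
     (if odd n then r1 = r2 else 2 dvd r1 \<and> 2 dvd r2 \<and> t1 = t2)"

end

theory Submission
  imports Defs
begin

text \<open>
  Up to a unit of \<open>O\<^sub>v\<close> and a central factor, \<open>\<gamma>\<close> is either \<open>\<Pi>\<close> or a unit \<open>\<delta>\<close> of \<open>O\<^sub>K\<close> of trace
  zero, according to the parity of its valuation. Replacing a pairing \<open>h\<close> by \<open>h x (\<beta> y)\<close> for a
  suitable unit \<open>\<beta>\<close> reduces the theorem to these two involutions, under which \<open>O\<^sub>K\<close> and \<open>\<Pi>\<close> are
  self-adjoint up to conjugation and sign.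

  A bilattice is free over \<open>O\<^sub>v\<close> on the right with a basis of eigenvectors for \<open>O\<^sub>K\<close>: one generator
  for each copy of \<open>O\<^sub>v\<close> and \<open>\<Pi> O\<^sub>v\<close>, and a pair \<open>g\<close>, \<open>\<Pi> g\<close> for each copy of \<open>L\<^sub>1\<close> and \<open>L\<^sub>2\<close>. Comparing
  eigenvalues, the value of a pairing on two generators is restricted to \<open>O\<^sub>K\<close> or to \<open>O\<^sub>K \<Pi>\<close>, so it
  can be a unit only for certain kinds of generators. By perfectness every generator has such a
  partner; the sub-bimodule generated by the two is an orthogonal summand, and its Gram matrix is
  brought to a normal form because the norm from \<open>O\<^sub>K\<close> is surjective onto the units and by Hensel's
  lemma. Splitting off these blocks one by one gives both the parity condition and uniqueness, and
  the normal forms themselves give existence.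
\<close>

section \<open>Quaternion orders\<close>

text \<open>Two obstacles shape the argument. The residue characteristic may be 2, so nothing can be
  halved: 2 is only ever cancelled, and where one would divide by it an element
  \<open>\<omega>\<close> of trace 1 takes over. Its existence, like that of the trace-zero unit
  \<open>\<delta>\<close>, expresses that the quadratic extension is unramified. Secondly,
  perfectness is a statement about a dual lattice inside a module of fractions, which is awkward to
  pass to orthogonal summands. It is replaced by a condition modulo the maximal ideal: a vector that
  pairs into the ideal with everything is a multiple of \<open>P\<close>. This condition is
  inherited by orthogonal complements, forces unit values of the pairing, and, applied repeatedly,
  gives back nondegeneracy and the full duality. A block splits off because its Gram matrix is
  invertible over the order, and the complement keeps a basis of the remaining kinds, so no
  cancellation theorem is needed in the induction. Finiteness of the residue field is used for
  counting squares and values of norm forms.\<close>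

text \<open>\<open>C\<close>, \<open>P\<close> and \<open>P * P\<close> are the ring of integers of the unramified extension, the uniformizer
  \<open>\<Pi>\<close> of the quaternion algebra and the uniformizer of its centre. That \<open>C\<close> is unramified also in
  residue characteristic 2 enters through \<open>\<delta>\<close> and \<open>\<omega>\<close>, and \<open>quad_solve\<close> is Hensel's lemma.\<close>

locale quat_order =
  fixes C :: "'a::ring_1 set" and cj :: "'a \<Rightarrow> 'a" and P \<delta> \<omega> :: 'a
  assumes C_one: "1 \<in> C"
    and C_add: "x \<in> C \<Longrightarrow> y \<in> C \<Longrightarrow> x + y \<in> C"
    and C_uminus: "x \<in> C \<Longrightarrow> - x \<in> C"
    and C_mult: "x \<in> C \<Longrightarrow> y \<in> C \<Longrightarrow> x * y \<in> C"
    and C_commute: "x \<in> C \<Longrightarrow> y \<in> C \<Longrightarrow> x * y = y * x"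
    and cj_add: "cj (x + y) = cj x + cj y"
    and cj_mult: "cj (x * y) = cj y * cj x"
    and cj_cj: "cj (cj x) = x"
    and cj_C: "x \<in> C \<Longrightarrow> cj x \<in> C"
    and cj_P: "cj P = - P"
    and P_C: "x \<in> C \<Longrightarrow> P * x = cj x * P"
    and PP_C: "P * P \<in> C"
    and C_indep: "a \<in> C \<Longrightarrow> b \<in> C \<Longrightarrow> a + b * P = 0 \<Longrightarrow> a = 0 \<and> b = 0"
    and C_cases: "x \<in> C \<Longrightarrow> (\<exists>y\<in>C. x * y = 1) \<or> (\<exists>y\<in>C. x = P * P * y)"
    and PP_nonunit: "y \<in> C \<Longrightarrow> P * P * y \<noteq> 1"
    and PP_cancel: "y \<in> C \<Longrightarrow> P * P * y = 0 \<Longrightarrow> y = 0"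
    and two_cancel: "(x::'a) + x = 0 \<Longrightarrow> x = 0"
    and \<delta>: "\<delta> \<in> C" "cj \<delta> = - \<delta>" "\<exists>y\<in>C. \<delta> * y = 1"
    and \<omega>: "\<omega> \<in> C" "\<omega> + cj \<omega> = 1"
    and norm_surj: "c \<in> C \<Longrightarrow> cj c = c \<Longrightarrow> \<exists>y\<in>C. c * y = 1 \<Longrightarrow> \<exists>a\<in>C. a * cj a = c"
    and quad_solve: "c \<in> C \<Longrightarrow> d \<in> C \<Longrightarrow> cj c = c \<Longrightarrow> cj d = d \<Longrightarrow>
      \<exists>t\<in>C. cj t = t \<and> t = c + P * P * d * t * t"
begin

section \<open>The order and its maximal ideal\<close>

definition R :: "'a set" where "R = {a + b * P | a b. a \<in> C \<and> b \<in> C}"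

text \<open>Plays the part of the maximal ideal. \<open>P\<close> normalizes \<open>R\<close>, so
  this left ideal is two-sided, and every element of \<open>C\<close> outside it is a unit
  (\<open>C_unit\<close>).\<close>

definition RP :: "'a set" where "RP = {x * P | x. x \<in> R}"

lemma C_zero: "0 \<in> C"
  using C_add[OF C_one C_uminus[OF C_one]] by simp

lemma C_diff: "x \<in> C \<Longrightarrow> y \<in> C \<Longrightarrow> x - y \<in> C"
  using C_add[of x "- y"] C_uminus by simp

lemmas C_closed = C_one C_zero C_add C_uminus C_diff C_mult cj_C PP_C

lemma cj_zero: "cj 0 = 0" using cj_add[of 0 0] by simp

lemma cj_uminus: "cj (- x) = - cj x"
  using cj_add[of x "- x"] by (simp add: cj_zero eq_neg_iff_add_eq_0 add.commute)

lemma cj_diff: "cj (x - y) = cj x - cj y"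
  using cj_add[of x "- y"] by (simp add: cj_uminus)

lemma cj_one: "cj 1 = 1"
  using cj_mult[of "cj 1" 1] by (simp add: cj_cj)

lemmas cj_simps = cj_zero cj_uminus cj_diff cj_one cj_add cj_mult cj_cj cj_P

lemma cj_sum: "cj (sum f A) = (\<Sum>i\<in>A. cj (f i))"
  by (induction A rule: infinite_finite_induct) (auto simp: cj_simps)

lemma C_P: "x \<in> C \<Longrightarrow> x * P = P * cj x"
  by (simp add: P_C cj_C cj_cj)

lemma PP_comm: "x \<in> C \<Longrightarrow> P * P * x = x * (P * P)"
  by (simp add: C_commute PP_C)

lemma R_I: "a \<in> C \<Longrightarrow> b \<in> C \<Longrightarrow> a + b * P \<in> R"
  unfolding R_def by blast

lemma R_E: assumes "x \<in> R" obtains a b where "a \<in> C" "b \<in> C" "x = a + b * P"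
  using assms unfolding R_def by blast

lemma C_R: "x \<in> C \<Longrightarrow> x \<in> R"
  using R_I[of x 0] C_zero by simp

lemma P_R: "P \<in> R"
  using R_I[OF C_zero C_one] by simp

lemma R_add: "x \<in> R \<Longrightarrow> y \<in> R \<Longrightarrow> x + y \<in> R"
proof (elim R_E)
  fix a b c d assume "a \<in> C" "b \<in> C" "x = a + b * P" "c \<in> C" "d \<in> C" "y = c + d * P"
  then have "x + y = (a + c) + (b + d) * P" by (simp add: algebra_simps)
  then show ?thesis using R_I C_add \<open>a \<in> C\<close> \<open>b \<in> C\<close> \<open>c \<in> C\<close> \<open>d \<in> C\<close> by metis
qed

lemma R_uminus: "x \<in> R \<Longrightarrow> - x \<in> R"
proof (elim R_E)
  fix a b assume "a \<in> C" "b \<in> C" "x = a + b * P"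
  then have "- x = - a + (- b) * P" by (simp add: algebra_simps)
  then show ?thesis using R_I C_uminus \<open>a \<in> C\<close> \<open>b \<in> C\<close> by metis
qed

lemma R_mult: "x \<in> R \<Longrightarrow> y \<in> R \<Longrightarrow> x * y \<in> R"
proof (elim R_E)
  fix a b c d assume *: "a \<in> C" "b \<in> C" "x = a + b * P" "c \<in> C" "d \<in> C" "y = c + d * P"
  have "b * P * c = b * cj c * P" "b * P * (d * P) = b * cj d * (P * P)"
    using * by (metis P_C mult.assoc)+
  then have "x * y = (a * c + b * cj d * (P * P)) + (a * d + b * cj c) * P"
    using * by (simp add: algebra_simps)
  moreover have "a * c + b * cj d * (P * P) \<in> C" "a * d + b * cj c \<in> C"
    using * by (auto intro!: C_closed)
  ultimately show ?thesis using R_I by metis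
qed

lemma cj_R: "x \<in> R \<Longrightarrow> cj x \<in> R"
proof (elim R_E)
  fix a b assume *: "a \<in> C" "b \<in> C" "x = a + b * P"
  then have "cj x = cj a + (- b) * P" by (simp add: cj_simps C_P cj_C)
  then show ?thesis using R_I C_uminus cj_C * by metis
qed

lemma R_zero: "0 \<in> R" using C_R C_zero by blast
lemma R_one: "1 \<in> R" using C_R C_one by blast
lemma R_diff: "x \<in> R \<Longrightarrow> y \<in> R \<Longrightarrow> x - y \<in> R"
  using R_add[of x "- y"] R_uminus by simp

lemmas R_closed = R_zero R_one R_add R_uminus R_diff R_mult cj_R P_R

lemma R_sum: "(\<And>i. i \<in> A \<Longrightarrow> f i \<in> R) \<Longrightarrow> sum f A \<in> R"
  by (induction A rule: infinite_finite_induct) (auto simp: R_closed)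

lemma P_right: assumes "x \<in> R" shows "\<exists>y\<in>R. P * x = y * P"
proof -
  obtain a b where *: "a \<in> C" "b \<in> C" "x = a + b * P" using assms by (rule R_E)
  have "P * x = (cj a + cj b * P) * P"
    using * P_C[of a] P_C[of b] by (simp add: distrib_left distrib_right mult.assoc[symmetric])
  then show ?thesis using * R_I cj_C by metis
qed

lemma RP_add: "x \<in> RP \<Longrightarrow> y \<in> RP \<Longrightarrow> x + y \<in> RP"
  unfolding RP_def using R_add by (auto simp: distrib_right[symmetric])

lemma RP_zero: "0 \<in> RP"
  unfolding RP_def using R_zero by force

lemma RP_uminus: assumes "x \<in> RP" shows "- x \<in> RP"
proof -
  obtain y where "y \<in> R" "x = y * P" using assms RP_def by auto
  then have "- x = (- y) * P" "- y \<in> R" using R_uminus by auto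
  then show ?thesis unfolding RP_def by blast
qed

lemma RP_R: "x \<in> RP \<Longrightarrow> x \<in> R"
  unfolding RP_def using R_mult P_R by auto

lemma RP_left: "x \<in> R \<Longrightarrow> y \<in> RP \<Longrightarrow> x * y \<in> RP"
  unfolding RP_def using R_mult by (auto simp: mult.assoc[symmetric])

lemma RP_right: assumes "x \<in> RP" "y \<in> R" shows "x * y \<in> RP"
proof -
  obtain z where z: "z \<in> R" "x = z * P" using assms RP_def by auto
  obtain w where "w \<in> R" "P * y = w * P" using P_right assms by blast
  then have "x * y = (z * w) * P" using z by (metis mult.assoc)
  then show ?thesis using z \<open>w \<in> R\<close> R_mult RP_def by auto
qed

lemma P_RP: "P \<in> RP" unfolding RP_def using R_one by force

lemma RP_cj: assumes "x \<in> RP" shows "cj x \<in> RP"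
proof -
  obtain z where z: "z \<in> R" "x = z * P" using assms RP_def by auto
  then have "cj x = - (P * cj z)" by (simp add: cj_simps)
  then show ?thesis using z RP_right[OF P_RP] RP_uminus cj_R by metis
qed

lemma RP_cj_iff: "cj x \<in> RP \<longleftrightarrow> x \<in> RP"
  using RP_cj cj_cj by metis

lemma RP_sum: "(\<And>i. i \<in> A \<Longrightarrow> f i \<in> RP) \<Longrightarrow> sum f A \<in> RP"
  by (induction A rule: infinite_finite_induct) (auto simp: RP_zero RP_add)

text \<open>A left inverse of \<open>P\<close> would have a \<open>P\<close>-component inverse to
  \<open>P * P\<close>, which is not a unit in \<open>C\<close>.\<close>

lemma one_notin_RP: "1 \<notin> RP"
proof
  assume "1 \<in> RP"
  then obtain x where "x \<in> R" "1 = x * P" unfolding RP_def by auto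
  then obtain a b where *: "a \<in> C" "b \<in> C" "1 = (a + b * P) * P" by (elim R_E) auto
  then have "(b * (P * P) - 1) + a * P = 0" by (simp add: algebra_simps)
  then have "b * (P * P) = 1" using C_indep[of "b * (P * P) - 1" a] * C_closed by auto
  then show False using PP_nonunit PP_comm * by metis
qed

lemma C_unit: assumes "x \<in> C" "x \<notin> RP" shows "\<exists>y\<in>C. x * y = 1 \<and> y * x = 1"
proof -
  have "\<not> (\<exists>y\<in>C. x = P * P * y)"
  proof
    assume "\<exists>y\<in>C. x = P * P * y"
    then obtain y where "y \<in> C" "x = y * P * P" using PP_comm by (metis mult.assoc)
    then have "x \<in> RP" unfolding RP_def using R_mult C_R P_R by blast
    then show False using assms by blast
  qed
  then show ?thesis using C_cases[OF assms(1)] C_commute assms(1) by metis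
qed

lemma unit_notin_RP: "x * y = 1 \<Longrightarrow> y \<in> R \<Longrightarrow> x \<notin> RP"
  using RP_right one_notin_RP by metis

lemma P_cancel: assumes "x \<in> R" "x * P = 0" shows "x = 0"
proof -
  obtain a b where *: "a \<in> C" "b \<in> C" "x = a + b * P" using assms by (elim R_E)
  then have "b * (P * P) + a * P = 0" using assms by (simp add: algebra_simps)
  then have "a = 0" "P * P * b = 0" using C_indep[of "b * (P * P)" a] * C_closed PP_comm by auto
  then show ?thesis using PP_cancel[of b] * by simp
qed

text \<open>As \<open>\<delta>\<close> has trace zero, it commutes with \<open>C\<close> and
  anticommutes with \<open>P\<close>. Commuting or anticommuting with \<open>\<delta>\<close>
  therefore kills twice one of the two components, and cancelling 2 and \<open>\<delta>\<close>
  suffices.\<close>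

lemma C_of_comm: assumes "z \<in> R" "\<delta> * z = z * \<delta>" shows "z \<in> C"
proof -
  obtain a b where *: "a \<in> C" "b \<in> C" "z = a + b * P" using assms by (elim R_E)
  have "b * P * \<delta> = - (\<delta> * b * P)" using P_C \<delta> * C_commute
    by (metis mult.assoc mult_minus_left mult_minus_right)
  then have "\<delta> * b * P + \<delta> * b * P = 0"
    using assms(2) * C_commute[OF \<delta>(1) *(1)] by (simp add: algebra_simps)
  then have "\<delta> * b * P = 0" by (rule two_cancel)
  then have "\<delta> * b = 0" using P_cancel C_R C_mult \<delta> * by metis
  then have "b = 0" using \<delta>(3) C_commute[OF \<delta>(1)] by (metis mult.assoc mult_1 mult_zero_right)
  then show ?thesis using * by simp
qed

lemma CP_of_anticomm: assumes "z \<in> R" "\<delta> * z = - (z * \<delta>)" obtains b where "b \<in> C" "z = b * P"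
proof -
  obtain a b where *: "a \<in> C" "b \<in> C" "z = a + b * P" using assms by (elim R_E)
  have "b * P * \<delta> = - (\<delta> * b * P)" using P_C \<delta> * C_commute
    by (metis mult.assoc mult_minus_left mult_minus_right)
  then have "\<delta> * a + \<delta> * a = 0"
    using assms(2) * C_commute[OF \<delta>(1) *(1)] by (simp add: algebra_simps)
  then have "\<delta> * a = 0" by (rule two_cancel)
  then have "a = 0" using \<delta>(3) C_commute[OF \<delta>(1)] by (metis mult.assoc mult_1 mult_zero_right)
  then show ?thesis using * that by simp
qed

text \<open>Elements of \<open>C * P\<close> have trace zero, so \<open>cj\<close> is -1 on them;
  self-conjugacy then leaves only 2-torsion, which is trivial.\<close>

lemma cj_CP_fixed: assumes "b \<in> C" "cj (b * P) = b * P" shows "b * P = 0"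
proof -
  have "cj (b * P) = - (b * P)" using assms(1) by (simp add: cj_simps C_P)
  then show ?thesis using assms(2) two_cancel[of "b * P"] by (metis add.right_inverse)
qed

section \<open>Coordinates with respect to generators\<close>

definition tw :: "bool \<Rightarrow> 'a \<Rightarrow> 'a" where "tw \<epsilon> a = (if \<epsilon> then cj a else a)"

lemma tw_C: "a \<in> C \<Longrightarrow> tw \<epsilon> a \<in> C"
  by (simp add: tw_def cj_C)

lemma tw_not: "tw (\<not> \<epsilon>) a = tw \<epsilon> (cj a)"
  by (simp add: tw_def cj_cj)

text \<open>A generator with \<open>fst\<close> true gives two right basis vectors, itself and its
  \<open>P\<close>-multiple, with coordinates \<open>c\<close> and \<open>d\<close>. Otherwise the
  \<open>P\<close>-multiple is already a right multiple of the generator, and \<open>d = 0\<close>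
  is what makes coordinates unique.\<close>

definition coords :: "'i set \<Rightarrow> ('i \<Rightarrow> bool \<times> bool) \<Rightarrow> ('i \<Rightarrow> 'a) \<Rightarrow> ('i \<Rightarrow> 'a) \<Rightarrow> bool" where
  "coords I \<kappa> c d \<longleftrightarrow> (\<forall>i\<in>I. c i \<in> R \<and> d i \<in> R \<and> (\<not> fst (\<kappa> i) \<longrightarrow> d i = 0))"

text \<open>New coordinates after left multiplication by \<open>P\<close>. For \<open>fst\<close>
  true, \<open>P\<close> exchanges the two basis vectors up to the factor \<open>P * P\<close>;
  otherwise it passes through the generator and multiplies the coordinate.\<close>

definition P_fst :: "('i \<Rightarrow> bool \<times> bool) \<Rightarrow> ('i \<Rightarrow> 'a) \<Rightarrow> ('i \<Rightarrow> 'a) \<Rightarrow> 'i \<Rightarrow> 'a" where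
  "P_fst \<kappa> c d i = (if fst (\<kappa> i) then P * P * d i else P * c i)"

definition P_snd :: "('i \<Rightarrow> bool \<times> bool) \<Rightarrow> ('i \<Rightarrow> 'a) \<Rightarrow> 'i \<Rightarrow> 'a" where
  "P_snd \<kappa> c i = (if fst (\<kappa> i) then c i else 0)"

lemma coords_add: "coords I \<kappa> c d \<Longrightarrow> coords I \<kappa> c' d' \<Longrightarrow>
    coords I \<kappa> (\<lambda>i. c i + c' i) (\<lambda>i. d i + d' i)"
  by (auto simp: coords_def R_closed)

lemma coords_uminus: "coords I \<kappa> c d \<Longrightarrow> coords I \<kappa> (\<lambda>i. - c i) (\<lambda>i. - d i)"
  by (auto simp: coords_def R_closed)

lemma coords_right: "coords I \<kappa> c d \<Longrightarrow> a \<in> R \<Longrightarrow> coords I \<kappa> (\<lambda>i. c i * a) (\<lambda>i. d i * a)"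
  by (auto simp: coords_def R_closed)

lemma coords_C: "coords I \<kappa> c d \<Longrightarrow> a \<in> C \<Longrightarrow>
    coords I \<kappa> (\<lambda>i. tw (snd (\<kappa> i)) a * c i) (\<lambda>i. tw (\<not> snd (\<kappa> i)) a * d i)"
  by (auto simp: coords_def R_closed C_R tw_C)

lemma coords_P: "coords I \<kappa> c d \<Longrightarrow> coords I \<kappa> (P_fst \<kappa> c d) (P_snd \<kappa> c)"
  by (auto simp: coords_def P_fst_def P_snd_def R_closed)

lemma coords_zero: "coords I \<kappa> (\<lambda>_. 0) (\<lambda>_. 0)"
  by (auto simp: coords_def R_closed)

lemma coords_mono: "coords I \<kappa> c d \<Longrightarrow> J \<subseteq> I \<Longrightarrow> coords J \<kappa> c d"
  by (auto simp: coords_def)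

lemma coords_single: "x \<in> R \<Longrightarrow> y \<in> R \<Longrightarrow> (\<not> fst (\<kappa> i) \<longrightarrow> y = 0) \<Longrightarrow>
  coords I \<kappa> (\<lambda>j. if j = i then x else 0) (\<lambda>j. if j = i then y else 0)"
  by (auto simp: coords_def R_closed)

end

section \<open>Bimodules with homogeneous generators\<close>

text \<open>\<open>PP_act\<close> rewrites two left multiplications by \<open>P\<close> as a right
  multiplication by \<open>P * P\<close>, so the right span of a generator and its
  \<open>P\<close>-multiple is stable under \<open>P\<close>.\<close>

locale bimod = quat_order C cj P \<delta> \<omega>
  for C :: "'a::ring_1 set" and cj P \<delta> \<omega> +
  fixes L :: "('a, 'l::ab_group_add) bimodule"
  assumes bim: "is_bimodule R L"
    and PP_act: "x \<in> bcarrier L \<Longrightarrow> lact L (P * P) x = ract L x (P * P)"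
begin

abbreviation V where "V \<equiv> bcarrier L"

abbreviation left_act (infixr "\<rhd>" 75) where "a \<rhd> x \<equiv> lact L a x"

abbreviation right_act (infixl "\<lhd>" 75) where "x \<lhd> a \<equiv> ract L x a"

lemma V_zero: "0 \<in> V" and V_add: "x \<in> V \<Longrightarrow> y \<in> V \<Longrightarrow> x + y \<in> V"
  and V_diff: "x \<in> V \<Longrightarrow> y \<in> V \<Longrightarrow> x - y \<in> V"
  and V_l: "a \<in> R \<Longrightarrow> x \<in> V \<Longrightarrow> a \<rhd> x \<in> V"
  and V_r: "a \<in> R \<Longrightarrow> x \<in> V \<Longrightarrow> x \<lhd> a \<in> V"
  using bim by (simp_all add: is_bimodule_def)

lemma V_uminus: "x \<in> V \<Longrightarrow> - x \<in> V"
  using V_diff[OF V_zero] by simp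

lemma V_sum: "(\<And>i. i \<in> A \<Longrightarrow> f i \<in> V) \<Longrightarrow> sum f A \<in> V"
  by (induction A rule: infinite_finite_induct) (auto simp: V_zero V_add)

lemmas V_closed = V_zero V_add V_diff V_uminus V_l V_r

lemma l_add: "a \<in> R \<Longrightarrow> x \<in> V \<Longrightarrow> y \<in> V \<Longrightarrow> a \<rhd> (x + y) = a \<rhd> x + a \<rhd> y"
  and r_add: "a \<in> R \<Longrightarrow> x \<in> V \<Longrightarrow> y \<in> V \<Longrightarrow> (x + y) \<lhd> a = x \<lhd> a + y \<lhd> a"
  and add_l: "a \<in> R \<Longrightarrow> b \<in> R \<Longrightarrow> x \<in> V \<Longrightarrow> (a + b) \<rhd> x = a \<rhd> x + b \<rhd> x"
  and add_r: "a \<in> R \<Longrightarrow> b \<in> R \<Longrightarrow> x \<in> V \<Longrightarrow> x \<lhd> (a + b) = x \<lhd> a + x \<lhd> b"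
  and mult_l: "a \<in> R \<Longrightarrow> b \<in> R \<Longrightarrow> x \<in> V \<Longrightarrow> (a * b) \<rhd> x = a \<rhd> b \<rhd> x"
  and mult_r: "a \<in> R \<Longrightarrow> b \<in> R \<Longrightarrow> x \<in> V \<Longrightarrow> x \<lhd> (a * b) = x \<lhd> a \<lhd> b"
  and l_r: "a \<in> R \<Longrightarrow> b \<in> R \<Longrightarrow> x \<in> V \<Longrightarrow> a \<rhd> (x \<lhd> b) = (a \<rhd> x) \<lhd> b"
  and one_l: "x \<in> V \<Longrightarrow> 1 \<rhd> x = x" and one_r: "x \<in> V \<Longrightarrow> x \<lhd> 1 = x"
  using bim by (simp_all add: is_bimodule_def)

lemma l_zero: "a \<in> R \<Longrightarrow> a \<rhd> 0 = 0"
  using l_add[of a 0 0] V_zero by simp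
lemma r_zero: "a \<in> R \<Longrightarrow> 0 \<lhd> a = 0"
  using r_add[of a 0 0] V_zero by simp
lemma zero_l: "x \<in> V \<Longrightarrow> 0 \<rhd> x = 0"
  using add_l[of 0 0 x] R_zero by simp
lemma zero_r: "x \<in> V \<Longrightarrow> x \<lhd> 0 = 0"
  using add_r[of 0 0 x] R_zero by simp
lemma l_uminus: "a \<in> R \<Longrightarrow> x \<in> V \<Longrightarrow> a \<rhd> (- x) = - (a \<rhd> x)"
  using l_add[of a x "- x"] V_uminus l_zero by (simp add: eq_neg_iff_add_eq_0 add.commute)
lemma r_uminus: "a \<in> R \<Longrightarrow> x \<in> V \<Longrightarrow> (- x) \<lhd> a = - (x \<lhd> a)"
  using r_add[of a x "- x"] V_uminus r_zero by (simp add: eq_neg_iff_add_eq_0 add.commute)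
lemma uminus_r: "a \<in> R \<Longrightarrow> x \<in> V \<Longrightarrow> x \<lhd> (- a) = - (x \<lhd> a)"
  using add_r[of a "- a" x] R_uminus zero_r by (simp add: eq_neg_iff_add_eq_0 add.commute)
lemma l_diff: "a \<in> R \<Longrightarrow> x \<in> V \<Longrightarrow> y \<in> V \<Longrightarrow> a \<rhd> (x - y) = a \<rhd> x - a \<rhd> y"
  using l_add[of a x "- y"] V_uminus l_uminus by simp
lemma r_diff: "a \<in> R \<Longrightarrow> x \<in> V \<Longrightarrow> y \<in> V \<Longrightarrow> (x - y) \<lhd> a = x \<lhd> a - y \<lhd> a"
  using r_add[of a x "- y"] V_uminus r_uminus by simp

lemma l_sum: "a \<in> R \<Longrightarrow> (\<And>i. i \<in> A \<Longrightarrow> f i \<in> V) \<Longrightarrow> a \<rhd> sum f A = (\<Sum>i\<in>A. a \<rhd> f i)"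
  by (induction A rule: infinite_finite_induct) (auto simp: l_zero l_add V_sum)

lemma r_sum: "a \<in> R \<Longrightarrow> (\<And>i. i \<in> A \<Longrightarrow> f i \<in> V) \<Longrightarrow> sum f A \<lhd> a = (\<Sum>i\<in>A. f i \<lhd> a)"
  by (induction A rule: infinite_finite_induct) (auto simp: r_zero r_add V_sum)

lemma PP_l: "x \<in> V \<Longrightarrow> P \<rhd> P \<rhd> x = x \<lhd> (P * P)"
  using PP_act mult_l P_R by metis

lemma l_split: "a \<in> C \<Longrightarrow> b \<in> C \<Longrightarrow> x \<in> V \<Longrightarrow> (a + b * P) \<rhd> x = a \<rhd> x + b \<rhd> P \<rhd> x"
  by (simp add: add_l mult_l C_R P_R R_mult)

section \<open>Sub-bimodules and homogeneous vectors\<close>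

definition sub_bimodule :: "'l set \<Rightarrow> bool" where
  "sub_bimodule N \<longleftrightarrow> N \<subseteq> V \<and> 0 \<in> N \<and> (\<forall>x\<in>N. \<forall>y\<in>N. x + y \<in> N) \<and> (\<forall>x\<in>N. - x \<in> N) \<and>
     (\<forall>a\<in>R. \<forall>x\<in>N. a \<rhd> x \<in> N \<and> x \<lhd> a \<in> N)"

lemma sub_bimoduleD:
  assumes "sub_bimodule N"
  shows "x \<in> N \<Longrightarrow> x \<in> V" "0 \<in> N" "x \<in> N \<Longrightarrow> y \<in> N \<Longrightarrow> x + y \<in> N" "x \<in> N \<Longrightarrow> - x \<in> N"
    "x \<in> N \<Longrightarrow> y \<in> N \<Longrightarrow> x - y \<in> N"
    "a \<in> R \<Longrightarrow> x \<in> N \<Longrightarrow> a \<rhd> x \<in> N" "a \<in> R \<Longrightarrow> x \<in> N \<Longrightarrow> x \<lhd> a \<in> N"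
  using assms unfolding sub_bimodule_def by (auto simp: diff_conv_add_uminus simp del: add_uminus_conv_diff)

lemma sub_bimodule_sum: "sub_bimodule N \<Longrightarrow> (\<And>i. i \<in> A \<Longrightarrow> f i \<in> N) \<Longrightarrow> sum f A \<in> N"
  by (induction A rule: infinite_finite_induct) (auto simp: sub_bimoduleD)

text \<open>A generator of kind \<open>(T, \<epsilon>)\<close>: \<open>C\<close> acts on the left as on the right, up to \<open>cj\<close> if \<open>\<epsilon>\<close>
  holds. If \<open>T\<close> fails then so does \<open>P\<close> (the summands \<open>\<O>\<close> and \<open>P \<O>\<close>); otherwise the generator
  generates a copy of one of the two matrix bimodules.\<close>

definition homog :: "bool \<Rightarrow> 'l \<Rightarrow> bool" where
  "homog \<epsilon> g \<longleftrightarrow> g \<in> V \<and> (\<forall>a\<in>C. a \<rhd> g = g \<lhd> tw \<epsilon> a)"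

definition gen :: "bool \<times> bool \<Rightarrow> 'l \<Rightarrow> bool" where
  "gen k g \<longleftrightarrow> homog (snd k) g \<and> (\<not> fst k \<longrightarrow> P \<rhd> g = g \<lhd> P)"

lemma homog_V: "homog \<epsilon> g \<Longrightarrow> g \<in> V"
  by (simp add: homog_def)

lemma homog_C: "homog \<epsilon> g \<Longrightarrow> a \<in> C \<Longrightarrow> a \<rhd> g = g \<lhd> tw \<epsilon> a"
  by (simp add: homog_def)

lemma homog_add: "homog \<epsilon> g \<Longrightarrow> homog \<epsilon> g' \<Longrightarrow> homog \<epsilon> (g + g')"
  by (simp add: homog_def V_add l_add r_add C_R tw_C)

text \<open>\<open>P\<close> conjugates elements of \<open>C\<close> that are moved past it, so the
  type of homogeneity flips, for the left action here and for the right action in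
  \<open>homog_P_r\<close>. Hence the \<open>P\<close>-multiple of a generator can have unit
  pairings with vectors for which the generator itself cannot.\<close>

lemma homog_P: assumes "homog \<epsilon> g" shows "homog (\<not> \<epsilon>) (P \<rhd> g)"
  unfolding homog_def
proof (intro conjI ballI)
  have g: "g \<in> V" using assms homog_def by auto
  then show "P \<rhd> g \<in> V" by (simp add: V_l P_R)
  fix a assume a: "a \<in> C"
  have "a \<rhd> P \<rhd> g = (a * P) \<rhd> g" using a g by (simp add: mult_l C_R P_R)
  also have "\<dots> = P \<rhd> cj a \<rhd> g" using a g by (simp add: C_P mult_l C_R P_R cj_C)
  also have "\<dots> = P \<rhd> (g \<lhd> tw \<epsilon> (cj a))" using assms a cj_C homog_C by auto
  also have "\<dots> = (P \<rhd> g) \<lhd> tw (\<not> \<epsilon>) a" using a g by (simp add: l_r P_R C_R cj_C tw_C tw_not)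
  finally show "a \<rhd> P \<rhd> g = (P \<rhd> g) \<lhd> tw (\<not> \<epsilon>) a" .
qed

lemma homog_C_r: assumes "homog \<epsilon> g" "c \<in> C" shows "homog \<epsilon> (g \<lhd> c)"
  unfolding homog_def
proof (intro conjI ballI)
  have g: "g \<in> V" using assms homog_def by auto
  then show "g \<lhd> c \<in> V" by (simp add: V_r C_R assms)
  fix a assume a: "a \<in> C"
  have "a \<rhd> (g \<lhd> c) = g \<lhd> tw \<epsilon> a \<lhd> c" using a g assms by (simp add: l_r C_R homog_C)
  also have "\<dots> = g \<lhd> c \<lhd> tw \<epsilon> a"
    using a g assms C_commute[of c "tw \<epsilon> a"] by (simp add: mult_r[symmetric] C_R tw_C)
  finally show "a \<rhd> (g \<lhd> c) = g \<lhd> c \<lhd> tw \<epsilon> a" .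
qed

lemma homog_P_r: assumes "homog \<epsilon> g" shows "homog (\<not> \<epsilon>) (g \<lhd> P)"
  unfolding homog_def
proof (intro conjI ballI)
  have g: "g \<in> V" using assms homog_def by auto
  then show "g \<lhd> P \<in> V" by (simp add: V_r P_R)
  fix a assume a: "a \<in> C"
  have "a \<rhd> (g \<lhd> P) = g \<lhd> tw \<epsilon> a \<lhd> P" using a g assms by (simp add: l_r C_R homog_C P_R)
  also have "\<dots> = g \<lhd> (tw \<epsilon> a * P)" using a g by (simp add: mult_r C_R tw_C P_R)
  also have "tw \<epsilon> a * P = P * tw (\<not> \<epsilon>) a" using a by (simp add: tw_def C_P cj_cj cj_C)
  also have "g \<lhd> \<dots> = g \<lhd> P \<lhd> tw (\<not> \<epsilon>) a" using a g by (simp add: mult_r C_R tw_C P_R)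
  finally show "a \<rhd> (g \<lhd> P) = g \<lhd> P \<lhd> tw (\<not> \<epsilon>) a" .
qed

lemma gen_V: "gen k g \<Longrightarrow> g \<in> V"
  by (auto simp: gen_def homog_def)

lemma gen_homog: "gen k g \<Longrightarrow> homog (snd k) g"
  by (simp add: gen_def)

lemma gen_T: "fst k \<Longrightarrow> homog (snd k) g \<Longrightarrow> gen k g"
  by (simp add: gen_def)

lemma gen_P: "gen k g \<Longrightarrow> \<not> fst k \<Longrightarrow> P \<rhd> g = g \<lhd> P"
  by (simp add: gen_def)

section \<open>Linear combinations and bases\<close>

definition lc :: "'i set \<Rightarrow> ('i \<Rightarrow> 'l) \<Rightarrow> ('i \<Rightarrow> 'a) \<Rightarrow> ('i \<Rightarrow> 'a) \<Rightarrow> 'l" where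
  "lc I g c d = (\<Sum>i\<in>I. g i \<lhd> c i + (P \<rhd> g i) \<lhd> d i)"

definition span :: "('i \<Rightarrow> bool \<times> bool) \<Rightarrow> 'i set \<Rightarrow> ('i \<Rightarrow> 'l) \<Rightarrow> 'l set" where
  "span \<kappa> I g = {lc I g c d | c d. coords I \<kappa> c d}"

definition gens :: "('i \<Rightarrow> bool \<times> bool) \<Rightarrow> 'i set \<Rightarrow> ('i \<Rightarrow> 'l) \<Rightarrow> bool" where
  "gens \<kappa> I g \<longleftrightarrow> finite I \<and> (\<forall>i\<in>I. gen (\<kappa> i) (g i))"

text \<open>Freeness is over \<open>R\<close> on the right and is tested on admissible coordinates
  only: with unrestricted \<open>d\<close>, a generator with \<open>fst\<close> false would give the
  relation \<open>P \<rhd> g i = g i \<lhd> P\<close>.\<close>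

definition basis :: "('i \<Rightarrow> bool \<times> bool) \<Rightarrow> 'i set \<Rightarrow> ('i \<Rightarrow> 'l) \<Rightarrow> 'l set \<Rightarrow> bool" where
  "basis \<kappa> I g M \<longleftrightarrow> gens \<kappa> I g \<and> M = span \<kappa> I g \<and>
     (\<forall>c d. coords I \<kappa> c d \<and> lc I g c d = 0 \<longrightarrow> (\<forall>i\<in>I. c i = 0 \<and> d i = 0))"

lemma gensD: "gens \<kappa> I g \<Longrightarrow> i \<in> I \<Longrightarrow> g i \<in> V" "gens \<kappa> I g \<Longrightarrow> i \<in> I \<Longrightarrow> P \<rhd> g i \<in> V"
  "gens \<kappa> I g \<Longrightarrow> i \<in> I \<Longrightarrow> homog (snd (\<kappa> i)) (g i)"
  "gens \<kappa> I g \<Longrightarrow> i \<in> I \<Longrightarrow> \<not> fst (\<kappa> i) \<Longrightarrow> P \<rhd> g i = g i \<lhd> P"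
  by (auto simp: gens_def gen_V V_l P_R gen_homog gen_P)

lemma gens_finite: "gens \<kappa> I g \<Longrightarrow> finite I"
  by (simp add: gens_def)

lemma coordsD: "coords I \<kappa> c d \<Longrightarrow> i \<in> I \<Longrightarrow> c i \<in> R" "coords I \<kappa> c d \<Longrightarrow> i \<in> I \<Longrightarrow> d i \<in> R"
  "coords I \<kappa> c d \<Longrightarrow> i \<in> I \<Longrightarrow> \<not> fst (\<kappa> i) \<Longrightarrow> d i = 0"
  by (auto simp: coords_def)

context
  fixes \<kappa> :: "'i \<Rightarrow> bool \<times> bool" and I g
  assumes g: "gens \<kappa> I g"
begin

lemma lc_term_V: "coords I \<kappa> c d \<Longrightarrow> i \<in> I \<Longrightarrow> g i \<lhd> c i + (P \<rhd> g i) \<lhd> d i \<in> V"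
  by (intro V_closed gensD[OF g] coordsD) auto

lemma lc_V: "coords I \<kappa> c d \<Longrightarrow> lc I g c d \<in> V"
  unfolding lc_def by (intro V_sum lc_term_V)

lemma lc_add: "coords I \<kappa> c d \<Longrightarrow> coords I \<kappa> c' d' \<Longrightarrow>
    lc I g (\<lambda>i. c i + c' i) (\<lambda>i. d i + d' i) = lc I g c d + lc I g c' d'"
  unfolding lc_def sum.distrib[symmetric]
  by (intro sum.cong refl) (simp add: add_r gensD[OF g] coordsD)

lemma lc_uminus: "coords I \<kappa> c d \<Longrightarrow> lc I g (\<lambda>i. - c i) (\<lambda>i. - d i) = - lc I g c d"
  unfolding lc_def sum_negf[symmetric]
  by (intro sum.cong refl) (simp add: uminus_r gensD[OF g] coordsD)

lemma lc_right: "coords I \<kappa> c d \<Longrightarrow> a \<in> R \<Longrightarrow>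
    lc I g (\<lambda>i. c i * a) (\<lambda>i. d i * a) = lc I g c d \<lhd> a"
  unfolding lc_def
  by (subst r_sum) (auto intro!: sum.cong lc_term_V simp: mult_r r_add gensD[OF g] coordsD V_r)

lemma lc_C: assumes cd: "coords I \<kappa> c d" and a: "a \<in> C"
  shows "lc I g (\<lambda>i. tw (snd (\<kappa> i)) a * c i) (\<lambda>i. tw (\<not> snd (\<kappa> i)) a * d i) = a \<rhd> lc I g c d"
proof -
  have "g i \<lhd> (tw (snd (\<kappa> i)) a * c i) + (P \<rhd> g i) \<lhd> (tw (\<not> snd (\<kappa> i)) a * d i) =
     a \<rhd> (g i \<lhd> c i + (P \<rhd> g i) \<lhd> d i)" if i: "i \<in> I" for i
  proof -
    note h = gensD(3)[OF g i]
    have "a \<rhd> (g i \<lhd> c i + (P \<rhd> g i) \<lhd> d i) = (a \<rhd> g i) \<lhd> c i + (a \<rhd> P \<rhd> g i) \<lhd> d i"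
      using a i by (simp add: l_add l_r gensD[OF g i] coordsD[OF cd i] C_R V_r)
    also have "\<dots> = (g i \<lhd> tw (snd (\<kappa> i)) a) \<lhd> c i + ((P \<rhd> g i) \<lhd> tw (\<not> snd (\<kappa> i)) a) \<lhd> d i"
      using homog_C[OF h a] homog_C[OF homog_P[OF h] a] by simp
    finally show ?thesis
      using a i by (simp add: mult_r gensD[OF g i] coordsD[OF cd i] C_R tw_C)
  qed
  then show ?thesis unfolding lc_def
    by (subst l_sum) (auto intro!: sum.cong lc_term_V[OF cd] simp: C_R a)
qed

lemma lc_P: assumes cd: "coords I \<kappa> c d"
  shows "lc I g (P_fst \<kappa> c d) (P_snd \<kappa> c) = P \<rhd> lc I g c d"
proof -
  have "g i \<lhd> P_fst \<kappa> c d i + (P \<rhd> g i) \<lhd> P_snd \<kappa> c i = P \<rhd> (g i \<lhd> c i + (P \<rhd> g i) \<lhd> d i)"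
    if i: "i \<in> I" for i
  proof -
    have "P \<rhd> (g i \<lhd> c i + (P \<rhd> g i) \<lhd> d i) = (P \<rhd> g i) \<lhd> c i + (g i \<lhd> (P * P)) \<lhd> d i"
      using i by (simp add: l_add l_r gensD[OF g i] coordsD[OF cd i] P_R V_r PP_l)
    then show ?thesis
      using gensD[OF g i] coordsD[OF cd i]
      by (cases "fst (\<kappa> i)")
        (auto simp: P_fst_def P_snd_def mult_r[symmetric] R_mult P_R zero_r r_zero V_r add.commute)
  qed
  then show ?thesis unfolding lc_def
    by (subst l_sum) (auto intro!: sum.cong lc_term_V[OF cd] simp: P_R)
qed

lemma lc_zero: "lc I g (\<lambda>_. 0) (\<lambda>_. 0) = 0"
  unfolding lc_def by (intro sum.neutral ballI) (simp add: zero_r gensD[OF g])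

lemma lc_single: assumes i: "i \<in> I" and x: "x \<in> R" "y \<in> R"
  shows "lc I g (\<lambda>j. if j = i then x else 0) (\<lambda>j. if j = i then y else 0) =
    g i \<lhd> x + (P \<rhd> g i) \<lhd> y"
proof -
  have "lc I g (\<lambda>j. if j = i then x else 0) (\<lambda>j. if j = i then y else 0) =
    (\<Sum>j\<in>I. if j = i then g i \<lhd> x + (P \<rhd> g i) \<lhd> y else 0)"
    unfolding lc_def by (intro sum.cong refl) (simp add: zero_r gensD[OF g])
  then show ?thesis using i gens_finite[OF g] by (simp add: sum.delta)
qed

text \<open>\<open>R\<close> is \<open>C + C * P\<close>, so left stability needs only the actions
  of \<open>C\<close> and of \<open>P\<close>, each of which has a formula in coordinates.\<close>

lemma span_sub: "sub_bimodule (span \<kappa> I g)"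
  unfolding sub_bimodule_def
proof (intro conjI ballI)
  show "span \<kappa> I g \<subseteq> V" using lc_V by (auto simp: span_def)
  show "0 \<in> span \<kappa> I g" using lc_zero[symmetric] coords_zero unfolding span_def by blast
  fix x assume "x \<in> span \<kappa> I g"
  then obtain c d where x: "x = lc I g c d" and cd: "coords I \<kappa> c d" by (auto simp: span_def)
  show "- x \<in> span \<kappa> I g"
    unfolding x span_def lc_uminus[OF cd, symmetric] using coords_uminus[OF cd] by blast
  show add: "x + y \<in> span \<kappa> I g" if *: "y \<in> span \<kappa> I g" for y
  proof -
    obtain c' d' where y: "y = lc I g c' d'" and cd': "coords I \<kappa> c' d'" using * unfolding span_def by blast
    show ?thesis
      unfolding x y span_def lc_add[OF cd cd', symmetric] using coords_add[OF cd cd'] by blast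
  qed
  fix a assume a: "a \<in> R"
  show "x \<lhd> a \<in> span \<kappa> I g"
    unfolding x span_def lc_right[OF cd a, symmetric] using coords_right[OF cd a] by blast
  obtain p q where pq: "p \<in> C" "q \<in> C" "a = p + q * P" using a by (rule R_E)
  note cdP = coords_P[OF cd]
  have "a \<rhd> x = p \<rhd> lc I g c d + q \<rhd> P \<rhd> lc I g c d"
    using pq x lc_V[OF cd] by (simp add: l_split)
  also have "\<dots> = p \<rhd> lc I g c d + q \<rhd> lc I g (P_fst \<kappa> c d) (P_snd \<kappa> c)"
    using lc_P[OF cd] by simp
  finally have "a \<rhd> x = lc I g (\<lambda>i. tw (snd (\<kappa> i)) p * c i + tw (snd (\<kappa> i)) q * P_fst \<kappa> c d i)
      (\<lambda>i. tw (\<not> snd (\<kappa> i)) p * d i + tw (\<not> snd (\<kappa> i)) q * P_snd \<kappa> c i)"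
    using lc_add[OF coords_C[OF cd pq(1)] coords_C[OF cdP pq(2)]]
      lc_C[OF cd pq(1)] lc_C[OF cdP pq(2)] by simp
  then show "a \<rhd> x \<in> span \<kappa> I g"
    using coords_add[OF coords_C[OF cd pq(1)] coords_C[OF cdP pq(2)]] unfolding span_def by blast
qed

lemma span_gen: assumes "i \<in> I" shows "g i \<in> span \<kappa> I g"
proof -
  have "g i = lc I g (\<lambda>j. if j = i then 1 else 0) (\<lambda>j. if j = i then 0 else 0)"
    using lc_single[OF assms R_one R_zero] gensD(1,2)[OF g assms] by (simp add: one_r zero_r)
  moreover have "coords I \<kappa> (\<lambda>j. if j = i then 1 else 0) (\<lambda>j. if j = i then 0 else 0)"
    by (rule coords_single[OF R_one R_zero]) simp
  ultimately show ?thesis unfolding span_def by blast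
qed

lemma span_least: assumes "sub_bimodule N" "\<And>i. i \<in> I \<Longrightarrow> g i \<in> N" shows "span \<kappa> I g \<subseteq> N"
proof
  fix x assume "x \<in> span \<kappa> I g"
  then obtain c d where x: "x = lc I g c d" and cd: "coords I \<kappa> c d" by (auto simp: span_def)
  show "x \<in> N" unfolding x lc_def
    by (intro sub_bimodule_sum assms(1) sub_bimoduleD(3,6,7)[OF assms(1)] assms(2) P_R coordsD[OF cd])
qed

end

lemma gens_mono: "gens \<kappa> I g \<Longrightarrow> J \<subseteq> I \<Longrightarrow> gens \<kappa> J g"
  by (auto simp: gens_def finite_subset)

lemma basis_gens: "basis \<kappa> I g M \<Longrightarrow> gens \<kappa> I g"
  by (simp add: basis_def)

lemma basis_unique:
  assumes b: "basis \<kappa> I g M" and cd: "coords I \<kappa> c d" "coords I \<kappa> c' d'"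
    and eq: "lc I g c d = lc I g c' d'" and i: "i \<in> I"
  shows "c i = c' i" "d i = d' i"
proof -
  note g = basis_gens[OF b]
  note n = coords_uminus[OF cd(2)]
  have "lc I g (\<lambda>i. c i + - c' i) (\<lambda>i. d i + - d' i) = 0"
    using lc_add[OF g cd(1) n] lc_uminus[OF g cd(2)] eq by simp
  moreover note coords_add[OF cd(1) n]
  ultimately have "c i + - c' i = 0 \<and> d i + - d' i = 0" using b i unfolding basis_def by blast
  then show "c i = c' i" "d i = d' i" by auto
qed

lemma basis_coords: assumes "basis \<kappa> I g M" "x \<in> M"
  obtains c d where "coords I \<kappa> c d" "x = lc I g c d"
  using assms unfolding basis_def span_def by blast

lemma basis_sub: "basis \<kappa> I g M \<Longrightarrow> sub_bimodule M"
  by (simp add: basis_def span_sub)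

lemma basis_gen: "basis \<kappa> I g M \<Longrightarrow> i \<in> I \<Longrightarrow> g i \<in> M"
  by (simp add: basis_def span_gen)

lemma lc_split:
  assumes g: "gens \<kappa> I g" and cd: "coords I \<kappa> c d" and J: "J \<subseteq> I"
  shows "lc I g c d = lc J g c d + lc (I - J) g c d"
  unfolding lc_def using sum.subset_diff[OF J, of "\<lambda>i. g i \<lhd> c i + (P \<rhd> g i) \<lhd> d i"] gens_finite[OF g]
  by (simp add: add.commute)

lemma lc_extend:
  assumes g: "gens \<kappa> I g" and K: "K \<subseteq> I"
  shows "lc I g (\<lambda>i. if i \<in> K then c i else 0) (\<lambda>i. if i \<in> K then d i else 0) = lc K g c d"
proof -
  have "lc I g (\<lambda>i. if i \<in> K then c i else 0) (\<lambda>i. if i \<in> K then d i else 0) =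
    (\<Sum>i\<in>I. if i \<in> K then g i \<lhd> c i + (P \<rhd> g i) \<lhd> d i else 0)"
    unfolding lc_def by (intro sum.cong refl) (simp add: zero_r gensD[OF g])
  also have "\<dots> = (\<Sum>i\<in>I \<inter> K. g i \<lhd> c i + (P \<rhd> g i) \<lhd> d i)"
    by (simp add: sum.inter_restrict[OF gens_finite[OF g]])
  also have "I \<inter> K = K" using K by blast
  finally show ?thesis unfolding lc_def .
qed

lemma coords_extend: "coords K \<kappa> c d \<Longrightarrow>
    coords I \<kappa> (\<lambda>i. if i \<in> K then c i else 0) (\<lambda>i. if i \<in> K then d i else 0)"
  by (auto simp: coords_def R_zero)

lemma lc_insert: "finite I \<Longrightarrow> i \<notin> I \<Longrightarrow>
    lc (insert i I) g c d = (g i \<lhd> c i + (P \<rhd> g i) \<lhd> d i) + lc I g c d"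
  by (simp add: lc_def)

lemma lc_cong: "(\<And>i. i \<in> I \<Longrightarrow> g i = g' i) \<Longrightarrow> (\<And>i. i \<in> I \<Longrightarrow> c i = c' i) \<Longrightarrow>
    (\<And>i. i \<in> I \<Longrightarrow> d i = d' i) \<Longrightarrow> lc I g c d = lc I g' c' d'"
  by (simp add: lc_def)

lemma basis_indep: "basis \<kappa> I g M \<Longrightarrow> coords I \<kappa> c d \<Longrightarrow> lc I g c d = 0 \<Longrightarrow>
    \<forall>i\<in>I. c i = 0 \<and> d i = 0"
  by (simp add: basis_def)

text \<open>Coordinate \<open>j\<close> gains \<open>a\<close> times coordinate \<open>i\<close>,
  for the generators and for their \<open>P\<close>-multiples alike, and subtracting the same amount
  is the inverse substitution. The kinds must agree for the new vector to be homogeneous; with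
  \<open>fst\<close> true there is no relation between left and right \<open>P\<close> that it could
  violate.\<close>

lemma basis_add_multiple:
  assumes b: "basis \<kappa> I g M" and ij: "i \<in> I" "j \<in> I" "i \<noteq> j"
    and k: "\<kappa> j = \<kappa> i" "fst (\<kappa> i)" and a: "a \<in> C"
  shows "basis \<kappa> I (g(i := g i + g j \<lhd> a)) M"
proof -
  note g = basis_gens[OF b]
  define g' where "g' = g(i := g i + g j \<lhd> a)"
  have aR: "a \<in> R" using a C_R by auto
  have g': "gens \<kappa> I g'"
    using g ij k a unfolding gens_def g'_def
    by (auto intro!: gen_T homog_add homog_C_r dest: gen_homog) (metis gen_homog)
  have lc': "lc I g' c d = lc I g (c(j := c j + a * c i)) (d(j := d j + a * d i))"
    and co: "coords I \<kappa> (c(j := c j + a * c i)) (d(j := d j + a * d i))"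
    if cd: "coords I \<kappa> c d" for c d
  proof -
    let ?c = "c(j := c j + a * c i)" and ?d = "d(j := d j + a * d i)"
    define K where "K = I - {i, j}"
    have I: "I = insert i (insert j K)" and K: "finite K" "i \<notin> insert j K" "j \<notin> K" "K \<subseteq> I"
      using ij gens_finite[OF g] by (auto simp: K_def)
    note V = gensD[OF g ij(1)] gensD[OF g ij(2)]
    note cR = coordsD[OF cd ij(1)] coordsD[OF cd ij(2)]
    have rest: "lc K g' c d = lc K g ?c ?d"
      by (rule lc_cong) (use K in \<open>auto simp: g'_def\<close>)
    have "(g i + g j \<lhd> a) \<lhd> c i + (P \<rhd> (g i + g j \<lhd> a)) \<lhd> d i =
       g i \<lhd> c i + (P \<rhd> g i) \<lhd> d i + (g j \<lhd> (a * c i) + (P \<rhd> g j) \<lhd> (a * d i))"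
      using V cR aR by (simp add: r_add l_add l_r mult_r P_R V_closed)
    moreover have "g j \<lhd> (c j + a * c i) + (P \<rhd> g j) \<lhd> (d j + a * d i) =
        g j \<lhd> c j + (P \<rhd> g j) \<lhd> d j + (g j \<lhd> (a * c i) + (P \<rhd> g j) \<lhd> (a * d i))"
      using V cR aR by (simp add: add_r R_mult)
    ultimately show "lc I g' c d = lc I g ?c ?d"
      using K ij rest unfolding I by (simp add: lc_insert) (simp add: g'_def)
    show "coords I \<kappa> ?c ?d"
      using cd ij aR k by (auto simp: coords_def R_closed)
  qed
  have inv: "lc I g c d = lc I g' (c(j := c j - a * c i)) (d(j := d j - a * d i))"
    and co': "coords I \<kappa> (c(j := c j - a * c i)) (d(j := d j - a * d i))"
    if cd: "coords I \<kappa> c d" for c d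
  proof -
    show *: "coords I \<kappa> (c(j := c j - a * c i)) (d(j := d j - a * d i))"
      using cd ij aR k by (auto simp: coords_def R_closed)
    have "c = (c(j := c j - a * c i))(j := (c(j := c j - a * c i)) j + a * (c(j := c j - a * c i)) i)"
      "d = (d(j := d j - a * d i))(j := (d(j := d j - a * d i)) j + a * (d(j := d j - a * d i)) i)"
      using ij by auto
    then show "lc I g c d = lc I g' (c(j := c j - a * c i)) (d(j := d j - a * d i))"
      using lc'[OF *] by simp
  qed
  show ?thesis unfolding basis_def g'_def[symmetric]
  proof (intro conjI allI impI ballI)
    show "gens \<kappa> I g'" by fact
    have "lc I g' c d \<in> span \<kappa> I g" if "coords I \<kappa> c d" for c d
      unfolding span_def lc'[OF that] using co[OF that] by blast
    moreover have "lc I g c d \<in> span \<kappa> I g'" if "coords I \<kappa> c d" for c d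
      unfolding span_def inv[OF that] using co'[OF that] by blast
    ultimately have "span \<kappa> I g' = span \<kappa> I g"
      unfolding span_def by blast
    then show "M = span \<kappa> I g'" using b by (simp add: basis_def)
    fix c d k assume cd: "coords I \<kappa> c d \<and> lc I g' c d = 0" and k: "k \<in> I"
    then have 0: "\<forall>k\<in>I. (c(j := c j + a * c i)) k = 0 \<and> (d(j := d j + a * d i)) k = 0"
      using basis_indep[OF b co[of c d]] lc'[of c d] by simp
    note z = 0[rule_format]
    have "c i = 0 \<and> d i = 0" using z[OF ij(1)] ij by auto
    then show "c k = 0" "d k = 0" using z[OF k] by (auto split: if_splits)
  qed
qed

end

section \<open>Hermitian pairings and orthogonal blocks\<close>

text \<open>\<open>od\<close> stands for the normal form with \<open>P\<close> in the role of
  \<open>\<gamma>\<close>, where the adjoint of \<open>a\<close> in \<open>C\<close> is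
  \<open>a\<close> and that of \<open>P\<close> is \<open>- P\<close>; in the other one, with
  \<open>\<delta>\<close>, these are \<open>cj a\<close> and \<open>P\<close>. Integrality of the
  values is assumed here, perfectness enters separately as \<open>LP\<close>.\<close>

locale herm = bimod C cj P \<delta> \<omega> L
  for C :: "'a::ring_1 set" and cj P \<delta> \<omega> and L :: "('a, 'l::ab_group_add) bimodule" +
  fixes od :: bool and h :: "'l \<Rightarrow> 'l \<Rightarrow> 'a"
  assumes h_R: "x \<in> bcarrier L \<Longrightarrow> y \<in> bcarrier L \<Longrightarrow> h x y \<in> R"
    and h_add: "x \<in> bcarrier L \<Longrightarrow> y \<in> bcarrier L \<Longrightarrow> z \<in> bcarrier L \<Longrightarrow> h x (y + z) = h x y + h x z"
    and h_cj: "x \<in> bcarrier L \<Longrightarrow> y \<in> bcarrier L \<Longrightarrow> h x y = cj (h y x)"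
    and h_r: "a \<in> R \<Longrightarrow> x \<in> bcarrier L \<Longrightarrow> y \<in> bcarrier L \<Longrightarrow> h x (ract L y a) = h x y * a"
    and h_C: "a \<in> C \<Longrightarrow> x \<in> bcarrier L \<Longrightarrow> y \<in> bcarrier L \<Longrightarrow>
      h (lact L a x) y = h x (lact L (if od then a else cj a) y)"
    and h_P: "x \<in> bcarrier L \<Longrightarrow> y \<in> bcarrier L \<Longrightarrow>
      h (lact L P x) y = (if od then - h x (lact L P y) else h x (lact L P y))"
begin

definition sg :: "'a \<Rightarrow> 'a" where "sg z = (if od then - z else z)"

lemma h_add_l: "x \<in> V \<Longrightarrow> y \<in> V \<Longrightarrow> z \<in> V \<Longrightarrow> h (x + y) z = h x z + h y z"
  using h_cj h_add V_add cj_add by metis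

lemma h_zero: "x \<in> V \<Longrightarrow> h x 0 = 0"
  using h_add[of x 0 0] V_zero by simp

lemma h_uminus: "x \<in> V \<Longrightarrow> y \<in> V \<Longrightarrow> h x (- y) = - h x y"
  using h_add[of x y "- y"] V_uminus h_zero by (simp add: eq_neg_iff_add_eq_0 add.commute)

lemma h_diff: "x \<in> V \<Longrightarrow> y \<in> V \<Longrightarrow> z \<in> V \<Longrightarrow> h x (y - z) = h x y - h x z"
  using h_add[of x y "- z"] V_uminus h_uminus by simp

lemma h_sum: "x \<in> V \<Longrightarrow> (\<And>i. i \<in> A \<Longrightarrow> f i \<in> V) \<Longrightarrow> h x (sum f A) = (\<Sum>i\<in>A. h x (f i))"
  by (induction A rule: infinite_finite_induct) (auto simp: h_zero h_add V_sum)

lemma h_l: "a \<in> R \<Longrightarrow> x \<in> V \<Longrightarrow> y \<in> V \<Longrightarrow> h (x \<lhd> a) y = cj a * h x y"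
  using h_cj h_r cj_mult V_r by metis

lemma h_Pl: "x \<in> V \<Longrightarrow> y \<in> V \<Longrightarrow> h (P \<rhd> x) y = sg (h x (P \<rhd> y))"
  by (simp add: h_P sg_def)

lemma h_Pr: "x \<in> V \<Longrightarrow> y \<in> V \<Longrightarrow> h x (P \<rhd> y) = sg (h (P \<rhd> x) y)"
  by (simp add: h_P sg_def)

lemma h_PP: "x \<in> V \<Longrightarrow> y \<in> V \<Longrightarrow> h (P \<rhd> x) (P \<rhd> y) = sg (h x y * (P * P))"
  by (simp add: h_Pl PP_l h_r R_mult P_R V_l)

lemma h_comm_zero: "x \<in> V \<Longrightarrow> y \<in> V \<Longrightarrow> h x y = 0 \<longleftrightarrow> h y x = 0"
  using h_cj cj_zero by metis

lemma sg_RP: "sg z \<in> RP \<longleftrightarrow> z \<in> RP"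
  unfolding sg_def using RP_uminus[of z] RP_uminus[of "- z"] by auto

lemma sg_C: "z \<in> C \<Longrightarrow> sg z \<in> C"
  by (simp add: sg_def C_closed)

text \<open>The conjugation in the first argument, the adjoint and the two twists each contribute at
  most a sign when \<open>\<delta>\<close> is moved across the pairing. So the value commutes or
  anticommutes with \<open>\<delta>\<close>, which puts it into \<open>C\<close> or into
  \<open>C * P\<close>.\<close>

lemma h_delta: assumes "homog \<epsilon> g" "homog \<epsilon>' g'"
  shows "\<delta> * h g g' = (if od = (\<epsilon> = \<epsilon>') then - (h g g' * \<delta>) else h g g' * \<delta>)"
proof -
  have V: "g \<in> V" "g' \<in> V" using assms homog_V by auto
  have s: "(if od then \<delta> else cj \<delta>) \<in> C" using \<delta>(1) cj_C by simp
  have "cj (tw \<epsilon> \<delta>) * h g g' = h g g' * tw \<epsilon>' (if od then \<delta> else cj \<delta>)"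
    using h_C[OF \<delta>(1) V] homog_C[OF assms(1) \<delta>(1)] homog_C[OF assms(2) s] V s \<delta>(1)
    by (simp add: h_l h_r C_R tw_C)
  moreover have "cj (tw \<epsilon> \<delta>) = (if \<epsilon> then \<delta> else - \<delta>)"
    by (simp add: tw_def \<delta> cj_uminus)
  moreover have "tw \<epsilon>' (if od then \<delta> else cj \<delta>) = (if od = \<epsilon>' then - \<delta> else \<delta>)"
    by (simp add: tw_def \<delta> cj_uminus)
  ultimately show ?thesis by (auto split: if_splits) (metis minus_minus)+
qed

lemma h_compat: assumes "homog \<epsilon> g" "homog \<epsilon>' g'" "od = (\<epsilon> \<noteq> \<epsilon>')"
  shows "h g g' \<in> C"
proof (rule C_of_comm)
  show "h g g' \<in> R" using assms homog_V h_R by auto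
  show "\<delta> * h g g' = h g g' * \<delta>" using h_delta[OF assms(1,2)] assms(3) by auto
qed

lemma h_incompat: assumes "homog \<epsilon> g" "homog \<epsilon>' g'" "od = (\<epsilon> = \<epsilon>')"
  obtains b where "b \<in> C" "h g g' = b * P"
proof (rule CP_of_anticomm)
  show "h g g' \<in> R" using assms homog_V h_R by auto
  show "\<delta> * h g g' = - (h g g' * \<delta>)" using h_delta[OF assms(1,2)] assms(3) by auto
qed

lemma h_incompat_RP: assumes "homog \<epsilon> g" "homog \<epsilon>' g'" "od = (\<epsilon> = \<epsilon>')"
  shows "h g g' \<in> RP"
  using h_incompat[OF assms] C_R by (auto simp: RP_def)

text \<open>Symmetry makes the value self-conjugate, and no nonzero element of \<open>C * P\<close>
  is. Several Gram entries vanish for this reason without any change of basis.\<close>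

lemma h_incompat_fixed:
  assumes "homog \<epsilon> g" "homog \<epsilon>' g'" "od = (\<epsilon> = \<epsilon>')" "h g g' = h g' g"
  shows "h g g' = 0"
proof -
  obtain b where b: "b \<in> C" "h g g' = b * P" using h_incompat[OF assms(1-3)] .
  have "cj (h g g') = h g g'" using h_cj[of g g'] h_cj[of g' g] assms homog_V by metis
  then show ?thesis using cj_CP_fixed b by metis
qed

lemma h_lc: assumes "x \<in> V" "gens \<kappa> I g" "coords I \<kappa> c d"
  shows "h x (lc I g c d) = (\<Sum>i\<in>I. h x (g i) * c i + h x (P \<rhd> g i) * d i)"
  unfolding lc_def
  by (subst h_sum[OF assms(1) lc_term_V[OF assms(2,3)]], assumption, intro sum.cong refl)
    (simp add: h_add h_r V_r gensD[OF assms(2)] coordsD[OF assms(3)] assms(1))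

text \<open>Perfectness, tested modulo the maximal ideal.\<close>

definition LP :: "'l set \<Rightarrow> bool" where
  "LP M \<longleftrightarrow> (\<forall>z\<in>M. (\<forall>y\<in>M. h z y \<in> RP) \<longrightarrow> (\<exists>w\<in>M. z = w \<lhd> P))"

section \<open>Orthogonal complements\<close>

definition orth :: "'l set \<Rightarrow> 'l set \<Rightarrow> 'l set" where
  "orth N M = {y \<in> M. \<forall>n\<in>N. h n y = 0}"

lemma orth_sub:
  assumes N: "sub_bimodule N" and M: "sub_bimodule M" shows "sub_bimodule (orth N M)"
  unfolding sub_bimodule_def
proof (intro conjI ballI)
  note D = sub_bimoduleD[OF N] sub_bimoduleD[OF M]
  show "orth N M \<subseteq> V" "0 \<in> orth N M" using D h_zero by (auto simp: orth_def)
  fix x assume x: "x \<in> orth N M"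
  then have xM: "x \<in> M" and x0: "\<And>n. n \<in> N \<Longrightarrow> h n x = 0" by (auto simp: orth_def)
  have xV: "x \<in> V" using xM D by auto
  show "x + y \<in> orth N M" if "y \<in> orth N M" for y
    using x that D by (auto simp: orth_def h_add)
  show "- x \<in> orth N M" using x D by (auto simp: orth_def h_uminus)
  fix a assume a: "a \<in> R"
  show "x \<lhd> a \<in> orth N M" using x a D by (auto simp: orth_def h_r)
  have Cx: "h n (b \<rhd> y) = 0" if "b \<in> C" "y \<in> V" "n \<in> N" "\<And>n. n \<in> N \<Longrightarrow> h n y = 0" for b n y
  proof -
    define b' where "b' = (if od then b else cj b)"
    have "b' \<in> C" "(if od then b' else cj b') = b" using that by (auto simp: b'_def cj_C cj_cj)
    then have "h n (b \<rhd> y) = h (b' \<rhd> n) y" using h_C[of b' n y] that D by auto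
    then show ?thesis using that D C_R \<open>b' \<in> C\<close> by metis
  qed
  have Px: "h n (P \<rhd> x) = 0" if "n \<in> N" for n
    using that x0[of "P \<rhd> n"] D xV h_Pr[of n x] P_R by (simp add: sg_def)
  obtain p q where pq: "p \<in> C" "q \<in> C" "a = p + q * P" using a by (rule R_E)
  have "h n (a \<rhd> x) = 0" if "n \<in> N" for n
  proof -
    have nV: "n \<in> V" using that D by auto
    have "h n (a \<rhd> x) = h n (p \<rhd> x) + h n (q \<rhd> P \<rhd> x)"
      using pq xV nV by (simp add: l_split h_add V_l C_R P_R)
    also have "\<dots> = 0"
      using Cx[OF pq(1) xV that x0] Cx[OF pq(2) _ that Px] V_l[OF P_R xV] by auto
    finally show ?thesis .
  qed
  then show "a \<rhd> x \<in> orth N M" using a xM D by (auto simp: orth_def)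
qed

text \<open>A vector \<open>z\<close> of the complement pairs with \<open>y\<close> as it does with
  the projection \<open>y - n\<close>, so \<open>LP\<close> for \<open>M\<close> applies and gives
  \<open>z = w \<lhd> P\<close>. Then \<open>h n w * P = h n z = 0\<close>, and cancelling
  \<open>P\<close> shows that \<open>w\<close> is again orthogonal to \<open>N\<close>.\<close>

lemma LP_orth:
  assumes N: "sub_bimodule N" and M: "sub_bimodule M" and LP: "LP M"
    and proj: "\<And>x. x \<in> M \<Longrightarrow> \<exists>n\<in>N. x - n \<in> orth N M"
  shows "LP (orth N M)"
  unfolding LP_def
proof (intro ballI impI)
  note D = sub_bimoduleD[OF N] sub_bimoduleD[OF M]
  fix z assume z: "z \<in> orth N M" and zy: "\<forall>y\<in>orth N M. h z y \<in> RP"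
  have zV: "z \<in> V" "z \<in> M" using z D by (auto simp: orth_def)
  have "h z y \<in> RP" if y: "y \<in> M" for y
  proof -
    obtain n where n: "n \<in> N" "y - n \<in> orth N M" using proj[OF y] by blast
    have V: "n \<in> V" "y \<in> V" using n y D by auto
    have "h z n = 0" using z n V zV h_comm_zero by (auto simp: orth_def)
    then have "h z y = h z (y - n)" using V zV by (simp add: h_diff)
    then show ?thesis using zy n by auto
  qed
  then obtain w where w: "w \<in> M" "z = w \<lhd> P" using LP zV by (auto simp: LP_def)
  have "h n w = 0" if "n \<in> N" for n
  proof -
    have "h n w * P = h n z" using w that D by (simp add: h_r P_R)
    also have "\<dots> = 0" using z that by (auto simp: orth_def)
    finally show ?thesis using P_cancel h_R that w D by metis
  qed
  then show "\<exists>w\<in>orth N M. z = w \<lhd> P" using w by (auto simp: orth_def)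
qed

text \<open>The projection onto the complement along \<open>N\<close> is a bimodule homomorphism, so
  it carries the generators outside \<open>J\<close> to generators of the same kinds. They form a
  basis because the complement is a copy of \<open>M\<close> modulo \<open>N\<close>.\<close>

lemma split_off:
  assumes b: "basis \<kappa> I g M" and J: "J \<subseteq> I" and N: "N = span \<kappa> J g"
    and proj: "\<And>x. x \<in> M \<Longrightarrow> \<exists>n\<in>N. x - n \<in> orth N M"
    and nondeg: "\<And>n. n \<in> N \<Longrightarrow> (\<And>n'. n' \<in> N \<Longrightarrow> h n' n = 0) \<Longrightarrow> n = 0"
  shows "\<exists>g'. basis \<kappa> (I - J) g' (orth N M)"
proof -
  note g = basis_gens[OF b]
  have gJ: "gens \<kappa> J g" and gK: "gens \<kappa> (I - J) g" using gens_mono[OF g] J by auto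
  have subM: "sub_bimodule M" by (rule basis_sub[OF b])
  have subN: "sub_bimodule N" using span_sub[OF gJ] N by simp
  have NM: "N \<subseteq> M"
    unfolding N by (rule span_least[OF gJ subM]) (use J basis_gen[OF b] in auto)
  note DM = sub_bimoduleD[OF subM] and DN = sub_bimoduleD[OF subN]
  have subO: "sub_bimodule (orth N M)" by (rule orth_sub[OF subN subM])
  note DO = sub_bimoduleD[OF subO]
  \<comment> \<open>A chosen component in the complement; \<open>nondeg\<close> makes it unique
    (\<open>qI\<close>), and uniqueness gives its linearity.\<close>
  define q where "q x = (SOME y. y \<in> orth N M \<and> x - y \<in> N)" for x
  have q: "q x \<in> orth N M \<and> x - q x \<in> N" if "x \<in> M" for x
  proof -
    obtain n where "n \<in> N" "x - n \<in> orth N M" using proj[OF \<open>x \<in> M\<close>] by blast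
    then have "x - n \<in> orth N M \<and> x - (x - n) \<in> N" by simp
    then show ?thesis unfolding q_def by (rule someI)
  qed
  have qI: "q x = y" if x: "x \<in> M" "y \<in> orth N M" "x - y \<in> N" for x y
  proof -
    have "y - q x \<in> orth N M" using q[OF x(1)] x(2) by (blast intro: DO(5))
    moreover have "y - q x \<in> N" using q[OF x(1)] x(3) DN(5)[of "x - q x" "x - y"] by simp
    ultimately have "y - q x = 0" by (intro nondeg) (auto simp: orth_def)
    then show ?thesis by simp
  qed
  have q_add: "q (x + y) = q x + q y" if "x \<in> M" "y \<in> M" for x y
  proof (rule qI)
    show "x + y \<in> M" by (rule DM(3)[OF that])
    show "q x + q y \<in> orth N M" using q that by (blast intro: DO(3))
    have "(x - q x) + (y - q y) \<in> N" using q that by (blast intro: DN(3))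
    then show "x + y - (q x + q y) \<in> N" by (simp add: algebra_simps)
  qed
  have q_r: "q (x \<lhd> a) = q x \<lhd> a" if x: "x \<in> M" and a: "a \<in> R" for x a
  proof (rule qI)
    show "x \<lhd> a \<in> M" by (rule DM(7)[OF a x])
    show "q x \<lhd> a \<in> orth N M" using q[OF x] by (blast intro: DO(7) a)
    have "(x - q x) \<lhd> a \<in> N" using q[OF x] by (blast intro: DN(7) a)
    then show "x \<lhd> a - q x \<lhd> a \<in> N" using DO(1)[of "q x"] q[OF x] DM(1)[OF x] a by (simp add: r_diff)
  qed
  have q_l: "q (a \<rhd> x) = a \<rhd> q x" if x: "x \<in> M" and a: "a \<in> R" for x a
  proof (rule qI)
    show "a \<rhd> x \<in> M" by (rule DM(6)[OF a x])
    show "a \<rhd> q x \<in> orth N M" using q[OF x] by (blast intro: DO(6) a)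
    have "a \<rhd> (x - q x) \<in> N" using q[OF x] by (blast intro: DN(6) a)
    then show "a \<rhd> x - a \<rhd> q x \<in> N" using DO(1)[of "q x"] q[OF x] DM(1)[OF x] a by (simp add: l_diff)
  qed
  have q_N: "q x = 0" if "x \<in> N" for x using that NM DO(2) by (intro qI) auto
  have q_O: "q x = x" if "x \<in> orth N M" for x using that DN(2) by (intro qI) (auto simp: orth_def)
  have q_sum: "q (sum f A) = (\<Sum>i\<in>A. q (f i))" if "\<And>i. i \<in> A \<Longrightarrow> f i \<in> M" for f and A :: "'b set"
    using that
    by (induction A rule: infinite_finite_induct)
      (auto simp: q_N DN(2) q_add sub_bimodule_sum[OF subM])
  define g' where "g' i = q (g i)" for i
  have gM: "g i \<in> M" if "i \<in> I" for i using that basis_gen[OF b] by auto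
  have g'O: "g' i \<in> orth N M" if "i \<in> I" for i using q[OF gM[OF that]] g'_def by simp
  have g': "gens \<kappa> (I - J) g'"
    unfolding gens_def gen_def homog_def
  proof (intro conjI ballI impI)
    show "finite (I - J)" using gens_finite[OF g] by simp
    fix i assume i: "i \<in> I - J"
    then show "g' i \<in> V" using DO(1)[OF g'O] by simp
    show "a \<rhd> g' i = g' i \<lhd> tw (snd (\<kappa> i)) a" if a: "a \<in> C" for a
    proof -
      have "a \<rhd> g' i = q (a \<rhd> g i)" using q_l gM i a C_R by (simp add: g'_def)
      also have "\<dots> = g' i \<lhd> tw (snd (\<kappa> i)) a"
        using homog_C[OF gensD(3)[OF g] a] q_r gM i a C_R tw_C by (simp add: g'_def)
      finally show ?thesis .
    qed
    show "P \<rhd> g' i = g' i \<lhd> P" if a: "\<not> fst (\<kappa> i)"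
      using q_l[of "g i" P] q_r[of "g i" P] gensD(4)[OF g _ a] gM i P_R by (simp add: g'_def)
  qed
  have lcM: "lc (I - J) g c d \<in> M" if "coords (I - J) \<kappa> c d" for c d
    using that basis_gen[OF b] span_least[OF gK subM] unfolding span_def by blast
  have lc': "lc (I - J) g' c d = q (lc (I - J) g c d)" if cd: "coords (I - J) \<kappa> c d" for c d
  proof -
    have "q (\<Sum>i\<in>I - J. g i \<lhd> c i + (P \<rhd> g i) \<lhd> d i) =
        (\<Sum>i\<in>I - J. q (g i \<lhd> c i + (P \<rhd> g i) \<lhd> d i))"
      by (intro q_sum DM(3,6,7) gM coordsD[OF cd] P_R) auto
    also have "\<dots> = (\<Sum>i\<in>I - J. g' i \<lhd> c i + (P \<rhd> g' i) \<lhd> d i)"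
    proof (intro sum.cong refl)
      fix i assume i: "i \<in> I - J"
      then have iM: "g i \<in> M" using gM by auto
      note ci = coordsD(1,2)[OF cd i]
      show "q (g i \<lhd> c i + (P \<rhd> g i) \<lhd> d i) = g' i \<lhd> c i + (P \<rhd> g' i) \<lhd> d i"
        using q_add[OF DM(7)[OF ci(1) iM] DM(7)[OF ci(2) DM(6)[OF P_R iM]]]
          q_r[OF iM ci(1)] q_r[OF DM(6)[OF P_R iM] ci(2)] q_l[OF iM P_R] by (simp add: g'_def)
    qed
    finally show ?thesis unfolding lc_def by simp
  qed
  show ?thesis
  proof (intro exI)
    show "basis \<kappa> (I - J) g' (orth N M)"
      unfolding basis_def
    proof (intro conjI allI impI)
      show "gens \<kappa> (I - J) g'" by fact
      show "orth N M = span \<kappa> (I - J) g'"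
      proof
        show "span \<kappa> (I - J) g' \<subseteq> orth N M" using span_least[OF g' subO] g'O by auto
        show "orth N M \<subseteq> span \<kappa> (I - J) g'"
        proof
          fix y assume y: "y \<in> orth N M"
          then have "y \<in> M" by (auto simp: orth_def)
          then obtain c d where cd: "coords I \<kappa> c d" "y = lc I g c d" by (rule basis_coords[OF b])
          have cdK: "coords (I - J) \<kappa> c d" and cdJ: "coords J \<kappa> c d"
            using coords_mono[OF cd(1)] J by auto
          have lJ: "lc J g c d \<in> N" using cdJ unfolding N span_def by blast
          have "y = q y" using q_O y by simp
          also have "\<dots> = q (lc J g c d + lc (I - J) g c d)"
            using lc_split[OF g cd(1) J] cd by simp
          also have "\<dots> = lc (I - J) g' c d"
            using q_add[of "lc J g c d" "lc (I - J) g c d"] lJ NM lcM[OF cdK] q_N lc'[OF cdK] by auto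
          finally show "y \<in> span \<kappa> (I - J) g'" unfolding span_def using cdK by blast
        qed
      qed
      fix c d assume "coords (I - J) \<kappa> c d \<and> lc (I - J) g' c d = 0"
      then have cd: "coords (I - J) \<kappa> c d" and 0: "q (lc (I - J) g c d) = 0" using lc' by auto
      \<comment> \<open>A relation between the projections lifts to an element of \<open>N\<close>.
        Its coordinates are supported both outside and inside \<open>J\<close>, so they
        vanish.\<close>
      have "lc (I - J) g c d \<in> N" using q[OF lcM[OF cd]] 0 by simp
      then obtain c' d' where cd': "coords J \<kappa> c' d'" "lc (I - J) g c d = lc J g c' d'"
        unfolding N span_def by blast
      have eq: "lc I g (\<lambda>i. if i \<in> I - J then c i else 0) (\<lambda>i. if i \<in> I - J then d i else 0) =
        lc I g (\<lambda>i. if i \<in> J then c' i else 0) (\<lambda>i. if i \<in> J then d' i else 0)"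
        using lc_extend[OF g, of "I - J" c d] lc_extend[OF g J, of c' d'] cd' by simp
      note u = basis_unique[OF b coords_extend[OF cd] coords_extend[OF cd'(1)] eq]
      show "\<forall>i\<in>I - J. c i = 0 \<and> d i = 0"
        using u J by fastforce
    qed
  qed
qed

text \<open>The basis \<open>u\<close> of the block need not consist of members of an old basis;
  only its span and the kinds of its members are tied to the indices. The last two conditions say
  that \<open>M\<close> is the direct sum of the block and its orthogonal complement.\<close>

definition splits :: "('i \<Rightarrow> bool \<times> bool) \<Rightarrow> 'i set \<Rightarrow> 'i set \<Rightarrow> ('i \<Rightarrow> 'l) \<Rightarrow> 'l set \<Rightarrow> bool" where
  "splits \<kappa> I J u M \<longleftrightarrow> J \<subseteq> I \<and> basis \<kappa> J u (span \<kappa> J u) \<and>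
     (\<exists>g'. basis \<kappa> (I - J) g' (orth (span \<kappa> J u) M)) \<and> span \<kappa> J u \<subseteq> M \<and>
     (\<forall>x\<in>M. \<exists>n\<in>span \<kappa> J u. x - n \<in> orth (span \<kappa> J u) M) \<and>
     (\<forall>n\<in>span \<kappa> J u. (\<forall>n'\<in>span \<kappa> J u. h n' n = 0) \<longrightarrow> n = 0)"

text \<open>\<open>A i\<close> and \<open>B i\<close> are, up to a unit, the basis dual to \<open>u i\<close> and \<open>P u i\<close>.\<close>

lemma splitsI:
  assumes b: "basis \<kappa> I g M" and J: "J \<subseteq> I" and u: "gens \<kappa> J u"
    and sp: "span \<kappa> J u = span \<kappa> J g"
    and AB: "\<And>i. i \<in> J \<Longrightarrow> A i \<in> span \<kappa> J u" "\<And>i. i \<in> J \<Longrightarrow> B i \<in> span \<kappa> J u"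
    and e: "e \<in> R" "e' \<in> R" "e * e' = 1" "e' * e = 1"
    and hA: "\<And>i c d. i \<in> J \<Longrightarrow> coords J \<kappa> c d \<Longrightarrow> h (A i) (lc J u c d) = e * c i"
    and hB: "\<And>i c d. i \<in> J \<Longrightarrow> coords J \<kappa> c d \<Longrightarrow> fst (\<kappa> i) \<Longrightarrow> h (B i) (lc J u c d) = e * d i"
    and cov: "\<And>y i. y \<in> V \<Longrightarrow> (\<And>i. i \<in> J \<Longrightarrow> h (A i) y = 0) \<Longrightarrow>
      (\<And>i. i \<in> J \<Longrightarrow> fst (\<kappa> i) \<Longrightarrow> h (B i) y = 0) \<Longrightarrow> i \<in> J \<Longrightarrow> h (u i) y = 0 \<and> h (P \<rhd> u i) y = 0"
  shows "splits \<kappa> I J u M"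
proof -
  define N where "N = span \<kappa> J u"
  note g = basis_gens[OF b]
  have gJ: "gens \<kappa> J g" using gens_mono[OF g] J by auto
  have subM: "sub_bimodule M" by (rule basis_sub[OF b])
  have subN: "sub_bimodule N" using span_sub[OF u] N_def by simp
  have NM: "N \<subseteq> M"
    unfolding N_def sp by (rule span_least[OF gJ subM]) (use J basis_gen[OF b] in auto)
  note DM = sub_bimoduleD[OF subM] and DN = sub_bimoduleD[OF subN]
  have AV: "A i \<in> V" "B i \<in> V" if "i \<in> J" for i using AB that DN unfolding N_def by auto
  have c0: "x = 0" if "e * x = 0" for x using that e by (metis mult.assoc mult_1 mult_zero_right)
  have nondeg: "(\<forall>i\<in>J. c i = 0 \<and> d i = 0)"
    if cd: "coords J \<kappa> c d" and 0: "\<And>n'. n' \<in> N \<Longrightarrow> h n' (lc J u c d) = 0" for c d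
  proof
    fix i assume i: "i \<in> J"
    have "c i = 0" using hA[OF i cd] 0[of "A i"] AB(1)[OF i] c0 N_def by simp
    moreover have "d i = 0"
      using hB[OF i cd] 0[of "B i"] AB(2)[OF i] c0 N_def coordsD(3)[OF cd i] by (cases "fst (\<kappa> i)") auto
    ultimately show "c i = 0 \<and> d i = 0" by simp
  qed
  have bN: "basis \<kappa> J u N"
    unfolding basis_def
  proof (intro conjI allI impI)
    fix c d assume *: "coords J \<kappa> c d \<and> lc J u c d = 0"
    show "\<forall>i\<in>J. c i = 0 \<and> d i = 0"
      by (rule nondeg) (use * h_zero DN in auto)
  qed (use u N_def in auto)
  have proj: "\<exists>n\<in>N. x - n \<in> orth N M" if x: "x \<in> M" for x
  proof -
    have xV: "x \<in> V" using x DM by auto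
    \<comment> \<open>Orthogonal projection by the dual basis: on a vector of \<open>N\<close> these
      formulas return its coordinates, \<open>e'\<close> undoing the unit \<open>e\<close>.\<close>
    define c where "c i = e' * h (A i) x" for i
    define d where "d i = (if fst (\<kappa> i) then e' * h (B i) x else 0)" for i
    have cd: "coords J \<kappa> c d"
      unfolding coords_def c_def d_def using h_R AV xV e R_mult R_zero by auto
    define n where "n = lc J u c d"
    have nN: "n \<in> N" using cd unfolding n_def N_def span_def by blast
    have nV: "n \<in> V" using nN DN by auto
    have yV: "x - n \<in> V" using xV nV V_diff by auto
    have "h (A i) (x - n) = 0" if i: "i \<in> J" for i
      using hA[OF i cd] AV[OF i] xV nV e unfolding n_def[symmetric]
      by (simp add: h_diff c_def mult.assoc[symmetric])
    moreover have "h (B i) (x - n) = 0" if i: "i \<in> J" "fst (\<kappa> i)" for i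
      using hB[OF i(1) cd i(2)] AV[OF i(1)] xV nV e i unfolding n_def[symmetric]
      by (simp add: h_diff d_def mult.assoc[symmetric])
    ultimately have u0: "h (u i) (x - n) = 0" "h (P \<rhd> u i) (x - n) = 0" if "i \<in> J" for i
      using cov[OF yV] that by auto
    have "h n' (x - n) = 0" if n': "n' \<in> N" for n'
    proof -
      obtain c' d' where cd': "coords J \<kappa> c' d'" "n' = lc J u c' d'"
        using n' unfolding N_def span_def by blast
      have "h (x - n) n' = 0"
        unfolding cd'(2) h_lc[OF yV u cd'(1)]
        using u0 h_comm_zero[OF yV gensD(1)[OF u]] h_comm_zero[OF yV gensD(2)[OF u]]
        by (intro sum.neutral) simp
      then show ?thesis using h_comm_zero yV n' DN by auto
    qed
    moreover have "x - n \<in> M" using x nN NM DM by auto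
    ultimately show ?thesis using nN unfolding orth_def by auto
  qed
  have nd: "n = 0" if n: "n \<in> N" and 0: "\<forall>n'\<in>N. h n' n = 0" for n
  proof -
    obtain c d where cd: "coords J \<kappa> c d" "n = lc J u c d"
      using n unfolding N_def span_def by blast
    have "\<forall>i\<in>J. c i = 0 \<and> d i = 0" using nondeg[OF cd(1)] 0 cd(2) by auto
    then have "lc J u c d = lc J u (\<lambda>_. 0) (\<lambda>_. 0)" by (intro lc_cong) auto
    then show "n = 0" using cd lc_zero[OF u] by simp
  qed
  have "\<exists>g'. basis \<kappa> (I - J) g' (orth N M)"
  proof (rule split_off[OF b J _ proj])
    show "N = span \<kappa> J g" using N_def sp by simp
  qed (use nd in blast)+
  then show ?thesis
    unfolding splits_def N_def[symmetric] using J bN NM proj nd by blast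
qed

section \<open>Generators that pair to a unit\<close>

lemma sg_odd: "od \<Longrightarrow> sg z = - z"
  unfolding sg_def by simp

lemma sg_even: "\<not> od \<Longrightarrow> sg z = z"
  unfolding sg_def by simp

text \<open>In both cases some coordinate equals 1, while all coordinates of a multiple of
  \<open>P\<close> lie in \<open>RP\<close>. So \<open>LP\<close> cannot let such a vector pair into
  \<open>RP\<close> with all of \<open>M\<close>.\<close>

lemma gen_not_divisible:
  assumes b: "basis \<kappa> I g M" and i: "i \<in> I" and w: "w \<in> M"
  shows "g i \<noteq> w \<lhd> P" "fst (\<kappa> i) \<Longrightarrow> P \<rhd> g i \<noteq> w \<lhd> P"
proof -
  note g = basis_gens[OF b]
  obtain c d where cd: "coords I \<kappa> c d" "w = lc I g c d" by (rule basis_coords[OF b w])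
  have wP: "w \<lhd> P = lc I g (\<lambda>i. c i * P) (\<lambda>i. d i * P)"
    using lc_right[OF g cd(1) P_R] cd(2) by simp
  note cP = coords_right[OF cd(1) P_R]
  have no: "x * P \<noteq> 1" if "x \<in> R" for x
    using that one_notin_RP unfolding RP_def by force
  show "g i \<noteq> w \<lhd> P"
  proof
    assume "g i = w \<lhd> P"
    then have "lc I g (\<lambda>j. if j = i then 1 else 0) (\<lambda>j. if j = i then 0 else 0) =
        lc I g (\<lambda>i. c i * P) (\<lambda>i. d i * P)"
      using lc_single[OF g i R_one R_zero] gensD(1,2)[OF g i] wP by (simp add: one_r zero_r)
    from basis_unique(1)[OF b coords_single[OF R_one R_zero] cP this i]
    show False using no[OF coordsD(1)[OF cd(1) i]] by simp
  qed
  show "P \<rhd> g i \<noteq> w \<lhd> P" if T: "fst (\<kappa> i)"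
  proof
    assume "P \<rhd> g i = w \<lhd> P"
    then have "lc I g (\<lambda>j. if j = i then 0 else 0) (\<lambda>j. if j = i then 1 else 0) =
        lc I g (\<lambda>i. c i * P) (\<lambda>i. d i * P)"
      using lc_single[OF g i R_zero R_one] gensD(1,2)[OF g i] wP by (simp add: one_r zero_r)
    from basis_unique(2)[OF b coords_single[OF R_zero R_one] cP this i]
    show False using no[OF coordsD(2)[OF cd(1) i]] T by simp
  qed
qed

text \<open>Contrapositive of \<open>LP\<close>: values in \<open>RP\<close> on the right basis give
  values in \<open>RP\<close> on all of \<open>M\<close>, since \<open>RP\<close> is a right
  ideal.\<close>

lemma unit_pairing:
  assumes b: "basis \<kappa> I g M" and LP: "LP M" and x: "x \<in> M" "\<And>w. w \<in> M \<Longrightarrow> x \<noteq> w \<lhd> P"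
  shows "\<exists>j\<in>I. h x (g j) \<notin> RP \<or> fst (\<kappa> j) \<and> h x (P \<rhd> g j) \<notin> RP"
proof (rule ccontr)
  assume "\<not> (\<exists>j\<in>I. h x (g j) \<notin> RP \<or> fst (\<kappa> j) \<and> h x (P \<rhd> g j) \<notin> RP)"
  then have *: "h x (g j) \<in> RP" "fst (\<kappa> j) \<Longrightarrow> h x (P \<rhd> g j) \<in> RP" if "j \<in> I" for j
    using that by blast+
  note g = basis_gens[OF b]
  have xV: "x \<in> V" using x sub_bimoduleD(1)[OF basis_sub[OF b]] by auto
  have "h x y \<in> RP" if y: "y \<in> M" for y
  proof -
    obtain c d where cd: "coords I \<kappa> c d" "y = lc I g c d" by (rule basis_coords[OF b y])
    have "h x (g j) * c j + h x (P \<rhd> g j) * d j \<in> RP" if j: "j \<in> I" for j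
      using *[OF j] coordsD[OF cd(1) j]
      by (cases "fst (\<kappa> j)") (auto intro!: RP_add RP_right)
    then show ?thesis unfolding cd(2) h_lc[OF xV g cd(1)] by (intro RP_sum)
  qed
  then show False using LP x unfolding LP_def by blast
qed

text \<open>The test vector is \<open>P \<rhd> g i\<close> rather than \<open>g i\<close>. Its
  values on other \<open>P\<close>-multiples contain \<open>P * P\<close>, and those on generators
  with \<open>fst\<close> false contain \<open>P\<close>, so a unit can only occur on a generator
  with \<open>fst\<close> true; homogeneity then fixes its second component.\<close>

lemma T_partner:
  assumes b: "basis \<kappa> I g M" and LP: "LP M" and i: "i \<in> I" "fst (\<kappa> i)"
  obtains j where "j \<in> I" "fst (\<kappa> j)" "od = (snd (\<kappa> i) = snd (\<kappa> j))"
    "h (P \<rhd> g i) (g j) \<in> C" "h (P \<rhd> g i) (g j) \<notin> RP"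
proof -
  note g = basis_gens[OF b]
  have PM: "P \<rhd> g i \<in> M"
    by (rule sub_bimoduleD(6)[OF basis_sub[OF b] P_R basis_gen[OF b i(1)]])
  then obtain j where j: "j \<in> I"
      "h (P \<rhd> g i) (g j) \<notin> RP \<or> fst (\<kappa> j) \<and> h (P \<rhd> g i) (P \<rhd> g j) \<notin> RP"
    using unit_pairing[OF b LP PM gen_not_divisible(2)[OF b i(1) _ i(2)]] by blast
  note V = gensD[OF g i(1)] gensD[OF g j(1)]
  have PPRP: "x * (P * P) \<in> RP" if "x \<in> R" for x
    using that P_RP P_R by (simp add: RP_left)
  have "h (P \<rhd> g i) (P \<rhd> g j) \<in> RP"
    using V by (simp add: h_PP sg_RP PPRP h_R)
  then have u: "h (P \<rhd> g i) (g j) \<notin> RP" using j by auto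
  have T: "fst (\<kappa> j)"
  proof (rule ccontr)
    assume "\<not> fst (\<kappa> j)"
    then have "h (P \<rhd> g i) (g j) = sg (h (g i) (g j) * P)"
      using V P_R by (simp add: h_Pl h_r)
    then show False using u V by (simp add: sg_RP RP_left P_RP h_R)
  qed
  have "od = (snd (\<kappa> i) = snd (\<kappa> j))"
    using h_incompat_RP[OF homog_P[OF V(3)] V(7)] u by auto
  moreover from this have "h (P \<rhd> g i) (g j) \<in> C"
    using h_compat[OF homog_P[OF V(3)] V(7)] by auto
  ultimately show ?thesis using that j(1) T u by auto
qed

text \<open>With no generator of the other sort left, the right basis contains no
  \<open>P\<close>-multiples that could attain the unit value instead. This dictates the order in
  which blocks are split off.\<close>

lemma R_partner:
  assumes b: "basis \<kappa> I g M" and LP: "LP M" and i: "i \<in> I" and noT: "\<And>j. j \<in> I \<Longrightarrow> \<not> fst (\<kappa> j)"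
  obtains j where "j \<in> I" "od = (snd (\<kappa> i) \<noteq> snd (\<kappa> j))" "h (g i) (g j) \<in> C" "h (g i) (g j) \<notin> RP"
proof -
  note g = basis_gens[OF b]
  obtain j where j: "j \<in> I" "h (g i) (g j) \<notin> RP"
    using unit_pairing[OF b LP basis_gen[OF b i] gen_not_divisible(1)[OF b i]] noT by blast
  note V = gensD[OF g i] gensD[OF g j(1)]
  have "od = (snd (\<kappa> i) \<noteq> snd (\<kappa> j))"
    using h_incompat_RP[OF V(3) V(7)] j by auto
  moreover from this have "h (g i) (g j) \<in> C"
    using h_compat[OF V(3) V(7)] by auto
  ultimately show ?thesis using that j by auto
qed

text \<open>For odd valuation the partner has the same kind but may be a different generator. Adding
  a multiple of it then creates a unit self-pairing, by polarization of a skew-hermitian form;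
  \<open>\<omega>\<close> makes the cross terms a unit even in residue characteristic 2.\<close>

lemma T_self_pairing:
  assumes od: od and b: "basis \<kappa> I g M" and LP: "LP M" and i: "i \<in> I" "fst (\<kappa> i)"
  obtains j g' where "j \<in> I" "\<kappa> j = \<kappa> i" "basis \<kappa> I g' M" "h (P \<rhd> g' j) (g' j) \<notin> RP"
proof (cases "\<exists>j\<in>I. \<kappa> j = \<kappa> i \<and> h (P \<rhd> g j) (g j) \<notin> RP")
  case True
  then show ?thesis using that b by blast
next
  case False
  note g = basis_gens[OF b]
  obtain j where j: "j \<in> I" "fst (\<kappa> j)" "od = (snd (\<kappa> i) = snd (\<kappa> j))"
    and z: "h (P \<rhd> g i) (g j) \<in> C" "h (P \<rhd> g i) (g j) \<notin> RP"
    by (rule T_partner[OF b LP i])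
  have k: "\<kappa> j = \<kappa> i" using j od i(2) by (simp add: prod_eq_iff)
  have ij: "i \<noteq> j" using False z i by auto
  have ii: "h (P \<rhd> g i) (g i) \<in> RP" and jj: "h (P \<rhd> g j) (g j) \<in> RP" using False i j k by auto
  note V = gensD[OF g i(1)] gensD[OF g j(1)]
  define z where "z = h (P \<rhd> g i) (g j)"
  obtain z' where z': "z' \<in> C" "z * z' = 1" using C_unit z by (auto simp: z_def)
  have zC: "z \<in> C" using z by (simp add: z_def)
  \<comment> \<open>Chosen so that the two cross terms are \<open>\<omega> * \<delta>\<close> and
    \<open>cj \<omega> * \<delta>\<close>, whose sum is \<open>\<delta>\<close> because
    \<open>\<omega>\<close> has trace 1.\<close>
  define a where "a = z' * (\<omega> * \<delta>)"
  have a: "a \<in> C" "a \<in> R" using z' \<omega> \<delta> C_mult C_R by (auto simp: a_def)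
  have za: "z * a = \<omega> * \<delta>" using z' by (simp add: a_def mult.assoc[symmetric])
  have ji: "h (P \<rhd> g j) (g i) = - cj z"
    using h_cj[of "P \<rhd> g j" "g i"] h_Pr[of "g i" "g j"] V
    by (simp add: z_def sg_odd[OF od] cj_uminus)
  define x where "x = g i + g j \<lhd> a"
  define g' where "g' = g(i := x)"
  have "basis \<kappa> I g' M"
    unfolding g'_def x_def using basis_add_multiple[OF b i(1) j(1) ij k i(2) a(1)] .
  moreover have "h (P \<rhd> x) x \<notin> RP"
  proof
    have Px: "P \<rhd> x = P \<rhd> g i + (P \<rhd> g j) \<lhd> a"
      using V a by (simp add: x_def l_add l_r P_R V_r)
    have "h (P \<rhd> x) x = h (P \<rhd> g i) (g i) + z * a + (cj a * (- cj z) + cj a * h (P \<rhd> g j) (g j) * a)"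
      unfolding Px unfolding x_def
      using V a ji by (simp add: h_add h_add_l V_r V_add h_l h_r z_def mult.assoc distrib_left distrib_right)
    moreover have "cj a * cj z = - (cj \<omega> * \<delta>)"
      using za \<delta> \<omega> C_commute[OF \<delta>(1) cj_C[OF \<omega>(1)]] by (metis cj_mult mult_minus_left)
    moreover have "\<omega> * \<delta> + cj \<omega> * \<delta> = \<delta>" using \<omega> by (metis distrib_right mult_1)
    ultimately have "h (P \<rhd> x) x = \<delta> + (h (P \<rhd> g i) (g i) + cj a * h (P \<rhd> g j) (g j) * a)"
      using za by (simp add: algebra_simps)
    moreover have "h (P \<rhd> g i) (g i) + cj a * h (P \<rhd> g j) (g j) * a \<in> RP" (is "?r \<in> RP")
      using a ii jj by (intro RP_add RP_right RP_left cj_R)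
    moreover assume "h (P \<rhd> x) x \<in> RP"
    ultimately have "\<delta> \<in> RP" using RP_add RP_uminus by (metis add_diff_cancel_right' diff_conv_add_uminus)
    then show False using unit_notin_RP C_R \<delta>(3) by blast
  qed
  ultimately show ?thesis using that[of i g'] i by (simp add: g'_def)
qed

section \<open>Blocks of matrix type for odd valuation\<close>

lemma span_eqI:
  assumes "gens \<kappa> J u" "gens \<kappa> J g"
    and "\<And>N. sub_bimodule N \<Longrightarrow> (\<forall>i\<in>J. u i \<in> N) \<longleftrightarrow> (\<forall>i\<in>J. g i \<in> N)"
  shows "span \<kappa> J u = span \<kappa> J g"
proof
  have "\<forall>i\<in>J. u i \<in> span \<kappa> J g"
    using assms(3)[OF span_sub[OF assms(2)]] span_gen[OF assms(2)] by simp
  then show "span \<kappa> J u \<subseteq> span \<kappa> J g" using span_least[OF assms(1) span_sub[OF assms(2)]] by auto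
  have "\<forall>i\<in>J. g i \<in> span \<kappa> J u"
    using assms(3)[OF span_sub[OF assms(1)]] span_gen[OF assms(1)] by simp
  then show "span \<kappa> J g \<subseteq> span \<kappa> J u" using span_least[OF assms(2) span_sub[OF assms(1)]] by auto
qed

lemma scale_mem:
  assumes N: "sub_bimodule N" and z: "z \<in> C" "z' \<in> C" "z * z' = 1" and x: "x \<in> V"
  shows "x \<lhd> z \<in> N \<longleftrightarrow> x \<in> N"
proof -
  have "x \<lhd> z \<lhd> z' = x" using x z by (simp add: mult_r[symmetric] C_R one_r)
  then show ?thesis using sub_bimoduleD(7)[OF N] z C_R by metis
qed

text \<open>Both \<open>\<delta>\<close> and the value from \<open>T_self_pairing\<close> are units
  of trace zero, so their quotient is fixed by \<open>cj\<close> and is a norm; rescaling by an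
  element of that norm turns the value into \<open>\<delta>\<close>. That \<open>h u u\<close> is
  zero comes for free, as it is self-conjugate in \<open>C * P\<close>.\<close>

lemma block_T_odd:
  assumes od: od and b: "basis \<kappa> I g M" and LP: "LP M" and i: "i \<in> I" "fst (\<kappa> i)"
  obtains j u where "j \<in> I" "\<kappa> j = \<kappa> i" "splits \<kappa> I {j} (\<lambda>_. u) M" "h u u = 0" "h (P \<rhd> u) u = \<delta>"
proof -
  obtain j g' where j: "j \<in> I" "\<kappa> j = \<kappa> i" and b': "basis \<kappa> I g' M"
    and u: "h (P \<rhd> g' j) (g' j) \<notin> RP"
    by (rule T_self_pairing[OF assms])
  note g' = basis_gens[OF b']
  note V = gensD[OF g' j(1)]
  define z where "z = h (P \<rhd> g' j) (g' j)"
  have zC: "z \<in> C" unfolding z_def using h_compat[OF homog_P[OF V(3)] V(3)] od by simp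
  then obtain z' where z': "z' \<in> C" "z * z' = 1" "z' * z = 1" using C_unit u z_def by blast
  have cjz: "cj z = - z"
    using h_cj[of "g' j" "P \<rhd> g' j"] h_Pr[of "g' j" "g' j"] V
    by (simp add: z_def sg_odd[OF od])
  have cjz': "cj z' = - z'"
  proof -
    have "z * cj z' = - 1" using z'(3) cjz by (metis cj_mult cj_one minus_minus mult_minus_left)
    then have "z' * (z * cj z') = - z'" by simp
    then show ?thesis using z'(3) by (simp add: mult.assoc[symmetric])
  qed
  obtain \<delta>' where \<delta>': "\<delta>' \<in> C" "\<delta> * \<delta>' = 1" "\<delta>' * \<delta> = 1" using \<delta> C_commute by metis
  have "\<exists>a\<in>C. a * cj a = \<delta> * z'"
  proof (rule norm_surj)
    show "\<delta> * z' \<in> C" using \<delta> z' C_mult by auto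
    show "cj (\<delta> * z') = \<delta> * z'" using cjz' \<delta> z' C_commute by (simp add: cj_mult)
    have "\<delta> * z' * (z * \<delta>') = 1" using z'(3) \<delta>'(2) by (metis mult.assoc mult_1)
    then show "\<exists>y\<in>C. \<delta> * z' * y = 1" using zC \<delta>' C_mult by blast
  qed
  then obtain a where a: "a \<in> C" "a * cj a = \<delta> * z'" by blast
  have aR: "a \<in> R" using a C_R by simp
  have a': "cj a * (z * \<delta>') \<in> C" "a * (cj a * (z * \<delta>')) = 1"
    using a zC \<delta>' C_mult cj_C z'(3) by auto (metis mult.assoc mult_1)
  define x where "x = g' j \<lhd> a"
  have xV: "x \<in> V" "P \<rhd> x \<in> V" using V aR by (simp_all add: x_def V_closed P_R)
  have hx: "homog (snd (\<kappa> j)) x" unfolding x_def by (rule homog_C_r[OF V(3) a(1)])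
  have u: "gens \<kappa> {j} (\<lambda>_. x)" using hx i j by (simp add: gens_def gen_T)
  have xx: "h x x = 0" using h_incompat_fixed[OF hx hx] od by simp
  have Pxx: "h (P \<rhd> x) x = \<delta>"
  proof -
    have "h (P \<rhd> x) x = cj a * z * a"
      using V aR by (simp add: x_def l_r[symmetric] P_R h_l h_r V_r z_def) (simp add: l_r P_R h_l h_r V_r z_def mult.assoc)
    also have "\<dots> = a * cj a * z" using a zC C_commute cj_C by (metis mult.assoc)
    finally show ?thesis using a z' by (simp add: mult.assoc)
  qed
  have xPx: "h x (P \<rhd> x) = - \<delta>" using h_Pr[of x x] Pxx xV by (simp add: sg_odd[OF od])
  have PxPx: "h (P \<rhd> x) (P \<rhd> x) = 0" using h_PP[of x x] xx xV by (simp add: sg_odd[OF od])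
  have sp: "span \<kappa> {j} (\<lambda>_. x) = span \<kappa> {j} g'"
    by (rule span_eqI[OF u]) (use gens_mono[OF g'] j scale_mem[OF _ a(1) a' V(1)] x_def in auto)
  note spD = sub_bimoduleD[OF span_sub[OF u]]
  have xs: "x \<in> span \<kappa> {j} (\<lambda>_. x)" using span_gen[OF u] by simp
  \<comment> \<open>\<open>P \<rhd> x\<close> and \<open>- x\<close> are dual to \<open>x\<close>
    and \<open>P \<rhd> x\<close>, up to the unit \<open>\<delta>\<close>.\<close>
  have hA: "h (P \<rhd> x) (lc {j} (\<lambda>_. x) c d) = \<delta> * c j" if "coords {j} \<kappa> c d" for c d
    unfolding h_lc[OF xV(2) u that] using Pxx PxPx by simp
  have hB: "h (- x) (lc {j} (\<lambda>_. x) c d) = \<delta> * d j" if cd: "coords {j} \<kappa> c d" for c d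
  proof -
    have neg: "h (- x) y = - h x y" if "y \<in> V" for y
      using h_cj[of "- x" y] h_cj[of x y] h_uminus[of y x] that xV V_uminus by (simp add: cj_uminus)
    show ?thesis unfolding h_lc[OF V_uminus[OF xV(1)] u cd] using xx xPx xV by (simp add: neg)
  qed
  have neg: "h (- x) y = - h x y" if "y \<in> V" for y
    using h_cj[of "- x" y] h_cj[of x y] h_uminus[of y x] that xV V_uminus by (simp add: cj_uminus)
  have *: "splits \<kappa> I {j} (\<lambda>_. x) M"
    by (rule splitsI[OF b' _ u sp, of "\<lambda>_. P \<rhd> x" "\<lambda>_. - x" \<delta> \<delta>'])
      (use i j spD(4)[OF xs] spD(6)[OF P_R xs] \<delta>(1) \<delta>' C_R hA hB neg in auto)
  show ?thesis by (rule that[OF j * xx Pxx])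
qed

section \<open>Blocks of matrix type for even valuation\<close>

definition equi :: "'l \<Rightarrow> 'l \<Rightarrow> 'l \<Rightarrow> 'l \<Rightarrow> bool" where
  "equi x y x' y' \<longleftrightarrow> (\<forall>N. sub_bimodule N \<longrightarrow> (x \<in> N \<and> y \<in> N \<longleftrightarrow> x' \<in> N \<and> y' \<in> N))"

lemma equi_trans: "equi x y x' y' \<Longrightarrow> equi x' y' x'' y'' \<Longrightarrow> equi x y x'' y''"
  by (simp add: equi_def)

lemma fixed_C: "x \<in> V \<Longrightarrow> cj (h x x) = h x x"
  using h_cj by metis

lemma normalize_partner:
  assumes od: "\<not> od" and x: "homog \<epsilon> x" and y: "homog (\<not> \<epsilon>) y" and u: "h (P \<rhd> x) y \<notin> RP"
  obtains z where "z \<in> C" "homog (\<not> \<epsilon>) (y \<lhd> z)" "equi x y x (y \<lhd> z)" "h (P \<rhd> x) (y \<lhd> z) = 1"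
proof -
  have V: "x \<in> V" "y \<in> V" "P \<rhd> x \<in> V" using x y homog_V V_l P_R by auto
  have "h (P \<rhd> x) y \<in> C" using h_compat[OF homog_P[OF x] y] od by simp
  then obtain z where z: "z \<in> C" "h (P \<rhd> x) y * z = 1" "z * h (P \<rhd> x) y = 1"
    using C_unit u by blast
  have "equi x y x (y \<lhd> z)"
    unfolding equi_def using scale_mem[OF _ z(1) _ z(3) V(2)] \<open>h (P \<rhd> x) y \<in> C\<close> by auto
  then show ?thesis using that[OF z(1) homog_C_r[OF y z(1)]] z V C_R by (simp add: h_r)
qed

text \<open>The correction is a multiple of \<open>P \<rhd> y\<close>, which has the same
  homogeneity as \<open>x\<close> and pairs with \<open>x\<close> to 1. With coefficient
  \<open>\<omega> * t\<close>, \<open>t\<close> fixed by \<open>cj\<close>, the cross terms add up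
  to \<open>t\<close> and the last term is divisible by \<open>P * P\<close>, so isotropy becomes an
  equation for Hensel's lemma.\<close>

lemma isotropic_first:
  assumes od: "\<not> od" and x: "homog \<epsilon> x" and y: "homog (\<not> \<epsilon>) y" and u: "h (P \<rhd> x) y = 1"
  obtains x' where "homog \<epsilon> x'" "equi x y x' y" "h (P \<rhd> x') y \<notin> RP" "h x' x' = 0"
proof -
  have V: "x \<in> V" "y \<in> V" "P \<rhd> x \<in> V" "P \<rhd> y \<in> V" using x y homog_V V_l P_R by auto
  define \<alpha> where "\<alpha> = h x x"
  define \<beta> where "\<beta> = h y y"
  have \<alpha>: "\<alpha> \<in> C" "cj \<alpha> = \<alpha>" using h_compat[OF x x] od fixed_C V by (auto simp: \<alpha>_def)
  have \<beta>: "\<beta> \<in> C" "cj \<beta> = \<beta>" using h_compat[OF y y] od fixed_C V by (auto simp: \<beta>_def)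
  have xPy: "h x (P \<rhd> y) = 1" using u h_Pr[OF V(1,2)] by (simp add: sg_even[OF od])
  have Pyx: "h (P \<rhd> y) x = 1" using xPy h_cj[OF V(4,1)] by (simp add: cj_one)
  have PyPy: "h (P \<rhd> y) (P \<rhd> y) = \<beta> * (P * P)"
    using h_PP[OF V(2,2)] by (simp add: sg_even[OF od] \<beta>_def)
  define \<nu> where "\<nu> = cj \<omega> * \<omega>"
  have \<nu>: "\<nu> \<in> C" "cj \<nu> = \<nu>" using \<omega> C_mult cj_C by (auto simp: \<nu>_def cj_mult cj_cj)
  \<comment> \<open>The condition \<open>h x' x' = 0\<close> solved for its linear term;
    \<open>\<nu>\<close> is the norm of \<open>\<omega>\<close>.\<close>
  obtain t where t: "t \<in> C" "cj t = t" "t = - \<alpha> + P * P * (- (\<beta> * \<nu>)) * t * t"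
    using quad_solve[of "- \<alpha>" "- (\<beta> * \<nu>)"] \<alpha> \<beta> \<nu> C_closed C_commute[OF \<beta>(1) \<nu>(1)]
    by (auto simp: cj_uminus cj_mult)
  define a where "a = \<omega> * t"
  have a: "a \<in> C" "a \<in> R" using \<omega> t C_mult C_R by (auto simp: a_def)
  have cja: "cj a = cj \<omega> * t" using t C_commute[OF t(1) cj_C[OF \<omega>(1)]] by (simp add: a_def cj_mult)
  define x' where "x' = x + (P \<rhd> y) \<lhd> a"
  have hx: "homog \<epsilon> x'"
    unfolding x'_def using homog_C_r[OF homog_P[OF y] a(1)] by (intro homog_add x) simp
  have "h x' x' = \<alpha> + (a + cj a) + cj a * (\<beta> * (P * P)) * a"
    unfolding x'_def using V a xPy Pyx PyPy
    by (simp add: h_add h_add_l V_r V_add h_l h_r \<alpha>_def[symmetric] mult.assoc[symmetric] distrib_left distrib_right)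
  also have "a + cj a = t" using \<omega> by (metis a_def cja distrib_right mult_1)
  also have "cj a * (\<beta> * (P * P)) * a = P * P * (\<beta> * \<nu>) * t * t"
    unfolding cja unfolding a_def \<nu>_def
    using C_commute PP_C \<omega> \<beta> t C_mult cj_C by (smt (verit, ccfv_threshold) mult.assoc)
  finally have "h x' x' = \<alpha> + t + P * P * (\<beta> * \<nu>) * t * t" .
  then have xx: "h x' x' = 0" using t(3) by (simp add: algebra_simps)
  have Px': "P \<rhd> x' = P \<rhd> x + y \<lhd> (P * P * a)"
    using V a by (simp add: x'_def l_add l_r P_R V_r PP_l mult_r R_mult)
  have "h (P \<rhd> x') y = 1 + cj (P * P * a) * \<beta>"
    unfolding Px' using V a u by (simp add: h_add_l h_l V_r R_mult P_R \<beta>_def)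
  moreover have PPRP: "P * P * a \<in> RP" using a P_RP P_R by (simp add: RP_left RP_right R_mult)
  moreover have "cj (P * P * a) * \<beta> \<in> RP" using PPRP RP_cj \<beta> C_R RP_right by blast
  ultimately have nu: "h (P \<rhd> x') y \<notin> RP"
    using RP_add[of "h (P \<rhd> x') y" "- (cj (P * P * a) * \<beta>)"] RP_uminus one_notin_RP by auto
  have "equi x y x' y"
    unfolding equi_def
  proof (intro allI impI)
    fix N assume N: "sub_bimodule N"
    note D = sub_bimoduleD[OF N]
    have "(P \<rhd> y) \<lhd> a \<in> N" if "y \<in> N" using that a by (intro D P_R)
    then show "x \<in> N \<and> y \<in> N \<longleftrightarrow> x' \<in> N \<and> y \<in> N"
      unfolding x'_def using D(3)[of x "(P \<rhd> y) \<lhd> a"] D(5)[of "x + (P \<rhd> y) \<lhd> a" "(P \<rhd> y) \<lhd> a"] by auto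
  qed
  then show ?thesis using that hx nu xx by blast
qed

text \<open>As \<open>x\<close> is isotropic, so is \<open>P \<rhd> x\<close>, and correcting
  \<open>y\<close> by a multiple of it is a linear problem: the coefficient must have trace
  \<open>- h y y\<close>, which \<open>- (h y y * \<omega>)\<close> has.\<close>

lemma isotropic_second:
  assumes od: "\<not> od" and x: "homog \<epsilon> x" and y: "homog (\<not> \<epsilon>) y" and u: "h (P \<rhd> x) y = 1"
    and xx: "h x x = 0"
  obtains y' where "homog (\<not> \<epsilon>) y'" "equi x y x y'" "h (P \<rhd> x) y' = 1" "h y' y' = 0"
proof -
  have V: "x \<in> V" "y \<in> V" "P \<rhd> x \<in> V" "P \<rhd> y \<in> V" using x y homog_V V_l P_R by auto
  define \<beta> where "\<beta> = h y y"
  have \<beta>: "\<beta> \<in> C" "cj \<beta> = \<beta>" using h_compat[OF y y] od fixed_C V by (auto simp: \<beta>_def)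
  have yPx: "h y (P \<rhd> x) = 1" using u h_cj[OF V(2,3)] by (simp add: cj_one)
  have PxPx: "h (P \<rhd> x) (P \<rhd> x) = 0"
    using h_PP[OF V(1,1)] xx by (simp add: sg_even[OF od])
  define b where "b = - (\<beta> * \<omega>)"
  have b: "b \<in> C" "b \<in> R" using \<omega> \<beta> C_mult C_uminus C_R by (auto simp: b_def)
  have cjb: "cj b = - (\<beta> * cj \<omega>)"
    using \<beta> C_commute[OF \<beta>(1) cj_C[OF \<omega>(1)]] by (simp add: b_def cj_mult cj_uminus)
  have bb: "b + cj b = - \<beta>"
    unfolding cjb unfolding b_def using \<omega>(2) by (metis distrib_left minus_add_distrib mult_1_right)
  define y' where "y' = y + (P \<rhd> x) \<lhd> b"
  have hy: "homog (\<not> \<epsilon>) y'"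
    unfolding y'_def using homog_add[OF y homog_C_r[OF homog_P[OF x] b(1)]] by simp
  have "h y' y' = \<beta> + (b + cj b)"
    unfolding y'_def using V b yPx u PxPx
    by (simp add: h_add h_add_l V_r V_add h_l h_r \<beta>_def[symmetric] mult.assoc[symmetric] distrib_left distrib_right)
  then have yy: "h y' y' = 0" using bb by simp
  have u': "h (P \<rhd> x) y' = 1"
    unfolding y'_def using V b u PxPx by (simp add: h_add h_r V_r)
  have "equi x y x y'"
    unfolding equi_def
  proof (intro allI impI)
    fix N assume N: "sub_bimodule N"
    note D = sub_bimoduleD[OF N]
    have "(P \<rhd> x) \<lhd> b \<in> N" if "x \<in> N" using that b by (intro D P_R)
    then show "x \<in> N \<and> y \<in> N \<longleftrightarrow> x \<in> N \<and> y' \<in> N"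
      unfolding y'_def using D(3)[of y "(P \<rhd> x) \<lhd> b"] D(5)[of "y + (P \<rhd> x) \<lhd> b" "(P \<rhd> x) \<lhd> b"] by auto
  qed
  then show ?thesis using that hy u' yy by blast
qed

text \<open>Since \<open>h x (P \<rhd> y) = 1\<close>, subtracting \<open>P \<rhd> y\<close> times
  \<open>h x y\<close> removes the remaining value. Isotropy of \<open>y\<close> survives:
  \<open>h (P \<rhd> y) y\<close> is self-conjugate in \<open>C * P\<close>, hence zero, and
  \<open>P \<rhd> y\<close> is isotropic with \<open>y\<close>.\<close>

lemma make_orthogonal:
  assumes od: "\<not> od" and x: "homog \<epsilon> x" and y: "homog (\<not> \<epsilon>) y" and u: "h (P \<rhd> x) y = 1"
    and xx: "h x x = 0" and yy: "h y y = 0"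
  obtains y' where "homog (\<not> \<epsilon>) y'" "equi x y x y'" "h (P \<rhd> x) y' \<notin> RP" "h y' y' = 0" "h x y' = 0"
proof -
  have V: "x \<in> V" "y \<in> V" "P \<rhd> x \<in> V" "P \<rhd> y \<in> V" using x y homog_V V_l P_R by auto
  obtain w where w: "w \<in> C" "h x y = w * P" using h_incompat[OF x y] od by auto
  define b where "b = w * P"
  have b: "b \<in> RP" "b \<in> R" using w C_R by (auto simp: b_def RP_def intro: R_mult P_R)
  have xPy: "h x (P \<rhd> y) = 1" using u h_Pr[OF V(1,2)] by (simp add: sg_even[OF od])
  have PyPy: "h (P \<rhd> y) (P \<rhd> y) = 0"
    using h_PP[OF V(2,2)] yy by (simp add: sg_even[OF od])
  have "h (P \<rhd> y) y = h y (P \<rhd> y)"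
    using h_Pl[OF V(2,2)] by (simp add: sg_even[OF od])
  then have Pyy: "h (P \<rhd> y) y = 0"
    using h_incompat_fixed[OF homog_P[OF y] y] od by simp
  have yPy: "h y (P \<rhd> y) = 0" using Pyy h_comm_zero V by auto
  have PxPy: "h (P \<rhd> x) (P \<rhd> y) = b * (P * P)"
    using h_PP[OF V(1,2)] w by (simp add: sg_even[OF od] b_def)
  define y' where "y' = y - (P \<rhd> y) \<lhd> b"
  have neg: "h (a - c) z = h a z - h c z" if "a \<in> V" "c \<in> V" "z \<in> V" for a c z
    using that h_cj h_diff cj_diff V_diff by metis
  have "homog (\<not> \<epsilon>) ((P \<rhd> y) \<lhd> w \<lhd> P)"
    using homog_P_r[OF homog_C_r[OF homog_P[OF y] w(1)]] by simp
  moreover have "- ((P \<rhd> y) \<lhd> b) = (P \<rhd> y) \<lhd> w \<lhd> P \<lhd> (- 1)"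
    using V w C_R P_R by (simp add: b_def mult_r uminus_r R_one one_r V_r)
  ultimately have hy: "homog (\<not> \<epsilon>) y'"
    unfolding y'_def using homog_add[OF y homog_C_r[of "\<not> \<epsilon>" "(P \<rhd> y) \<lhd> w \<lhd> P" "- 1"]] C_one C_uminus
    by (metis diff_conv_add_uminus)
  have yy': "h y' y' = 0"
    unfolding y'_def using V b yPy Pyy PyPy yy by (simp add: h_diff neg V_r V_diff h_l h_r)
  have xy': "h x y' = 0"
    unfolding y'_def using V b xPy w by (simp add: h_diff V_r h_r b_def)
  have "h (P \<rhd> x) y' = 1 - b * (P * P) * b"
    unfolding y'_def using V b u PxPy by (simp add: h_diff V_r h_r)
  moreover have bb: "b * (P * P) * b \<in> RP" using b P_R by (simp add: RP_left R_mult)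
  ultimately have nu: "h (P \<rhd> x) y' \<notin> RP"
    using RP_add[of "h (P \<rhd> x) y'" "b * (P * P) * b"] one_notin_RP by auto
  have "P \<rhd> y' = P \<rhd> y - y \<lhd> (P * P * b)"
    using V b by (simp add: y'_def l_diff l_r P_R V_r PP_l mult_r R_mult)
  \<comment> \<open>Applying the opposite correction returns \<open>y\<close> up to the unit
    \<open>1 - P * P * b * b\<close>, so nothing is lost from the generated sub-bimodule.\<close>
  then have y_back: "y' + (P \<rhd> y') \<lhd> b = y \<lhd> (1 - P * P * b * b)"
    using V b by (simp add: y'_def r_diff V_r mult_r R_closed P_R)
      (simp add: add_r[of 1 "- (P * P * b * b)", simplified] uminus_r R_closed P_R one_r mult_r)
  have PPbb: "P * P * b * b \<in> C" "P * P * b * b \<in> RP"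
  proof -
    have "b * b = w * cj w * (P * P)" using P_C[OF w(1)] by (simp add: b_def) (metis mult.assoc)
    then have "P * P * b * b = P * P * (w * cj w * (P * P))" by (simp add: mult.assoc)
    then show "P * P * b * b \<in> C" using PP_C w C_mult cj_C by presburger
    show "P * P * b * b \<in> RP" using b P_R by (simp add: RP_left R_mult)
  qed
  have "1 - P * P * b * b \<in> C" "1 - P * P * b * b \<notin> RP"
    using PPbb C_diff C_one RP_add[of "1 - P * P * b * b" "P * P * b * b"] one_notin_RP by auto
  then obtain z where z: "z \<in> C" "(1 - P * P * b * b) * z = 1" "1 - P * P * b * b \<in> C" using C_unit by blast
  have "equi x y x y'"
    unfolding equi_def
  proof (intro allI impI)
    fix N assume N: "sub_bimodule N"
    note D = sub_bimoduleD[OF N]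
    have "(P \<rhd> y) \<lhd> b \<in> N" if "y \<in> N" using that b by (intro D P_R)
    moreover have "(P \<rhd> y') \<lhd> b \<in> N" if "y' \<in> N" using that b by (intro D P_R)
    ultimately show "x \<in> N \<and> y \<in> N \<longleftrightarrow> x \<in> N \<and> y' \<in> N"
      using D(5)[of y "(P \<rhd> y) \<lhd> b"] D(3)[of y' "(P \<rhd> y') \<lhd> b"] y_back
        scale_mem[OF N z(3,1,2) V(2)] by (auto simp: y'_def)
  qed
  then show ?thesis using that hy nu yy' xy' by blast
qed

text \<open>The order matters: \<open>x\<close> is made isotropic while \<open>y\<close> is
  arbitrary, then \<open>y\<close> is corrected linearly, and \<open>h x y\<close> is removed last.
  Some corrections leave \<open>h (P \<rhd> x) y\<close> only a unit, whence the rescalings of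
  \<open>y\<close> in between. \<open>equi\<close> records, by membership in arbitrary
  sub-bimodules, that the generated sub-bimodule does not change.\<close>

lemma hyperbolic_pair:
  assumes od: "\<not> od" and x: "homog \<epsilon> x" and y: "homog (\<not> \<epsilon>) y" and u: "h (P \<rhd> x) y \<notin> RP"
  obtains x' y' where "homog \<epsilon> x'" "homog (\<not> \<epsilon>) y'" "equi x y x' y'"
    "h x' x' = 0" "h y' y' = 0" "h x' y' = 0" "h (P \<rhd> x') y' = 1"
proof -
  obtain z where 1: "z \<in> C" "homog (\<not> \<epsilon>) (y \<lhd> z)" "equi x y x (y \<lhd> z)" "h (P \<rhd> x) (y \<lhd> z) = 1"
    by (rule normalize_partner[OF assms])
  obtain x2 where 2: "homog \<epsilon> x2" "equi x (y \<lhd> z) x2 (y \<lhd> z)" "h (P \<rhd> x2) (y \<lhd> z) \<notin> RP" "h x2 x2 = 0"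
    by (rule isotropic_first[OF od x 1(2,4)])
  obtain z3 where 3: "z3 \<in> C" "homog (\<not> \<epsilon>) (y \<lhd> z \<lhd> z3)" "equi x2 (y \<lhd> z) x2 (y \<lhd> z \<lhd> z3)"
      "h (P \<rhd> x2) (y \<lhd> z \<lhd> z3) = 1"
    by (rule normalize_partner[OF od 2(1) 1(2) 2(3)])
  obtain y4 where 4: "homog (\<not> \<epsilon>) y4" "equi x2 (y \<lhd> z \<lhd> z3) x2 y4" "h (P \<rhd> x2) y4 = 1" "h y4 y4 = 0"
    by (rule isotropic_second[OF od 2(1) 3(2,4) 2(4)])
  obtain y5 where 5: "homog (\<not> \<epsilon>) y5" "equi x2 y4 x2 y5" "h (P \<rhd> x2) y5 \<notin> RP" "h y5 y5 = 0" "h x2 y5 = 0"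
    by (rule make_orthogonal[OF od 2(1) 4(1,3) 2(4) 4(4)])
  obtain z6 where 6: "z6 \<in> C" "homog (\<not> \<epsilon>) (y5 \<lhd> z6)" "equi x2 y5 x2 (y5 \<lhd> z6)"
      "h (P \<rhd> x2) (y5 \<lhd> z6) = 1"
    by (rule normalize_partner[OF od 2(1) 5(1,3)])
  have V: "y5 \<in> V" "x2 \<in> V" using 5 2 homog_V by auto
  have "h (y5 \<lhd> z6) (y5 \<lhd> z6) = 0" "h x2 (y5 \<lhd> z6) = 0"
    using V 5 6(1) C_R by (simp_all add: h_l h_r V_r)
  moreover have "equi x y x2 (y5 \<lhd> z6)"
    using 1(3) 2(2) 3(3) 4(2) 5(2) 6(3) by (meson equi_trans)
  ultimately show ?thesis using that 2 6 by blast
qed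

text \<open>The self-pairings \<open>h (P \<rhd> z) z\<close> vanish as symmetric values in
  \<open>C * P\<close>. The only nonzero Gram entries left are the ones, between \<open>x\<close>
  and \<open>P \<rhd> y\<close> and between \<open>y\<close> and \<open>P \<rhd> x\<close>.\<close>

lemma block_T_even:
  assumes od: "\<not> od" and b: "basis \<kappa> I g M" and LP: "LP M" and i: "i \<in> I" "fst (\<kappa> i)"
  obtains j u where "j \<in> I" "i \<noteq> j" "fst (\<kappa> j)" "snd (\<kappa> j) = (\<not> snd (\<kappa> i))" "splits \<kappa> I {i, j} u M"
    "h (u i) (u i) = 0" "h (u j) (u j) = 0" "h (u i) (u j) = 0" "h (P \<rhd> u i) (u j) = 1"
    "h (P \<rhd> u i) (u i) = 0" "h (P \<rhd> u j) (u j) = 0"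
proof -
  note g = basis_gens[OF b]
  obtain j where j: "j \<in> I" "fst (\<kappa> j)" "od = (snd (\<kappa> i) = snd (\<kappa> j))"
    and nu: "h (P \<rhd> g i) (g j) \<notin> RP"
    by (rule T_partner[OF b LP i])
  have k: "snd (\<kappa> j) = (\<not> snd (\<kappa> i))" using j od by auto
  have ij: "i \<noteq> j" using k by auto
  note gi = gensD[OF g i(1)] and gj = gensD[OF g j(1)]
  obtain x y where x: "homog (snd (\<kappa> i)) x" and y: "homog (\<not> snd (\<kappa> i)) y"
    and eq: "equi (g i) (g j) x y"
    and xx: "h x x = 0" and yy: "h y y = 0" and xy: "h x y = 0" and Pxy: "h (P \<rhd> x) y = 1"
    by (rule hyperbolic_pair[OF od gi(3) _ nu]) (use gj(3) k in auto)
  have V: "x \<in> V" "y \<in> V" "P \<rhd> x \<in> V" "P \<rhd> y \<in> V" using x y homog_V V_l P_R by auto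
  have self: "h (P \<rhd> z) z = 0" if "homog \<epsilon> z" for \<epsilon> z
  proof -
    have "h (P \<rhd> z) z = h z (P \<rhd> z)"
      using h_Pl[of z z] homog_V[OF that] by (simp add: sg_even[OF od])
    then show ?thesis using h_incompat_fixed[OF homog_P[OF that] that] od by simp
  qed
  note Pxx = self[OF x] and Pyy = self[OF y]
  have xPx: "h x (P \<rhd> x) = 0" and yPy: "h y (P \<rhd> y) = 0" using Pxx Pyy V h_comm_zero by auto
  have yx: "h y x = 0" using xy V h_comm_zero by auto
  have yPx: "h y (P \<rhd> x) = 1" using Pxy h_cj[OF V(2,3)] by (simp add: cj_one)
  have Pyx: "h (P \<rhd> y) x = 1" using yPx h_Pl[OF V(2,1)] by (simp add: sg_even[OF od])
  have xPy: "h x (P \<rhd> y) = 1" using Pyx h_cj[OF V(1,4)] by (simp add: cj_one)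
  have PP: "h (P \<rhd> x) (P \<rhd> x) = 0" "h (P \<rhd> x) (P \<rhd> y) = 0" "h (P \<rhd> y) (P \<rhd> x) = 0" "h (P \<rhd> y) (P \<rhd> y) = 0"
    using h_PP V xx yy xy yx by (simp_all add: sg_even[OF od])
  note G = xx yy xy yx Pxx Pyy xPx yPy Pxy yPx Pyx xPy PP
  define u where "u = (\<lambda>k. if k = i then x else y)"
  have u: "u i = x" "u j = y" using ij by (auto simp: u_def)
  have gu: "gens \<kappa> {i, j} u" using x y i j k u by (auto simp: gens_def gen_T)
  have sp: "span \<kappa> {i, j} u = span \<kappa> {i, j} g"
    by (rule span_eqI[OF gu]) (use gens_mono[OF g] i j eq u in \<open>auto simp: equi_def\<close>)
  have mem: "x \<in> span \<kappa> {i, j} u" "y \<in> span \<kappa> {i, j} u"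
    using span_gen[OF gu, of i] span_gen[OF gu, of j] u by auto
  note D = sub_bimoduleD[OF span_sub[OF gu]]
  have hlc: "h z (lc {i, j} u c d) = h z x * c i + h z (P \<rhd> x) * d i + (h z y * c j + h z (P \<rhd> y) * d j)"
    if "z \<in> V" "coords {i, j} \<kappa> c d" for z c d
    unfolding h_lc[OF that(1) gu that(2)] using ij u by simp
  \<comment> \<open>The dual basis is a permutation: \<open>P \<rhd> y\<close> and
    \<open>P \<rhd> x\<close> read off the coordinates of \<open>x\<close> and \<open>y\<close>,
    while \<open>y\<close> and \<open>x\<close> read off those of \<open>P \<rhd> x\<close> and
    \<open>P \<rhd> y\<close>.\<close>
  define A where "A = (\<lambda>k. if k = i then P \<rhd> y else P \<rhd> x)"
  define B where "B = (\<lambda>k. if k = i then y else x)"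
  have AB: "A i = P \<rhd> y" "A j = P \<rhd> x" "B i = y" "B j = x" using ij by (auto simp: A_def B_def)
  have "splits \<kappa> I {i, j} u M"
  proof (rule splitsI[OF b _ gu sp, of A B 1 1])
    show "{i, j} \<subseteq> I" using i j by auto
    show "A k \<in> span \<kappa> {i, j} u" "B k \<in> span \<kappa> {i, j} u" if "k \<in> {i, j}" for k
      using D(6)[OF P_R mem(1)] D(6)[OF P_R mem(2)] mem by (simp_all add: A_def B_def)
    show "h (A k) (lc {i, j} u c d) = 1 * c k" if k: "k \<in> {i, j}" and cd: "coords {i, j} \<kappa> c d" for k c d
    proof -
      have "h (P \<rhd> y) (lc {i, j} u c d) = c i" "h (P \<rhd> x) (lc {i, j} u c d) = c j"
        unfolding hlc[OF V(4) cd] hlc[OF V(3) cd] by (simp_all add: G)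
      then show ?thesis using k by (auto simp: A_def)
    qed
    show "h (B k) (lc {i, j} u c d) = 1 * d k" if k: "k \<in> {i, j}" and cd: "coords {i, j} \<kappa> c d" for k c d
    proof -
      have "h y (lc {i, j} u c d) = d i" "h x (lc {i, j} u c d) = d j"
        unfolding hlc[OF V(1) cd] hlc[OF V(2) cd] by (simp_all add: G)
      then show ?thesis using k by (auto simp: B_def)
    qed
    fix z k assume "\<And>k. k \<in> {i, j} \<Longrightarrow> h (A k) z = 0" "\<And>k. k \<in> {i, j} \<Longrightarrow> fst (\<kappa> k) \<Longrightarrow> h (B k) z = 0"
    from this(1)[of i] this(1)[of j] this(2)[of i] this(2)[of j]
    have "h (P \<rhd> x) z = 0" "h (P \<rhd> y) z = 0" "h x z = 0" "h y z = 0" using AB i j by auto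
    then show "h (u k) z = 0 \<and> h (P \<rhd> u k) z = 0" by (simp add: u_def)
  qed (auto simp: R_one)
  then show ?thesis using that[of j u] j ij k u G by auto
qed

text \<open>Evaluating the pairing of \<open>P \<rhd> g k\<close> with \<open>g l\<close> by moving
  \<open>P\<close> through either generator shows that a value in \<open>C\<close> is fixed by
  \<open>cj\<close> for odd valuation and has trace zero for even valuation. Hence the diagonal
  vanishes, the partner is a different generator, and 1 and \<open>\<delta>\<close> are the
  respective normal forms.\<close>

lemma block_R:
  assumes b: "basis \<kappa> I g M" and LP: "LP M" and i: "i \<in> I" and noT: "\<And>j. j \<in> I \<Longrightarrow> \<not> fst (\<kappa> j)"
  obtains j u where "j \<in> I" "i \<noteq> j" "od = (snd (\<kappa> i) \<noteq> snd (\<kappa> j))" "splits \<kappa> I {i, j} u M"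
    "h (u i) (u i) = 0" "h (u j) (u j) = 0" "h (u i) (u j) = (if od then 1 else \<delta>)"
proof -
  note g = basis_gens[OF b]
  obtain j where j: "j \<in> I" "od = (snd (\<kappa> i) \<noteq> snd (\<kappa> j))"
    and z: "h (g i) (g j) \<in> C" "h (g i) (g j) \<notin> RP"
    by (rule R_partner[OF b LP i noT])
  note gi = gensD[OF g i] and gj = gensD[OF g j(1)]
  have Pswap: "cj (h (g k) (g l)) * P = - sg (h (g k) (g l)) * P"
    if k: "k \<in> I" and l: "l \<in> I" and hC: "h (g k) (g l) \<in> C" for k l
  proof -
    note gk = gensD[OF g k] and gl = gensD[OF g l]
    have "h (P \<rhd> g k) (g l) = - (P * h (g k) (g l))"
      using gk(1,2,4) gl(1) noT[OF k] by (simp add: h_l P_R cj_P)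
    moreover have "h (P \<rhd> g k) (g l) = sg (h (g k) (g l) * P)"
      using gk(1) gl(1,4) noT[OF l] by (simp add: h_Pl h_r P_R)
    ultimately show ?thesis using P_C[OF hC] by (auto simp: sg_def minus_equation_iff)
  qed
  have cj_h: "cj (h (g k) (g l)) = - sg (h (g k) (g l))"
    if k: "k \<in> I" and l: "l \<in> I" and hC: "h (g k) (g l) \<in> C" for k l
  proof -
    have "(cj (h (g k) (g l)) + sg (h (g k) (g l))) * P = 0"
      using Pswap[OF that] by (simp add: distrib_right)
    moreover have "cj (h (g k) (g l)) + sg (h (g k) (g l)) \<in> R"
      using hC by (intro R_add C_R cj_C sg_C)
    ultimately show ?thesis using P_cancel by (simp add: eq_neg_iff_add_eq_0)
  qed
  define z where "z = h (g i) (g j)"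
  obtain z' where z': "z' \<in> C" "z * z' = 1" "z' * z = 1" using C_unit z by (auto simp: z_def)
  define e where "e = (if od then 1 else \<delta>)"
  obtain e' where e: "e \<in> C" "e' \<in> C" "e * e' = 1" "e' * e = 1"
  proof (cases od)
    case True then show ?thesis using that[of 1] C_one by (simp add: e_def)
  next
    case False then show ?thesis using that \<delta> C_commute unfolding e_def by metis
  qed
  have cje: "cj e = - sg e" by (auto simp: e_def sg_def cj_one \<delta>)
  have cjz: "cj z = - sg z" using cj_h[OF i j(1) z(1)] by (simp add: z_def)
  have self0: "h (g k) (g k) = 0" if k: "k \<in> I" for k
  proof (cases od)
    case True
    then show ?thesis using h_incompat_fixed[OF gensD(3)[OF g k] gensD(3)[OF g k]] by simp
  next
    case False
    have hC: "h (g k) (g k) \<in> C" using h_compat[OF gensD(3)[OF g k] gensD(3)[OF g k]] False by simp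
    have "h (g k) (g k) = - h (g k) (g k)"
      using cj_h[OF k k hC] fixed_C[OF gensD(1)[OF g k]] by (simp add: sg_even[OF False])
    then have "h (g k) (g k) + h (g k) (g k) = 0" by (metis add.right_inverse)
    then show ?thesis by (rule two_cancel)
  qed
  have zC: "z \<in> C" using z z_def by simp
  have ij: "i \<noteq> j"
  proof
    assume "i = j"
    then have "z = 0" using self0[OF i] by (simp add: z_def)
    then show False using z'(2) C_indep[OF C_one C_zero] by simp
  qed
  define a where "a = z' * e"
  have a: "a \<in> C" "a \<in> R" using z' e C_mult C_R by (auto simp: a_def)
  have za: "z * a = e" using z' by (simp add: a_def mult.assoc[symmetric])
  have a': "e' * z \<in> C" "a * (e' * z) = 1"
    using e zC C_mult z' by (auto simp: a_def) (metis mult.assoc mult_1)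
  \<comment> \<open>Scaling by \<open>a\<close> respects \<open>P \<rhd> y = y \<lhd> P\<close>
    because \<open>a\<close>, being fixed by \<open>cj\<close>, commutes with
    \<open>P\<close>.\<close>
  have cja: "cj a = a"
  proof -
    have "cj a * cj z = cj e" using za C_commute[OF zC a(1)] cj_mult[of z a] by simp
    then have "cj a * - sg z = - sg e" unfolding cjz cje .
    then have "cj a * z = e" unfolding sg_def by (cases od) simp_all
    then have "cj a * z * z' = e * z'" by simp
    then show ?thesis using z' C_commute[OF e(1) z'(1)] by (simp add: a_def mult.assoc)
  qed
  define y where "y = g j \<lhd> a"
  have y: "gen (\<kappa> j) y"
    unfolding gen_def
  proof (intro conjI impI)
    show "homog (snd (\<kappa> j)) y" unfolding y_def by (rule homog_C_r[OF gj(3) a(1)])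
    have "P \<rhd> y = g j \<lhd> (P * a)" using gj noT[OF j(1)] a by (simp add: y_def l_r P_R mult_r)
    also have "P * a = a * P" using P_C[OF a(1)] cja by simp
    also have "g j \<lhd> (a * P) = y \<lhd> P" using gj a by (simp add: y_def mult_r P_R)
    finally show "P \<rhd> y = y \<lhd> P" .
  qed
  define u where "u = (\<lambda>k. if k = i then g i else y)"
  have u: "u i = g i" "u j = y" using ij by (auto simp: u_def)
  have gu: "gens \<kappa> {i, j} u" using y g i j u by (auto simp: gens_def)
  have sp: "span \<kappa> {i, j} u = span \<kappa> {i, j} g"
    by (rule span_eqI[OF gu])
      (use gens_mono[OF g] i j u scale_mem[OF _ a(1) a' gj(1)] y_def in auto)
  have mem: "g i \<in> span \<kappa> {i, j} u" "y \<in> span \<kappa> {i, j} u"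
    using span_gen[OF gu, of i] span_gen[OF gu, of j] u by auto
  note D = sub_bimoduleD[OF span_sub[OF gu]]
  have V: "g i \<in> V" "y \<in> V" "P \<rhd> g i \<in> V" "P \<rhd> y \<in> V"
    using gi gj a by (auto simp: y_def V_r V_l P_R)
  have xy: "h (g i) y = e" using gi gj a za by (simp add: y_def h_r z_def)
  have yx: "h y (g i) = - sg e" using xy cje h_cj[OF V(2,1)] by simp
  have yy: "h y y = 0" using self0[OF j(1)] gj a by (simp add: y_def h_r h_l V_r)
  have hlc: "h w (lc {i, j} u c d) = h w (g i) * c i + h w y * c j"
    if "w \<in> V" "coords {i, j} \<kappa> c d" for w c d
    unfolding h_lc[OF that(1) gu that(2)] using ij u coordsD(3)[OF that(2)] noT i j by simp
  \<comment> \<open>The sign compensates \<open>h y (g i) = - sg e\<close>, so that both dual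
    vectors give the same unit \<open>e\<close>.\<close>
  define A where "A = (\<lambda>k. if k = i then (if od then y else - y) else g i)"
  have A: "A i = (if od then y else - y)" "A j = g i" using ij by (auto simp: A_def)
  have neg: "h (- w) t = - h w t" if "w \<in> V" "t \<in> V" for w t
    using that h_cj[of "- w" t] h_cj[of w t] h_uminus[of t w] V_uminus by (simp add: cj_uminus)
  have "splits \<kappa> I {i, j} u M"
  proof (rule splitsI[OF b _ gu sp, of A u e e'])
    show "{i, j} \<subseteq> I" using i j by auto
    show "A k \<in> span \<kappa> {i, j} u" if "k \<in> {i, j}" for k
      using mem D(4)[OF mem(2)] by (simp add: A_def)
    show "u k \<in> span \<kappa> {i, j} u" if "k \<in> {i, j}" for k
      using span_gen[OF gu that] .
    show "h (A k) (lc {i, j} u c d) = e * c k" if k: "k \<in> {i, j}" and cd: "coords {i, j} \<kappa> c d" for k c d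
      using k hlc[OF V(1) cd] hlc[OF V(2) cd] neg[OF V(2) lc_V[OF gu cd]] A self0[OF i] xy yx yy
      by (auto simp: sg_def)
    show "h (u k) (lc {i, j} u c d) = e * d k" if "k \<in> {i, j}" "coords {i, j} \<kappa> c d" "fst (\<kappa> k)" for k c d
      using that noT i j by auto
    fix t k assume t: "t \<in> V" and k: "k \<in> {i, j}" and "\<And>k. k \<in> {i, j} \<Longrightarrow> h (A k) t = 0"
    from this(3)[of i] this(3)[of j] have 0: "h y t = 0" "h (g i) t = 0"
      using A neg[OF V(2) t] by (auto split: if_splits)
    have "P \<rhd> g i = g i \<lhd> P" "P \<rhd> y = y \<lhd> P" using gi(4) y gen_P noT i j by auto
    then have "h (P \<rhd> g i) t = 0" "h (P \<rhd> y) t = 0" using 0 V t by (simp_all add: h_l P_R)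
    then show "h (u k) t = 0 \<and> h (P \<rhd> u k) t = 0" using 0 by (simp add: u_def)
  qed (use e C_R in auto)
  then show ?thesis using that[of j u] j ij u xy yy self0[OF i] by (auto simp: e_def)
qed

end

text \<open>An orthogonal block consists of generators of kinds \<open>k\<close> and \<open>partner od k\<close>, which may be
  the same generator only for odd valuation and \<open>fst k\<close>.\<close>

definition partner :: "bool \<Rightarrow> bool \<times> bool \<Rightarrow> bool \<times> bool" where
  "partner od k = (fst k, if od = fst k then snd k else \<not> snd k)"

text \<open>In terms of \<open>std_kind\<close>, \<open>(False, False)\<close> and
  \<open>(False, True)\<close> belong to the order and to its ideal generated by \<open>P\<close>,
  \<open>(True, False)\<close> and \<open>(True, True)\<close> to the two matrix bimodules. The
  latter are unconstrained for odd valuation, since each such generator forms a block by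
  itself.\<close>

definition parity :: "bool \<Rightarrow> (bool \<times> bool \<Rightarrow> nat) \<Rightarrow> bool" where
  "parity od c \<longleftrightarrow> (if od then c (False, False) = c (False, True)
     else even (c (False, False)) \<and> even (c (False, True)) \<and> c (True, False) = c (True, True))"

context quat_order
begin

text \<open>The normal forms depend only on the kind, so equal kinds give isometric blocks. For
  \<open>fst\<close> false the entries involving \<open>P\<close> are forced by \<open>P\<close>
  passing through the generator and by \<open>cj P = - P\<close>.\<close>

definition gram_ij :: "bool \<Rightarrow> bool \<times> bool \<Rightarrow> 'a" where
  "gram_ij od k = (if fst k then 0 else if od then 1 else \<delta>)"

definition gram_Pij :: "bool \<Rightarrow> bool \<times> bool \<Rightarrow> 'a" where
  "gram_Pij od k = (if fst k then if od then \<delta> else 1 else - (P * gram_ij od k))"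

definition gram_Pii :: "bool \<Rightarrow> bool \<times> bool \<Rightarrow> 'a" where
  "gram_Pii od k = (if od \<and> fst k then \<delta> else 0)"

end

context herm
begin

text \<open>Generators with \<open>fst\<close> true have priority, as \<open>R_partner\<close>
  demands. The output is uniform over all cases, with \<open>i = j\<close> when a generator is its
  own partner.\<close>

lemma block:
  assumes b: "basis \<kappa> I g M" and LP: "LP M" and i0: "i0 \<in> I"
    and T: "fst (\<kappa> i0) \<or> (\<forall>j\<in>I. \<not> fst (\<kappa> j))"
  obtains i j u where "i \<in> I" "j \<in> I" "\<kappa> i = \<kappa> i0" "\<kappa> j = partner od (\<kappa> i0)"
    "i = j \<longleftrightarrow> od \<and> fst (\<kappa> i0)" "splits \<kappa> I {i, j} u M"
    "\<forall>k\<in>{i, j}. h (u k) (u k) = 0 \<and> h (P \<rhd> u k) (u k) = gram_Pii od (\<kappa> i0)"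
    "i \<noteq> j \<Longrightarrow> h (u i) (u j) = gram_ij od (\<kappa> i0) \<and> h (P \<rhd> u i) (u j) = gram_Pij od (\<kappa> i0)"
proof (cases "fst (\<kappa> i0)")
  case True
  show ?thesis
  proof (cases od)
    case odd: True
    obtain j u where "j \<in> I" "\<kappa> j = \<kappa> i0" "splits \<kappa> I {j} (\<lambda>_. u) M" "h u u = 0" "h (P \<rhd> u) u = \<delta>"
      by (rule block_T_odd[OF odd b LP i0 True])
    then show ?thesis
      using that[of j j "\<lambda>_. u"] True odd by (simp add: partner_def gram_Pii_def prod_eq_iff)
  next
    case even: False
    obtain j u where "j \<in> I" "i0 \<noteq> j" "fst (\<kappa> j)" "snd (\<kappa> j) = (\<not> snd (\<kappa> i0))" "splits \<kappa> I {i0, j} u M"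
      "h (u i0) (u i0) = 0" "h (u j) (u j) = 0" "h (u i0) (u j) = 0" "h (P \<rhd> u i0) (u j) = 1"
      "h (P \<rhd> u i0) (u i0) = 0" "h (P \<rhd> u j) (u j) = 0"
      by (rule block_T_even[OF even b LP i0 True])
    then show ?thesis
      using that[of i0 j u] True even i0
      unfolding partner_def gram_Pii_def gram_Pij_def gram_ij_def by (simp add: prod_eq_iff)
  qed
next
  case False
  then have noT: "\<not> fst (\<kappa> j)" if "j \<in> I" for j using T that by auto
  obtain j u where j: "j \<in> I" "i0 \<noteq> j" "od = (snd (\<kappa> i0) \<noteq> snd (\<kappa> j))" and s: "splits \<kappa> I {i0, j} u M"
    and h0: "h (u i0) (u i0) = 0" "h (u j) (u j) = 0" and h1: "h (u i0) (u j) = (if od then 1 else \<delta>)"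
    by (rule block_R[OF b LP i0 noT])
  have gu: "gens \<kappa> {i0, j} u" using s basis_gens unfolding splits_def by auto
  have Pu: "h (P \<rhd> u k) y = - (P * h (u k) y)" if "k \<in> {i0, j}" "y \<in> V" for k y
    using gensD(1,4)[OF gu that(1)] noT[of k] that i0 j(1) by (auto simp: h_l P_R cj_P)
  have V: "u i0 \<in> V" "u j \<in> V" using gensD(1)[OF gu] by auto
  show ?thesis
  proof (rule that[OF i0 j(1) refl _ _ s])
    show "\<kappa> j = partner od (\<kappa> i0)" using j noT[OF j(1)] False unfolding partner_def by (auto simp: prod_eq_iff)
    show "i0 = j \<longleftrightarrow> od \<and> fst (\<kappa> i0)" using j False by simp
    show "\<forall>k\<in>{i0, j}. h (u k) (u k) = 0 \<and> h (P \<rhd> u k) (u k) = gram_Pii od (\<kappa> i0)"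
      using h0 Pu V False by (auto simp: gram_Pii_def)
    show "h (u i0) (u j) = gram_ij od (\<kappa> i0) \<and> h (P \<rhd> u i0) (u j) = gram_Pij od (\<kappa> i0)"
      using h1 Pu[of i0 "u j"] V False unfolding gram_ij_def gram_Pij_def by simp
  qed
qed

lemma splitsD:
  assumes s: "splits \<kappa> I J u M" and b: "basis \<kappa> I g M" and LP: "LP M"
  defines "N \<equiv> span \<kappa> J u"
  shows "J \<subseteq> I" "basis \<kappa> J u N" "sub_bimodule N" "N \<subseteq> M" "LP (orth N M)"
    "\<exists>g'. basis \<kappa> (I - J) g' (orth N M)" "\<And>x. x \<in> M \<Longrightarrow> \<exists>n\<in>N. x - n \<in> orth N M"
    "\<And>n. n \<in> N \<Longrightarrow> n \<in> orth N M \<Longrightarrow> n = 0" "sub_bimodule (orth N M)"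
proof -
  show J: "J \<subseteq> I" and bN: "basis \<kappa> J u N" and "N \<subseteq> M" "\<exists>g'. basis \<kappa> (I - J) g' (orth N M)"
    and p: "\<And>x. x \<in> M \<Longrightarrow> \<exists>n\<in>N. x - n \<in> orth N M"
    using s unfolding splits_def N_def by auto
  show "\<And>n. n \<in> N \<Longrightarrow> n \<in> orth N M \<Longrightarrow> n = 0"
    using s unfolding splits_def N_def orth_def by auto
  show subN: "sub_bimodule N" by (rule basis_sub[OF bN])
  show "LP (orth N M)" by (rule LP_orth[OF subN basis_sub[OF b] LP p])
  show "sub_bimodule (orth N M)" by (rule orth_sub[OF subN basis_sub[OF b]])
qed

end

context quat_order
begin

definition cnt :: "('i \<Rightarrow> bool \<times> bool) \<Rightarrow> 'i set \<Rightarrow> bool \<times> bool \<Rightarrow> nat" where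
  "cnt \<kappa> I k = card {i \<in> I. \<kappa> i = k}"

lemma cnt_diff: "finite I \<Longrightarrow> J \<subseteq> I \<Longrightarrow> cnt \<kappa> I k = cnt \<kappa> J k + cnt \<kappa> (I - J) k"
proof -
  assume "finite I" "J \<subseteq> I"
  moreover from this have "{i \<in> I. \<kappa> i = k} = {i \<in> J. \<kappa> i = k} \<union> {i \<in> I - J. \<kappa> i = k}" by auto
  ultimately show ?thesis unfolding cnt_def
    by (simp only:) (rule card_Un_disjoint; auto intro: finite_subset)
qed

lemma cnt_pair: "cnt \<kappa> {i, j} k =
    (if \<kappa> i = k then 1 else 0) + (if \<kappa> j = k \<and> i \<noteq> j then 1 else 0)"
proof -
  have "{l \<in> {i, j}. \<kappa> l = k} = (if \<kappa> i = k then {i} else {}) \<union> (if \<kappa> j = k then {j} else {})" by auto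
  then show ?thesis unfolding cnt_def by auto
qed

lemma cnt_pos: "finite I \<Longrightarrow> i \<in> I \<Longrightarrow> cnt \<kappa> I (\<kappa> i) > 0"
  unfolding cnt_def by (subst card_gt_0_iff) auto

lemma cnt_posD: "cnt \<kappa> I k > 0 \<Longrightarrow> \<exists>i\<in>I. \<kappa> i = k"
  unfolding cnt_def by (subst (asm) card_gt_0_iff) auto

end

context herm
begin

text \<open>Removing a block lowers by one each of two counts that the condition equates, or by two
  a count that must be even, or only a count that it ignores.\<close>

lemma parity_of_basis:
  assumes "basis \<kappa> I g M" "LP M" shows "parity od (cnt \<kappa> I)"
  using assms
proof (induction "card I" arbitrary: I g M rule: less_induct)
  case less
  note b = less.prems(1) and LP = less.prems(2)
  have fin: "finite I" by (rule gens_finite[OF basis_gens[OF b]])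
  show ?case
  proof (cases "I = {}")
    case True
    then show ?thesis by (simp add: parity_def cnt_def)
  next
    case False
    then obtain i0 where i0: "i0 \<in> I" "fst (\<kappa> i0) \<or> (\<forall>j\<in>I. \<not> fst (\<kappa> j))" by blast
    obtain i j u where ij: "i \<in> I" "j \<in> I" "\<kappa> i = \<kappa> i0" "\<kappa> j = partner od (\<kappa> i0)"
      "i = j \<longleftrightarrow> od \<and> fst (\<kappa> i0)" and s: "splits \<kappa> I {i, j} u M"
      by (rule block[OF b LP i0])
    obtain g' where g': "basis \<kappa> (I - {i, j}) g' (orth (span \<kappa> {i, j} u) M)"
      using splitsD(6)[OF s b LP] by blast
    have "card (I - {i, j}) < card I" using fin ij by (intro psubset_card_mono) auto
    then have "parity od (cnt \<kappa> (I - {i, j}))" using less.hyps g' splitsD(5)[OF s b LP] by blast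
    moreover have "cnt \<kappa> I k = cnt \<kappa> {i, j} k + cnt \<kappa> (I - {i, j}) k" for k
      using cnt_diff[OF fin] ij by simp
    ultimately show ?thesis
      unfolding parity_def cnt_pair using ij(3-5)
      by (cases "\<kappa> i0"; cases od) (auto simp: partner_def)
  qed
qed

end

section \<open>Isometries\<close>

locale herm_pair = A: herm C cj P \<delta> \<omega> L od h + B: herm C cj P \<delta> \<omega> L' od h'
  for C :: "'a::ring_1 set" and cj P \<delta> \<omega> and L :: "('a, 'l::ab_group_add) bimodule"
    and L' :: "('a, 'm::ab_group_add) bimodule" and od h h'
begin

abbreviation iso :: "'l set \<Rightarrow> 'm set \<Rightarrow> bool" where
  "iso M M' \<equiv> isometric A.R (L\<lparr>bcarrier := M\<rparr>) h (L'\<lparr>bcarrier := M'\<rparr>) h'"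

lemma isoI:
  assumes "bij_betw f M M'" "\<And>x y. x \<in> M \<Longrightarrow> y \<in> M \<Longrightarrow> f (x + y) = f x + f y"
    "\<And>a x. a \<in> A.R \<Longrightarrow> x \<in> M \<Longrightarrow> f (lact L a x) = lact L' a (f x)"
    "\<And>a x. a \<in> A.R \<Longrightarrow> x \<in> M \<Longrightarrow> f (ract L x a) = ract L' (f x) a"
    "\<And>x y. x \<in> M \<Longrightarrow> y \<in> M \<Longrightarrow> h' (f x) (f y) = h x y"
  shows "iso M M'"
  using assms unfolding isometric_def bimodule_iso_def by (intro exI[of _ f]) auto

lemma isoE:
  assumes "iso M M'"
  obtains f where "bij_betw f M M'" "\<And>x y. x \<in> M \<Longrightarrow> y \<in> M \<Longrightarrow> f (x + y) = f x + f y"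
    "\<And>a x. a \<in> A.R \<Longrightarrow> x \<in> M \<Longrightarrow> f (lact L a x) = lact L' a (f x)"
    "\<And>a x. a \<in> A.R \<Longrightarrow> x \<in> M \<Longrightarrow> f (ract L x a) = ract L' (f x) a"
    "\<And>x y. x \<in> M \<Longrightarrow> y \<in> M \<Longrightarrow> h' (f x) (f y) = h x y"
  using assms unfolding isometric_def bimodule_iso_def by auto

text \<open>Coordinates transport one lattice to the other. \<open>G\<close> and \<open>GP\<close>
  determine the form, because Gram entries with \<open>P\<close> in the second or in both arguments
  follow from the adjoint of \<open>P\<close> and from \<open>PP_act\<close>.\<close>

lemma iso_basis:
  assumes b: "A.basis \<kappa> J u N" and b': "B.basis \<kappa> J u' N'"
    and G: "\<And>i j. i \<in> J \<Longrightarrow> j \<in> J \<Longrightarrow> h (u i) (u j) = h' (u' i) (u' j)"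
    and GP: "\<And>i j. i \<in> J \<Longrightarrow> j \<in> J \<Longrightarrow> h (lact L P (u i)) (u j) = h' (lact L' P (u' i)) (u' j)"
  shows "iso N N'"
proof -
  note g = A.basis_gens[OF b] and g' = B.basis_gens[OF b']
  \<comment> \<open>Well defined because coordinates in a basis are unique.\<close>
  define f where "f x = (SOME y. \<exists>c d. A.coords J \<kappa> c d \<and> x = A.lc J u c d \<and> y = B.lc J u' c d)" for x
  have f: "f (A.lc J u c d) = B.lc J u' c d" if cd: "A.coords J \<kappa> c d" for c d
  proof -
    let ?Q = "\<lambda>y. \<exists>c' d'. A.coords J \<kappa> c' d' \<and> A.lc J u c d = A.lc J u c' d' \<and> y = B.lc J u' c' d'"
    have "?Q (B.lc J u' c d)" using cd by blast
    then have "?Q (f (A.lc J u c d))" unfolding f_def by (rule someI)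
    then obtain c' d' where *: "A.coords J \<kappa> c' d'" "A.lc J u c d = A.lc J u c' d'"
      "f (A.lc J u c d) = B.lc J u' c' d'" by blast
    have "B.lc J u' c d = B.lc J u' c' d'"
      using A.basis_unique[OF b cd *(1,2)] by (intro B.lc_cong) auto
    then show ?thesis using * by simp
  qed
  have N: "\<exists>c d. A.coords J \<kappa> c d \<and> x = A.lc J u c d" if "x \<in> N" for x
    using A.basis_coords[OF b that] by blast
  have fC: "f (lact L a x) = lact L' a (f x)" if a: "a \<in> C" and x: "x \<in> N" for a x
  proof -
    obtain c d where cd: "A.coords J \<kappa> c d" "x = A.lc J u c d" using N[OF x] by blast
    show ?thesis unfolding cd(2) A.lc_C[OF g cd(1) a, symmetric] f[OF cd(1)] f[OF A.coords_C[OF cd(1) a]]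
      by (rule B.lc_C[OF g' cd(1) a])
  qed
  have fP: "f (lact L P x) = lact L' P (f x)" if x: "x \<in> N" for x
  proof -
    obtain c d where cd: "A.coords J \<kappa> c d" "x = A.lc J u c d" using N[OF x] by blast
    show ?thesis unfolding cd(2) A.lc_P[OF g cd(1), symmetric] f[OF cd(1)] f[OF A.coords_P[OF cd(1)]]
      by (rule B.lc_P[OF g' cd(1)])
  qed
  have fadd: "f (x + y) = f x + f y" if x: "x \<in> N" and y: "y \<in> N" for x y
  proof -
    obtain c d where cd: "A.coords J \<kappa> c d" "x = A.lc J u c d" using N[OF x] by blast
    obtain c' d' where cd': "A.coords J \<kappa> c' d'" "y = A.lc J u c' d'" using N[OF y] by blast
    show ?thesis
      unfolding cd(2) cd'(2) A.lc_add[OF g cd(1) cd'(1), symmetric] f[OF cd(1)] f[OF cd'(1)]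
        f[OF A.coords_add[OF cd(1) cd'(1)]]
      by (rule B.lc_add[OF g' cd(1) cd'(1)])
  qed
  have fr: "f (ract L x a) = ract L' (f x) a" if a: "a \<in> A.R" and x: "x \<in> N" for a x
  proof -
    obtain c d where cd: "A.coords J \<kappa> c d" "x = A.lc J u c d" using N[OF x] by blast
    show ?thesis unfolding cd(2) A.lc_right[OF g cd(1) a, symmetric] f[OF cd(1)] f[OF A.coords_right[OF cd(1) a]]
      by (rule B.lc_right[OF g' cd(1) a])
  qed
  have subN: "A.sub_bimodule N" and subN': "B.sub_bimodule N'" using A.basis_sub[OF b] B.basis_sub[OF b'] .
  note D = A.sub_bimoduleD[OF subN]
  have fN: "f x \<in> N'" if x: "x \<in> N" for x
  proof -
    obtain c d where cd: "A.coords J \<kappa> c d" "x = A.lc J u c d" using N[OF x] by blast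
    then show ?thesis using b' f[OF cd(1)] unfolding B.basis_def B.span_def by auto
  qed
  have fl: "f (lact L a x) = lact L' a (f x)" if a: "a \<in> A.R" and x: "x \<in> N" for a x
  proof -
    obtain p q where pq: "p \<in> C" "q \<in> C" "a = p + q * P" using a by (rule A.R_E)
    note xV = D(1)[OF x] and xV' = B.sub_bimoduleD(1)[OF subN' fN[OF x]]
    have m: "lact L p x \<in> N" "lact L q (lact L P x) \<in> N" "lact L P x \<in> N"
      using x pq by (auto intro: D A.C_R A.P_R)
    show ?thesis unfolding pq(3) A.l_split[OF pq(1,2) xV] B.l_split[OF pq(1,2) xV'] fadd[OF m(1,2)]
      using fC[OF pq(1) x] fC[OF pq(2) m(3)] fP[OF x] by simp
  qed
  have inj: "inj_on f N"
  proof (rule inj_onI)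
    fix x y assume x: "x \<in> N" and y: "y \<in> N" and eq: "f x = f y"
    obtain c d where cd: "A.coords J \<kappa> c d" "x = A.lc J u c d" using N[OF x] by blast
    obtain c' d' where cd': "A.coords J \<kappa> c' d'" "y = A.lc J u c' d'" using N[OF y] by blast
    have "B.lc J u' c d = B.lc J u' c' d'" using eq f cd cd' by simp
    from B.basis_unique[OF b' cd(1) cd'(1) this]
    show "x = y" unfolding cd(2) cd'(2) by (intro A.lc_cong) auto
  qed
  have surj: "f ` N = N'"
  proof
    show "f ` N \<subseteq> N'" using fN by auto
    show "N' \<subseteq> f ` N"
    proof
      fix y assume "y \<in> N'"
      then obtain c d where cd: "A.coords J \<kappa> c d" "y = B.lc J u' c d" by (rule B.basis_coords[OF b'])
      then have "A.lc J u c d \<in> N" using b unfolding A.basis_def A.span_def by blast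
      then show "y \<in> f ` N" using f[OF cd(1)] cd(2) by (intro image_eqI) auto
    qed
  qed
  have GP': "h (u i) (lact L P (u j)) = h' (u' i) (lact L' P (u' j))" if "i \<in> J" "j \<in> J" for i j
    using GP[OF that] A.gensD(1)[OF g] B.gensD(1)[OF g'] that
    by (simp add: A.h_Pr B.h_Pr A.sg_def B.sg_def)
  have GPP: "h (lact L P (u i)) (lact L P (u j)) = h' (lact L' P (u' i)) (lact L' P (u' j))"
    if "i \<in> J" "j \<in> J" for i j
    using G[OF that] A.gensD(1)[OF g] B.gensD(1)[OF g'] that
    by (simp add: A.h_PP B.h_PP A.sg_def B.sg_def)
  have h_f: "h' (f x) (f y) = h x y" if x: "x \<in> N" and y: "y \<in> N" for x y
  proof -
    obtain c d where cd: "A.coords J \<kappa> c d" "x = A.lc J u c d" using N[OF x] by blast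
    obtain c' d' where cd': "A.coords J \<kappa> c' d'" "y = A.lc J u c' d'" using N[OF y] by blast
    note xV = A.lc_V[OF g cd(1)] and xV' = B.lc_V[OF g' cd(1)]
    have e: "h (u j) (A.lc J u c d) = h' (u' j) (B.lc J u' c d)"
      "h (lact L P (u j)) (A.lc J u c d) = h' (lact L' P (u' j)) (B.lc J u' c d)" if "j \<in> J" for j
      using that A.gensD(1,2)[OF g that] B.gensD(1,2)[OF g' that] G GP GP' GPP
      by (auto simp: A.h_lc[OF _ g cd(1)] B.h_lc[OF _ g' cd(1)] intro!: sum.cong)
    have "h (A.lc J u c d) (u j) = h' (B.lc J u' c d) (u' j)"
      "h (A.lc J u c d) (lact L P (u j)) = h' (B.lc J u' c d) (lact L' P (u' j))" if j: "j \<in> J" for j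
      using e[OF j] A.h_cj[OF xV A.gensD(1)[OF g j]] A.h_cj[OF xV A.gensD(2)[OF g j]]
        B.h_cj[OF xV' B.gensD(1)[OF g' j]] B.h_cj[OF xV' B.gensD(2)[OF g' j]] by simp_all
    then show ?thesis
      unfolding cd(2) cd'(2) f[OF cd(1)] f[OF cd'(1)] A.h_lc[OF xV g cd'(1)] B.h_lc[OF xV' g' cd'(1)]
      by simp
  qed
  show ?thesis
    by (rule isoI[of f]) (use inj surj fadd fl fr h_f in \<open>auto simp: bij_betw_def\<close>)
qed

end

context bimod
begin

text \<open>Two lattices carry unrelated index sets. A bijection between blocks that preserves kinds
  is absorbed into the basis, so that \<open>iso_basis\<close> can work with a common index
  set.\<close>

lemma basis_reindex:
  assumes b: "basis \<kappa>' (\<phi> ` J) u N" and inj: "inj_on \<phi> J" and k: "\<And>i. i \<in> J \<Longrightarrow> \<kappa>' (\<phi> i) = \<kappa> i"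
  shows "basis \<kappa> J (\<lambda>i. u (\<phi> i)) N"
proof -
  note g = basis_gens[OF b]
  have fin: "finite J" using gens_finite[OF g] finite_image_iff[OF inj] by simp
  have lc: "lc (\<phi> ` J) u c d = lc J (\<lambda>i. u (\<phi> i)) (\<lambda>i. c (\<phi> i)) (\<lambda>i. d (\<phi> i))" for c d
    unfolding lc_def by (simp add: sum.reindex[OF inj])
  have co: "coords J \<kappa> (\<lambda>i. c (\<phi> i)) (\<lambda>i. d (\<phi> i))" if "coords (\<phi> ` J) \<kappa>' c d" for c d
    using that k by (auto simp: coords_def)
  define \<psi> where "\<psi> = inv_into J \<phi>"
  have \<psi>: "\<psi> (\<phi> i) = i" if "i \<in> J" for i using inj that by (simp add: \<psi>_def)
  have co': "coords (\<phi> ` J) \<kappa>' (\<lambda>i. c (\<psi> i)) (\<lambda>i. d (\<psi> i))" if "coords J \<kappa> c d" for c d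
    using that k \<psi> by (auto simp: coords_def)
  have lc': "lc (\<phi> ` J) u (\<lambda>i. c (\<psi> i)) (\<lambda>i. d (\<psi> i)) = lc J (\<lambda>i. u (\<phi> i)) c d" for c d
    unfolding lc by (rule lc_cong) (simp_all add: \<psi>)
  have sp: "span \<kappa>' (\<phi> ` J) u = span \<kappa> J (\<lambda>i. u (\<phi> i))"
  proof
    show "span \<kappa>' (\<phi> ` J) u \<subseteq> span \<kappa> J (\<lambda>i. u (\<phi> i))"
      unfolding span_def lc using co by blast
    show "span \<kappa> J (\<lambda>i. u (\<phi> i)) \<subseteq> span \<kappa>' (\<phi> ` J) u"
      unfolding span_def lc'[symmetric] using co' by blast
  qed
  have g': "gens \<kappa> J (\<lambda>i. u (\<phi> i))" using g k fin unfolding gens_def by auto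
  have ind: "\<forall>i\<in>J. c i = 0 \<and> d i = 0"
    if cd: "coords J \<kappa> c d" "lc J (\<lambda>i. u (\<phi> i)) c d = 0" for c d
  proof
    fix i assume i: "i \<in> J"
    show "c i = 0 \<and> d i = 0"
      using basis_indep[OF b co'[OF cd(1)]] cd(2) lc' \<psi>[OF i] i by auto
  qed
  have "N = span \<kappa>' (\<phi> ` J) u" using b by (simp add: basis_def)
  then have N: "N = span \<kappa> J (\<lambda>i. u (\<phi> i))" using sp by simp
  have "\<forall>c d. coords J \<kappa> c d \<and> lc J (\<lambda>i. u (\<phi> i)) c d = 0 \<longrightarrow> (\<forall>i\<in>J. c i = 0 \<and> d i = 0)"
    by (intro allI impI, elim conjE, rule ind)
  then show ?thesis unfolding basis_def using N g' by (intro conjI)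
qed

end

context herm_pair
begin

text \<open>Block and complement are orthogonal on both sides, so the cross terms vanish and the sum
  of two isometries is an isometry.\<close>

lemma iso_glue:
  assumes N: "A.sub_bimodule N" "N \<subseteq> M" and N': "B.sub_bimodule N'" "N' \<subseteq> M'"
    and M: "A.sub_bimodule M" and M': "B.sub_bimodule M'"
    and p: "\<And>x. x \<in> M \<Longrightarrow> \<exists>n\<in>N. x - n \<in> A.orth N M"
    and p': "\<And>x. x \<in> M' \<Longrightarrow> \<exists>n\<in>N'. x - n \<in> B.orth N' M'"
    and z: "\<And>n. n \<in> N \<Longrightarrow> n \<in> A.orth N M \<Longrightarrow> n = 0"
    and z': "\<And>n. n \<in> N' \<Longrightarrow> n \<in> B.orth N' M' \<Longrightarrow> n = 0"
    and iso1: "iso N N'" and iso2: "iso (A.orth N M) (B.orth N' M')"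
  shows "iso M M'"
proof -
  let ?O = "A.orth N M" and ?O' = "B.orth N' M'"
  have O: "A.sub_bimodule ?O" and O': "B.sub_bimodule ?O'"
    using A.orth_sub[OF N(1) M] B.orth_sub[OF N'(1) M'] .
  note DN = A.sub_bimoduleD[OF N(1)] and DO = A.sub_bimoduleD[OF O] and DM = A.sub_bimoduleD[OF M]
  note DN' = B.sub_bimoduleD[OF N'(1)] and DO' = B.sub_bimoduleD[OF O'] and DM' = B.sub_bimoduleD[OF M']
  have OM: "?O \<subseteq> M" and OM': "?O' \<subseteq> M'" by (auto simp: A.orth_def B.orth_def)
  obtain f where f: "bij_betw f N N'" "\<And>x y. x \<in> N \<Longrightarrow> y \<in> N \<Longrightarrow> f (x + y) = f x + f y"
    "\<And>a x. a \<in> A.R \<Longrightarrow> x \<in> N \<Longrightarrow> f (lact L a x) = lact L' a (f x)"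
    "\<And>a x. a \<in> A.R \<Longrightarrow> x \<in> N \<Longrightarrow> f (ract L x a) = ract L' (f x) a"
    "\<And>x y. x \<in> N \<Longrightarrow> y \<in> N \<Longrightarrow> h' (f x) (f y) = h x y" by (rule isoE[OF iso1]) blast
  obtain e where e: "bij_betw e ?O ?O'" "\<And>x y. x \<in> ?O \<Longrightarrow> y \<in> ?O \<Longrightarrow> e (x + y) = e x + e y"
    "\<And>a x. a \<in> A.R \<Longrightarrow> x \<in> ?O \<Longrightarrow> e (lact L a x) = lact L' a (e x)"
    "\<And>a x. a \<in> A.R \<Longrightarrow> x \<in> ?O \<Longrightarrow> e (ract L x a) = ract L' (e x) a"
    "\<And>x y. x \<in> ?O \<Longrightarrow> y \<in> ?O \<Longrightarrow> h' (e x) (e y) = h x y" by (rule isoE[OF iso2]) blast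
  have fN: "f n \<in> N'" if "n \<in> N" for n using f(1) that by (auto simp: bij_betw_def)
  have eO: "e n \<in> ?O'" if "n \<in> ?O" for n using e(1) that by (auto simp: bij_betw_def)
  define q where "q x = (SOME n. n \<in> N \<and> x - n \<in> ?O)" for x
  define F where "F x = f (q x) + e (x - q x)" for x
  have q: "q (n + y) = n" if n: "n \<in> N" and y: "y \<in> ?O" for n y
  proof -
    have "q (n + y) \<in> N \<and> (n + y) - q (n + y) \<in> ?O"
      unfolding q_def by (rule someI[of _ n]) (use n y in simp)
    then have *: "q (n + y) \<in> N" "(n + y) - q (n + y) \<in> ?O" by auto
    have "n - q (n + y) \<in> N" by (rule DN(5)[OF n *(1)])
    moreover have "((n + y) - q (n + y)) - y \<in> ?O" by (rule DO(5)[OF *(2) y])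
    then have "n - q (n + y) \<in> ?O" by (simp add: algebra_simps)
    ultimately show ?thesis using z by fastforce
  qed
  have F: "F (n + y) = f n + e y" if "n \<in> N" "y \<in> ?O" for n y
    using q[OF that] by (simp add: F_def)
  have dec: "\<exists>n y. n \<in> N \<and> y \<in> ?O \<and> x = n + y" if x: "x \<in> M" for x
  proof -
    obtain n where "n \<in> N" "x - n \<in> ?O" using p[OF x] by blast
    moreover have "x = n + (x - n)" by simp
    ultimately show ?thesis by blast
  qed
  have cross: "h n y = 0 \<and> h y n = 0" if "n \<in> N" "y \<in> ?O" for n y
    using A.h_comm_zero[OF DN(1)[OF that(1)] DO(1)[OF that(2)]] that by (simp add: A.orth_def)
  have cross': "h' n y = 0 \<and> h' y n = 0" if "n \<in> N'" "y \<in> ?O'" for n y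
    using B.h_comm_zero[OF DN'(1)[OF that(1)] DO'(1)[OF that(2)]] that by (simp add: B.orth_def)
  show ?thesis
  proof (rule isoI[of F])
    show "bij_betw F M M'"
      unfolding bij_betw_def
    proof
      show "inj_on F M"
      proof (rule inj_onI)
        fix x x' assume x: "x \<in> M" and x': "x' \<in> M" and eq: "F x = F x'"
        obtain n y where ny: "n \<in> N" "y \<in> ?O" "x = n + y" using dec[OF x] by blast
        obtain n' y' where ny': "n' \<in> N" "y' \<in> ?O" "x' = n' + y'" using dec[OF x'] by blast
        have fe: "f n + e y = f n' + e y'" using eq F ny ny' by simp
        then have "f n - f n' = e y' - e y" by (simp add: algebra_simps)
        moreover have "f n - f n' \<in> N'" by (intro DN'(5) fN ny ny')
        moreover have "e y' - e y \<in> ?O'" by (intro DO'(5) eO ny ny')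
        ultimately have "f n - f n' = 0" using z' by metis
        then have "f n = f n'" "e y = e y'" using fe by auto
        then have "n = n'" "y = y'"
          using f(1) e(1) ny ny' by (auto simp: bij_betw_def dest: inj_onD)
        then show "x = x'" using ny ny' by simp
      qed
      show "F ` M = M'"
      proof
        show "F ` M \<subseteq> M'"
        proof
          fix w assume "w \<in> F ` M"
          then obtain x where x: "x \<in> M" "w = F x" by blast
          obtain n y where ny: "n \<in> N" "y \<in> ?O" "x = n + y" using dec[OF x(1)] by blast
          then show "w \<in> M'" using F[OF ny(1,2)] x DM'(3)[of "f n" "e y"] fN[OF ny(1)] eO[OF ny(2)] N'(2) OM' by auto
        qed
        show "M' \<subseteq> F ` M"
        proof
          fix w assume w: "w \<in> M'"
          obtain n' where n': "n' \<in> N'" "w - n' \<in> ?O'" using p'[OF w] by blast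
          obtain n where n: "n \<in> N" "f n = n'" using f(1) n'(1) by (auto simp: bij_betw_def)
          have "w - n' \<in> e ` ?O" using e(1) n'(2) by (simp add: bij_betw_def)
          then obtain y where y: "y \<in> ?O" "e y = w - n'" by (metis imageE)
          have "F (n + y) = w" using F[OF n(1) y(1)] n y by simp
          moreover have "n + y \<in> M" using DM(3)[of n y] n y N(2) OM by auto
          ultimately show "w \<in> F ` M" by blast
        qed
      qed
    qed
    fix x assume x: "x \<in> M"
    obtain n y where ny: "n \<in> N" "y \<in> ?O" "x = n + y" using dec[OF x] by blast
    note V = DN(1)[OF ny(1)] DO(1)[OF ny(2)]
    note V' = DN'(1)[OF fN[OF ny(1)]] DO'(1)[OF eO[OF ny(2)]]
    show "F (lact L a x) = lact L' a (F x)" if a: "a \<in> A.R" for a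
      unfolding ny(3) A.l_add[OF a V] F[OF ny(1,2)] F[OF DN(6)[OF a ny(1)] DO(6)[OF a ny(2)]]
        f(3)[OF a ny(1)] e(3)[OF a ny(2)] B.l_add[OF a V'] ..
    show "F (ract L x a) = ract L' (F x) a" if a: "a \<in> A.R" for a
      unfolding ny(3) A.r_add[OF a V] F[OF ny(1,2)] F[OF DN(7)[OF a ny(1)] DO(7)[OF a ny(2)]]
        f(4)[OF a ny(1)] e(4)[OF a ny(2)] B.r_add[OF a V'] ..
    fix x' assume x': "x' \<in> M"
    obtain n' y' where ny': "n' \<in> N" "y' \<in> ?O" "x' = n' + y'" using dec[OF x'] by blast
    note W = DN(1)[OF ny'(1)] DO(1)[OF ny'(2)]
    note W' = DN'(1)[OF fN[OF ny'(1)]] DO'(1)[OF eO[OF ny'(2)]]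
    have "x + x' = (n + n') + (y + y')" using ny ny' by simp
    then have "F (x + x') = f (n + n') + e (y + y')"
      using F[OF DN(3)[OF ny(1) ny'(1)] DO(3)[OF ny(2) ny'(2)]] by simp
    then show "F (x + x') = F x + F x'"
      unfolding ny(3) ny'(3) F[OF ny(1,2)] F[OF ny'(1,2)]
      using f(2)[OF ny(1) ny'(1)] e(2)[OF ny(2) ny'(2)] by simp
    show "h' (F x) (F x') = h x x'"
      unfolding ny(3) ny'(3) F[OF ny(1,2)] F[OF ny'(1,2)]
      using cross[OF ny(1) ny'(2)] cross[OF ny'(1) ny(2)]
        cross'[OF fN[OF ny(1)] eO[OF ny'(2)]] cross'[OF fN[OF ny'(1)] eO[OF ny(2)]]
        f(5)[OF ny(1) ny'(1)] e(5)[OF ny(2) ny'(2)] V V' W W'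
      by (simp add: A.h_add A.h_add_l A.V_add B.h_add B.h_add_l B.V_add)
  qed
qed

text \<open>Stated for arbitrary bases with equal counts of every kind, because of the basis of a
  complement only the kinds are known. Equal counts also supply a generator of the required kind in
  the other lattice, from which the matching block is built.\<close>

lemma unique_up_to_isometry:
  fixes I :: "'i set" and I' :: "'j set"
  assumes "A.basis \<kappa> I g M" "A.LP M" "B.basis \<kappa>' I' g' M'" "B.LP M'"
    and "\<And>k. A.cnt \<kappa> I k = A.cnt \<kappa>' I' k"
  shows "iso M M'"
  using assms
proof (induction "card I" arbitrary: I g M I' g' M' rule: less_induct)
  case less
  note b = less.prems(1) and LP = less.prems(2) and b' = less.prems(3) and LP' = less.prems(4)
  note cnt = less.prems(5)
  have fin: "finite I" by (rule A.gens_finite[OF A.basis_gens[OF b]])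
  have fin': "finite I'" by (rule B.gens_finite[OF B.basis_gens[OF b']])
  show ?case
  proof (cases "I = {}")
    case True
    then have "A.cnt \<kappa>' I' k = 0" for k using cnt[of k] by (simp add: A.cnt_def)
    then have "I' = {}" using A.cnt_pos[OF fin'] by (metis ex_in_conv less_irrefl)
    then have "B.basis \<kappa> I (\<lambda>_. 0) M'"
      using b' True unfolding B.basis_def B.gens_def B.span_def A.coords_def B.lc_def by simp
    then show ?thesis using iso_basis[OF b] True by simp
  next
    case False
    then obtain i0 where i0: "i0 \<in> I" "fst (\<kappa> i0) \<or> (\<forall>j\<in>I. \<not> fst (\<kappa> j))" by blast
    have "A.cnt \<kappa>' I' (\<kappa> i0) > 0" using A.cnt_pos[OF fin i0(1), of \<kappa>] cnt by simp
    then obtain i0' where i0': "i0' \<in> I'" "\<kappa>' i0' = \<kappa> i0" using A.cnt_posD by blast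
    have T': "fst (\<kappa>' i0') \<or> (\<forall>j\<in>I'. \<not> fst (\<kappa>' j))"
    proof -
      have "\<not> fst (\<kappa>' j)" if *: "\<forall>j\<in>I. \<not> fst (\<kappa> j)" and j: "j \<in> I'" for j
      proof -
        have "A.cnt \<kappa> I (\<kappa>' j) > 0" using A.cnt_pos[OF fin' j, of \<kappa>'] cnt by simp
        then obtain i where "i \<in> I" "\<kappa> i = \<kappa>' j" using A.cnt_posD by blast
        then show ?thesis using * by metis
      qed
      then show ?thesis using i0 i0' by auto
    qed
    obtain i j u where ij: "i \<in> I" "j \<in> I" "\<kappa> i = \<kappa> i0" "\<kappa> j = partner od (\<kappa> i0)"
      "i = j \<longleftrightarrow> od \<and> fst (\<kappa> i0)" and s: "A.splits \<kappa> I {i, j} u M"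
      and G: "\<forall>k\<in>{i, j}. h (u k) (u k) = 0 \<and> h (lact L P (u k)) (u k) = A.gram_Pii od (\<kappa> i0)"
      "i \<noteq> j \<Longrightarrow> h (u i) (u j) = A.gram_ij od (\<kappa> i0) \<and> h (lact L P (u i)) (u j) = A.gram_Pij od (\<kappa> i0)"
      by (rule A.block[OF b LP i0]) blast
    obtain i' j' u' where ij': "i' \<in> I'" "j' \<in> I'" "\<kappa>' i' = \<kappa>' i0'" "\<kappa>' j' = partner od (\<kappa>' i0')"
      "i' = j' \<longleftrightarrow> od \<and> fst (\<kappa>' i0')" and s': "B.splits \<kappa>' I' {i', j'} u' M'"
      and G': "\<forall>k\<in>{i', j'}. h' (u' k) (u' k) = 0 \<and> h' (lact L' P (u' k)) (u' k) = A.gram_Pii od (\<kappa>' i0')"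
      "i' \<noteq> j' \<Longrightarrow> h' (u' i') (u' j') = A.gram_ij od (\<kappa>' i0') \<and> h' (lact L' P (u' i')) (u' j') = A.gram_Pij od (\<kappa>' i0')"
      by (rule B.block[OF b' LP' i0'(1) T']) blast
    note S = A.splitsD[OF s b LP] and S' = B.splitsD[OF s' b' LP']
    have eqij: "i = j \<longleftrightarrow> i' = j'" using ij(5) ij'(5) i0' by simp
    define \<phi> where "\<phi> k = (if k = i then i' else j')" for k
    have \<phi>: "\<phi> i = i'" "\<phi> j = j'" using eqij by (auto simp: \<phi>_def)
    have im: "{i', j'} = \<phi> ` {i, j}" using \<phi> by auto
    have inj: "inj_on \<phi> {i, j}" using \<phi> eqij by (auto simp: inj_on_def)
    have k\<phi>: "\<kappa>' (\<phi> k) = \<kappa> k" if "k \<in> {i, j}" for k using that \<phi> ij ij' i0' by auto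
    have bN': "B.basis \<kappa> {i, j} (\<lambda>k. u' (\<phi> k)) (B.span \<kappa>' {i', j'} u')"
      by (rule B.basis_reindex[where \<kappa>' = \<kappa>']) (use S'(2) im inj k\<phi> in auto)
    note gu = A.basis_gens[OF S(2)] and gu' = B.basis_gens[OF S'(2)]
    have V: "u i \<in> A.V" "u j \<in> A.V" "lact L P (u i) \<in> A.V" using A.gensD[OF gu] by auto
    have V': "u' i' \<in> B.V" "u' j' \<in> B.V" "lact L' P (u' i') \<in> B.V" using B.gensD[OF gu'] by auto
    have Gij: "h (u i) (u j) = h' (u' i') (u' j')" "h (lact L P (u i)) (u j) = h' (lact L' P (u' i')) (u' j')"
      using G G' i0' eqij by (cases "i = j"; simp)+
    have Gii: "h (u i) (u i) = h' (u' i') (u' i')" "h (u j) (u j) = h' (u' j') (u' j')"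
      "h (lact L P (u i)) (u i) = h' (lact L' P (u' i')) (u' i')"
      "h (lact L P (u j)) (u j) = h' (lact L' P (u' j')) (u' j')"
      using G(1) G'(1) i0' by auto
    have Gji: "h (u j) (u i) = h' (u' j') (u' i')"
      using Gij(1) A.h_cj[OF V(2,1)] B.h_cj[OF V'(2,1)] by simp
    have "h (lact L P (u j)) (u i) = A.sg (cj (h (lact L P (u i)) (u j)))"
      using A.h_Pl[OF V(2,1)] A.h_cj[OF V(2,3)] by simp
    moreover have "h' (lact L' P (u' j')) (u' i') = B.sg (cj (h' (lact L' P (u' i')) (u' j')))"
      using B.h_Pl[OF V'(2,1)] B.h_cj[OF V'(2,3)] by simp
    ultimately have GPji: "h (lact L P (u j)) (u i) = h' (lact L' P (u' j')) (u' i')"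
      using Gij(2) by (simp add: A.sg_def B.sg_def)
    have iso1: "iso (A.span \<kappa> {i, j} u) (B.span \<kappa>' {i', j'} u')"
      by (rule iso_basis[OF S(2) bN']) (use Gij Gii Gji GPji \<phi> in auto)
    obtain g1 where g1: "A.basis \<kappa> (I - {i, j}) g1 (A.orth (A.span \<kappa> {i, j} u) M)" using S(6) by blast
    obtain g1' where g1': "B.basis \<kappa>' (I' - {i', j'}) g1' (B.orth (B.span \<kappa>' {i', j'} u') M')"
      using S'(6) by blast
    have "A.cnt \<kappa> {i, j} k = A.cnt \<kappa>' {i', j'} k" for k
      unfolding A.cnt_pair using ij ij' i0' by auto
    then have "A.cnt \<kappa> (I - {i, j}) k = A.cnt \<kappa>' (I' - {i', j'}) k" for k
      using cnt[of k] A.cnt_diff[OF fin S(1), of \<kappa> k] A.cnt_diff[OF fin' S'(1), of \<kappa>' k] by simp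
    moreover have "card (I - {i, j}) < card I" using fin ij by (intro psubset_card_mono) auto
    ultimately have iso2: "iso (A.orth (A.span \<kappa> {i, j} u) M) (B.orth (B.span \<kappa>' {i', j'} u') M')"
      using less.hyps g1 g1' S(5) S'(5) by blast
    show ?thesis
      by (rule iso_glue[OF S(3,4) S'(3,4) A.basis_sub[OF b] B.basis_sub[OF b'] S(7) S'(7) S(8) S'(8) iso1 iso2])
  qed
qed

end

section \<open>Construction of pairings\<close>

text \<open>Data for a pairing in normal form: \<open>\<rho>\<close> matches each generator with its
  partner, and \<open>s i\<close> is their value when \<open>fst\<close> is false. The two equations
  for \<open>s\<close> are hermitian symmetry and compatibility with the adjoint of
  \<open>P\<close>, the latter being the constraint met in \<open>block_R\<close>.\<close>

locale paired_basis = bimod C cj P \<delta> \<omega> L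
  for C :: "'a::ring_1 set" and cj P \<delta> \<omega> and L :: "('a, 'l::ab_group_add) bimodule" +
  fixes od :: bool and \<kappa> :: "'i \<Rightarrow> bool \<times> bool" and I :: "'i set" and g :: "'i \<Rightarrow> 'l"
    and \<rho> :: "'i \<Rightarrow> 'i" and s :: "'i \<Rightarrow> 'a"
  assumes b: "basis \<kappa> I g (bcarrier L)"
    and \<rho>: "i \<in> I \<Longrightarrow> \<rho> i \<in> I" "i \<in> I \<Longrightarrow> \<rho> (\<rho> i) = i" "i \<in> I \<Longrightarrow> \<kappa> (\<rho> i) = partner od (\<kappa> i)"
    and s: "i \<in> I \<Longrightarrow> s i \<in> C" "i \<in> I \<Longrightarrow> \<exists>y\<in>C. s i * y = 1"
      "i \<in> I \<Longrightarrow> \<not> fst (\<kappa> i) \<Longrightarrow> s (\<rho> i) = cj (s i)"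
      "i \<in> I \<Longrightarrow> \<not> fst (\<kappa> i) \<Longrightarrow> cj (s i) = (if od then s i else - s i)"
begin

lemma g: "gens \<kappa> I g"
  by (rule basis_gens[OF b])

lemma ex_coords: "\<exists>cd. x \<in> V \<longrightarrow> coords I \<kappa> (fst cd) (snd cd) \<and> x = lc I g (fst cd) (snd cd)"
  using basis_coords[OF b, of x] by (metis fst_conv snd_conv)

definition co where "co = (SOME f. \<forall>x. x \<in> V \<longrightarrow> coords I \<kappa> (fst (f x)) (snd (f x)) \<and>
    x = lc I g (fst (f x)) (snd (f x)))"

definition cf where "cf x = fst (co x)"
definition df where "df x = snd (co x)"

lemma cf: "x \<in> V \<Longrightarrow> coords I \<kappa> (cf x) (df x)" "x \<in> V \<Longrightarrow> x = lc I g (cf x) (df x)"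
proof -
  have "\<forall>x. x \<in> V \<longrightarrow> coords I \<kappa> (fst (co x)) (snd (co x)) \<and> x = lc I g (fst (co x)) (snd (co x))"
    unfolding co_def by (rule someI_ex[OF choice[OF allI[OF ex_coords]]])
  then show "x \<in> V \<Longrightarrow> coords I \<kappa> (cf x) (df x)" "x \<in> V \<Longrightarrow> x = lc I g (cf x) (df x)"
    by (auto simp: cf_def df_def)
qed

lemma cf_R: "x \<in> V \<Longrightarrow> i \<in> I \<Longrightarrow> cf x i \<in> R" "x \<in> V \<Longrightarrow> i \<in> I \<Longrightarrow> df x i \<in> R"
  "x \<in> V \<Longrightarrow> i \<in> I \<Longrightarrow> \<not> fst (\<kappa> i) \<Longrightarrow> df x i = 0"
  using coordsD[OF cf(1)] by auto

lemma cf_lc: "coords I \<kappa> c d \<Longrightarrow> i \<in> I \<Longrightarrow> cf (lc I g c d) i = c i"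
  "coords I \<kappa> c d \<Longrightarrow> i \<in> I \<Longrightarrow> df (lc I g c d) i = d i"
  using basis_unique[OF b _ cf(1)] cf(2) lc_V[OF g] by (metis (no_types, lifting))+

lemma cf_add: assumes "x \<in> V" "y \<in> V" "i \<in> I"
  shows "cf (x + y) i = cf x i + cf y i" "df (x + y) i = df x i + df y i"
proof -
  note c = coords_add[OF cf(1)[OF assms(1)] cf(1)[OF assms(2)]]
  have "x + y = lc I g (\<lambda>i. cf x i + cf y i) (\<lambda>i. df x i + df y i)"
    using lc_add[OF g cf(1)[OF assms(1)] cf(1)[OF assms(2)]] cf(2) assms by simp
  then show "cf (x + y) i = cf x i + cf y i" "df (x + y) i = df x i + df y i"
    using cf_lc[OF c assms(3)] by simp_all
qed

lemma cf_r: assumes "x \<in> V" "a \<in> R" "i \<in> I"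
  shows "cf (x \<lhd> a) i = cf x i * a" "df (x \<lhd> a) i = df x i * a"
proof -
  note c = coords_right[OF cf(1)[OF assms(1)] assms(2)]
  have "x \<lhd> a = lc I g (\<lambda>i. cf x i * a) (\<lambda>i. df x i * a)"
    using lc_right[OF g cf(1)[OF assms(1)] assms(2)] cf(2)[OF assms(1)] by simp
  then show "cf (x \<lhd> a) i = cf x i * a" "df (x \<lhd> a) i = df x i * a"
    using cf_lc[OF c assms(3)] by simp_all
qed

lemma cf_C: assumes "x \<in> V" "a \<in> C" "i \<in> I"
  shows "cf (a \<rhd> x) i = tw (snd (\<kappa> i)) a * cf x i" "df (a \<rhd> x) i = tw (\<not> snd (\<kappa> i)) a * df x i"
proof -
  note c = coords_C[OF cf(1)[OF assms(1)] assms(2)]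
  have "a \<rhd> x = lc I g (\<lambda>i. tw (snd (\<kappa> i)) a * cf x i) (\<lambda>i. tw (\<not> snd (\<kappa> i)) a * df x i)"
    using lc_C[OF g cf(1)[OF assms(1)] assms(2)] cf(2)[OF assms(1)] by simp
  then show "cf (a \<rhd> x) i = tw (snd (\<kappa> i)) a * cf x i" "df (a \<rhd> x) i = tw (\<not> snd (\<kappa> i)) a * df x i"
    using cf_lc[OF c assms(3)] by simp_all
qed

lemma cf_P: assumes "x \<in> V" "i \<in> I"
  shows "cf (P \<rhd> x) i = P_fst \<kappa> (cf x) (df x) i" "df (P \<rhd> x) i = P_snd \<kappa> (cf x) i"
proof -
  note c = coords_P[OF cf(1)[OF assms(1)]]
  have "P \<rhd> x = lc I g (P_fst \<kappa> (cf x) (df x)) (P_snd \<kappa> (cf x))"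
    using lc_P[OF g cf(1)[OF assms(1)]] cf(2)[OF assms(1)] by simp
  then show "cf (P \<rhd> x) i = P_fst \<kappa> (cf x) (df x) i" "df (P \<rhd> x) i = P_snd \<kappa> (cf x) i"
    using cf_lc[OF c assms(2)] by simp_all
qed

lemma cf_single: assumes i: "i \<in> I" and xy: "x \<in> R" "y \<in> R" "\<not> fst (\<kappa> i) \<longrightarrow> y = 0" and j: "j \<in> I"
  shows "cf (g i \<lhd> x + (P \<rhd> g i) \<lhd> y) j = (if j = i then x else 0)"
    "df (g i \<lhd> x + (P \<rhd> g i) \<lhd> y) j = (if j = i then y else 0)"
  using cf_lc[OF coords_single[of x y \<kappa> i] j] lc_single[OF g i xy(1,2)] xy by simp_all

definition t :: 'a where "t = (if od then \<delta> else 1)"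

lemma t: "t \<in> C" "\<exists>y\<in>C. t * y = 1" "cj t = (if od then - t else t)"
  unfolding t_def using \<delta> C_one by (auto simp: cj_one)

text \<open>For \<open>fst\<close> true the generator \<open>i\<close> pairs with the
  \<open>P\<close>-multiple of its partner to \<open>t\<close>, and its own
  \<open>P\<close>-multiple pairs with the partner to \<open>cj t\<close>; the other Gram entries
  involving it are zero.\<close>

definition hterm where "hterm x y i = (if fst (\<kappa> i) then cj (cf x i) * t * df y (\<rho> i) + cj (df x i) * cj t * cf y (\<rho> i)
    else cj (cf x i) * s i * cf y (\<rho> i))"

definition h where "h x y = (\<Sum>i\<in>I. hterm x y i)"

lemma herm: "herm C cj P \<delta> \<omega> L od h"
proof unfold_locales
  fix x y assume x: "x \<in> V" and y: "y \<in> V"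
  have V: "P \<rhd> x \<in> V" "P \<rhd> y \<in> V" using x y V_l P_R by auto
  have fT: "fst (\<kappa> (\<rho> i)) = fst (\<kappa> i)" if "i \<in> I" for i using \<rho>(3)[OF that] by (simp add: partner_def)
  show "h x y \<in> R"
  proof -
    have "hterm x y i \<in> R" if i: "i \<in> I" for i
      using cf_R(1,2)[OF x i] cf_R(1,2)[OF y \<rho>(1)[OF i]] C_R[OF t(1)] C_R[OF cj_C[OF t(1)]] C_R[OF s(1)[OF i]]
      by (simp add: hterm_def R_add R_mult cj_R)
    then show ?thesis unfolding h_def by (rule R_sum)
  qed
  show "h x (y + z) = h x y + h x z" if z: "z \<in> V" for z
    unfolding h_def sum.distrib[symmetric] hterm_def
    by (intro sum.cong refl) (simp add: cf_add[OF y z \<rho>(1)] algebra_simps)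
  show "h x (y \<lhd> a) = h x y * a" if a: "a \<in> R" for a
    unfolding h_def sum_distrib_right hterm_def
    by (intro sum.cong refl) (simp add: cf_r[OF y a \<rho>(1)] algebra_simps)
  show "h x y = cj (h y x)"
  proof -
    have "cj (h y x) = (\<Sum>i\<in>I. cj (hterm y x i))" by (simp add: h_def cj_sum)
    \<comment> \<open>Reindexing by \<open>\<rho>\<close> exchanges the members of each pair, which
      is what transposing the form requires.\<close>
    also have "\<dots> = (\<Sum>i\<in>I. cj (hterm y x (\<rho> i)))"
      by (rule sum.reindex_bij_witness[of _ \<rho> \<rho>]) (auto simp: \<rho>)
    also have "\<dots> = h x y"
      unfolding h_def
    proof (intro sum.cong refl)
      fix i assume i: "i \<in> I"
      show "cj (hterm y x (\<rho> i)) = hterm x y i"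
        using s(3)[OF \<rho>(1)[OF i]] fT[OF i] i
        by (simp add: hterm_def \<rho> cj_add cj_mult cj_cj mult.assoc add.commute)
    qed
    finally show ?thesis by simp
  qed
  show "h (a \<rhd> x) y = h x ((if od then a else cj a) \<rhd> y)" if a: "a \<in> C" for a
    unfolding h_def
  proof (intro sum.cong refl)
    fix i assume i: "i \<in> I"
    define a' where "a' = (if od then a else cj a)"
    have a': "a' \<in> C" using a cj_C by (simp add: a'_def)
    have k: "snd (\<kappa> (\<rho> i)) = (if od = fst (\<kappa> i) then snd (\<kappa> i) else \<not> snd (\<kappa> i))"
      using \<rho>(3)[OF i] by (simp add: partner_def)
    have 1: "cj (tw (snd (\<kappa> i)) a) = tw (\<not> snd (\<kappa> (\<rho> i))) a'"
      "cj (tw (\<not> snd (\<kappa> i)) a) = tw (snd (\<kappa> (\<rho> i))) a'" if "fst (\<kappa> i)"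
      using that by (auto simp: k a'_def tw_def cj_cj)
    have 2: "cj (tw (snd (\<kappa> i)) a) = tw (snd (\<kappa> (\<rho> i))) a'" if "\<not> fst (\<kappa> i)"
      using that by (auto simp: k a'_def tw_def cj_cj)
    have com: "tw \<epsilon> a' * (c * z) = c * (tw \<epsilon> a' * z)" if "c \<in> C" for c z \<epsilon>
      using C_commute[OF tw_C[OF a'] that] by (simp add: mult.assoc[symmetric])
    show "hterm (a \<rhd> x) y i = hterm x ((if od then a else cj a) \<rhd> y) i"
      unfolding a'_def[symmetric] hterm_def
      by (cases "fst (\<kappa> i)")
        (simp_all add: cf_C[OF x a i] cf_C[OF y a' \<rho>(1)[OF i]] cj_mult 1 2 mult.assoc
          com[OF t(1)] com[OF cj_C[OF t(1)]] com[OF s(1)[OF i]])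
  qed
  show "h (P \<rhd> x) y = (if od then - h x (P \<rhd> y) else h x (P \<rhd> y))"
  proof -
    have "hterm (P \<rhd> x) y i = (if od then - hterm x (P \<rhd> y) i else hterm x (P \<rhd> y) i)" if i: "i \<in> I" for i
    proof (cases "fst (\<kappa> i)")
      case True
      have E: "hterm (P \<rhd> x) y i = cj (df x i) * (P * P) * t * df y (\<rho> i) + cj (cf x i) * cj t * cf y (\<rho> i)"
        "hterm x (P \<rhd> y) i = cj (cf x i) * t * cf y (\<rho> i) + cj (df x i) * cj t * (P * P * df y (\<rho> i))"
        using True fT[OF i]
        by (simp_all add: hterm_def cf_P[OF x i] cf_P[OF y \<rho>(1)[OF i]] P_fst_def P_snd_def cj_mult cj_P mult.assoc)
      have "c * (P * P) * u * d + e * cj u * f = (if od then - (e * u * f + c * cj u * (P * P * d))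
          else e * u * f + c * cj u * (P * P * d))"
        if "P * P * u = u * (P * P)" "cj u = (if od then - u else u)" for c d e f u
      proof -
        have "c * (P * P) * u * d = c * u * (P * P * d)" using that(1) by (metis mult.assoc)
        then show ?thesis using that(2) by simp
      qed
      from this[OF PP_comm[OF t(1)] t(3)] show ?thesis unfolding E .
    next
      case False
      have E: "hterm (P \<rhd> x) y i = - (cj (cf x i) * (P * s i) * cf y (\<rho> i))"
        "hterm x (P \<rhd> y) i = cj (cf x i) * (s i * P) * cf y (\<rho> i)"
        using False fT[OF i]
        by (simp_all add: hterm_def cf_P[OF x i] cf_P[OF y \<rho>(1)[OF i]] P_fst_def cj_mult cj_P mult.assoc)
      have "P * s i = (if od then s i * P else - (s i * P))"
        using P_C[OF s(1)[OF i]] s(4)[OF i False] by simp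
      then show ?thesis unfolding E by simp
    qed
    then show ?thesis unfolding h_def by (simp add: sum_negf[symmetric])
  qed
qed

text \<open>Pairing \<open>z\<close> with the generator \<open>\<rho> i\<close> and its
  \<open>P\<close>-multiple isolates the conjugate coordinates of \<open>z\<close> at
  \<open>i\<close>, times units. So all coordinates lie in \<open>RP\<close> and can be divided by
  \<open>P\<close>.\<close>

lemma LP: "herm.LP C P L h V"
proof -
  interpret H: herm C cj P \<delta> \<omega> L od h by (rule herm)
  have fT: "fst (\<kappa> (\<rho> i)) = fst (\<kappa> i)" if "i \<in> I" for i using \<rho>(3)[OF that] by (simp add: partner_def)
  have fin: "finite I" by (rule gens_finite[OF g])
  have unit: "c \<in> RP" if "cj c * u \<in> RP" "c \<in> R" "u \<in> C" "y \<in> C" "u * y = 1" for c u y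
  proof -
    have "cj c * u * y \<in> RP" using that C_R RP_right by blast
    then show ?thesis using that RP_cj_iff by (simp add: mult.assoc)
  qed
  show ?thesis
    unfolding H.LP_def
  proof (intro ballI impI)
    fix z assume z: "z \<in> V" and zy: "\<forall>y\<in>V. h z y \<in> RP"
    have one: "h z (g (\<rho> i) \<lhd> x + (P \<rhd> g (\<rho> i)) \<lhd> y) =
       (if fst (\<kappa> i) then cj (cf z i) * t * y + cj (df z i) * cj t * x else cj (cf z i) * s i * x)"
      if i: "i \<in> I" and xy: "x \<in> R" "y \<in> R" "\<not> fst (\<kappa> i) \<longrightarrow> y = 0" for i x y
    proof -
      have inj: "\<rho> j = \<rho> i \<longleftrightarrow> j = i" if "j \<in> I" for j using \<rho> i that by metis
      have "h z (g (\<rho> i) \<lhd> x + (P \<rhd> g (\<rho> i)) \<lhd> y) = (\<Sum>j\<in>I. if j = i then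
        (if fst (\<kappa> i) then cj (cf z i) * t * y + cj (df z i) * cj t * x else cj (cf z i) * s i * x) else 0)"
        unfolding h_def
        by (intro sum.cong refl) (use cf_single[OF \<rho>(1)[OF i] xy(1,2) _ \<rho>(1)] fT[OF i] xy(3) inj in \<open>auto simp: hterm_def\<close>)
      then show ?thesis using i fin by (simp add: sum.delta)
    qed
    have gV: "g (\<rho> i) \<lhd> x + (P \<rhd> g (\<rho> i)) \<lhd> y \<in> V" if "i \<in> I" "x \<in> R" "y \<in> R" for i x y
      using that by (intro V_r V_add gensD(1,2)[OF g \<rho>(1)])
    obtain t' where t': "t' \<in> C" "t * t' = 1" using t by blast
    have t'': "cj t * cj t' = 1" using t' C_commute t cj_mult cj_one by metis
    have cRP: "cf z i \<in> RP" if i: "i \<in> I" for i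
    proof (cases "fst (\<kappa> i)")
      case True
      then have "cj (cf z i) * t \<in> RP"
        using one[OF i R_zero R_one] zy gV[OF i R_zero R_one] by auto
      then show ?thesis using unit t t' cf_R z i by blast
    next
      case False
      then have "cj (cf z i) * s i \<in> RP"
        using one[OF i R_one R_zero] zy gV[OF i R_one R_zero] by auto
      then show ?thesis using unit s(1,2)[OF i] cf_R z i by blast
    qed
    have dRP: "df z i \<in> RP" if i: "i \<in> I" for i
    proof (cases "fst (\<kappa> i)")
      case True
      then have "cj (df z i) * cj t \<in> RP"
        using one[OF i R_one R_zero] zy gV[OF i R_one R_zero] by auto
      then show ?thesis using unit t t' t'' cf_R z i cj_C by blast
    next
      case False
      then show ?thesis using cf_R z i RP_zero by simp
    qed
    define c where "c i = (SOME x. x \<in> R \<and> cf z i = x * P)" for i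
    \<comment> \<open>The default 0 keeps the quotient coordinates admissible where
      \<open>fst\<close> is false.\<close>
    define d where "d i = (if fst (\<kappa> i) then SOME x. x \<in> R \<and> df z i = x * P else 0)" for i
    have c: "c i \<in> R \<and> cf z i = c i * P" if "i \<in> I" for i
      unfolding c_def by (rule someI_ex) (use cRP[OF that] in \<open>auto simp: RP_def\<close>)
    have d: "d i \<in> R \<and> df z i = d i * P" if i: "i \<in> I" for i
    proof (cases "fst (\<kappa> i)")
      case True
      have "(SOME x. x \<in> R \<and> df z i = x * P) \<in> R \<and> df z i = (SOME x. x \<in> R \<and> df z i = x * P) * P"
        by (rule someI_ex) (use dRP[OF i] in \<open>auto simp: RP_def\<close>)
      then show ?thesis using True by (simp add: d_def)
    next
      case False
      then show ?thesis using cf_R z i R_zero by (simp add: d_def)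
    qed
    have cd: "coords I \<kappa> c d" using c d by (auto simp: coords_def d_def)
    have "z = lc I g (cf z) (df z)" by (rule cf(2)[OF z])
    also have "\<dots> = lc I g (\<lambda>i. c i * P) (\<lambda>i. d i * P)" by (rule lc_cong) (use c d in auto)
    also have "\<dots> = lc I g c d \<lhd> P" by (rule lc_right[OF g cd P_R])
    finally show "\<exists>w\<in>V. z = w \<lhd> P" using lc_V[OF g cd] by blast
  qed
qed

end

section \<open>Standard bimodules\<close>

definition std_index :: "nat \<Rightarrow> nat \<Rightarrow> nat \<Rightarrow> nat \<Rightarrow> (bool \<times> bool \<times> nat) set" where
  "std_index r1 r2 t1 t2 = {(T, \<epsilon>, n). n < (if T then if \<epsilon> then t2 else t1 else if \<epsilon> then r2 else r1)}"

definition std_kind :: "bool \<times> bool \<times> nat \<Rightarrow> bool \<times> bool" where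
  "std_kind i = (fst i, fst (snd i))"

lemma finite_std_index: "finite (std_index r1 r2 t1 t2)"
proof (rule finite_subset)
  show "std_index r1 r2 t1 t2 \<subseteq> UNIV \<times> UNIV \<times> {..<r1 + r2 + t1 + t2}"
    by (auto simp: std_index_def split: if_splits)
qed simp

definition std_bimodule ::
  "'a::ring_1 set \<Rightarrow> 'a \<Rightarrow> ('a \<Rightarrow> 'a^2^2) \<Rightarrow> ('a \<Rightarrow> 'a^2^2) \<Rightarrow> nat \<Rightarrow> nat \<Rightarrow> nat \<Rightarrow> nat \<Rightarrow>
   ('a, (nat \<Rightarrow> 'a) \<times> (nat \<Rightarrow> 'a) \<times> (nat \<Rightarrow> 'a^2) \<times> (nat \<Rightarrow> 'a^2)) bimodule" where
  "std_bimodule R P \<phi>1 \<phi>2 r1 r2 t1 t2 =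
     bimodule_sum (bimodule_power r1 (natural_bimodule R))
       (bimodule_sum (bimodule_power r2 (natural_bimodule ((*) P ` R)))
         (bimodule_sum (bimodule_power t1 (column_bimodule R \<phi>1))
           (bimodule_power t2 (column_bimodule R \<phi>2))))"

lemma sum_fun_apply: "(\<Sum>i\<in>A. f i) x = (\<Sum>i\<in>A. f i x)"
  by (induction A rule: infinite_finite_induct) auto

context quat_order
begin

text \<open>1 and \<open>P\<close> generate the order and its ideal, and the first unit column
  generates either matrix bimodule, \<open>P\<close> carrying it to the second. The ideal has
  twisted kind because \<open>a * P = P * cj a\<close>.\<close>

definition std_gen :: "bool \<times> bool \<times> nat \<Rightarrow> (nat \<Rightarrow> 'a) \<times> (nat \<Rightarrow> 'a) \<times> (nat \<Rightarrow> 'a^2) \<times> (nat \<Rightarrow> 'a^2)" where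
  "std_gen i = (\<lambda>m. if i = (False, False, m) then 1 else 0, \<lambda>m. if i = (False, True, m) then P else 0,
     \<lambda>m. if i = (True, False, m) then vector [1, 0] else 0,
     \<lambda>m. if i = (True, True, m) then vector [1, 0] else 0)"

definition std_vec :: "(bool \<times> bool \<times> nat) set \<Rightarrow> (bool \<times> bool \<times> nat \<Rightarrow> 'a) \<Rightarrow> (bool \<times> bool \<times> nat \<Rightarrow> 'a) \<Rightarrow>
    (nat \<Rightarrow> 'a) \<times> (nat \<Rightarrow> 'a) \<times> (nat \<Rightarrow> 'a^2) \<times> (nat \<Rightarrow> 'a^2)" where
  "std_vec I c d = (\<lambda>m. if (False, False, m) \<in> I then c (False, False, m) else 0,
     \<lambda>m. if (False, True, m) \<in> I then P * c (False, True, m) else 0,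
     \<lambda>m. if (True, False, m) \<in> I then vector [c (True, False, m), d (True, False, m)] else 0,
     \<lambda>m. if (True, True, m) \<in> I then vector [c (True, True, m), d (True, True, m)] else 0)"

lemma P_cancel_left: assumes "x \<in> R" "P * x = 0" shows "x = 0"
proof -
  have "cj (P * x) = 0" using assms by (simp add: cj_zero)
  then have "cj x * P = 0" by (simp add: cj_mult cj_P)
  then have "cj x = 0" using P_cancel cj_R assms by blast
  then show ?thesis using cj_cj[of x] by (simp add: cj_zero)
qed

context
  fixes \<phi>1 \<phi>2 :: "'a \<Rightarrow> 'a^2^2"
  assumes \<phi>1: "\<phi>1 P = vector [vector [0, P * P], vector [1, 0]]"
      "\<And>a. a \<in> C \<Longrightarrow> \<phi>1 a = vector [vector [a, 0], vector [0, cj a]]"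
    and \<phi>2: "\<phi>2 P = vector [vector [0, P * P], vector [1, 0]]"
      "\<And>a. a \<in> C \<Longrightarrow> \<phi>2 a = vector [vector [cj a, 0], vector [0, a]]"
begin

lemmas std_simps = std_bimodule_def bimodule_sum_def bimodule_power_def natural_bimodule_def
  column_bimodule_def std_gen_def

lemma matrix_vector_2: "(M::'a^2^2) *v x = vector [M$1$1 * x$1 + M$1$2 * x$2, M$2$1 * x$1 + M$2$2 * x$2]"
  by (simp add: vec_eq_iff forall_2 matrix_vector_mult_def sum_2)

lemma std_term:
  assumes i: "i \<in> std_index r1 r2 t1 t2" and d: "\<not> fst i \<longrightarrow> d = 0"
  shows "ract (std_bimodule R P \<phi>1 \<phi>2 r1 r2 t1 t2) (std_gen i) c +
      ract (std_bimodule R P \<phi>1 \<phi>2 r1 r2 t1 t2) (lact (std_bimodule R P \<phi>1 \<phi>2 r1 r2 t1 t2) P (std_gen i)) d =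
    (\<lambda>m. if i = (False, False, m) then c else 0, \<lambda>m. if i = (False, True, m) then P * c else 0,
     \<lambda>m. if i = (True, False, m) then vector [c, d] else 0,
     \<lambda>m. if i = (True, True, m) then vector [c, d] else 0)"
proof -
  obtain T \<epsilon> n where "i = (T, \<epsilon>, n)" by (cases i)
  then show ?thesis using i d
    by (cases T; cases \<epsilon>)
      (auto simp: std_simps std_index_def fun_eq_iff vec_eq_iff forall_2 matrix_vector_2 \<phi>1(1) \<phi>2(1))
qed

lemma std_gen_C:
  assumes i: "i \<in> std_index r1 r2 t1 t2" and a: "a \<in> C"
  shows "lact (std_bimodule R P \<phi>1 \<phi>2 r1 r2 t1 t2) a (std_gen i) =
    ract (std_bimodule R P \<phi>1 \<phi>2 r1 r2 t1 t2) (std_gen i) (tw (snd (std_kind i)) a)"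
proof -
  obtain T \<epsilon> n where "i = (T, \<epsilon>, n)" by (cases i)
  then show ?thesis using i a
    by (cases T; cases \<epsilon>)
      (auto simp: std_simps std_index_def std_kind_def tw_def fun_eq_iff vec_eq_iff forall_2 matrix_vector_2
        \<phi>1(2) \<phi>2(2) C_P)
qed

lemma std_gen_P:
  assumes i: "i \<in> std_index r1 r2 t1 t2" and T: "\<not> fst (std_kind i)"
  shows "lact (std_bimodule R P \<phi>1 \<phi>2 r1 r2 t1 t2) P (std_gen i) =
    ract (std_bimodule R P \<phi>1 \<phi>2 r1 r2 t1 t2) (std_gen i) P"
proof -
  obtain T \<epsilon> n where "i = (T, \<epsilon>, n)" by (cases i)
  then show ?thesis using i T
    by (cases T; cases \<epsilon>)
      (auto simp: std_simps std_index_def std_kind_def fun_eq_iff vec_eq_iff forall_2 matrix_vector_2)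
qed

lemma std_gen_carrier:
  assumes i: "i \<in> std_index r1 r2 t1 t2"
  shows "std_gen i \<in> bcarrier (std_bimodule R P \<phi>1 \<phi>2 r1 r2 t1 t2)"
proof -
  obtain T \<epsilon> n where "i = (T, \<epsilon>, n)" by (cases i)
  moreover have "0 \<in> (*) P ` R" "P \<in> (*) P ` R" using R_zero R_one by force+
  ultimately show ?thesis using i
    by (cases T; cases \<epsilon>)
      (auto simp: std_simps std_index_def forall_2 R_zero R_one)
qed

lemma std_sum:
  assumes I: "I = std_index r1 r2 t1 t2" and cd: "coords I std_kind c d"
  shows "(\<Sum>i\<in>I. ract (std_bimodule R P \<phi>1 \<phi>2 r1 r2 t1 t2) (std_gen i) (c i) +
      ract (std_bimodule R P \<phi>1 \<phi>2 r1 r2 t1 t2) (lact (std_bimodule R P \<phi>1 \<phi>2 r1 r2 t1 t2) P (std_gen i)) (d i)) =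
    std_vec I c d"
proof -
  have fin: "finite I" unfolding I by (rule finite_std_index)
  have D: "(\<Sum>i\<in>I. if i = j then w i else 0) = (if j \<in> I then w j else 0)"
    for w :: "_ \<Rightarrow> 'c::comm_monoid_add" and j
    using sum.delta[OF fin, of j w] by simp
  have "\<not> fst i \<longrightarrow> d i = 0" if "i \<in> I" for i
    using cd that by (auto simp: coords_def std_kind_def)
  then have "(\<Sum>i\<in>I. ract (std_bimodule R P \<phi>1 \<phi>2 r1 r2 t1 t2) (std_gen i) (c i) +
      ract (std_bimodule R P \<phi>1 \<phi>2 r1 r2 t1 t2) (lact (std_bimodule R P \<phi>1 \<phi>2 r1 r2 t1 t2) P (std_gen i)) (d i)) =
    (\<Sum>i\<in>I. (\<lambda>m. if i = (False, False, m) then c i else 0, \<lambda>m. if i = (False, True, m) then P * c i else 0,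
     \<lambda>m. if i = (True, False, m) then vector [c i, d i] else 0,
     \<lambda>m. if i = (True, True, m) then vector [c i, d i] else 0))"
    using I by (intro sum.cong refl std_term) auto
  also have "\<dots> = std_vec I c d"
    unfolding std_vec_def
    by (intro prod_eqI ext) (simp_all only: fst_sum snd_sum fst_conv snd_conv sum_fun_apply D)
  finally show ?thesis .
qed

end

end

context bimod
begin

text \<open>The coordinates are the entries in the standard sum. In the summands that are ideals an
  entry is a left multiple of \<open>P\<close>, and cancelling \<open>P\<close> makes its coordinate
  unique.\<close>

lemma basis_of_iso:
  assumes \<phi>1: "\<phi>1 P = vector [vector [0, P * P], vector [1, 0]]"
      "\<And>a. a \<in> C \<Longrightarrow> \<phi>1 a = vector [vector [a, 0], vector [0, cj a]]"
    and \<phi>2: "\<phi>2 P = vector [vector [0, P * P], vector [1, 0]]"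
      "\<And>a. a \<in> C \<Longrightarrow> \<phi>2 a = vector [vector [cj a, 0], vector [0, a]]"
    and iso: "bimodule_iso R L (std_bimodule R P \<phi>1 \<phi>2 r1 r2 t1 t2) f"
  obtains g where "basis std_kind (std_index r1 r2 t1 t2) g V"
proof -
  define S where "S = std_bimodule R P \<phi>1 \<phi>2 r1 r2 t1 t2"
  define I where "I = std_index r1 r2 t1 t2"
  have bij: "bij_betw f V (bcarrier S)" and f_add: "\<And>x y. x \<in> V \<Longrightarrow> y \<in> V \<Longrightarrow> f (x + y) = f x + f y"
    and f_l: "\<And>a x. a \<in> R \<Longrightarrow> x \<in> V \<Longrightarrow> f (a \<rhd> x) = lact S a (f x)"
    and f_r: "\<And>a x. a \<in> R \<Longrightarrow> x \<in> V \<Longrightarrow> f (x \<lhd> a) = ract S (f x) a"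
    using iso unfolding bimodule_iso_def S_def by auto
  have inj: "x = y" if "f x = f y" "x \<in> V" "y \<in> V" for x y
    using bij that by (auto simp: bij_betw_def dest: inj_onD)
  have f0: "f 0 = 0" using f_add[OF V_zero V_zero] by simp
  have f_sum: "f (sum w A) = (\<Sum>i\<in>A. f (w i))" if "\<And>i. i \<in> A \<Longrightarrow> w i \<in> V" for w and A :: "'c set"
    using that by (induction A rule: infinite_finite_induct) (auto simp: f0 f_add V_sum)
  define g where "g i = (SOME x. x \<in> V \<and> f x = std_gen i)" for i
  have g: "g i \<in> V" "f (g i) = std_gen i" if "i \<in> I" for i
  proof -
    have "std_gen i \<in> f ` V"
      using std_gen_carrier[OF \<phi>1 \<phi>2] that bij unfolding I_def S_def bij_betw_def by blast
    then have "\<exists>x. x \<in> V \<and> f x = std_gen i" by (metis imageE)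
    then have "g i \<in> V \<and> f (g i) = std_gen i" unfolding g_def by (rule someI_ex)
    then show "g i \<in> V" "f (g i) = std_gen i" by auto
  qed
  have gens: "gens std_kind I g"
    unfolding gens_def gen_def homog_def
  proof (intro conjI ballI impI)
    show "finite I" unfolding I_def by (rule finite_std_index)
    fix i assume i: "i \<in> I"
    note V = g(1)[OF i]
    show "g i \<in> V" by fact
    show "a \<rhd> g i = g i \<lhd> tw (snd (std_kind i)) a" if a: "a \<in> C" for a
      by (rule inj) (use V a g(2)[OF i] std_gen_C[OF \<phi>1 \<phi>2, of i r1 r2 t1 t2] i in
        \<open>simp_all add: f_l f_r C_R tw_C V_l V_r I_def S_def\<close>)
    show "P \<rhd> g i = g i \<lhd> P" if T: "\<not> fst (std_kind i)"
      by (rule inj) (use V T g(2)[OF i] std_gen_P[OF \<phi>1 \<phi>2, of i r1 r2 t1 t2] i in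
        \<open>simp_all add: f_l f_r P_R V_l V_r I_def S_def\<close>)
  qed
  have f_lc: "f (lc I g c d) = std_vec I c d" if cd: "coords I std_kind c d" for c d
  proof -
    have "f (lc I g c d) = (\<Sum>i\<in>I. f (g i \<lhd> c i + (P \<rhd> g i) \<lhd> d i))"
      unfolding lc_def by (rule f_sum) (rule lc_term_V[OF gens cd])
    also have "\<dots> = (\<Sum>i\<in>I. ract S (std_gen i) (c i) + ract S (lact S P (std_gen i)) (d i))"
      by (intro sum.cong refl) (simp add: f_add f_l f_r g coordsD[OF cd] V_l V_r P_R)
    also have "\<dots> = std_vec I c d"
      unfolding S_def by (rule std_sum[OF \<phi>1 \<phi>2 I_def cd])
    finally show ?thesis .
  qed
  have "basis std_kind I g V"
    unfolding basis_def
  proof (intro conjI allI impI)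
    show "gens std_kind I g" by fact
    show "V = span std_kind I g"
    proof
      show "span std_kind I g \<subseteq> V" using sub_bimoduleD(1)[OF span_sub[OF gens]] by blast
      show "V \<subseteq> span std_kind I g"
      proof
        fix x assume x: "x \<in> V"
        obtain u v X Y where fx: "f x = (u, v, X, Y)" by (cases "f x")
        have "f x \<in> bcarrier S" using bij x by (auto simp: bij_betw_def)
        then have u: "\<forall>m<r1. u m \<in> R" "\<forall>m\<ge>r1. u m = 0" and v: "\<forall>m<r2. v m \<in> (*) P ` R" "\<forall>m\<ge>r2. v m = 0"
          and X: "\<forall>m<t1. X m $ 1 \<in> R \<and> X m $ 2 \<in> R" "\<forall>m\<ge>t1. X m = 0"
          and Y: "\<forall>m<t2. Y m $ 1 \<in> R \<and> Y m $ 2 \<in> R" "\<forall>m\<ge>t2. Y m = 0"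
          unfolding fx S_def by (auto simp: std_bimodule_def bimodule_sum_def bimodule_power_def
              natural_bimodule_def column_bimodule_def)
        have "\<forall>m. \<exists>w. m < r2 \<longrightarrow> w \<in> R \<and> v m = P * w" using v by auto
        then obtain w where w: "\<And>m. m < r2 \<Longrightarrow> w m \<in> R \<and> v m = P * w m" by metis
        define c where "c = (\<lambda>(T, \<epsilon>, m). if T then if \<epsilon> then Y m $ 1 else X m $ 1 else if \<epsilon> then w m else u m)"
        define d where "d = (\<lambda>(T, \<epsilon>, m). if T then if \<epsilon> then Y m $ 2 else X m $ 2 else 0)"
        have cd: "coords I std_kind c d"
          unfolding coords_def
        proof
          fix i assume i: "i \<in> I"
          obtain T \<epsilon> m where im: "i = (T, \<epsilon>, m)" by (cases i)
          show "c i \<in> R \<and> d i \<in> R \<and> (\<not> fst (std_kind i) \<longrightarrow> d i = 0)"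
            using i u X Y w R_zero unfolding im I_def std_index_def c_def d_def std_kind_def
            by (cases T; cases \<epsilon>) auto
        qed
        have "std_vec I c d = f x"
          unfolding fx std_vec_def I_def using u v X Y w
          by (auto simp: fun_eq_iff std_index_def c_def d_def vec_eq_iff forall_2 not_less)
        then have "x = lc I g c d" using f_lc[OF cd] inj x lc_V[OF gens cd] by metis
        then show "x \<in> span std_kind I g" unfolding span_def using cd by blast
      qed
    qed
    fix c d assume "coords I std_kind c d \<and> lc I g c d = 0"
    then have cd: "coords I std_kind c d" and "std_vec I c d = 0" using f_lc f0 by metis+
    then have z: "(\<lambda>m. if (False, False, m) \<in> I then c (False, False, m) else 0) = (\<lambda>_. 0)"
      "(\<lambda>m. if (False, True, m) \<in> I then P * c (False, True, m) else 0) = (\<lambda>_. 0)"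
      "(\<lambda>m. if (True, False, m) \<in> I then vector [c (True, False, m), d (True, False, m)] else 0) = (\<lambda>_. 0 :: 'a^2)"
      "(\<lambda>m. if (True, True, m) \<in> I then vector [c (True, True, m), d (True, True, m)] else 0) = (\<lambda>_. 0 :: 'a^2)"
      by (simp_all add: std_vec_def zero_prod_def zero_fun_def)
    show "\<forall>i\<in>I. c i = 0 \<and> d i = 0"
    proof
      fix i assume i: "i \<in> I"
      obtain T \<epsilon> m where im: "i = (T, \<epsilon>, m)" by (cases i)
      have d0: "\<not> T \<Longrightarrow> d i = 0" using coordsD(3)[OF cd i] by (simp add: im std_kind_def)
      have "P * c i = 0 \<Longrightarrow> c i = 0" using P_cancel_left coordsD(1)[OF cd i] by blast
      then show "c i = 0 \<and> d i = 0"
        using fun_cong[OF z(1), of m] fun_cong[OF z(2), of m] fun_cong[OF z(3), of m] fun_cong[OF z(4), of m] i d0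
        unfolding im by (cases T; cases \<epsilon>) (auto simp: vec_eq_iff forall_2)
    qed
  qed
  then show ?thesis using that by (simp add: I_def)
qed

end

context quat_order
begin

lemma cnt_std_index:
  "cnt std_kind (std_index r1 r2 t1 t2) (False, False) = r1"
  "cnt std_kind (std_index r1 r2 t1 t2) (False, True) = r2"
  "cnt std_kind (std_index r1 r2 t1 t2) (True, False) = t1"
  "cnt std_kind (std_index r1 r2 t1 t2) (True, True) = t2"
proof -
  have "{i \<in> std_index r1 r2 t1 t2. std_kind i = (T, \<epsilon>)} =
      (\<lambda>n. (T, \<epsilon>, n)) ` {..<(if T then if \<epsilon> then t2 else t1 else if \<epsilon> then r2 else r1)}" for T \<epsilon>
    by (auto simp: std_index_def std_kind_def)
  then have "cnt std_kind (std_index r1 r2 t1 t2) (T, \<epsilon>) = (if T then if \<epsilon> then t2 else t1 else if \<epsilon> then r2 else r1)" for T \<epsilon>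
    unfolding cnt_def by (simp add: card_image inj_on_def)
  then show "cnt std_kind (std_index r1 r2 t1 t2) (False, False) = r1"
    "cnt std_kind (std_index r1 r2 t1 t2) (False, True) = r2"
    "cnt std_kind (std_index r1 r2 t1 t2) (True, False) = t1"
    "cnt std_kind (std_index r1 r2 t1 t2) (True, True) = t2" by simp_all
qed

lemma parity_std_index:
  "parity od (cnt std_kind (std_index r1 r2 t1 t2)) \<longleftrightarrow>
    (if od then r1 = r2 else even r1 \<and> even r2 \<and> t1 = t2)"
  by (simp add: parity_def cnt_std_index)

end

context bimod
begin

text \<open>For odd valuation the copies of the order are matched with those of its ideal, and
  matrix summands with themselves; for even valuation the two matrix types are matched, and the
  other copies are paired off among their own type. There \<open>s\<close> alternates between
  \<open>\<delta>\<close> and \<open>- \<delta>\<close>, because partners must have conjugate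
  values.\<close>

lemma paired_basis_std:
  assumes b: "basis std_kind (std_index r1 r2 t1 t2) g V"
    and par: "if od then r1 = r2 else even r1 \<and> even r2 \<and> t1 = t2"
  shows "\<exists>\<rho> s. paired_basis C cj P \<delta> \<omega> L od std_kind (std_index r1 r2 t1 t2) g \<rho> s"
proof -
  \<comment> \<open>Exchanges 2k and 2k + 1, so it stays below any even bound.\<close>
  define sw where "sw n = (if even n then n + 1 else n - 1)" for n :: nat
  have sw: "sw (sw n) = n" "even (sw n) \<longleftrightarrow> odd n" for n
    by (auto simp: sw_def elim: oddE)
  have sw_less: "sw n < r" if "n < r" "even r" for n r
    using that by (auto simp: sw_def elim!: evenE)
  define \<rho> where "\<rho> = (\<lambda>(T, \<epsilon>, n::nat). if od then (T, if T then \<epsilon> else \<not> \<epsilon>, n)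
    else (T, if T then \<not> \<epsilon> else \<epsilon>, if T then n else sw n))"
  define s where "s = (\<lambda>(T::bool, \<epsilon>::bool, n::nat). if od \<or> T then 1 else if even n then \<delta> else - \<delta>)"
  have "paired_basis C cj P \<delta> \<omega> L od std_kind (std_index r1 r2 t1 t2) g \<rho> s"
  proof unfold_locales
    show "basis std_kind (std_index r1 r2 t1 t2) g V" by fact
    fix i assume i: "i \<in> std_index r1 r2 t1 t2"
    obtain T \<epsilon> n where im: "i = (T, \<epsilon>, n)" by (cases i)
    show "\<rho> i \<in> std_index r1 r2 t1 t2"
      using i par sw_less unfolding im \<rho>_def std_index_def by (cases T; cases \<epsilon>; cases od) auto
    show "\<rho> (\<rho> i) = i" using sw unfolding im \<rho>_def by (cases T; cases \<epsilon>; cases od) auto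
    show "std_kind (\<rho> i) = partner od (std_kind i)"
      unfolding im \<rho>_def partner_def std_kind_def by (cases T; cases \<epsilon>; cases od) auto
    show "s i \<in> C" using \<delta> C_one C_uminus unfolding im s_def by auto
    obtain \<delta>' where "\<delta>' \<in> C" "\<delta> * \<delta>' = 1" using \<delta> by blast
    then show "\<exists>y\<in>C. s i * y = 1"
      using C_one C_uminus[of \<delta>'] unfolding im s_def
      by (auto intro: bexI[of _ "- \<delta>'"])
    assume T: "\<not> fst (std_kind i)"
    show "s (\<rho> i) = cj (s i)"
      using T sw \<delta> unfolding im s_def \<rho>_def std_kind_def by (cases od) (auto simp: cj_one cj_uminus)
    show "cj (s i) = (if od then s i else - s i)"
      using T \<delta> unfolding im s_def std_kind_def by (cases od) (auto simp: cj_one cj_uminus)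
  qed
  then show ?thesis by blast
qed

end

section \<open>Ultrametric fields\<close>

text \<open>Serves to count squares in a residue field: fibres have at most two elements and the one
  through 0 only one, so more than half of the residues are attained.\<close>

lemma card_image_two_fibres:
  assumes fin: "finite T" and two: "\<And>a. card {t \<in> T. f t = a} \<le> 2"
    and a0: "a0 \<in> f ` T" "card {t \<in> T. f t = a0} \<le> 1"
  shows "card T + 1 \<le> 2 * card (f ` T)"
proof -
  define A where "A = f ` T"
  have finA: "finite A" using fin by (simp add: A_def)
  have "T = (\<Union>a\<in>A. {t \<in> T. f t = a})" by (auto simp: A_def)
  then have "card T \<le> (\<Sum>a\<in>A. card {t \<in> T. f t = a})" using card_UN_le[OF finA] by metis
  also have "\<dots> = card {t \<in> T. f t = a0} + (\<Sum>a\<in>A - {a0}. card {t \<in> T. f t = a})"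
    using a0(1) finA by (simp add: A_def sum.remove)
  also have "(\<Sum>a\<in>A - {a0}. card {t \<in> T. f t = a}) \<le> (\<Sum>a\<in>A - {a0}. 2)" by (intro sum_mono two)
  also have "\<dots> = 2 * (card A - 1)" using a0(1) finA by (simp add: A_def)
  finally have "card T \<le> 1 + 2 * (card A - 1)" using a0(2) by linarith
  moreover have "card A \<ge> 1" using a0(1) finA by (metis A_def Suc_leI card_gt_0_iff empty_iff One_nat_def)
  ultimately show ?thesis unfolding A_def by linarith
qed

text \<open>The strong inequality is required only on the unit ball, which is what the valuation of
  the algebra yields directly; dividing by the larger summand gives \<open>wv_add\<close>.\<close>

locale ultrametric_field =
  fixes wv :: "'k::field \<Rightarrow> real"
  assumes av: "absolute_value wv"
    and ultra: "wv x \<le> 1 \<Longrightarrow> wv y \<le> 1 \<Longrightarrow> wv (x + y) \<le> 1"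
begin

lemma wv_nonneg: "wv x \<ge> 0" and wv_0_iff: "wv x = 0 \<longleftrightarrow> x = 0"
  and wv_mult: "wv (x * y) = wv x * wv y"
  using av by (auto simp: absolute_value_def)

lemma wv_0: "wv 0 = 0" by (simp add: wv_0_iff)

lemma wv_1: "wv 1 = 1"
  using wv_mult[of 1 1] wv_0_iff[of 1] by simp

lemma wv_minus: "wv (- x) = wv x"
proof -
  have "wv (- 1) * wv (- 1) = 1" using wv_mult[of "- 1" "- 1"] wv_1 by simp
  then have "wv (- 1) = 1" using wv_nonneg[of "- 1"]
    by (metis abs_of_nonneg abs_mult_self_eq mult_cancel_left real_sqrt_abs2 real_sqrt_one)
  then show ?thesis using wv_mult[of "- 1" x] by simp
qed

lemma wv_power: "wv (x ^ n) = wv x ^ n"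
  by (induction n) (simp_all add: wv_1 wv_mult)

lemma wv_inverse: "wv (inverse x) = inverse (wv x)"
proof (cases "x = 0")
  case False
  then have "wv x * wv (inverse x) = 1" using wv_mult[of x "inverse x"] wv_1 by simp
  then show ?thesis by (metis inverse_unique)
qed (simp add: wv_0)

lemma wv_divide: "wv (x / y) = wv x / wv y"
  by (simp add: divide_inverse wv_mult wv_inverse)

lemma wv_add: "wv (x + y) \<le> max (wv x) (wv y)"
proof -
  have *: "wv (x + y) \<le> wv y" if "wv x \<le> wv y" for x y
  proof (cases "y = 0")
    case True
    then show ?thesis using that wv_nonneg[of x] wv_0_iff[of x] by (simp add: wv_0)
  next
    case False
    then have pos: "wv y > 0" using wv_nonneg[of y] wv_0_iff[of y] by linarith
    then have "wv (x / y + 1) \<le> 1" using ultra[of "x / y" 1] that by (simp add: wv_divide wv_1)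
    moreover have "x / y + 1 = (x + y) / y" using False by (simp add: field_simps)
    ultimately show ?thesis using pos by (simp add: wv_divide)
  qed
  show ?thesis using *[of x y] *[of y x] by (cases "wv x \<le> wv y") (auto simp: add.commute)
qed

lemma wv_diff: "wv (x - y) \<le> max (wv x) (wv y)"
  using wv_add[of x "- y"] wv_minus[of y] by simp

lemma wv_diff_commute: "wv (x - y) = wv (y - x)"
  using wv_minus[of "x - y"] by simp

lemma wv_add_less: "wv x < e \<Longrightarrow> wv y < e \<Longrightarrow> wv (x + y) < e"
  using wv_add[of x y] by linarith

lemma wv_diff_less: "wv x < e \<Longrightarrow> wv y < e \<Longrightarrow> wv (x - y) < e"
  using wv_diff[of x y] by linarith

lemma wv_mult_less: "wv x < 1 \<Longrightarrow> wv y \<le> 1 \<Longrightarrow> wv (x * y) < 1"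
  using wv_nonneg[of x] wv_nonneg[of y] by (simp add: wv_mult) (smt (verit) mult_left_le)

lemma wv_mult_le: "wv x \<le> 1 \<Longrightarrow> wv y \<le> 1 \<Longrightarrow> wv (x * y) \<le> 1"
  using wv_nonneg[of x] wv_nonneg[of y] by (simp add: wv_mult mult_le_one)

lemma wv_mult_less_cases: "wv (x * y) < 1 \<Longrightarrow> wv x < 1 \<or> wv y < 1"
  by (simp add: wv_mult) (smt (verit) mult_left_le_one_le mult_le_cancel_left1)

lemma wv_trans: "wv (x - y) < 1 \<Longrightarrow> wv (y - z) < 1 \<Longrightarrow> wv (x - z) < 1"
  using wv_add_less[of "x - y" 1 "y - z"] by simp

text \<open>Hensel's lemma in the only case that is needed, by the contraction principle.\<close>

lemma quadratic_fixed_point: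
  assumes compl: "\<And>s. cauchy_seq wv s \<Longrightarrow> \<exists>l. null_seq wv (\<lambda>n. s n - l)"
    and c: "wv c \<le> 1" and d: "wv d < 1"
  shows "\<exists>t. wv t \<le> 1 \<and> t = c + d * t * t"
proof -
  define q where "q = wv d"
  have q: "0 \<le> q" "q < 1" using d wv_nonneg by (auto simp: q_def)
  define F where "F t = c + d * t * t" for t
  define s where "s n = (F ^^ n) 0" for n :: nat
  have s_Suc: "s (Suc n) = F (s n)" for n by (simp add: s_def)
  have F_le: "wv (F t) \<le> 1" if "wv t \<le> 1" for t
    unfolding F_def using that c d by (intro ultra wv_mult_le) auto
  have s_le: "wv (s n) \<le> 1" for n
    by (induction n) (use F_le s_Suc in \<open>auto simp: s_def wv_0\<close>)
  have F_contr: "wv (F x - F y) \<le> q * wv (x - y)" if "wv x \<le> 1" "wv y \<le> 1" for x y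
  proof -
    have "F x - F y = d * ((x - y) * (x + y))" by (simp add: F_def algebra_simps)
    moreover have "wv ((x - y) * (x + y)) \<le> wv (x - y)"
      using ultra[OF that] wv_nonneg by (simp add: wv_mult mult_right_le_one_le)
    ultimately show ?thesis using q by (simp add: wv_mult q_def mult_left_mono)
  qed
  have step: "wv (s (Suc n) - s n) \<le> q ^ n" for n
  proof (induction n)
    case 0
    then show ?case using c by (simp add: s_def F_def)
  next
    case (Suc n)
    have "wv (s (Suc (Suc n)) - s (Suc n)) \<le> q * wv (s (Suc n) - s n)"
      using F_contr[OF s_le s_le] s_Suc by metis
    also have "\<dots> \<le> q * q ^ n" using Suc q by (intro mult_left_mono) auto
    finally show ?case by simp
  qed
  have dist: "wv (s (m + k) - s m) \<le> q ^ m" for m k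
  proof (induction k)
    case 0
    then show ?case using q by (simp add: wv_0)
  next
    case (Suc k)
    have "wv (s (m + Suc k) - s m) \<le> max (wv (s (Suc (m + k)) - s (m + k))) (wv (s (m + k) - s m))"
      using wv_add[of "s (Suc (m + k)) - s (m + k)" "s (m + k) - s m"] by simp
    moreover have "q ^ (m + k) \<le> q ^ m" using q by (intro power_decreasing) auto
    ultimately show ?case using step[of "m + k"] Suc by linarith
  qed
  have "cauchy_seq wv s"
    unfolding cauchy_seq_def
  proof (intro allI impI)
    fix e :: real assume e: "e > 0"
    obtain M where M: "q ^ M < e" using real_arch_pow_inv[OF e q(2)] by blast
    have M': "wv (s m - s M) < e" if "m \<ge> M" for m
      using dist[of M "m - M"] that M by simp
    have "wv (s m - s n) < e" if "m \<ge> M" "n \<ge> M" for m n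
      using wv_diff_less[OF M'[OF that(1)] M'[OF that(2)]] by simp
    then show "\<exists>M. \<forall>m\<ge>M. \<forall>n\<ge>M. wv (s m - s n) < e" by blast
  qed
  then obtain l where l: "(\<lambda>n. wv (s n - l)) \<longlonglongrightarrow> 0" using compl by (auto simp: null_seq_def)
  have ev: "eventually (\<lambda>n. wv (s n - l) < e) sequentially" if "e > 0" for e
    using order_tendstoD(2)[OF l that] .
  have wl: "wv l \<le> 1"
  proof -
    obtain n where "wv (s n - l) < 1" using ev[of 1] eventually_happens by fastforce
    then show ?thesis using wv_diff[of "s n" "s n - l"] s_le[of n] by simp
  qed
  have "wv (l - F l) < e" if e: "e > 0" for e
  proof -
    obtain N where N: "\<And>n. n \<ge> N \<Longrightarrow> wv (s n - l) < e" using ev[OF e] by (auto simp: eventually_sequentially)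
    have "wv (F (s N) - F l) \<le> q * wv (s N - l)" by (rule F_contr[OF s_le wl])
    also have "\<dots> \<le> wv (s N - l)" using q wv_nonneg by (simp add: mult_left_le_one_le)
    finally have 1: "wv (s (Suc N) - F l) < e" using N[of N] s_Suc by simp
    have 2: "wv (s (Suc N) - l) < e" using N by simp
    show ?thesis using wv_diff_less[OF 1 2] by simp
  qed
  then have "wv (l - F l) \<le> 0" by (meson less_irrefl not_less)
  then have "l = F l" using wv_nonneg[of "l - F l"] wv_0_iff[of "l - F l"] by simp
  then show ?thesis using wl unfolding F_def by blast
qed

section \<open>Residue classes and counting\<close>

context
  fixes T0 assumes T0: "finite T0" "\<And>x. wv x \<le> 1 \<Longrightarrow> \<exists>t\<in>T0. wv (x - t) < 1"
begin

definition rep where "rep x = (SOME t. t \<in> T0 \<and> wv (x - t) < 1)"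

lemma rep: "wv x \<le> 1 \<Longrightarrow> rep x \<in> T0" "wv x \<le> 1 \<Longrightarrow> wv (x - rep x) < 1"
  using someI_ex[of "\<lambda>t. t \<in> T0 \<and> wv (x - t) < 1"] T0(2)[of x] unfolding rep_def by blast+

lemma rep_le: "wv x \<le> 1 \<Longrightarrow> wv (rep x) \<le> 1"
  using rep(2)[of x] wv_diff[of x "x - rep x"] by simp

text \<open>Which \<open>t\<close> are admissible for \<open>x\<close> depends only on the residue
  class of \<open>x\<close>, so the choice operator returns the same representative on a whole
  class.\<close>

lemma rep_eq_iff: assumes "wv x \<le> 1" "wv y \<le> 1" shows "rep x = rep y \<longleftrightarrow> wv (x - y) < 1"
proof
  assume "rep x = rep y"
  then show "wv (x - y) < 1" using wv_diff_less[OF rep(2)[OF assms(1)] rep(2)[OF assms(2)]] by simp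
next
  assume xy: "wv (x - y) < 1"
  have "wv (x - t) < 1 \<longleftrightarrow> wv (y - t) < 1" for t
    using wv_trans[of x y t] wv_trans[of y x t] xy wv_diff_commute by metis
  then show "rep x = rep y" unfolding rep_def by simp
qed

definition reps where "reps = rep ` {x. wv x \<le> 1}"

lemma finite_reps: "finite reps"
  by (rule finite_subset[OF _ T0(1)]) (auto simp: reps_def rep)

lemma reps_le: "t \<in> reps \<Longrightarrow> wv t \<le> 1"
  by (auto simp: reps_def rep_le)

lemma rep_reps: "t \<in> reps \<Longrightarrow> rep t = t"
  unfolding reps_def using rep_eq_iff rep_le rep(2) wv_diff_commute by force

lemma rep_in_reps: "wv x \<le> 1 \<Longrightarrow> rep x \<in> reps"
  by (auto simp: reps_def)

lemma reps_eq_iff: "s \<in> reps \<Longrightarrow> t \<in> reps \<Longrightarrow> s = t \<longleftrightarrow> wv (s - t) < 1"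
  using rep_eq_iff[OF reps_le reps_le] rep_reps by metis

text \<open>Modulo 2 the difference of two squares is the square of the difference, so squaring is
  injective on the finite set of residues and hence onto.\<close>

lemma square_root_mod:
  assumes two: "wv (1 + 1) < 1" and n: "wv n \<le> 1"
  shows "\<exists>m. wv m \<le> 1 \<and> wv (n - m * m) < 1"
proof -
  define f where "f t = rep (t * t)" for t
  have sq: "wv (t * t) \<le> 1" if "t \<in> reps" for t using reps_le[OF that] wv_mult_le by blast
  have "inj_on f reps"
  proof (rule inj_onI)
    fix s t assume s: "s \<in> reps" and t: "t \<in> reps" and "f s = f t"
    then have 1: "wv (s * s - t * t) < 1" using rep_eq_iff sq by (simp add: f_def)
    have "wv (s - t) \<le> 1"
      using wv_diff[of s t] reps_le[OF s] reps_le[OF t] by (meson max.boundedI order_trans)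
    then have "wv ((1 + 1) * (t * (s - t))) < 1"
      using reps_le[OF t] by (intro wv_mult_less two wv_mult_le)
    from wv_diff_less[OF 1 this] have "wv ((s - t) * (s - t)) < 1" by (simp add: algebra_simps)
    then have "wv (s - t) < 1" using wv_mult_less_cases by blast
    then show "s = t" using reps_eq_iff s t by blast
  qed
  moreover have "f ` reps \<subseteq> reps" using sq rep_in_reps by (auto simp: f_def)
  ultimately have "f ` reps = reps" using finite_reps by (simp add: endo_inj_surj)
  then obtain m where m: "m \<in> reps" "rep n = rep (m * m)"
    using rep_in_reps[OF n] unfolding f_def by (metis (no_types, lifting) imageE)
  then show ?thesis using rep_eq_iff[OF n sq[OF m(1)]] reps_le by blast
qed

text \<open>The residues of \<open>x * x\<close> and those of \<open>c + D * (y * y)\<close> each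
  fill more than half of a finite set, so they share a value.\<close>

lemma represent_by_norm_form_mod:
  assumes two: "wv (1 + 1) = 1" and D: "wv D = 1" and c: "wv c \<le> 1"
  shows "\<exists>x y. wv x \<le> 1 \<and> wv y \<le> 1 \<and> wv (x * x - D * (y * y) - c) < 1"
proof -
  have main: "card reps + 1 \<le> 2 * card ((\<lambda>t. rep (e + E * (t * t))) ` reps)"
    if e: "wv e \<le> 1" and E: "wv E = 1" for e E
  proof (rule card_image_two_fibres[OF finite_reps])
    have le: "wv (e + E * (t * t)) \<le> 1" if "t \<in> reps" for t
      using reps_le[OF that] e E by (intro ultra wv_mult_le) auto
    have eq: "rep (e + E * (s * s)) = rep (e + E * (t * t)) \<longleftrightarrow> wv ((s - t) * (s + t)) < 1"
      if "s \<in> reps" "t \<in> reps" for s t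
    proof -
      have "e + E * (s * s) - (e + E * (t * t)) = E * ((s - t) * (s + t))" by (simp add: algebra_simps)
      then show ?thesis using rep_eq_iff[OF le[OF that(1)] le[OF that(2)]] E wv_mult[of E] by simp
    qed
    fix a
    show "card {t \<in> reps. rep (e + E * (t * t)) = a} \<le> 2"
    proof (cases "{t \<in> reps. rep (e + E * (t * t)) = a} = {}")
      case False
      then obtain t where t: "t \<in> reps" "rep (e + E * (t * t)) = a" by blast
      have "{t \<in> reps. rep (e + E * (t * t)) = a} \<subseteq> {t, rep (- t)}"
      proof
        fix s assume "s \<in> {t \<in> reps. rep (e + E * (t * t)) = a}"
        then have s: "s \<in> reps" "wv ((s - t) * (s + t)) < 1" using eq t by auto
        have nt: "wv (- t) \<le> 1" using reps_le[OF t(1)] by (simp add: wv_minus)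
        have "wv (s - t) < 1 \<or> wv (s - (- t)) < 1" using wv_mult_less_cases[OF s(2)] by simp
        then show "s \<in> {t, rep (- t)}"
          using reps_eq_iff[OF s(1) t(1)] rep_eq_iff[OF reps_le[OF s(1)] nt] rep_reps[OF s(1)] by auto
      qed
      then have "card {t \<in> reps. rep (e + E * (t * t)) = a} \<le> card {t, rep (- t)}" by (intro card_mono) auto
      also have "\<dots> \<le> 2" by (cases "t = rep (- t)") auto
      finally show ?thesis .
    next
      case True
      show ?thesis unfolding True by simp
    qed
    have z: "rep 0 \<in> reps" using rep_in_reps wv_0 by simp
    have rz: "wv (rep 0) < 1" using rep(2)[of 0] wv_0 by (simp add: wv_minus)
    show "rep (e + E * (rep 0 * rep 0)) \<in> (\<lambda>t. rep (e + E * (t * t))) ` reps" using z by blast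
    have "{t \<in> reps. rep (e + E * (t * t)) = rep (e + E * (rep 0 * rep 0))} \<subseteq> {rep 0}"
    proof
      fix s assume "s \<in> {t \<in> reps. rep (e + E * (t * t)) = rep (e + E * (rep 0 * rep 0))}"
      then have s: "s \<in> reps" "wv ((s - rep 0) * (s + rep 0)) < 1" using eq z by auto
      then have "wv (s - rep 0) < 1 \<or> wv (s + rep 0) < 1" using wv_mult_less_cases by blast
      then have "wv (s - rep 0) < 1"
      proof
        assume "wv (s + rep 0) < 1"
        then have "wv s < 1" using wv_diff_less[OF _ rz, of "s + rep 0"] by simp
        then show ?thesis using wv_diff_less rz by blast
      qed
      then show "s \<in> {rep 0}" using reps_eq_iff s z by simp
    qed
    then show "card {t \<in> reps. rep (e + E * (t * t)) = rep (e + E * (rep 0 * rep 0))} \<le> 1"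
      using card_mono[of "{rep 0}"] by fastforce
  qed
  define A where "A = (\<lambda>t. rep (0 + 1 * (t * t))) ` reps"
  define B where "B = (\<lambda>t. rep (c + D * (t * t))) ` reps"
  have "card A + card B > card reps"
    using main[of 0 1] main[OF c D] wv_0 wv_1 unfolding A_def B_def by linarith
  moreover have "A \<union> B \<subseteq> reps"
    unfolding A_def B_def using reps_le c D by (auto intro!: rep_in_reps ultra wv_mult_le simp: wv_0)
  then have "card (A \<union> B) \<le> card reps" using finite_reps card_mono by blast
  moreover have "finite A" "finite B" using finite_reps by (auto simp: A_def B_def)
  ultimately have "A \<inter> B \<noteq> {}" by (metis card_Un_disjoint not_le)
  then obtain x y where xy: "x \<in> reps" "y \<in> reps" "rep (x * x) = rep (c + D * (y * y))"
    unfolding A_def B_def by auto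
  then have "wv (x * x - (c + D * (y * y))) < 1"
    using rep_eq_iff[of "x * x" "c + D * (y * y)"] reps_le c D ultra wv_mult_le by simp
  then show ?thesis using xy reps_le by (metis diff_add_eq_diff_diff_swap)
qed

end

end

section \<open>The local quaternion algebra\<close>

locale valued_algebra =
  fixes \<iota> :: "'k::field \<Rightarrow> 'a::ring_1" and wv :: "'k \<Rightarrow> real" and ord :: "'a \<Rightarrow> int"
  assumes \<iota>: "ring_map \<iota>" and av: "absolute_value wv" and nv: "normalized_valuation \<iota> wv ord"
begin

lemma \<iota>_simps: "\<iota> 1 = 1" "\<iota> (x + y) = \<iota> x + \<iota> y" "\<iota> (x * y) = \<iota> x * \<iota> y"
  using \<iota> by (auto simp: ring_map_def)

lemma \<iota>_0: "\<iota> 0 = 0"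
  using \<iota>_simps(2)[of 0 0] by simp

lemma \<iota>_minus: "\<iota> (- x) = - \<iota> x"
  using \<iota>_simps(2)[of x "- x"] \<iota>_0 by (simp add: eq_neg_iff_add_eq_0 add.commute)

lemma \<iota>_diff: "\<iota> (x - y) = \<iota> x - \<iota> y"
  using \<iota>_simps(2)[of x "- y"] \<iota>_minus by simp

lemma \<iota>_inverse: "c \<noteq> 0 \<Longrightarrow> \<iota> c * \<iota> (inverse c) = 1"
  by (simp add: \<iota>_simps(3)[symmetric] \<iota>_simps(1))

lemma \<iota>_eq_0: "\<iota> c = 0 \<longleftrightarrow> c = 0"
  using \<iota>_inverse[of c] \<iota>_0 by (metis mult_zero_left zero_neq_one)

lemma ord_mult: "x \<noteq> 0 \<Longrightarrow> y \<noteq> 0 \<Longrightarrow> ord (x * y) = ord x + ord y"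
  and ord_add: "x \<noteq> 0 \<Longrightarrow> y \<noteq> 0 \<Longrightarrow> x + y \<noteq> 0 \<Longrightarrow> ord (x + y) \<ge> min (ord x) (ord y)"
  and ord_surj: "ord ` {x. x \<noteq> 0} = UNIV"
  and ord_\<iota>: "c \<noteq> 0 \<Longrightarrow> ord (\<iota> c) \<ge> 0 \<longleftrightarrow> wv c \<le> 1"
  using nv by (auto simp: normalized_valuation_def)

lemma ord_1: "ord 1 = 0"
  using ord_mult[of 1 1] by simp

lemma ord_minus: "x \<noteq> 0 \<Longrightarrow> ord (- x) = ord x"
proof -
  assume x: "x \<noteq> 0"
  have "ord (- 1) = 0" using ord_mult[of "- 1" "- 1"] ord_1 by simp
  then show ?thesis using ord_mult[of "- 1" x] x by simp
qed

sublocale ultrametric_field wv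
proof
  show "absolute_value wv" by (rule av)
  fix x y assume x: "wv x \<le> 1" and y: "wv y \<le> 1"
  show "wv (x + y) \<le> 1"
  proof (cases "x = 0 \<or> y = 0 \<or> x + y = 0")
    case True
    moreover have "wv 0 = 0" using av by (simp add: absolute_value_def)
    ultimately show ?thesis using x y by auto
  next
    case False
    then have "\<iota> x \<noteq> 0" "\<iota> y \<noteq> 0" "\<iota> x + \<iota> y \<noteq> 0" using \<iota>_eq_0 \<iota>_simps(2) by metis+
    moreover have "ord (\<iota> x) \<ge> 0" "ord (\<iota> y) \<ge> 0" using ord_\<iota> x y False by auto
    ultimately have "ord (\<iota> x + \<iota> y) \<ge> 0" using ord_add[of "\<iota> x" "\<iota> y"] by linarith
    then show ?thesis using ord_\<iota>[of "x + y"] False \<iota>_simps by simp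
  qed
qed

end

locale local_quaternion = valued_algebra \<iota> wv ord
  for \<iota> :: "'k::field \<Rightarrow> 'a::ring_1" and wv :: "'k \<Rightarrow> real" and cj :: "'a \<Rightarrow> 'a" and ord :: "'a \<Rightarrow> int" +
  fixes Ov K :: "'a set" and \<sigma> :: "'a \<Rightarrow> 'a" and \<pi> :: 'k and P :: 'a
  assumes central: "\<iota> c * x = x * \<iota> c"
    and complete: "cauchy_seq wv s \<Longrightarrow> \<exists>l. null_seq wv (\<lambda>n. s n - l)"
    and ci: "canonical_involution \<iota> cj"
    and pres: "local_presentation \<iota> wv Ov K \<sigma> \<pi> P"
    and Ov_ring: "1 \<in> Ov" "x \<in> Ov \<Longrightarrow> y \<in> Ov \<Longrightarrow> x + y \<in> Ov" "x \<in> Ov \<Longrightarrow> y \<in> Ov \<Longrightarrow> x - y \<in> Ov"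
      "x \<in> Ov \<Longrightarrow> y \<in> Ov \<Longrightarrow> x * y \<in> Ov"
    and Ov_span: "\<exists>c. c \<noteq> 0 \<and> \<iota> c * y \<in> Ov"
    and char_not_2: "(1::'k) + 1 \<noteq> 0"
    and residue_finite: "\<exists>T. finite T \<and> (\<forall>x. wv x \<le> 1 \<longrightarrow> (\<exists>t\<in>T. wv (x - t) < 1))"
begin

definition OK where "OK = integral_closure \<iota> (valuation_ring wv) K"

lemma \<iota>_cancel: "c \<noteq> 0 \<Longrightarrow> \<iota> c * x = 0 \<Longrightarrow> x = 0"
  using \<iota>_inverse[of c] central[of c] by (metis mult.assoc mult_1 mult_zero_right)

lemma \<iota>_two: "\<iota> (1 + 1) * x = x + x"
  unfolding \<iota>_simps by (simp only: distrib_right mult_1)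

lemma two_cancel: "(x::'a) + x = 0 \<Longrightarrow> x = 0"
  using \<iota>_cancel[OF char_not_2, of x] unfolding \<iota>_two .

lemma \<pi>: "\<pi> \<noteq> 0" "wv \<pi> < 1" "wv x < 1 \<Longrightarrow> wv x \<le> wv \<pi>"
  using pres by (auto simp: local_presentation_def uniformizer_def)

lemma PP: "P * P = \<iota> \<pi>"
  using pres by (auto simp: local_presentation_def)

lemma Ov_eq: "Ov = {a + b * P | a b. a \<in> OK \<and> b \<in> OK}"
  and OK_indep: "a \<in> OK \<Longrightarrow> b \<in> OK \<Longrightarrow> a + b * P = 0 \<Longrightarrow> a = 0 \<and> b = 0"
  and P_OK: "a \<in> OK \<Longrightarrow> P * a = \<sigma> a * P"
  using pres by (simp_all add: local_presentation_def OK_def Let_def)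

lemma K_\<iota>: "\<iota> c \<in> K" and K_add: "x \<in> K \<Longrightarrow> y \<in> K \<Longrightarrow> x + y \<in> K"
  and K_mult: "x \<in> K \<Longrightarrow> y \<in> K \<Longrightarrow> x * y \<in> K"
  and K_commute: "x \<in> K \<Longrightarrow> y \<in> K \<Longrightarrow> x * y = y * x"
  and K_inverse: "x \<in> K \<Longrightarrow> x \<noteq> 0 \<Longrightarrow> \<exists>y\<in>K. x * y = 1"
  using pres unfolding local_presentation_def unramified_quadratic_def quadratic_subfield_def by blast+

lemma K_minus: "x \<in> K \<Longrightarrow> - x \<in> K"
  using K_mult[OF K_\<iota>[of "- 1"]] by (simp add: \<iota>_minus \<iota>_simps)

lemma K_diff: "x \<in> K \<Longrightarrow> y \<in> K \<Longrightarrow> x - y \<in> K"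
  using K_add[of x "- y"] K_minus by simp

lemma OK_cases: "x \<in> OK \<Longrightarrow> (\<exists>y\<in>OK. x * y = 1) \<or> (\<exists>y\<in>OK. x = \<iota> \<pi> * y)"
proof -
  assume x: "x \<in> OK"
  have "unramified_quadratic \<iota> wv K" "uniformizer wv \<pi>" using pres by (auto simp: local_presentation_def)
  then show ?thesis using x unfolding unramified_quadratic_def OK_def Let_def by blast
qed

lemma \<sigma>_K: "x \<in> K \<Longrightarrow> \<sigma> x \<in> K" and \<sigma>_add: "x \<in> K \<Longrightarrow> y \<in> K \<Longrightarrow> \<sigma> (x + y) = \<sigma> x + \<sigma> y"
  and \<sigma>_mult: "x \<in> K \<Longrightarrow> y \<in> K \<Longrightarrow> \<sigma> (x * y) = \<sigma> x * \<sigma> y"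
  and \<sigma>_\<iota>: "\<sigma> (\<iota> c) = \<iota> c" and \<sigma>_nontrivial: "\<exists>x\<in>K. \<sigma> x \<noteq> x"
  using pres unfolding local_presentation_def nontrivial_automorphism_def bij_betw_def by blast+

lemma cj_add: "cj (x + y) = cj x + cj y" and cj_\<iota>: "cj (\<iota> c) = \<iota> c"
  and cj_mult: "cj (x * y) = cj y * cj x" and cj_cj: "cj (cj x) = x"
  and trace_norm: "x + cj x \<in> range \<iota>" "x * cj x \<in> range \<iota>"
  using ci by (auto simp: canonical_involution_def)

lemma cj_0: "cj 0 = 0" using cj_add[of 0 0] by simp

lemma cj_1: "cj 1 = 1" using cj_\<iota>[of 1] by (simp add: \<iota>_simps)

lemma cj_minus: "cj (- x) = - cj x"
  using cj_add[of x "- x"] cj_0 by (simp add: eq_neg_iff_add_eq_0 add.commute)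

lemma cj_diff: "cj (x - y) = cj x - cj y"
  using cj_add[of x "- y"] cj_minus by simp

lemma char_poly: obtains t n where "cj x = \<iota> t - x" "x * cj x = \<iota> n" "x * x = \<iota> t * x - \<iota> n"
proof -
  obtain t n where tn: "x + cj x = \<iota> t" "x * cj x = \<iota> n" using trace_norm by blast
  then have c: "cj x = \<iota> t - x" by (simp add: eq_diff_eq add.commute)
  moreover have "x * x = \<iota> t * x - \<iota> n"
    using tn(2) central[of t x] by (simp add: c right_diff_distrib algebra_simps)
  ultimately show ?thesis using that tn by blast
qed

lemma cj_comm: "x * cj x = cj x * x"
proof -
  obtain t n where c: "cj x = \<iota> t - x" by (rule char_poly)
  show ?thesis unfolding c using central[of t x] by (simp add: left_diff_distrib right_diff_distrib)
qed

lemma OK_K: "x \<in> OK \<Longrightarrow> x \<in> K"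
  by (simp add: OK_def integral_closure_def)

lemma OK_\<iota>: "wv c \<le> 1 \<Longrightarrow> \<iota> c \<in> OK"
  unfolding OK_def integral_closure_def
  by (auto intro!: K_\<iota> exI[of _ 1] exI[of _ "\<lambda>_. - c"] simp: valuation_ring_def wv_minus \<iota>_minus)

lemma OK_quadratic: assumes "x \<in> K" "x * x = \<iota> t * x - \<iota> n" "wv t \<le> 1" "wv n \<le> 1" shows "x \<in> OK"
proof -
  define c where "c i = (if i = 0 then n else - t)" for i :: nat
  have "x ^ 2 + (\<Sum>i<2. \<iota> (c i) * x ^ i) = 0"
    using assms(2) by (simp add: numeral_2_eq_2 c_def \<iota>_minus)
  moreover have "\<forall>i<2. c i \<in> valuation_ring wv"
    using assms by (simp add: c_def valuation_ring_def wv_minus)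
  ultimately show ?thesis unfolding OK_def integral_closure_def using assms(1) by blast
qed

lemma \<pi>_power_small: assumes "e > 0" obtains k where "wv (\<pi> ^ k) < e" "wv (\<pi> ^ k) \<le> 1" "\<pi> ^ k \<noteq> 0"
proof -
  obtain k where "wv \<pi> ^ k < e" using real_arch_pow_inv[OF assms \<pi>(2)] by blast
  moreover have "wv \<pi> ^ k \<le> 1" using \<pi> wv_nonneg by (simp add: power_le_one)
  ultimately show ?thesis using that[of k] \<pi> by (simp add: wv_power)
qed

text \<open>Scaling \<open>x\<close> by \<open>c\<close> multiplies its trace by \<open>c\<close>
  and its norm by the square of \<open>c\<close>; a high power of \<open>\<pi>\<close> makes both
  integral.\<close>

lemma OK_scale: assumes x: "x \<in> K" shows "\<exists>c. c \<noteq> 0 \<and> \<iota> c * x \<in> OK"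
proof -
  obtain t n where tn: "x * x = \<iota> t * x - \<iota> n" by (rule char_poly)
  have pos: "1 + wv t + wv n > 0" using wv_nonneg[of t] wv_nonneg[of n] by linarith
  obtain k where k: "wv (\<pi> ^ k) < 1 / (1 + wv t + wv n)" "wv (\<pi> ^ k) \<le> 1" "\<pi> ^ k \<noteq> 0"
    using \<pi>_power_small[of "1 / (1 + wv t + wv n)"] pos by auto
  define c where "c = \<pi> ^ k"
  have c1: "wv c * (1 + wv t + wv n) < 1" using k(1) pos by (simp add: c_def field_simps)
  have nn: "0 \<le> wv c" "0 \<le> wv t" "0 \<le> wv n" using wv_nonneg by auto
  have "wv c * (1 + wv t + wv n) = wv c + wv c * wv t + wv c * wv n" by (simp add: distrib_left)
  then have ct: "wv c * wv t \<le> 1" "wv c * wv n \<le> 1"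
    using c1 nn mult_nonneg_nonneg[OF nn(1,2)] mult_nonneg_nonneg[OF nn(1,3)] by linarith+
  have "wv c * (wv c * wv n) \<le> 1"
    using k(2) ct(2) nn mult_le_one[of "wv c" "wv c * wv n"] by (simp add: c_def)
  then have le: "wv (c * t) \<le> 1" "wv (c * (c * n)) \<le> 1" using ct by (simp_all add: wv_mult)
  have "\<iota> c * x * (\<iota> c * x) = \<iota> c * \<iota> c * (x * x)" using central by (metis mult.assoc)
  also have "\<dots> = \<iota> (c * t) * (\<iota> c * x) - \<iota> (c * (c * n))"
    unfolding tn using central[of t] by (simp add: \<iota>_simps right_diff_distrib mult.assoc)
  finally have "\<iota> c * x \<in> OK" using OK_quadratic[OF K_mult[OF K_\<iota> x] _ le] by blast
  then show ?thesis using k(3) c_def by blast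
qed

lemma \<sigma>_nontrivial_OK: "\<exists>x\<in>OK. \<sigma> x \<noteq> x"
proof -
  obtain x where x: "x \<in> K" "\<sigma> x \<noteq> x" using \<sigma>_nontrivial by blast
  obtain c where c: "c \<noteq> 0" "\<iota> c * x \<in> OK" using OK_scale[OF x(1)] by blast
  have "\<sigma> (\<iota> c * x) = \<iota> c * \<sigma> x" using \<sigma>_mult[OF K_\<iota> x(1)] \<sigma>_\<iota> by simp
  moreover have "\<iota> c * \<sigma> x \<noteq> \<iota> c * x"
    using \<iota>_cancel[OF c(1), of "\<sigma> x - x"] x(2) by (auto simp: right_diff_distrib)
  ultimately show ?thesis using c by (metis (no_types, lifting))
qed

lemma P_inverse: "P * (P * \<iota> (inverse \<pi>)) = 1" "P * \<iota> (inverse \<pi>) * P = 1"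
proof -
  show 1: "P * (P * \<iota> (inverse \<pi>)) = 1" using \<iota>_inverse[OF \<pi>(1)] by (simp add: mult.assoc[symmetric] PP)
  then show "P * \<iota> (inverse \<pi>) * P = 1" using central by (metis mult.assoc)
qed

text \<open>In \<open>K\<close> it would commute with \<open>OK\<close>, whereas conjugation by
  \<open>P\<close> is \<open>\<sigma>\<close>, which is nontrivial already on
  \<open>OK\<close>.\<close>

lemma P_notin_K: "P \<notin> K"
proof
  assume PK: "P \<in> K"
  obtain x where x: "x \<in> OK" "\<sigma> x \<noteq> x" using \<sigma>_nontrivial_OK by blast
  have "\<sigma> x * P = x * P" using P_OK[OF x(1)] K_commute[OF PK OK_K[OF x(1)]] by simp
  then have "\<sigma> x * (P * (P * \<iota> (inverse \<pi>))) = x * (P * (P * \<iota> (inverse \<pi>)))" by (metis mult.assoc)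
  then show False using x(2) P_inverse by simp
qed

lemma OK_0: "0 \<in> OK" using OK_\<iota>[of 0] by (simp add: wv_0 \<iota>_0)
lemma OK_1: "1 \<in> OK" using OK_\<iota>[of 1] by (simp add: wv_1 \<iota>_simps)

text \<open>An integral closure is not visibly closed under addition and multiplication, an
  intersection of two rings is. A nonzero \<open>P\<close>-component of an element of
  \<open>K\<close> would put \<open>P\<close> itself into \<open>K\<close>.\<close>

lemma OK_eq: "OK = Ov \<inter> K"
proof
  show "OK \<subseteq> Ov \<inter> K"
  proof
    fix x assume x: "x \<in> OK"
    have "x = x + 0 * P" by simp
    then have "x \<in> Ov" unfolding Ov_eq using x OK_0 by blast
    then show "x \<in> Ov \<inter> K" using OK_K x by blast
  qed
  show "Ov \<inter> K \<subseteq> OK"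
  proof
    fix x assume x: "x \<in> Ov \<inter> K"
    then obtain a b where ab: "a \<in> OK" "b \<in> OK" "x = a + b * P" unfolding Ov_eq by blast
    have "b = 0"
    proof (rule ccontr)
      assume "b \<noteq> 0"
      then obtain y where y: "y \<in> K" "b * y = 1" using K_inverse OK_K ab by blast
      have "y * b = 1" using K_commute[OF y(1) OK_K[OF ab(2)]] y(2) by simp
      then have "P = y * (x - a)" using ab(3) by (simp add: mult.assoc[symmetric])
      then have "P \<in> K" using K_mult[OF y(1) K_diff[of x a]] x OK_K ab by simp
      then show False using P_notin_K by blast
    qed
    then show "x \<in> OK" using ab by simp
  qed
qed

lemma OK_add: "x \<in> OK \<Longrightarrow> y \<in> OK \<Longrightarrow> x + y \<in> OK" and OK_mult: "x \<in> OK \<Longrightarrow> y \<in> OK \<Longrightarrow> x * y \<in> OK"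
  and OK_diff: "x \<in> OK \<Longrightarrow> y \<in> OK \<Longrightarrow> x - y \<in> OK"
  unfolding OK_eq using Ov_ring K_add K_mult K_diff by auto

lemma OK_minus: "x \<in> OK \<Longrightarrow> - x \<in> OK"
  using OK_diff[OF OK_0] by simp

lemma OK_commute: "x \<in> OK \<Longrightarrow> y \<in> OK \<Longrightarrow> x * y = y * x"
  using K_commute OK_K by blast

text \<open>In the field \<open>K\<close> the characteristic polynomial of \<open>x\<close> has only
  the roots \<open>x\<close> and \<open>cj x\<close>, and \<open>\<sigma> x\<close> is a root. The
  choice of root might vary with \<open>x\<close>; adding an element \<open>x0\<close> moved by
  \<open>\<sigma>\<close> excludes this.\<close>

lemma \<sigma>_eq_cj: assumes x: "x \<in> K" shows "\<sigma> x = cj x"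
proof -
  have dich: "\<sigma> x = x \<or> \<sigma> x = cj x" if x: "x \<in> K" for x
  proof -
    obtain t n where tn: "cj x = \<iota> t - x" "x * cj x = \<iota> n" "x * x = \<iota> t * x - \<iota> n" by (rule char_poly)
    have s: "\<sigma> x * \<sigma> x = \<iota> t * \<sigma> x - \<iota> n"
    proof -
      have "\<sigma> x * \<sigma> x + \<iota> n = \<sigma> (x * x + \<iota> n)" by (simp add: \<sigma>_add \<sigma>_mult \<sigma>_\<iota> x K_mult K_\<iota>)
      also have "\<dots> = \<iota> t * \<sigma> x" unfolding tn(3) by (simp add: \<sigma>_mult \<sigma>_\<iota> x K_\<iota>)
      finally show ?thesis by (simp add: eq_diff_eq)
    qed
    have cK: "cj x \<in> K" unfolding tn(1) by (intro K_diff K_\<iota> x)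
    have "(\<sigma> x - x) * (\<sigma> x - cj x) = \<sigma> x * \<sigma> x - (\<sigma> x * cj x + x * \<sigma> x) + x * cj x"
      by (simp add: algebra_simps)
    also have "\<sigma> x * cj x + x * \<sigma> x = \<iota> t * \<sigma> x"
      unfolding tn(1) using K_commute[OF x \<sigma>_K[OF x]] central[of t "\<sigma> x"] by (simp add: algebra_simps)
    finally have 0: "(\<sigma> x - x) * (\<sigma> x - cj x) = 0" unfolding s tn(2) by simp
    show ?thesis
    proof (cases "\<sigma> x - x = 0")
      case False
      then obtain y where y: "y \<in> K" "(\<sigma> x - x) * y = 1" using K_inverse K_diff \<sigma>_K x by metis
      have "y * (\<sigma> x - x) = 1" using y K_commute[OF y(1) K_diff[OF \<sigma>_K[OF x] x]] by simp
      then have "\<sigma> x - cj x = 0" using 0 by (metis mult.assoc mult_1 mult_zero_right)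
      then show ?thesis by simp
    qed simp
  qed
  obtain x0 where x0: "x0 \<in> K" "\<sigma> x0 \<noteq> x0" using \<sigma>_nontrivial by blast
  show ?thesis
    using dich[OF x] dich[OF K_add[OF x x0(1)]] dich[OF x0(1)] x0 \<sigma>_add[OF x x0(1)] cj_add[of x x0] by auto
qed

lemma P_C: "x \<in> OK \<Longrightarrow> P * x = cj x * P"
  using P_OK \<sigma>_eq_cj OK_K by simp

text \<open>With a nonzero trace, the characteristic equation would express \<open>P\<close> as a
  scalar, since \<open>P * P\<close> is one.\<close>

lemma cj_P: "cj P = - P"
proof -
  obtain t n where tn: "cj P = \<iota> t - P" "P * P = \<iota> t * P - \<iota> n" by (rule char_poly)
  have "t = 0"
  proof (rule ccontr)
    assume t: "t \<noteq> 0"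
    have "\<iota> t * P = \<iota> (\<pi> + n)" using tn(2) PP by (simp add: \<iota>_simps algebra_simps)
    then have "\<iota> (inverse t) * (\<iota> t * P) = \<iota> (inverse t) * \<iota> (\<pi> + n)" by simp
    moreover have "\<iota> (inverse t) * (\<iota> t * P) = P"
      using \<iota>_inverse[OF t] central[of t "\<iota> (inverse t)"] by (simp add: mult.assoc[symmetric])
    ultimately have "P = \<iota> (inverse t * (\<pi> + n))" by (simp add: \<iota>_simps)
    then show False using P_notin_K K_\<iota> by metis
  qed
  then show ?thesis using tn by (simp add: \<iota>_0)
qed

lemma cj_OK: assumes "x \<in> OK" shows "cj x \<in> OK"
proof -
  obtain n c where nc: "\<forall>i<n. c i \<in> valuation_ring wv" "x ^ n + (\<Sum>i<n. \<iota> (c i) * x ^ i) = 0"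
    using assms by (auto simp: OK_def integral_closure_def)
  have pw: "cj (x ^ i) = cj x ^ i" for i by (induction i) (simp_all add: cj_1 cj_mult power_commutes)
  have sm: "cj (sum f A) = (\<Sum>i\<in>A. cj (f i))" for f and A :: "nat set"
    by (induction A rule: infinite_finite_induct) (auto simp: cj_0 cj_add)
  have "cj (x ^ n + (\<Sum>i<n. \<iota> (c i) * x ^ i)) = cj x ^ n + (\<Sum>i<n. \<iota> (c i) * cj x ^ i)"
    by (simp add: cj_add sm cj_mult cj_\<iota> pw central)
  then have "cj x ^ n + (\<Sum>i<n. \<iota> (c i) * cj x ^ i) = 0" using nc(2) cj_0 by simp
  moreover have "cj x \<in> K" using \<sigma>_eq_cj \<sigma>_K OK_K assms by metis
  ultimately show ?thesis using nc(1) unfolding OK_def integral_closure_def by blast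
qed

lemma OK_nz_power: "x \<in> K \<Longrightarrow> x \<noteq> 0 \<Longrightarrow> x ^ n \<noteq> 0 \<and> ord (x ^ n) = int n * ord x"
proof (induction n)
  case 0
  then show ?case by (simp add: ord_1)
next
  case (Suc n)
  obtain y where y: "x * y = 1" "y \<in> K" using K_inverse Suc by blast
  have "y * x = 1" using K_commute[OF y(2)] y Suc by simp
  then have "x * x ^ n \<noteq> 0" using Suc by (metis mult.assoc mult_1 mult_zero_right)
  then show ?case using Suc ord_mult[of x "x ^ n"] by (simp add: distrib_right)
qed

text \<open>With negative valuation the leading term of an integral equation would have strictly
  smaller valuation than the sum of all the others.\<close>

lemma ord_OK: assumes x: "x \<in> OK" "x \<noteq> 0" shows "ord x \<ge> 0"
proof (rule ccontr)
  assume neg: "\<not> ord x \<ge> 0"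
  note xK = OK_K[OF x(1)]
  obtain n c where nc: "\<forall>i<n. c i \<in> valuation_ring wv" "x ^ n + (\<Sum>i<n. \<iota> (c i) * x ^ i) = 0"
    using x by (auto simp: OK_def integral_closure_def)
  have bound: "(\<Sum>i<m. \<iota> (c i) * x ^ i) = 0 \<or> ord (\<Sum>i<m. \<iota> (c i) * x ^ i) > int m * ord x" if "m \<le> n" for m
    using that
  proof (induction m)
    case (Suc m)
    define S where "S = (\<Sum>i<m. \<iota> (c i) * x ^ i)"
    define y where "y = \<iota> (c m) * x ^ m"
    have y: "y = 0 \<or> ord y \<ge> int m * ord x"
    proof (cases "c m = 0")
      case True
      then show ?thesis by (simp add: y_def \<iota>_0)
    next
      case False
      have "wv (c m) \<le> 1" using nc(1) Suc by (auto simp: valuation_ring_def)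
      then have "ord (\<iota> (c m)) \<ge> 0" using ord_\<iota>[OF False] by simp
      moreover have "ord y = ord (\<iota> (c m)) + ord (x ^ m)"
        unfolding y_def using ord_mult \<iota>_eq_0 False OK_nz_power[OF xK x(2)] by blast
      ultimately show ?thesis using OK_nz_power[OF xK x(2), of m] by simp
    qed
    have S: "S = 0 \<or> ord S > int m * ord x" using Suc by (simp add: S_def)
    have "int (Suc m) * ord x < int m * ord x" using neg by (simp add: distrib_right)
    then have "S + y = 0 \<or> ord (S + y) > int (Suc m) * ord x"
    proof (cases "S = 0 \<or> y = 0 \<or> S + y = 0")
      case False
      then have "min (ord S) (ord y) \<ge> int m * ord x" using S y by simp
      moreover have "int (Suc m) * ord x = ord x + int m * ord x" by (simp add: distrib_right)
      ultimately show ?thesis using ord_add[of S y] False neg by linarith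
    qed (use S y in auto)
    then show ?case by (simp add: S_def y_def)
  qed simp
  have "(\<Sum>i<n. \<iota> (c i) * x ^ i) = - (x ^ n)" using nc(2) by (simp add: eq_neg_iff_add_eq_0 add.commute)
  then show False using bound[of n] OK_nz_power[OF xK x(2), of n] ord_minus[of "x ^ n"] by auto
qed

lemma ord_\<pi>: "ord (\<iota> \<pi>) > 0"
proof -
  have "wv (inverse \<pi>) > 1" using \<pi>(1,2) wv_nonneg[of \<pi>] wv_0_iff[of \<pi>]
    by (simp add: wv_inverse one_less_inverse_iff)
  then have "\<not> ord (\<iota> (inverse \<pi>)) \<ge> 0" using ord_\<iota>[of "inverse \<pi>"] \<pi>(1) by simp
  moreover have "ord (\<iota> \<pi>) + ord (\<iota> (inverse \<pi>)) = 0"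
    using ord_mult[of "\<iota> \<pi>" "\<iota> (inverse \<pi>)"] \<iota>_inverse[OF \<pi>(1)] ord_1 \<pi>(1) \<iota>_eq_0 by simp
  ultimately show ?thesis by simp
qed

lemma \<pi>_nonunit: "y \<in> OK \<Longrightarrow> \<iota> \<pi> * y \<noteq> 1"
proof
  assume y: "y \<in> OK" "\<iota> \<pi> * y = 1"
  then have "y \<noteq> 0" by auto
  then have "ord (\<iota> \<pi>) + ord y = 0" using ord_mult[of "\<iota> \<pi>" y] y ord_1 \<pi>(1) \<iota>_eq_0 by simp
  then show False using ord_\<pi> ord_OK[OF y(1) \<open>y \<noteq> 0\<close>] by simp
qed

text \<open>The trace \<open>x + x\<close> is a scalar and 2 is invertible in the field, so
  \<open>x\<close> is a scalar. Its integrality comes from the valuation, as 2 may be a non-unit of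
  the valuation ring.\<close>

lemma OK_fixed: assumes "x \<in> OK" "cj x = x" obtains c where "x = \<iota> c" "wv c \<le> 1"
proof -
  obtain t n where "cj x = \<iota> t - x" by (rule char_poly)
  then have "x + x = \<iota> t" using assms(2) by (simp add: eq_diff_eq)
  then have "\<iota> (1 + 1) * x = \<iota> t" unfolding \<iota>_two .
  then have "\<iota> (inverse (1 + 1)) * (\<iota> (1 + 1) * x) = \<iota> (inverse (1 + 1) * t)"
    by (simp only: \<iota>_simps(3))
  moreover have "\<iota> (inverse (1 + 1)) * \<iota> (1 + 1) = 1" using \<iota>_inverse[OF char_not_2] central by metis
  moreover define c where "c = inverse (1 + 1) * t"
  ultimately have x: "x = \<iota> c" by (simp only: mult.assoc[symmetric] mult_1)
  have "wv c \<le> 1"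
  proof (cases "c = 0")
    case False
    then show ?thesis using ord_\<iota>[OF False] ord_OK[OF assms(1)] x \<iota>_eq_0 by auto
  qed (simp add: wv_0)
  then show ?thesis using that x by blast
qed

lemma OK_small: assumes "wv c < 1" shows "\<exists>y\<in>OK. \<iota> c = \<iota> \<pi> * y"
proof -
  have "wv \<pi> > 0" using wv_nonneg[of \<pi>] wv_0_iff[of \<pi>] \<pi>(1) by linarith
  then have "wv (c / \<pi>) \<le> 1" using \<pi>(3)[OF assms] by (simp add: wv_divide divide_le_eq_1)
  moreover have "\<iota> c = \<iota> \<pi> * \<iota> (c / \<pi>)" using \<pi>(1) by (simp add: \<iota>_simps(3)[symmetric])
  ultimately show ?thesis using OK_\<iota> by blast
qed

lemma quad_solve:
  assumes "c \<in> OK" "d \<in> OK" "cj c = c" "cj d = d"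
  shows "\<exists>t\<in>OK. cj t = t \<and> t = c + P * P * d * t * t"
proof -
  obtain c' where c': "c = \<iota> c'" "wv c' \<le> 1" by (rule OK_fixed[OF assms(1,3)])
  obtain d' where d': "d = \<iota> d'" "wv d' \<le> 1" by (rule OK_fixed[OF assms(2,4)])
  obtain t where t: "wv t \<le> 1" "t = c' + \<pi> * d' * t * t"
    using quadratic_fixed_point[OF complete c'(2) wv_mult_less[OF \<pi>(2) d'(2)]] by blast
  have "\<iota> t = c + P * P * d * \<iota> t * \<iota> t"
    unfolding PP c' d' using t(2) by (metis \<iota>_simps(2,3))
  then show ?thesis using OK_\<iota>[OF t(1)] cj_\<iota> by blast
qed

section \<open>Residues of \<open>OK\<close> and surjectivity of the norm\<close>

definition \<pi>OK where "\<pi>OK = {\<iota> \<pi> * y | y. y \<in> OK}"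

lemma \<pi>OK_add: "x \<in> \<pi>OK \<Longrightarrow> y \<in> \<pi>OK \<Longrightarrow> x + y \<in> \<pi>OK"
  unfolding \<pi>OK_def using OK_add by (auto simp: distrib_left[symmetric])

lemma \<pi>OK_mult: assumes "x \<in> \<pi>OK" "y \<in> OK" shows "x * y \<in> \<pi>OK"
  using assms OK_mult by (auto simp: \<pi>OK_def mult.assoc)

lemma \<pi>OK_small: "wv c < 1 \<Longrightarrow> \<iota> c \<in> \<pi>OK"
  using OK_small by (auto simp: \<pi>OK_def)

lemma \<pi>OK_I: "y \<in> OK \<Longrightarrow> \<iota> \<pi> * y \<in> \<pi>OK"
  by (auto simp: \<pi>OK_def)

lemma unit_or_\<pi>OK: "x \<in> OK \<Longrightarrow> (\<exists>y\<in>OK. x * y = 1) \<or> x \<in> \<pi>OK"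
  using OK_cases by (auto simp: \<pi>OK_def)

lemma one_notin_\<pi>OK: "1 \<notin> \<pi>OK"
  using \<pi>_nonunit by (auto simp: \<pi>OK_def)

lemma unit_notin_\<pi>OK: "y \<in> OK \<Longrightarrow> x * y = 1 \<Longrightarrow> x \<notin> \<pi>OK"
  using \<pi>OK_mult one_notin_\<pi>OK by metis

lemma \<pi>OK_prime: assumes "x \<in> OK" "y \<in> OK" "x * y \<in> \<pi>OK" shows "x \<in> \<pi>OK \<or> y \<in> \<pi>OK"
proof (rule ccontr)
  assume "\<not> (x \<in> \<pi>OK \<or> y \<in> \<pi>OK)"
  then obtain x' y' where *: "x' \<in> OK" "x * x' = 1" "y' \<in> OK" "y * y' = 1" using unit_or_\<pi>OK assms by blast
  have "x * y * (y' * x') = 1" using * by (metis mult.assoc mult_1)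
  then show False using unit_notin_\<pi>OK[of "y' * x'"] * OK_mult assms by blast
qed

lemma wv_two: "wv (1 + 1) \<le> 1"
  using ultra[of 1 1] wv_1 by simp

text \<open>If \<open>cj\<close> is trivial modulo \<open>\<pi>\<close>, then \<open>OK\<close> has
  no residues beyond those of the base field. When 2 is a unit, \<open>x\<close> is half its trace
  modulo \<open>\<pi>\<close>; otherwise its norm is congruent to its square, and for a square root
  \<open>m\<close> of the norm from \<open>square_root_mod\<close> the square of
  \<open>x - \<iota> m\<close> is divisible by \<open>\<pi>\<close>.\<close>

lemma reduces_to_base:
  assumes triv: "\<And>x. x \<in> OK \<Longrightarrow> x - cj x \<in> \<pi>OK" and x: "x \<in> OK"
  obtains c y where "y \<in> OK" "x = \<iota> c + \<iota> \<pi> * y"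
proof (cases "wv (1 + 1) = 1")
  case True
  define i where "i = inverse (1 + 1 :: 'k)"
  have i: "wv i \<le> 1" "i * (1 + 1) = 1" using True char_not_2 by (simp_all only: i_def wv_inverse) (simp, metis left_inverse)
  obtain y where y: "y \<in> OK" "x - cj x = \<iota> \<pi> * y" using triv[OF x] by (auto simp: \<pi>OK_def)
  obtain t where t: "x + cj x = \<iota> t" using trace_norm(1)[of x] by blast
  have "x = \<iota> i * (x + x)" using i(2) by (metis \<iota>_simps(1,3) \<iota>_two mult.assoc mult_1)
  also have "x + x = \<iota> t + \<iota> \<pi> * y" unfolding t[symmetric] y(2)[symmetric] by simp
  also have "\<iota> i * \<dots> = \<iota> (i * t) + \<iota> \<pi> * (\<iota> i * y)"
    using central[of i "\<iota> \<pi>"] by (simp add: \<iota>_simps distrib_left mult.assoc[symmetric])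
  finally show ?thesis using that OK_mult[OF OK_\<iota>[OF i(1)] y(1)] by blast
next
  case False
  then have two: "wv (1 + 1) < 1" using wv_two by simp
  note cx = cj_OK[OF x]
  have "cj (x * cj x) = x * cj x" by (simp add: cj_mult cj_cj)
  then obtain n where n: "x * cj x = \<iota> n" "wv n \<le> 1" using OK_fixed[OF OK_mult[OF x cx]] by blast
  obtain T0 where "finite T0" "\<forall>x. wv x \<le> 1 \<longrightarrow> (\<exists>t\<in>T0. wv (x - t) < 1)" using residue_finite by blast
  then obtain m where m: "wv m \<le> 1" "wv (n - m * m) < 1" using square_root_mod[OF _ _ two n(2)] by blast
  note mK = OK_\<iota>[OF m(1)]
  have xm: "x - \<iota> m \<in> OK" by (rule OK_diff[OF x mK])
  have "(x - \<iota> m) * (x - \<iota> m) = (x - cj x) * x + \<iota> (n - m * m) + \<iota> (1 + 1) * (\<iota> m * (\<iota> m - x))"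
  proof -
    have "(x - cj x) * x = x * x - \<iota> n" using n(1) cj_comm[of x] by (simp add: left_diff_distrib)
    then show ?thesis unfolding \<iota>_two using central[of m x] by (simp add: \<iota>_diff \<iota>_simps algebra_simps)
  qed
  moreover have "(x - cj x) * x + \<iota> (n - m * m) + \<iota> (1 + 1) * (\<iota> m * (\<iota> m - x)) \<in> \<pi>OK"
    by (intro \<pi>OK_add \<pi>OK_mult triv x \<pi>OK_small m(2) two OK_mult mK OK_diff)
  ultimately have "x - \<iota> m \<in> \<pi>OK" using \<pi>OK_prime[OF xm xm] by simp
  then obtain y where "y \<in> OK" "x - \<iota> m = \<iota> \<pi> * y" by (auto simp: \<pi>OK_def)
  then show ?thesis using that[of y m] by (simp add: diff_eq_eq add.commute)
qed

text \<open>Unramifiedness enters here through \<open>unit_or_\<pi>OK\<close>. If no difference were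
  a unit, every \<open>x\<close> would be \<open>\<iota> c + \<iota> \<pi> * y\<close>, and passing
  to \<open>y\<close> divides \<open>x - cj x\<close> by \<open>\<pi>\<close>; infinite descent on
  the valuation would make \<open>cj\<close> trivial on \<open>OK\<close>.\<close>

lemma unit_difference: "\<exists>x\<in>OK. \<exists>y\<in>OK. (x - cj x) * y = 1"
proof (rule ccontr)
  assume no: "\<not> ?thesis"
  have triv: "x - cj x \<in> \<pi>OK" if "x \<in> OK" for x
    using unit_or_\<pi>OK[of "x - cj x"] no that OK_diff cj_OK by blast
  have fixed: "x = cj x" if "x \<in> OK" for x
    using that
  proof (induction "nat (ord (x - cj x))" arbitrary: x rule: less_induct)
    case less
    show ?case
    proof (rule ccontr)
      assume ne: "x \<noteq> cj x"
      obtain c y where y: "y \<in> OK" "x = \<iota> c + \<iota> \<pi> * y" by (rule reduces_to_base[OF triv less.prems])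
      have e: "x - cj x = \<iota> \<pi> * (y - cj y)"
        unfolding y(2) using central[of \<pi> "cj y"] by (simp add: cj_add cj_mult cj_\<iota> right_diff_distrib)
      have ne': "y - cj y \<noteq> 0" using e ne by auto
      have "ord (x - cj x) = ord (\<iota> \<pi>) + ord (y - cj y)"
        unfolding e using ord_mult[OF _ ne'] \<iota>_eq_0 \<pi>(1) by simp
      moreover have "ord (y - cj y) \<ge> 0" using ord_OK[OF _ ne'] OK_diff cj_OK y by simp
      ultimately have "nat (ord (y - cj y)) < nat (ord (x - cj x))" using ord_\<pi> by simp
      then have "y = cj y" using less.hyps y by simp
      then show False using ne' by simp
    qed
  qed
  obtain x where "x \<in> OK" "\<sigma> x \<noteq> x" using \<sigma>_nontrivial_OK by blast
  then show False using fixed \<sigma>_eq_cj OK_K by metis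
qed

text \<open>The equation is solved modulo \<open>\<pi>\<close> and then corrected. In residue
  characteristic 2 a square root does; otherwise the norm of
  \<open>\<iota> x + \<iota> y * \<delta>\<close> is the form treated by counting. The remaining
  factor \<open>1 + \<iota> \<pi> * e\<close> is a norm by Hensel's lemma.\<close>

lemma norm_surj:
  assumes \<delta>: "\<delta> \<in> OK" "cj \<delta> = - \<delta>" "\<delta>' \<in> OK" "\<delta> * \<delta>' = 1" and \<omega>: "\<omega> \<in> OK" "\<omega> + cj \<omega> = 1"
    and c: "c \<in> OK" "cj c = c" "c' \<in> OK" "c * c' = 1"
  shows "\<exists>a\<in>OK. a * cj a = c"
proof -
  obtain c0 where c0: "c = \<iota> c0" "wv c0 \<le> 1" by (rule OK_fixed[OF c(1,2)])
  obtain T0 where T0: "finite T0" "\<And>x. wv x \<le> 1 \<Longrightarrow> (\<exists>t\<in>T0. wv (x - t) < 1)" using residue_finite by blast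
  have "\<exists>a\<in>OK. a * cj a - c \<in> \<pi>OK"
  proof (cases "wv (1 + 1) = 1")
    case False
    then have two: "wv (1 + 1) < 1" using wv_two by simp
    obtain m where m: "wv m \<le> 1" "wv (c0 - m * m) < 1" using square_root_mod[OF T0 two c0(2)] by blast
    have "wv (m * m - c0) < 1" using m(2) wv_diff_commute by metis
    then have "\<iota> m * cj (\<iota> m) - c \<in> \<pi>OK"
      using \<pi>OK_small[of "m * m - c0"] by (simp add: c0 cj_\<iota> \<iota>_diff \<iota>_simps)
    then show ?thesis using OK_\<iota>[OF m(1)] by blast
  next
    case True
    have "cj (\<delta> * \<delta>) = \<delta> * \<delta>" by (simp add: cj_mult \<delta>)
    then obtain D where D: "\<delta> * \<delta> = \<iota> D" "wv D \<le> 1" using OK_fixed[OF OK_mult[OF \<delta>(1,1)]] by blast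
    have "\<not> wv D < 1"
    proof
      assume "wv D < 1"
      then have "\<delta> * \<delta> \<in> \<pi>OK" using \<pi>OK_small D by simp
      then have "\<delta> \<in> \<pi>OK" using \<pi>OK_prime \<delta> by blast
      then show False using unit_notin_\<pi>OK \<delta> by blast
    qed
    then have D1: "wv D = 1" using D by simp
    obtain x y where xy: "wv x \<le> 1" "wv y \<le> 1" "wv (x * x - D * (y * y) - c0) < 1"
      using represent_by_norm_form_mod[OF T0 True D1 c0(2)] by blast
    define a where "a = \<iota> x + \<iota> y * \<delta>"
    have cja: "cj a = \<iota> x - \<iota> y * \<delta>"
      using central[of y \<delta>] by (simp add: a_def cj_add cj_mult cj_\<iota> \<delta>)
    have comm: "\<iota> x * (\<iota> y * \<delta>) = \<iota> y * \<delta> * \<iota> x" using central by metis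
    have "\<iota> y * \<delta> * (\<iota> y * \<delta>) = \<iota> y * (\<iota> y * (\<delta> * \<delta>))" using central by (metis mult.assoc)
    also have "\<dots> = \<iota> (D * (y * y))" unfolding D by (simp add: \<iota>_simps(3)[symmetric] ac_simps)
    finally have "a * cj a = \<iota> (x * x - D * (y * y))"
      unfolding cja unfolding a_def using comm by (simp add: \<iota>_diff \<iota>_simps algebra_simps)
    then have "a * cj a - c \<in> \<pi>OK" using \<pi>OK_small[OF xy(3)] by (simp add: c0 \<iota>_diff)
    moreover have "a \<in> OK" unfolding a_def by (intro OK_add OK_mult OK_\<iota> xy \<delta>)
    ultimately show ?thesis by blast
  qed
  then obtain a where a: "a \<in> OK" "a * cj a - c \<in> \<pi>OK" by blast
  define n where "n = a * cj a"
  have nK: "n \<in> OK" unfolding n_def by (intro OK_mult a cj_OK)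
  have cjn: "cj n = n" by (simp add: n_def cj_mult cj_cj)
  have "n \<notin> \<pi>OK"
  proof
    assume n: "n \<in> \<pi>OK"
    obtain y where y: "y \<in> OK" "n - c = \<iota> \<pi> * y" using a(2) by (auto simp: \<pi>OK_def n_def)
    have "n + \<iota> \<pi> * (- y) = c" using y(2) by (simp add: diff_eq_eq)
    then have "c \<in> \<pi>OK" using \<pi>OK_add[OF n \<pi>OK_I[OF OK_minus[OF y(1)]]] by simp
    then show False using unit_notin_\<pi>OK c by blast
  qed
  then obtain n' where n': "n' \<in> OK" "n * n' = 1" using unit_or_\<pi>OK nK by blast
  have n'n: "n' * n = 1" using OK_commute n' nK by metis
  have cjn': "cj n' = n'"
  proof -
    have "cj n' * n = 1" using n'n cjn by (metis cj_mult cj_1 cj_comm n'(2))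
    then show ?thesis using n'(2) by (metis mult.assoc mult_1 mult_1_right)
  qed
  obtain y where y: "y \<in> OK" "n - c = \<iota> \<pi> * y" using a(2) by (auto simp: \<pi>OK_def n_def)
  define e where "e = - (y * n')"
  have eK: "e \<in> OK" unfolding e_def by (intro OK_minus OK_mult y n')
  have cn: "c * n' = 1 + \<iota> \<pi> * e"
  proof -
    have "c = n - \<iota> \<pi> * y" using y(2) by (simp add: algebra_simps)
    then show ?thesis using n'(2) by (simp add: e_def left_diff_distrib mult.assoc)
  qed
  have cje: "cj e = e"
  proof -
    have "cj (c * n') = c * n'" using c(2) cjn' OK_commute[OF c(1) n'(1)] by (simp add: cj_mult)
    then have "\<iota> \<pi> * (cj e - e) = 0" unfolding cn using central[of \<pi> "cj e"]
      by (simp add: cj_add cj_1 cj_mult cj_\<iota> right_diff_distrib)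
    then show ?thesis using \<iota>_cancel \<pi>(1) by force
  qed
  define \<nu> where "\<nu> = \<omega> * cj \<omega>"
  have \<nu>: "\<nu> \<in> OK" "cj \<nu> = \<nu>" unfolding \<nu>_def using OK_mult \<omega> cj_OK by (auto simp: cj_mult cj_cj)
  obtain t where t: "t \<in> OK" "cj t = t" "t = e + P * P * (- \<nu>) * t * t"
    using quad_solve[OF eK OK_minus[OF \<nu>(1)] cje] \<nu>(2) cj_minus by auto
  have tc: "t * x = x * t" for x using OK_fixed[OF t(1,2)] central by metis
  \<comment> \<open>As \<open>\<omega>\<close> has trace 1 and norm \<open>\<nu>\<close>, the norm
    of \<open>b\<close> is 1 plus \<open>\<iota> \<pi>\<close> times
    \<open>t + P * P * \<nu> * t * t\<close>, and \<open>t\<close> was chosen to make the latter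
    \<open>e\<close>.\<close>
  define b where "b = 1 + \<iota> \<pi> * (\<omega> * t)"
  have "\<iota> \<pi> \<in> OK" using OK_\<iota>[of \<pi>] \<pi>(2) by simp
  then have bK: "b \<in> OK" unfolding b_def by (rule OK_add[OF OK_1 OK_mult[OF _ OK_mult[OF \<omega>(1) t(1)]]])
  have "cj b = 1 + \<iota> \<pi> * (cj \<omega> * t)"
    unfolding b_def using central[of \<pi> "t * cj \<omega>"] tc[of "cj \<omega>"] by (simp add: cj_add cj_1 cj_mult cj_\<iota> t(2))
  then have "b * cj b = 1 + \<iota> \<pi> * ((\<omega> + cj \<omega>) * t) + \<iota> \<pi> * (\<omega> * t) * (\<iota> \<pi> * (cj \<omega> * t))"
    by (simp add: b_def algebra_simps)
  also have "\<iota> \<pi> * (\<omega> * t) * (\<iota> \<pi> * (cj \<omega> * t)) = \<iota> \<pi> * (P * P * \<nu> * t * t)"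
    unfolding PP \<nu>_def using central tc by (metis mult.assoc)
  also have "1 + \<iota> \<pi> * ((\<omega> + cj \<omega>) * t) + \<iota> \<pi> * (P * P * \<nu> * t * t) = 1 + \<iota> \<pi> * (t + P * P * \<nu> * t * t)"
    using \<omega>(2) by (simp add: distrib_left)
  also have "t + P * P * \<nu> * t * t = e" using t(3) by (simp add: algebra_simps)
  finally have bb: "b * cj b = c * n'" using cn by simp
  have "a * b * cj (a * b) = a * (b * cj b) * cj a" by (simp add: cj_mult mult.assoc)
  also have "\<dots> = n * (c * n')"
    unfolding bb n_def using OK_commute[OF OK_mult[OF c(1) n'(1)] cj_OK[OF a(1)]] by (simp add: mult.assoc)
  also have "\<dots> = c" using n'n OK_commute[OF nK OK_mult[OF c(1) n'(1)]] by (simp add: mult.assoc)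
  finally show ?thesis using OK_mult[OF a(1) bK] by blast
qed

text \<open>\<open>\<delta>\<close> is the difference \<open>x - cj x\<close> of
  \<open>unit_difference\<close> and \<open>\<omega>\<close> is \<open>x\<close> divided by
  \<open>\<delta>\<close>. Since \<open>cj\<close> changes the sign of \<open>\<delta>\<close>, the
  trace of \<open>\<omega>\<close> is \<open>x - cj x\<close> divided by \<open>\<delta>\<close>,
  that is, 1.\<close>

lemma quat_order_exists: "\<exists>\<delta> \<omega>. quat_order OK cj P \<delta> \<omega>"
proof -
  obtain x \<delta>' where x: "x \<in> OK" "\<delta>' \<in> OK" "(x - cj x) * \<delta>' = 1" using unit_difference by blast
  define \<delta> where "\<delta> = x - cj x"
  have \<delta>: "\<delta> \<in> OK" "cj \<delta> = - \<delta>" using x cj_OK OK_diff by (auto simp: \<delta>_def cj_diff cj_cj)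
  have d1: "\<delta> * \<delta>' = 1" using x by (simp add: \<delta>_def)
  have d2: "\<delta>' * \<delta> = 1" using d1 OK_commute \<delta> x by metis
  have cjd: "cj \<delta>' = - \<delta>'"
  proof -
    have "\<delta> * cj \<delta>' = - 1" using d2 \<delta>(2) cj_1 by (metis cj_mult minus_minus mult_minus_left)
    then have "\<delta>' * (\<delta> * cj \<delta>') = - \<delta>'" by simp
    then show ?thesis using d2 by (simp add: mult.assoc[symmetric])
  qed
  define \<omega> where "\<omega> = x * \<delta>'"
  have \<omega>: "\<omega> \<in> OK" unfolding \<omega>_def by (intro OK_mult x)
  have "\<omega> + cj \<omega> = x * \<delta>' - \<delta>' * cj x" by (simp add: \<omega>_def cj_mult cjd)
  also have "\<dots> = 1" using x(3) OK_commute[OF x(2) cj_OK[OF x(1)]] by (simp add: left_diff_distrib)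
  finally have \<omega>2: "\<omega> + cj \<omega> = 1" .
  have "quat_order OK cj P \<delta> \<omega>"
  proof
    show "\<exists>y\<in>OK. \<delta> * y = 1" using d1 x by blast
    show "P * P \<in> OK" unfolding PP using OK_\<iota> \<pi>(2) by simp
    show "(\<exists>z\<in>OK. y * z = 1) \<or> (\<exists>z\<in>OK. y = P * P * z)" if "y \<in> OK" for y
      unfolding PP using OK_cases[OF that] .
    show "P * P * y \<noteq> 1" if "y \<in> OK" for y unfolding PP using \<pi>_nonunit[OF that] .
    show "y = 0" if "P * P * y = 0" for y using \<iota>_cancel[OF \<pi>(1)] that PP by simp
    show "\<exists>a\<in>OK. a * cj a = c" if "c \<in> OK" "cj c = c" "\<exists>y\<in>OK. c * y = 1" for c
      using norm_surj[OF \<delta> x(2) d1 \<omega> \<omega>2 that(1,2)] that(3) by blast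
  qed (rule OK_1 OK_add OK_minus OK_mult OK_commute cj_add cj_mult cj_cj cj_OK cj_P P_C two_cancel
      \<delta> \<omega> \<omega>2 quad_solve OK_indep; assumption)+
  then show ?thesis by blast
qed

section \<open>The normalized valuation on \<open>Ov\<close>\<close>

lemma ord_P_pos: "ord P > 0" and P_nz: "P \<noteq> 0"
proof -
  show "P \<noteq> 0" using P_notin_K K_\<iota>[of 0] \<iota>_0 by auto
  then show "ord P > 0" using ord_mult[of P P] PP ord_\<pi> by simp
qed

lemma ord_Ov: assumes "x \<in> Ov" "x \<noteq> 0" shows "ord x \<ge> 0"
proof -
  obtain a b where ab: "a \<in> OK" "b \<in> OK" "x = a + b * P" using assms(1) unfolding Ov_eq by blast
  have a: "a = 0 \<or> ord a \<ge> 0" using ord_OK ab by blast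
  have bP: "b * P = 0 \<or> ord (b * P) \<ge> 0"
    using ord_OK[OF ab(2)] ord_mult[of b P] P_nz ord_P_pos by (cases "b = 0") auto
  show ?thesis using a bP ord_add[of a "b * P"] assms(2) ab(3) by (cases "a = 0"; cases "b * P = 0") auto
qed

lemma Ov_OK: "x \<in> OK \<Longrightarrow> x \<in> Ov"
  using OK_eq by blast

lemma P_Ov: "P \<in> Ov"
  using pres by (simp add: local_presentation_def)

lemma cj_Ov: assumes "x \<in> Ov" shows "cj x \<in> Ov"
proof -
  obtain a b where ab: "a \<in> OK" "b \<in> OK" "x = a + b * P" using assms(1) unfolding Ov_eq by blast
  have "cj x = cj a + - (P * cj b)" by (simp add: ab cj_add cj_mult cj_P)
  also have "\<dots> = cj a - b * P" using P_C[OF cj_OK[OF ab(2)]] by (simp add: cj_cj)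
  finally show ?thesis using Ov_ring Ov_OK cj_OK ab P_Ov by auto
qed

text \<open>If the component \<open>a\<close> is divisible by \<open>\<pi>\<close>, a factor
  \<open>P\<close> can be pulled out. If not, the reduced norm is congruent to
  \<open>a * cj a\<close> modulo \<open>\<pi>\<close>, hence a unit, and the conjugate divided by
  the norm is the inverse.\<close>

lemma Ov_unit_or_P:
  assumes "x \<in> Ov" shows "(\<exists>y\<in>Ov. x * y = 1 \<and> y * x = 1) \<or> (\<exists>y\<in>Ov. x = y * P)"
proof -
  obtain a b where ab: "a \<in> OK" "b \<in> OK" "x = a + b * P" using assms(1) unfolding Ov_eq by blast
  show ?thesis
  proof (cases "a \<in> \<pi>OK")
    case True
    then obtain y where y: "y \<in> OK" "a = \<iota> \<pi> * y" by (auto simp: \<pi>OK_def)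
    have "x = (y * P + b) * P" using ab(3) y(2) central[of \<pi> y] PP by (simp add: distrib_right mult.assoc)
    moreover have "y * P + b \<in> Ov" by (intro Ov_ring(2,4) Ov_OK y(1) ab(2) P_Ov)
    ultimately show ?thesis by blast
  next
    case False
    obtain n where n: "x * cj x = \<iota> n" using trace_norm(2)[of x] by blast
    have "cj x = cj a + - (P * cj b)" by (simp add: ab cj_add cj_mult cj_P)
    also have "\<dots> = cj a - b * P" using P_C[OF cj_OK[OF ab(2)]] by (simp add: cj_cj)
    finally have cjx: "cj x = cj a - b * P" .
    have "b * P * cj a = a * b * P" using P_C[OF cj_OK[OF ab(1)]] OK_commute[OF ab(1,2)] by (simp add: cj_cj mult.assoc)
    moreover have "b * P * (b * P) = \<iota> \<pi> * (b * cj b)"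
      using P_C[OF ab(2)] PP central[of \<pi> "b * cj b"] by (metis mult.assoc)
    ultimately have N: "\<iota> n = a * cj a + \<iota> \<pi> * (- (b * cj b))"
      unfolding n[symmetric] cjx unfolding ab(3) by (simp add: algebra_simps)
    have "\<iota> n \<in> OK" unfolding N by (intro OK_add OK_mult OK_minus OK_\<iota> ab cj_OK) (use \<pi>(2) in simp)
    moreover have "\<iota> n \<notin> \<pi>OK"
    proof
      assume "\<iota> n \<in> \<pi>OK"
      then have "\<iota> n + \<iota> \<pi> * (b * cj b) \<in> \<pi>OK" using \<pi>OK_add \<pi>OK_I OK_mult ab cj_OK by blast
      then have "a * cj a \<in> \<pi>OK" using N by simp
      then have "cj a \<in> \<pi>OK" using \<pi>OK_prime[OF ab(1) cj_OK[OF ab(1)]] False by blast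
      then obtain y where y: "y \<in> OK" "cj a = \<iota> \<pi> * y" by (auto simp: \<pi>OK_def)
      have "a = \<iota> \<pi> * cj y" using cj_cj[of a] y(2) central[of \<pi> "cj y"] by (simp add: cj_mult cj_\<iota>)
      then show False using False \<pi>OK_I[OF cj_OK[OF y(1)]] by simp
    qed
    ultimately obtain w where w: "w \<in> OK" "\<iota> n * w = 1" using unit_or_\<pi>OK by blast
    have "x * (cj x * w) = 1" using n w by (simp add: mult.assoc[symmetric])
    moreover have "cj x * w * x = 1"
    proof -
      have "n \<noteq> 0" using w(2) \<iota>_0 by auto
      have "w = \<iota> (inverse n)" using w(2) \<iota>_inverse[OF \<open>n \<noteq> 0\<close>] central by (metis mult.assoc mult_1 mult_1_right)
      then show ?thesis using n cj_comm[of x] central \<iota>_inverse[OF \<open>n \<noteq> 0\<close>] by (metis mult.assoc)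
    qed
    ultimately show ?thesis using Ov_ring(4)[OF cj_Ov[OF assms] Ov_OK[OF w(1)]] by blast
  qed
qed

lemma Ov_unit_ord: assumes "x \<in> Ov" "y \<in> Ov" "x * y = 1" shows "ord x = 0"
proof -
  have "x \<noteq> 0" "y \<noteq> 0" using assms(3) by auto
  then show ?thesis using ord_mult[of x y] ord_Ov[OF assms(1)] ord_Ov[OF assms(2)] assms(3) ord_1 by simp
qed

text \<open>Dividing by \<open>P\<close> lowers \<open>ord\<close>, which is nonnegative on
  \<open>Ov\<close>, so the process ends at a unit.\<close>

lemma Ov_factor:
  assumes "x \<in> Ov" "x \<noteq> 0"
  shows "\<exists>u u' k. u \<in> Ov \<and> u' \<in> Ov \<and> u * u' = 1 \<and> u' * u = 1 \<and> x = u * P ^ k \<and> ord x = int k * ord P"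
  using assms
proof (induction "nat (ord x)" arbitrary: x rule: less_induct)
  case less
  show ?case
  proof (cases "\<exists>y\<in>Ov. x * y = 1 \<and> y * x = 1")
    case True
    then obtain y where "y \<in> Ov" "x * y = 1" "y * x = 1" by blast
    then show ?thesis using less.prems Ov_unit_ord
      by (intro exI[of _ x] exI[of _ y] exI[of _ 0]) simp
  next
    case False
    then obtain y where y: "y \<in> Ov" "x = y * P" using Ov_unit_or_P less.prems by blast
    have yz: "y \<noteq> 0" using y less.prems by auto
    have o: "ord x = ord y + ord P" unfolding y(2) by (rule ord_mult[OF yz P_nz])
    then have "nat (ord y) < nat (ord x)" using ord_P_pos ord_Ov[OF y(1) yz] by simp
    then obtain u u' k where *: "u \<in> Ov" "u' \<in> Ov" "u * u' = 1" "u' * u = 1" "y = u * P ^ k" "ord y = int k * ord P"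
      using less.hyps y yz by blast
    have "x = u * P ^ Suc k" unfolding y(2) *(5) by (simp add: mult.assoc power_commutes)
    moreover have "ord x = int (Suc k) * ord P" unfolding o *(6) by (simp add: distrib_right)
    ultimately show ?thesis using * by blast
  qed
qed

text \<open>By \<open>Ov_factor\<close> the value \<open>ord P\<close> divides all valuations on
  \<open>Ov\<close>, hence those of scalars, hence all valuations, since scalars bring every element
  into \<open>Ov\<close>. But \<open>ord\<close> takes the value 1.\<close>

lemma ord_P: "ord P = 1"
proof -
  have Ov_dvd: "ord P dvd ord x" if x: "x \<in> Ov" "x \<noteq> 0" for x
  proof -
    obtain k where "ord x = int k * ord P" using Ov_factor[OF x] by blast
    then show ?thesis by simp
  qed
  have \<iota>dvd: "ord P dvd ord (\<iota> c)" if c: "c \<noteq> 0" for c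
  proof (cases "wv c \<le> 1")
    case True
    then show ?thesis using Ov_dvd[OF Ov_OK[OF OK_\<iota>]] c \<iota>_eq_0 by simp
  next
    case False
    then have "wv (inverse c) \<le> 1" by (simp add: wv_inverse inverse_le_1_iff)
    then have "ord P dvd ord (\<iota> (inverse c))"
      using Ov_dvd[OF Ov_OK[OF OK_\<iota>]] c \<iota>_eq_0 by simp
    moreover have "ord (\<iota> c) = - ord (\<iota> (inverse c))"
      using ord_mult[of "\<iota> c" "\<iota> (inverse c)"] \<iota>_inverse[OF c] ord_1 c \<iota>_eq_0 by simp
    ultimately show ?thesis by simp
  qed
  have "1 \<in> ord ` {x. x \<noteq> 0}" using ord_surj by simp
  then obtain y where y: "y \<noteq> 0" "ord y = 1" by force
  obtain c where c: "c \<noteq> 0" "\<iota> c * y \<in> Ov" using Ov_span by blast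
  have nz: "\<iota> c * y \<noteq> 0" using \<iota>_cancel c y by blast
  have "ord P dvd ord (\<iota> c * y)" by (rule Ov_dvd[OF c(2) nz])
  moreover have "ord (\<iota> c * y) = ord (\<iota> c) + 1" using ord_mult[of "\<iota> c" y] c y \<iota>_eq_0 by simp
  ultimately have "ord P dvd 1" using \<iota>dvd[OF c(1)] by (metis dvd_add_right_iff)
  then show ?thesis using ord_P_pos by simp
qed

text \<open>For a scalar \<open>c\<close> bringing \<open>y\<close> into \<open>Ov\<close>, both
  \<open>\<iota> c\<close> and \<open>\<iota> c * y\<close> are units times the same power of
  \<open>P\<close>, so \<open>y\<close> is a quotient of two units.\<close>

lemma unit_of_ord_0:
  assumes y: "y \<noteq> 0" "ord y = 0"
  shows "\<exists>y'\<in>Ov. y \<in> Ov \<and> y * y' = 1 \<and> y' * y = 1"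
proof -
  obtain c where c: "c \<noteq> 0" "\<iota> c * y \<in> Ov" using Ov_span by blast
  have nz: "\<iota> c * y \<noteq> 0" using \<iota>_cancel c y by blast
  obtain u u' k where k: "u \<in> Ov" "u' \<in> Ov" "u * u' = 1" "u' * u = 1" "\<iota> c * y = u * P ^ k" "ord (\<iota> c * y) = int k"
    using Ov_factor[OF c(2) nz] ord_P by auto
  have oc: "ord (\<iota> c) = int k" using ord_mult[of "\<iota> c" y] k(6) c y \<iota>_eq_0 by simp
  then have "wv c \<le> 1" using ord_\<iota>[OF c(1)] by simp
  moreover have "\<iota> c \<noteq> 0" using c \<iota>_eq_0 by simp
  ultimately obtain v v' l where l: "v \<in> Ov" "v' \<in> Ov" "v * v' = 1" "v' * v = 1" "\<iota> c = v * P ^ l"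
      "ord (\<iota> c) = int l * ord P"
    using Ov_factor[OF Ov_OK[OF OK_\<iota>]] by blast
  have "l = k" using oc l(6) ord_P by simp
  then have "P ^ k = v' * \<iota> c" using l(4,5) by (simp add: mult.assoc[symmetric])
  then have "\<iota> c * y = \<iota> c * (u * v')" using k(5) central by (metis mult.assoc)
  then have "\<iota> c * (y - u * v') = 0" by (simp add: right_diff_distrib)
  then have yuv: "y = u * v'" using \<iota>_cancel[OF c(1)] by force
  have "y * (v * u') = 1" "v * u' * y = 1" unfolding yuv using k l by (metis mult.assoc mult_1)+
  then show ?thesis using yuv Ov_ring(4) k l by blast
qed

text \<open>The quotient of a nonzero \<open>x\<close> by \<open>P ^ n\<close> has valuation
  \<open>ord x - n\<close>, which cannot stay nonnegative.\<close>

lemma Ov_separated: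
  assumes "\<And>n. \<exists>y\<in>Ov. x = y * P ^ n" shows "x = 0"
proof (rule ccontr)
  assume x: "x \<noteq> 0"
  have Pn: "P ^ n \<noteq> 0 \<and> ord (P ^ n) = int n" for n
  proof (induction n)
    case (Suc n)
    have "P * P ^ n \<noteq> 0"
    proof
      assume "P * P ^ n = 0"
      then have "P * \<iota> (inverse \<pi>) * P * P ^ n = 0" by (metis mult.assoc mult_zero_right)
      then show False using P_inverse(2) Suc by simp
    qed
    then show ?case using ord_mult[of P "P ^ n"] P_nz Suc ord_P by simp
  qed (simp add: ord_1)
  obtain y where y: "y \<in> Ov" "x = y * P ^ nat (ord x + 1)" using assms by blast
  have yz: "y \<noteq> 0" using y x by auto
  have "ord x = ord y + int (nat (ord x + 1))" using ord_mult[OF yz] Pn y(2) by metis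
  moreover have "int (nat (ord x + 1)) \<ge> ord x + 1" by simp
  ultimately show False using ord_Ov[OF y(1) yz] by linarith
qed

end

section \<open>Bilattices over the local order\<close>

locale local_gamma = local_quaternion \<iota> wv cj ord Ov K \<sigma> \<pi> P
  for \<iota> :: "'k::field \<Rightarrow> 'a::ring_1" and wv cj ord Ov K \<sigma> \<pi> P +
  fixes \<gamma> \<gamma>' :: 'a and starv :: "'a \<Rightarrow> 'a" and \<delta> \<omega> :: 'a
  assumes \<gamma>: "\<gamma> * \<gamma>' = 1" "\<gamma>' * \<gamma> = 1" "cj \<gamma> = - \<gamma>"
    and starv: "starv \<alpha> = \<gamma> * cj \<alpha> * \<gamma>'"
    and quat: "quat_order OK cj P \<delta> \<omega>"
begin

sublocale Q: quat_order OK cj P \<delta> \<omega>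
  by (rule quat)

lemma R_eq: "Q.R = Ov"
  by (auto simp: Q.R_def Ov_eq)

definition od :: bool where "od \<longleftrightarrow> odd (ord \<gamma>)"

definition twist :: "'a \<Rightarrow> 'a" where "twist a = (if od then a else cj a)"

definition twist_P :: 'a where "twist_P = (if od then - P else P)"

lemma ord_\<pi>_eq: "ord (\<iota> \<pi>) = 2"
  using ord_mult[of P P] PP P_nz ord_P by simp

lemma ord_\<iota>_even: "\<exists>e. e \<noteq> 0 \<and> ord (\<iota> e) = 2 * k"
proof -
  have pw: "\<pi> ^ n \<noteq> 0 \<and> ord (\<iota> (\<pi> ^ n)) = 2 * int n" for n
  proof (induction n)
    case (Suc n)
    then show ?case using ord_mult[of "\<iota> \<pi>" "\<iota> (\<pi> ^ n)"] \<pi>(1) \<iota>_eq_0 ord_\<pi>_eq by (simp add: \<iota>_simps)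
  qed (simp add: \<iota>_simps ord_1)
  show ?thesis
  proof (cases "k \<ge> 0")
    case True
    then show ?thesis using pw[of "nat k"] by (intro exI[of _ "\<pi> ^ nat k"]) simp
  next
    case False
    define c where "c = \<pi> ^ nat (- k)"
    have c: "c \<noteq> 0" "ord (\<iota> c) = - 2 * k" using pw[of "nat (- k)"] False by (auto simp: c_def)
    have "ord (\<iota> c) + ord (\<iota> (inverse c)) = 0"
      using ord_mult[of "\<iota> c" "\<iota> (inverse c)"] \<iota>_inverse[OF c(1)] ord_1 c(1) \<iota>_eq_0 by simp
    then show ?thesis using c by (intro exI[of _ "inverse c"]) simp
  qed
qed

text \<open>Up to a central factor \<open>\<beta>\<close> is \<open>\<gamma> \<gamma>\<^sub>0\<close> with \<open>\<gamma>\<^sub>0 = P\<close> or \<open>\<gamma>\<^sub>0 = \<delta>\<close>; replacing a pairing \<open>h\<close> by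
  \<open>h x (\<beta> y)\<close> replaces \<open>\<gamma>\<close> by \<open>\<gamma>\<^sub>0\<close>.\<close>

lemma normalizer_exists:
  "\<exists>\<beta> \<beta>'. \<beta> \<in> Ov \<and> \<beta>' \<in> Ov \<and> \<beta> * \<beta>' = 1 \<and> \<beta>' * \<beta> = 1 \<and> starv \<beta> = \<beta> \<and>
     (\<forall>a\<in>OK. starv a * \<beta> = \<beta> * twist a) \<and> starv P * \<beta> = \<beta> * twist_P"
proof -
  obtain \<delta>' where \<delta>': "\<delta>' \<in> OK" "\<delta> * \<delta>' = 1" using Q.\<delta>(3) by blast
  have \<delta>'\<delta>: "\<delta>' * \<delta> = 1" using \<delta>' OK_commute Q.\<delta>(1) by metis
  have \<delta>nz: "\<delta> \<noteq> 0" using \<delta>' by auto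
  have ord\<delta>: "ord \<delta> = 0" using Ov_unit_ord[OF Ov_OK[OF Q.\<delta>(1)] Ov_OK[OF \<delta>'(1)] \<delta>'(2)] .
  have \<gamma>nz: "\<gamma> \<noteq> 0" using \<gamma>(1) by auto
  define g0 where "g0 = (if od then P else \<delta>)"
  have g0: "g0 \<noteq> 0" "cj g0 = - g0" using P_nz cj_P \<delta>nz Q.\<delta>(2) by (auto simp: g0_def)
  have cancel: "\<gamma> * x \<noteq> 0" if "x \<noteq> 0" for x
    using that \<gamma>(2) by (metis mult.assoc mult_1 mult_zero_right)
  \<comment> \<open>\<open>ord g0\<close> is 1 or 0 according to \<open>od\<close>, so
    \<open>ord \<gamma> + ord g0\<close> is even, and a scalar of valuation \<open>2 * k\<close>
    makes \<open>\<beta>\<close> a unit.\<close>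
  define k where "k = (if od then - (ord \<gamma> + 1) div 2 else - (ord \<gamma> div 2))"
  obtain e where e: "e \<noteq> 0" "ord (\<iota> e) = 2 * k" using ord_\<iota>_even by blast
  define \<beta> where "\<beta> = \<gamma> * (g0 * \<iota> e)"
  have ge: "g0 * \<iota> e \<noteq> 0" using \<iota>_cancel[OF e(1), of g0] g0(1) central by metis
  have \<beta>nz: "\<beta> \<noteq> 0" unfolding \<beta>_def by (rule cancel[OF ge])
  have "ord \<beta> = ord \<gamma> + (ord g0 + ord (\<iota> e))"
    unfolding \<beta>_def using ord_mult[OF \<gamma>nz ge] ord_mult[of g0 "\<iota> e"] g0(1) e(1) \<iota>_eq_0 by simp
  also have "\<dots> = 0"
  proof (cases od)
    case True
    then obtain m where "ord \<gamma> = 2 * m + 1" unfolding od_def by (elim oddE)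
    then show ?thesis using True ord_P e(2) by (simp add: g0_def k_def)
  next
    case False
    then obtain m where "ord \<gamma> = 2 * m" unfolding od_def by (auto elim: evenE)
    then show ?thesis using False ord\<delta> e(2) by (simp add: g0_def k_def)
  qed
  finally obtain \<beta>' where \<beta>': "\<beta>' \<in> Ov" "\<beta> \<in> Ov" "\<beta> * \<beta>' = 1" "\<beta>' * \<beta> = 1"
    using unit_of_ord_0[OF \<beta>nz] by blast
  have star_\<beta>: "starv a * \<beta> = \<gamma> * (cj a * g0) * \<iota> e" for a
  proof -
    have "starv a * \<beta> = \<gamma> * cj a * (\<gamma>' * \<gamma>) * (g0 * \<iota> e)" by (simp only: starv \<beta>_def mult.assoc)
    then show ?thesis by (simp add: \<gamma>(2) mult.assoc)
  qed
  have \<beta>_r: "\<beta> * a = \<gamma> * (g0 * a) * \<iota> e" for a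
    unfolding \<beta>_def using central[of e a] by (simp add: mult.assoc)
  have "starv \<beta> = \<gamma> * (\<iota> e * g0) * (\<gamma> * \<gamma>')"
    by (simp add: starv \<beta>_def cj_mult cj_\<iota> g0 \<gamma>(3) mult.assoc)
  then have "starv \<beta> = \<beta>" using \<gamma>(1) central[of e g0] by (simp add: \<beta>_def)
  moreover have "starv a * \<beta> = \<beta> * twist a" if a: "a \<in> OK" for a
  proof -
    \<comment> \<open>\<open>star_\<beta>\<close> and \<open>\<beta>_r\<close> reduce the claim to
      \<open>g0\<close>: conjugation by \<open>P\<close> is \<open>cj\<close> on \<open>OK\<close>,
      while \<open>\<delta>\<close> commutes with \<open>OK\<close>.\<close>
    have "cj a * g0 = g0 * twist a"
      using P_C[OF a] OK_commute[OF cj_OK[OF a] Q.\<delta>(1)] by (simp add: g0_def twist_def)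
    then show ?thesis unfolding star_\<beta> \<beta>_r by simp
  qed
  moreover have "starv P * \<beta> = \<beta> * twist_P"
  proof -
    have "cj P * g0 = g0 * twist_P"
      using P_C[OF Q.\<delta>(1)] by (simp add: g0_def twist_P_def cj_P Q.\<delta>(2))
    then show ?thesis unfolding star_\<beta> \<beta>_r by simp
  qed
  ultimately show ?thesis using \<beta>' by blast
qed

definition normalizer where "normalizer = (SOME b. \<exists>b'. b \<in> Ov \<and> b' \<in> Ov \<and> b * b' = 1 \<and> b' * b = 1 \<and>
  starv b = b \<and> (\<forall>a\<in>OK. starv a * b = b * twist a) \<and> starv P * b = b * twist_P)"

abbreviation \<beta> where "\<beta> \<equiv> normalizer"

lemma normalizer: "\<exists>\<beta>'. \<beta> \<in> Ov \<and> \<beta>' \<in> Ov \<and> \<beta> * \<beta>' = 1 \<and> \<beta>' * \<beta> = 1 \<and>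
  starv \<beta> = \<beta> \<and> (\<forall>a\<in>OK. starv a * \<beta> = \<beta> * twist a) \<and> starv P * \<beta> = \<beta> * twist_P"
  unfolding normalizer_def by (rule someI_ex) (rule normalizer_exists)

definition \<beta>' where "\<beta>' = (SOME b. b \<in> Ov \<and> \<beta> * b = 1 \<and> b * \<beta> = 1)"

lemma \<beta>': "\<beta>' \<in> Ov" "\<beta> * \<beta>' = 1" "\<beta>' * \<beta> = 1"
proof -
  have "\<beta>' \<in> Ov \<and> \<beta> * \<beta>' = 1 \<and> \<beta>' * \<beta> = 1"
    unfolding \<beta>'_def by (rule someI_ex) (use normalizer in blast)
  then show "\<beta>' \<in> Ov" "\<beta> * \<beta>' = 1" "\<beta>' * \<beta> = 1" by auto
qed

lemma \<beta>: "\<beta> \<in> Ov" "starv \<beta> = \<beta>" "a \<in> OK \<Longrightarrow> starv a * \<beta> = \<beta> * twist a" "starv P * \<beta> = \<beta> * twist_P"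
  using normalizer by auto

lemma starv_mult: "starv (x * y) = starv y * starv x"
proof -
  have "starv y * starv x = \<gamma> * cj y * (\<gamma>' * \<gamma>) * cj x * \<gamma>'" by (simp only: starv mult.assoc)
  then show ?thesis by (simp add: starv cj_mult \<gamma>(2) mult.assoc)
qed

lemma starv_add: "starv (x + y) = starv x + starv y"
  by (simp add: starv cj_add distrib_left distrib_right)

lemma starv_conj: "starv x * \<beta> = \<beta> * y \<Longrightarrow> starv x = \<beta> * y * \<beta>'"
  using \<beta>'(2) by (metis mult.assoc mult_1_right)

lemma twist_OK: "a \<in> OK \<Longrightarrow> twist a \<in> OK" and twist_P_Ov: "twist_P \<in> Ov"
  using cj_OK P_Ov Ov_ring(3)[of 0 P] Ov_OK[OF OK_0] by (auto simp: twist_def twist_P_def)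

lemma starv_Ov: assumes "x \<in> Ov" shows "starv x \<in> Ov"
proof -
  have C: "starv a \<in> Ov" if "a \<in> OK" for a
    unfolding starv_conj[OF \<beta>(3)[OF that]] by (intro Ov_ring(4) \<beta>(1) \<beta>'(1) Ov_OK twist_OK that)
  have "starv P \<in> Ov"
    unfolding starv_conj[OF \<beta>(4)] by (intro Ov_ring(4) \<beta>(1) \<beta>'(1) twist_P_Ov)
  moreover obtain a b where "a \<in> OK" "b \<in> OK" "x = a + b * P" using assms unfolding Ov_eq by blast
  ultimately show ?thesis using C Ov_ring(2,4) by (simp add: starv_add starv_mult)
qed

end

locale local_lattice = local_gamma \<iota> wv cj ord Ov K \<sigma> \<pi> P \<gamma> \<gamma>' starv \<delta> \<omega>
  for \<iota> :: "'k::field \<Rightarrow> 'a::ring_1" and wv cj ord Ov K \<sigma> \<pi> P \<gamma> \<gamma>' starv \<delta> \<omega> +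
  fixes L :: "('a, 'l::ab_group_add) bimodule" and r1 r2 t1 t2 :: nat
  assumes bil: "bilattice \<iota> (valuation_ring wv) Ov L"
    and inv: "has_structural_invariant \<iota> wv Ov K \<sigma> \<pi> P L (r1, r2, t1, t2)"
begin

abbreviation OF where "OF \<equiv> valuation_ring wv"

lemma OF_iff: "c \<in> OF \<longleftrightarrow> wv c \<le> 1"
  by (simp add: valuation_ring_def)

lemma bil_act: "c \<in> OF \<Longrightarrow> x \<in> bcarrier L \<Longrightarrow> lact L (\<iota> c) x = ract L x (\<iota> c)"
  and bil_torsion: "c \<in> OF \<Longrightarrow> x \<in> bcarrier L \<Longrightarrow> lact L (\<iota> c) x = 0 \<Longrightarrow> c = 0 \<or> x = 0"
  and bil_bim: "is_bimodule Ov L"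
  using bil by (auto simp: bilattice_def)

sublocale B: bimod OK cj P \<delta> \<omega> L
proof
  show "is_bimodule Q.R L" using bil_bim R_eq by simp
  show "lact L (P * P) x = ract L x (P * P)" if "x \<in> bcarrier L" for x
    unfolding PP using bil_act[OF _ that, of \<pi>] \<pi>(2) by (simp add: OF_iff)
qed

notation B.left_act (infixr "\<rhd>" 75)
notation B.right_act (infixl "\<lhd>" 75)

lemma \<iota>_Ov: "c \<in> OF \<Longrightarrow> \<iota> c \<in> Ov"
  using OK_\<iota> Ov_OK by (simp add: OF_iff)

lemma torsion_P: assumes "x \<in> B.V" "x \<lhd> P = 0" shows "x = 0"
proof -
  have "\<iota> \<pi> \<rhd> x = x \<lhd> P \<lhd> P"
    using bil_act[of \<pi> x] \<pi>(2) assms(1) B.mult_r[of P P x] Q.P_R PP by (simp add: OF_iff)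
  also have "\<dots> = 0" using assms(2) B.r_zero Q.P_R by simp
  finally show ?thesis using bil_torsion[of \<pi> x] \<pi> assms(1) by (simp add: OF_iff)
qed

lemma basis_exists: obtains g where "B.basis std_kind (std_index r1 r2 t1 t2) g B.V"
proof -
  have inv': "\<exists>\<phi>1 \<phi>2. matrix_embedding \<iota> Ov OK \<pi> P (\<lambda>a. a) \<sigma> \<phi>1 \<and> matrix_embedding \<iota> Ov OK \<pi> P \<sigma> (\<lambda>a. a) \<phi>2 \<and>
      (\<exists>f. bimodule_iso Ov L (std_bimodule Ov P \<phi>1 \<phi>2 r1 r2 t1 t2) f)"
    using inv unfolding has_structural_invariant_def Let_def OK_def[symmetric] std_bimodule_def by simp
  then obtain \<phi>1 \<phi>2 f where \<phi>1: "matrix_embedding \<iota> Ov OK \<pi> P (\<lambda>a. a) \<sigma> \<phi>1"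
    and \<phi>2: "matrix_embedding \<iota> Ov OK \<pi> P \<sigma> (\<lambda>a. a) \<phi>2"
    and f: "bimodule_iso Ov L (std_bimodule Ov P \<phi>1 \<phi>2 r1 r2 t1 t2) f" by blast
  have s: "\<sigma> a = cj a" if "a \<in> OK" for a using \<sigma>_eq_cj OK_K that by simp
  show ?thesis
    by (rule B.basis_of_iso[OF _ _ _ _ f[folded R_eq]])
      (use \<phi>1 \<phi>2 s that in \<open>auto simp: matrix_embedding_def PP\<close>)
qed

section \<open>Fractions and the extended pairing\<close>

definition frac where "frac x c = fraction_rel \<iota> OF L `` {(x, c)}"

lemma rel_iff: "((x, c), (y, d)) \<in> fraction_rel \<iota> OF L \<longleftrightarrow>
    x \<in> B.V \<and> y \<in> B.V \<and> c \<in> OF - {0} \<and> d \<in> OF - {0} \<and> \<iota> d \<rhd> x = \<iota> c \<rhd> y"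
  by (simp add: fraction_rel_def)

lemma \<iota>_l_commute: "c \<in> OF \<Longrightarrow> d \<in> OF \<Longrightarrow> x \<in> B.V \<Longrightarrow> \<iota> c \<rhd> \<iota> d \<rhd> x = \<iota> d \<rhd> \<iota> c \<rhd> x"
  using B.mult_l[of "\<iota> c" "\<iota> d" x] B.mult_l[of "\<iota> d" "\<iota> c" x] \<iota>_Ov central[of c "\<iota> d"] by (simp add: R_eq)

lemma \<iota>_l_cancel: assumes "c \<in> OF - {0}" "x \<in> B.V" "y \<in> B.V" "\<iota> c \<rhd> x = \<iota> c \<rhd> y" shows "x = y"
proof -
  have "\<iota> c \<rhd> (x - y) = 0" using assms \<iota>_Ov by (simp add: B.l_diff R_eq)
  then show ?thesis using bil_torsion[of c "x - y"] assms B.V_diff by auto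
qed

lemma frac_eq: assumes "((x, c), (y, d)) \<in> fraction_rel \<iota> OF L" shows "frac x c = frac y d"
proof -
  have tr: "((z, e), (w, f)) \<in> fraction_rel \<iota> OF L"
    if "((y, d), (z, e)) \<in> fraction_rel \<iota> OF L" "((y, d), (w, f)) \<in> fraction_rel \<iota> OF L" for y d z e w f
  proof -
    have V: "y \<in> B.V" "z \<in> B.V" "w \<in> B.V" and F: "d \<in> OF - {0}" "e \<in> OF - {0}" "f \<in> OF - {0}"
      and e1: "\<iota> e \<rhd> y = \<iota> d \<rhd> z" and e2: "\<iota> f \<rhd> y = \<iota> d \<rhd> w" using that by (auto simp: rel_iff)
    have "\<iota> d \<rhd> \<iota> f \<rhd> z = \<iota> d \<rhd> \<iota> e \<rhd> w"
      using e1 e2 V F \<iota>_l_commute[of d f z] \<iota>_l_commute[of d e w] \<iota>_l_commute[of e f y] by auto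
    then have "\<iota> f \<rhd> z = \<iota> e \<rhd> w"
      using \<iota>_l_cancel[OF F(1)] V F \<iota>_Ov B.V_l by (simp add: R_eq)
    then show ?thesis using V F by (simp add: rel_iff)
  qed
  have sym: "((w, f), (z, e)) \<in> fraction_rel \<iota> OF L" if "((z, e), (w, f)) \<in> fraction_rel \<iota> OF L" for z e w f
    using that by (auto simp: rel_iff)
  have "p \<in> frac x c \<longleftrightarrow> p \<in> frac y d" for p
  proof -
    obtain w f where p: "p = (w, f)" by (cases p)
    have "((x, c), (w, f)) \<in> fraction_rel \<iota> OF L \<longleftrightarrow> ((y, d), (w, f)) \<in> fraction_rel \<iota> OF L"
      using tr[OF assms] tr[OF sym[OF assms]] by blast
    then show ?thesis by (simp add: frac_def p)
  qed
  then show ?thesis by blast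
qed

lemma one_OF: "1 \<in> OF - {0}" by (simp add: OF_iff wv_1)

lemma to_fraction_eq: "to_fraction \<iota> OF L x = frac x 1"
  by (simp add: to_fraction_def frac_def)

lemma fraction_moduleE: assumes "X \<in> fraction_module \<iota> OF L"
  obtains x c where "x \<in> B.V" "c \<in> OF - {0}" "X = frac x c"
  using assms unfolding fraction_module_def frac_def quotient_def by auto

lemma frac_mem: "x \<in> B.V \<Longrightarrow> c \<in> OF - {0} \<Longrightarrow> frac x c \<in> fraction_module \<iota> OF L"
  unfolding fraction_module_def frac_def quotient_def by auto

text \<open>All representatives of two fractions give the same value, by clearing denominators, so
  the definite description in \<open>extend_pairing\<close> is meaningful.\<close>

lemma extend_pairing_frac:
  assumes hl: "\<And>c x y. c \<in> OF \<Longrightarrow> x \<in> B.V \<Longrightarrow> y \<in> B.V \<Longrightarrow> h (\<iota> c \<rhd> x) y = \<iota> c * h x y"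
    and hr: "\<And>c x y. c \<in> OF \<Longrightarrow> x \<in> B.V \<Longrightarrow> y \<in> B.V \<Longrightarrow> h x (\<iota> c \<rhd> y) = \<iota> c * h x y"
    and x: "x \<in> B.V" "c \<in> OF - {0}" and y: "y \<in> B.V" "d \<in> OF - {0}"
  shows "extend_pairing \<iota> h (frac x c) (frac y d) = \<iota> (inverse (c * d)) * h x y"
proof -
  have mx: "(x, c) \<in> frac x c" and my: "(y, d) \<in> frac y d" using x y by (auto simp: frac_def rel_iff)
  have eq: "\<iota> (inverse (c' * d')) * h x' y' = \<iota> (inverse (c * d)) * h x y"
    if "(x', c') \<in> frac x c" "(y', d') \<in> frac y d" for x' c' y' d'
  proof -
    have comm: "\<iota> a * (\<iota> b * z) = \<iota> b * (\<iota> a * z)" for a b z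
      using central[of a "\<iota> b"] by (simp add: mult.assoc[symmetric])
    have inv: "\<iota> (inverse a) * (\<iota> a * z) = z" if "a \<noteq> 0" for a z
      using \<iota>_inverse[OF that] central[of a "\<iota> (inverse a)"] by (simp add: mult.assoc[symmetric])
    have x': "x' \<in> B.V" "c' \<in> OF - {0}" "\<iota> c' \<rhd> x = \<iota> c \<rhd> x'"
      and y': "y' \<in> B.V" "d' \<in> OF - {0}" "\<iota> d' \<rhd> y = \<iota> d \<rhd> y'"
      using that by (auto simp: frac_def rel_iff)
    have "\<iota> c' * h x y = \<iota> c * h x' y"
      using hl[of c' x y] hl[of c x' y] x x' y by simp
    moreover have "\<iota> d' * h x' y = \<iota> d * h x' y'"
      using hr[of d' x' y] hr[of d x' y'] y x' y' by simp
    ultimately have 1: "\<iota> (c' * d') * h x y = \<iota> (c * d) * h x' y'"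
      by (simp only: \<iota>_simps mult.assoc) (metis comm)
    define e where "e = c * d" define e' where "e' = c' * d'"
    have nz: "e \<noteq> 0" "e' \<noteq> 0" using x y x' y' by (auto simp: e_def e'_def)
    have "\<iota> (inverse e') * h x' y' = \<iota> (inverse e') * (\<iota> (inverse e) * (\<iota> e * h x' y'))"
      using inv[OF nz(1)] by simp
    also have "\<dots> = \<iota> (inverse e') * (\<iota> (inverse e) * (\<iota> e' * h x y))"
      using 1 by (simp add: e_def e'_def)
    also have "\<dots> = \<iota> (inverse e) * h x y"
      unfolding comm[of "inverse e" e'] by (rule inv[OF nz(2)])
    finally show ?thesis by (simp add: e_def e'_def)
  qed
  show ?thesis
    unfolding extend_pairing_def
  proof (rule the_equality)
    show "\<forall>(x', c')\<in>frac x c. \<forall>(y', d')\<in>frac y d. \<iota> (inverse (c * d)) * h x y = \<iota> (inverse (c' * d')) * h x' y'"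
      using eq by (fastforce split: prod.splits)
    fix z assume "\<forall>(x', c')\<in>frac x c. \<forall>(y', d')\<in>frac y d. z = \<iota> (inverse (c' * d')) * h x' y'"
    then show "z = \<iota> (inverse (c * d)) * h x y" using mx my by blast
  qed
qed

section \<open>From a perfect pairing to a normalized one\<close>

abbreviation hp where "hp h \<equiv> hermitian_pairing \<iota> OF Ov cj starv L h"
abbreviation php where "php h \<equiv> perfect_hermitian_pairing \<iota> OF Ov cj starv L h"

lemma hp_iff: "hp h \<longleftrightarrow>
     (\<forall>x\<in>B.V. \<forall>y\<in>B.V. \<forall>z\<in>B.V. h (x + y) z = h x z + h y z \<and> h x (y + z) = h x y + h x z) \<and>
     (\<forall>c\<in>OF. \<forall>x\<in>B.V. \<forall>y\<in>B.V. h (\<iota> c \<rhd> x) y = \<iota> c * h x y \<and> h x (\<iota> c \<rhd> y) = \<iota> c * h x y) \<and>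
     (\<forall>X\<in>fraction_module \<iota> OF L.
        (\<forall>Y\<in>fraction_module \<iota> OF L. extend_pairing \<iota> h X Y = 0) \<longrightarrow> X = to_fraction \<iota> OF L 0) \<and>
     (\<forall>x\<in>B.V. \<forall>y\<in>B.V. h x y = cj (h y x)) \<and>
     (\<forall>x\<in>B.V. \<forall>y\<in>B.V. \<forall>a\<in>Ov. \<forall>b\<in>Ov. h (x \<lhd> a) (y \<lhd> b) = cj a * h x y * b) \<and>
     (\<forall>x\<in>B.V. \<forall>y\<in>B.V. \<forall>a\<in>Ov. h (a \<rhd> x) y = h x (starv a \<rhd> y))"
  by (simp add: hermitian_pairing_def)

lemma R_I: "a \<in> Ov \<Longrightarrow> a \<in> Q.R"
  by (simp add: R_eq)

lemma \<beta>_act: "x \<in> B.V \<Longrightarrow> \<beta> \<rhd> x \<in> B.V" "x \<in> B.V \<Longrightarrow> \<beta>' \<rhd> x \<in> B.V"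
  "x \<in> B.V \<Longrightarrow> \<beta> \<rhd> \<beta>' \<rhd> x = x" "x \<in> B.V \<Longrightarrow> \<beta>' \<rhd> \<beta> \<rhd> x = x"
  using \<beta>(1) \<beta>' B.mult_l[of \<beta> \<beta>' x] B.mult_l[of \<beta>' \<beta> x] B.one_l by (auto simp: R_eq B.V_l)

lemma twist_eq: "twist a = (if od then a else cj a)"
  unfolding twist_def ..

context
  fixes h assumes h: "php h"
begin

lemma h_add2: "x \<in> B.V \<Longrightarrow> y \<in> B.V \<Longrightarrow> z \<in> B.V \<Longrightarrow> h x (y + z) = h x y + h x z"
  and h_sc1: "c \<in> OF \<Longrightarrow> x \<in> B.V \<Longrightarrow> y \<in> B.V \<Longrightarrow> h (\<iota> c \<rhd> x) y = \<iota> c * h x y"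
  and h_sc2: "c \<in> OF \<Longrightarrow> x \<in> B.V \<Longrightarrow> y \<in> B.V \<Longrightarrow> h x (\<iota> c \<rhd> y) = \<iota> c * h x y"
  and h_cj: "x \<in> B.V \<Longrightarrow> y \<in> B.V \<Longrightarrow> h x y = cj (h y x)"
  and h_sesq: "x \<in> B.V \<Longrightarrow> y \<in> B.V \<Longrightarrow> a \<in> Ov \<Longrightarrow> b \<in> Ov \<Longrightarrow> h (x \<lhd> a) (y \<lhd> b) = cj a * h x y * b"
  and h_star: "x \<in> B.V \<Longrightarrow> y \<in> B.V \<Longrightarrow> a \<in> Ov \<Longrightarrow> h (a \<rhd> x) y = h x (starv a \<rhd> y)"
proof -
  have "hp h" using h by (simp add: perfect_hermitian_pairing_def)
  note * = this[unfolded hp_iff]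
  note c1 = *[THEN conjunct1] and c2 = *[THEN conjunct2, THEN conjunct1]
    and c4 = *[THEN conjunct2, THEN conjunct2, THEN conjunct2]
  note d1 = c4[THEN conjunct1] and d2 = c4[THEN conjunct2, THEN conjunct1]
    and d3 = c4[THEN conjunct2, THEN conjunct2]
  show "x \<in> B.V \<Longrightarrow> y \<in> B.V \<Longrightarrow> z \<in> B.V \<Longrightarrow> h x (y + z) = h x y + h x z"
    using c1 by simp
  show "c \<in> OF \<Longrightarrow> x \<in> B.V \<Longrightarrow> y \<in> B.V \<Longrightarrow> h (\<iota> c \<rhd> x) y = \<iota> c * h x y"
    "c \<in> OF \<Longrightarrow> x \<in> B.V \<Longrightarrow> y \<in> B.V \<Longrightarrow> h x (\<iota> c \<rhd> y) = \<iota> c * h x y"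
    using c2 by simp_all
  show "x \<in> B.V \<Longrightarrow> y \<in> B.V \<Longrightarrow> h x y = cj (h y x)"
    using d1 by blast
  show "x \<in> B.V \<Longrightarrow> y \<in> B.V \<Longrightarrow> a \<in> Ov \<Longrightarrow> b \<in> Ov \<Longrightarrow> h (x \<lhd> a) (y \<lhd> b) = cj a * h x y * b"
    using d2 by blast
  show "x \<in> B.V \<Longrightarrow> y \<in> B.V \<Longrightarrow> a \<in> Ov \<Longrightarrow> h (a \<rhd> x) y = h x (starv a \<rhd> y)"
    using d3 by blast
qed

lemma extend_h: "x \<in> B.V \<Longrightarrow> c \<in> OF - {0} \<Longrightarrow> y \<in> B.V \<Longrightarrow>
    extend_pairing \<iota> h (frac x c) (to_fraction \<iota> OF L y) = \<iota> (inverse c) * h x y"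
  unfolding to_fraction_eq using extend_pairing_frac[OF h_sc1 h_sc2 _ _ _ one_OF, of x c y] by simp

lemma dual_lattice: "{X \<in> fraction_module \<iota> OF L. \<forall>y\<in>B.V. extend_pairing \<iota> h X (to_fraction \<iota> OF L y) \<in> Ov} =
    to_fraction \<iota> OF L ` B.V"
  using h by (simp add: perfect_hermitian_pairing_def)

lemma h_Ov: assumes "x \<in> B.V" "y \<in> B.V" shows "h x y \<in> Ov"
proof -
  have "to_fraction \<iota> OF L x \<in> to_fraction \<iota> OF L ` B.V" using assms by blast
  then have "extend_pairing \<iota> h (to_fraction \<iota> OF L x) (to_fraction \<iota> OF L y) \<in> Ov"
    using dual_lattice assms by blast
  then show ?thesis
    using extend_h[OF assms(1) one_OF assms(2)] by (simp add: to_fraction_eq[symmetric] \<iota>_simps)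
qed

text \<open>\<open>\<beta>\<close> is self-adjoint for the original involution, which preserves
  hermitian symmetry; the relation \<open>starv a * \<beta> = \<beta> * twist a\<close> and its
  analogue for \<open>P\<close> carry adjoints past \<open>\<beta>\<close>.\<close>

lemma twisted_herm: "herm OK cj P \<delta> \<omega> L od (\<lambda>x y. h x (\<beta> \<rhd> y))"
proof
  fix x y assume x: "x \<in> B.V" and y: "y \<in> B.V"
  note \<beta>y = \<beta>_act(1)[OF y]
  show "h x (\<beta> \<rhd> y) \<in> Q.R" using h_Ov[OF x \<beta>y] by (simp add: R_eq)
  show "h x (\<beta> \<rhd> (y + z)) = h x (\<beta> \<rhd> y) + h x (\<beta> \<rhd> z)" if z: "z \<in> B.V" for z
    using h_add2[OF x \<beta>y \<beta>_act(1)[OF z]] B.l_add[OF R_I[OF \<beta>(1)] y z] by simp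
  show "h x (\<beta> \<rhd> y) = cj (h y (\<beta> \<rhd> x))"
    using h_cj[OF \<beta>_act(1)[OF x] y] h_star[OF x y \<beta>(1)] \<beta>(2) h_cj[OF y \<beta>_act(1)[OF x]] cj_cj by simp
  show "h x (\<beta> \<rhd> (y \<lhd> a)) = h x (\<beta> \<rhd> y) * a" if a: "a \<in> Q.R" for a
    using h_sesq[OF x \<beta>y Ov_ring(1), of a] a B.l_r[OF R_I[OF \<beta>(1)] a y] B.one_r[OF x] cj_1
    by (simp add: R_eq)
  show "h (a \<rhd> x) (\<beta> \<rhd> y) = h x (\<beta> \<rhd> (if od then a else cj a) \<rhd> y)" if a: "a \<in> OK" for a
  proof -
    have "h (a \<rhd> x) (\<beta> \<rhd> y) = h x ((starv a * \<beta>) \<rhd> y)"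
      using h_star[OF x \<beta>y Ov_OK[OF a]] B.mult_l[OF R_I[OF starv_Ov[OF Ov_OK[OF a]]] R_I[OF \<beta>(1)] y] by simp
    also have "\<dots> = h x (\<beta> \<rhd> twist a \<rhd> y)"
      using B.mult_l[OF R_I[OF \<beta>(1)] R_I[OF Ov_OK[OF twist_OK[OF a]]] y] \<beta>(3)[OF a] by simp
    finally show ?thesis by (simp only: twist_eq)
  qed
  have "h (P \<rhd> x) (\<beta> \<rhd> y) = h x ((starv P * \<beta>) \<rhd> y)"
    using h_star[OF x \<beta>y P_Ov] B.mult_l[OF R_I[OF starv_Ov[OF P_Ov]] R_I[OF \<beta>(1)] y] by simp
  also have "\<dots> = h x (\<beta> \<rhd> twist_P \<rhd> y)"
    using B.mult_l[OF R_I[OF \<beta>(1)] R_I[OF twist_P_Ov] y] \<beta>(4) by simp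
  also have "\<dots> = (if od then - h x (\<beta> \<rhd> P \<rhd> y) else h x (\<beta> \<rhd> P \<rhd> y))"
  proof -
    have Py: "P \<rhd> y \<in> B.V" using y by (simp add: B.V_l Q.P_R)
    have "(- P) \<rhd> y + P \<rhd> y = 0"
      using B.add_l[OF Q.R_uminus[OF Q.P_R] Q.P_R y] B.zero_l[OF y] by simp
    then have neg: "(- P) \<rhd> y = - (P \<rhd> y)" by (simp add: eq_neg_iff_add_eq_0)
    have "h x 0 = 0" using h_add2[OF x B.V_zero B.V_zero] by simp
    then have "h x (- (\<beta> \<rhd> P \<rhd> y)) = - h x (\<beta> \<rhd> P \<rhd> y)"
      using h_add2[OF x \<beta>_act(1)[OF Py] B.V_uminus[OF \<beta>_act(1)[OF Py]]]
      by (simp add: eq_neg_iff_add_eq_0 add.commute)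
    then have "h x (\<beta> \<rhd> (- (P \<rhd> y))) = - h x (\<beta> \<rhd> P \<rhd> y)"
      unfolding B.l_uminus[OF R_I[OF \<beta>(1)] Py] .
    then show ?thesis unfolding twist_P_def using neg by simp
  qed
  finally show "h (P \<rhd> x) (\<beta> \<rhd> y) = (if od then - h x (\<beta> \<rhd> P \<rhd> y) else h x (\<beta> \<rhd> P \<rhd> y))" .
qed

text \<open>If \<open>z\<close> pairs into \<open>RP\<close> with all of \<open>L\<close>, then the
  fraction of \<open>z \<lhd> P\<close> by \<open>\<pi>\<close> pairs integrally, so duality gives
  \<open>w\<close> in \<open>L\<close> with \<open>z \<lhd> P = w \<lhd> P \<lhd> P\<close>, and
  \<open>P\<close> cancels by torsion-freeness.\<close>

lemma twisted_LP: "herm.LP OK P L (\<lambda>x y. h x (\<beta> \<rhd> y)) B.V"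
proof -
  interpret H: herm OK cj P \<delta> \<omega> L od "\<lambda>x y. h x (\<beta> \<rhd> y)" by (rule twisted_herm)
  show ?thesis
    unfolding H.LP_def
  proof (intro ballI impI)
    fix z assume z: "z \<in> B.V" and zy: "\<forall>y\<in>B.V. h z (\<beta> \<rhd> y) \<in> Q.RP"
    have RP: "h z y \<in> Q.RP" if "y \<in> B.V" for y
      using zy \<beta>_act(2,3)[OF that] by metis
    have zP: "z \<lhd> P \<in> B.V" using z by (simp add: B.V_r Q.P_R)
    have \<pi>F: "\<pi> \<in> OF - {0}" using \<pi> by (simp add: OF_iff)
    have "\<iota> (inverse \<pi>) * h (z \<lhd> P) y \<in> Ov" if y: "y \<in> B.V" for y
    proof -
      obtain r where r: "r \<in> Ov" "cj (h z y) = r * P"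
        using RP[OF y] Q.RP_cj[of "h z y"] by (auto simp: Q.RP_def R_eq)
      have "h z y = - (P * cj r)" using arg_cong[OF r(2), of cj] by (simp add: cj_cj cj_mult cj_P)
      moreover have "h (z \<lhd> P) y = cj P * h z y"
        using h_sesq[OF z y P_Ov Ov_ring(1)] B.one_r[OF y] by simp
      ultimately have "h (z \<lhd> P) y = \<iota> \<pi> * cj r" by (simp add: cj_P PP[symmetric] mult.assoc)
      moreover have "\<iota> (inverse \<pi>) * \<iota> \<pi> = 1" using \<iota>_inverse[OF \<pi>(1)] central by metis
      ultimately have "\<iota> (inverse \<pi>) * h (z \<lhd> P) y = cj r" by (simp add: mult.assoc[symmetric])
      then show ?thesis using cj_Ov r by simp
    qed
    then have "frac (z \<lhd> P) \<pi> \<in> to_fraction \<iota> OF L ` B.V"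
      unfolding dual_lattice[symmetric] using frac_mem[OF zP \<pi>F] extend_h[OF zP \<pi>F] by simp
    then obtain w where w: "w \<in> B.V" "frac (z \<lhd> P) \<pi> = frac w 1" by (auto simp: to_fraction_eq)
    have "(w, 1) \<in> frac (z \<lhd> P) \<pi>" unfolding w(2) using w(1) one_OF by (simp add: frac_def rel_iff)
    then have "\<iota> 1 \<rhd> (z \<lhd> P) = \<iota> \<pi> \<rhd> w" by (simp add: frac_def rel_iff)
    then have "z \<lhd> P = w \<lhd> P \<lhd> P"
      using bil_act[of \<pi> w] \<pi>F w(1) zP B.mult_r[OF Q.P_R Q.P_R w(1)] by (simp add: \<iota>_simps B.one_l PP)
    moreover have wP: "w \<lhd> P \<in> B.V" using w by (simp add: B.V_r Q.P_R)
    ultimately have "(z - w \<lhd> P) \<lhd> P = 0" using z by (simp add: B.r_diff Q.P_R)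
    then have "z - w \<lhd> P = 0" using torsion_P B.V_diff[OF z wP] by blast
    then show "\<exists>w\<in>B.V. z = w \<lhd> P" using w(1) by auto
  qed
qed

lemma perfect_parity: "parity_condition (ord \<gamma>) r1 r2 t1 t2"
proof -
  interpret H: herm OK cj P \<delta> \<omega> L od "\<lambda>x y. h x (\<beta> \<rhd> y)" by (rule twisted_herm)
  obtain g where "B.basis std_kind (std_index r1 r2 t1 t2) g B.V" by (rule basis_exists)
  then have "parity od (Q.cnt std_kind (std_index r1 r2 t1 t2))"
    using H.parity_of_basis twisted_LP by blast
  then show ?thesis unfolding Q.parity_std_index parity_condition_def od_def by simp
qed

end

section \<open>From a normalized pairing back to a perfect one\<close>

context
  fixes h assumes herm: "herm OK cj P \<delta> \<omega> L od h" and LP: "herm.LP OK P L h B.V"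
begin

interpretation H: herm OK cj P \<delta> \<omega> L od h by (rule herm)

lemma LP_D: assumes "z \<in> B.V" "\<And>y. y \<in> B.V \<Longrightarrow> h z y \<in> Q.RP" obtains w where "w \<in> B.V" "z = w \<lhd> P"
  using LP assms unfolding H.LP_def by blast

text \<open>By \<open>LP\<close> a vector of the radical is \<open>w \<lhd> P\<close> with
  \<open>w\<close> again in the radical, hence divisible by every power of \<open>P\<close>. So are
  its coordinates, and \<open>Ov_separated\<close> makes them zero.\<close>

lemma h_nondegenerate: assumes z: "z \<in> B.V" "\<And>y. y \<in> B.V \<Longrightarrow> h z y = 0" shows "z = 0"
proof -
  obtain g where b: "B.basis std_kind (std_index r1 r2 t1 t2) g B.V" by (rule basis_exists)
  have Pn: "P ^ n \<in> Q.R" for n by (induction n) (auto simp: Q.R_one Q.R_mult Q.P_R)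
  have div: "\<exists>w\<in>B.V. z = w \<lhd> P ^ n \<and> (\<forall>y\<in>B.V. h w y = 0)" for n
  proof (induction n)
    case 0
    then show ?case using z B.one_r by force
  next
    case (Suc n)
    then obtain w where w: "w \<in> B.V" "z = w \<lhd> P ^ n" "\<forall>y\<in>B.V. h w y = 0" by blast
    obtain v where v: "v \<in> B.V" "w = v \<lhd> P" by (rule LP_D[OF w(1)]) (use w(3) Q.RP_zero in simp)
    have "h v y = 0" if y: "y \<in> B.V" for y
    proof -
      have "P * h v y = 0" using w(3) y H.h_l[OF Q.P_R v(1) y] v(2) cj_P by simp
      then show ?thesis using Q.P_cancel_left H.h_R[OF v(1) y] by blast
    qed
    moreover have "z = v \<lhd> P ^ Suc n" using w(2) v B.mult_r[OF Q.P_R Pn v(1)] by simp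
    ultimately show ?case using v(1) by blast
  qed
  obtain c d where cd: "Q.coords (std_index r1 r2 t1 t2) std_kind c d" "z = B.lc (std_index r1 r2 t1 t2) g c d"
    by (rule B.basis_coords[OF b z(1)])
  have zero: "c i = 0 \<and> d i = 0" if i: "i \<in> std_index r1 r2 t1 t2" for i
  proof -
    have "\<exists>y\<in>Ov. \<exists>y'\<in>Ov. c i = y * P ^ n \<and> d i = y' * P ^ n" for n
    proof -
      obtain w where w: "w \<in> B.V" "z = w \<lhd> P ^ n" using div by blast
      obtain c' d' where cd': "Q.coords (std_index r1 r2 t1 t2) std_kind c' d'" "w = B.lc (std_index r1 r2 t1 t2) g c' d'"
        by (rule B.basis_coords[OF b w(1)])
      have "B.lc (std_index r1 r2 t1 t2) g c d = B.lc (std_index r1 r2 t1 t2) g (\<lambda>i. c' i * P ^ n) (\<lambda>i. d' i * P ^ n)"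
        using w(2) cd(2) cd'(2) B.lc_right[OF B.basis_gens[OF b] cd'(1) Pn] by simp
      from B.basis_unique[OF b cd(1) Q.coords_right[OF cd'(1) Pn] this i]
      show ?thesis using B.coordsD(1,2)[OF cd'(1) i] by (auto simp: R_eq)
    qed
    then show ?thesis using Ov_separated by metis
  qed
  have "B.lc (std_index r1 r2 t1 t2) g c d = B.lc (std_index r1 r2 t1 t2) g (\<lambda>_. 0) (\<lambda>_. 0)"
    by (rule B.lc_cong) (use zero in auto)
  then show ?thesis using cd(2) B.lc_zero[OF B.basis_gens[OF b]] by simp
qed

text \<open>Here the condition modulo the maximal ideal regains the full dual lattice: each factor
  \<open>\<pi> = P * P\<close> of \<open>c\<close> costs two applications of \<open>LP\<close>, and
  a unit costs none.\<close>

lemma divisible: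
  assumes "c \<in> OF - {0}" "x \<in> B.V" "\<And>y. y \<in> B.V \<Longrightarrow> \<exists>r\<in>Ov. h x y = \<iota> c * r"
  shows "\<exists>w\<in>B.V. x = \<iota> c \<rhd> w"
  using assms
proof (induction "nat (ord (\<iota> c))" arbitrary: c x rule: less_induct)
  case less
  note x = less.prems(2)
  show ?case
  proof (cases "wv c < 1")
    case False
    then have ic: "inverse c \<in> OF" using less.prems(1) by (simp add: OF_iff wv_inverse)
    have "\<iota> c \<rhd> \<iota> (inverse c) \<rhd> x = x"
      using B.mult_l[OF R_I[OF \<iota>_Ov] R_I[OF \<iota>_Ov[OF ic]] x, of c] \<iota>_inverse[of c] less.prems(1) B.one_l[OF x] by simp
    then show ?thesis using B.V_l[OF R_I[OF \<iota>_Ov[OF ic]] x] by metis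
  next
    case True
    define c1 where "c1 = c / \<pi>"
    have "wv \<pi> > 0" using wv_nonneg[of \<pi>] wv_0_iff[of \<pi>] \<pi>(1) by linarith
    then have c1: "c1 \<in> OF - {0}" "c = \<pi> * c1"
      using \<pi>(3)[OF True] \<pi>(1) less.prems(1) by (auto simp: c1_def OF_iff wv_divide divide_le_eq_1)
    have \<pi>F: "\<pi> \<in> OF" using \<pi> by (simp add: OF_iff)
    have ic: "\<iota> c = P * (P * \<iota> c1)" unfolding c1(2) \<iota>_simps PP[symmetric] by (simp add: mult.assoc)
    have R1: "P * (\<iota> c1 * r) \<in> Q.RP" "\<iota> c1 * r \<in> Q.R" if "r \<in> Ov" for r
      using that \<iota>_Ov[of c1] c1(1) Ov_ring(4) Q.RP_right[OF Q.P_RP] by (auto simp: R_eq)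
    obtain w where w: "w \<in> B.V" "x = w \<lhd> P"
    proof (rule LP_D[OF x])
      fix y assume "y \<in> B.V"
      then obtain r where r: "r \<in> Ov" "h x y = \<iota> c * r" using less.prems(3) by blast
      then show "h x y \<in> Q.RP" using Q.RP_left[OF Q.P_R R1(1)[OF r(1)]] unfolding ic by (simp add: mult.assoc)
    qed
    have hw: "\<exists>r\<in>Ov. h w y = - (P * (\<iota> c1 * r))" if y: "y \<in> B.V" for y
    proof -
      obtain r where r: "r \<in> Ov" "h x y = \<iota> c * r" using less.prems(3)[OF y] by blast
      have "- (P * h w y) = P * (P * (\<iota> c1 * r))"
        using r(2) H.h_l[OF Q.P_R w(1) y] w(2) cj_P unfolding ic by (simp add: mult.assoc)
      then have "P * (h w y + P * (\<iota> c1 * r)) = 0" by (simp add: distrib_left) (metis add.right_inverse)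
      moreover have "h w y + P * (\<iota> c1 * r) \<in> Q.R"
        using H.h_R[OF w(1) y] Q.RP_R[OF R1(1)[OF r(1)]] by (rule Q.R_add)
      ultimately have "h w y + P * (\<iota> c1 * r) = 0" using Q.P_cancel_left by blast
      then show ?thesis using r(1) by (auto simp: eq_neg_iff_add_eq_0)
    qed
    obtain v where v: "v \<in> B.V" "w = v \<lhd> P"
    proof (rule LP_D[OF w(1)])
      fix y assume "y \<in> B.V"
      then obtain r where r: "r \<in> Ov" "h w y = - (P * (\<iota> c1 * r))" using hw by blast
      then show "h w y \<in> Q.RP" using Q.RP_uminus[OF R1(1)[OF r(1)]] by simp
    qed
    have hv: "\<exists>r\<in>Ov. h v y = \<iota> c1 * r" if y: "y \<in> B.V" for y
    proof -
      obtain r where r: "r \<in> Ov" "h w y = - (P * (\<iota> c1 * r))" using hw[OF y] by blast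
      have "P * h v y = P * (\<iota> c1 * r)"
        using r(2) H.h_l[OF Q.P_R v(1) y] v(2) cj_P by simp
      then have "P * (h v y - \<iota> c1 * r) = 0" by (simp add: right_diff_distrib)
      moreover have "h v y - \<iota> c1 * r \<in> Q.R"
        using H.h_R[OF v(1) y] R1(2)[OF r(1)] by (rule Q.R_diff)
      ultimately have "h v y - \<iota> c1 * r = 0" using Q.P_cancel_left by blast
      then show ?thesis using r(1) by auto
    qed
    have "ord (\<iota> c) = 2 + ord (\<iota> c1)"
      unfolding c1(2) \<iota>_simps using ord_mult[of "\<iota> \<pi>" "\<iota> c1"] \<iota>_eq_0 \<pi>(1) c1(1) ord_\<pi>_eq by simp
    moreover have "ord (\<iota> c1) \<ge> 0" using ord_\<iota>[of c1] c1(1) by (simp add: OF_iff)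
    ultimately have "nat (ord (\<iota> c1)) < nat (ord (\<iota> c))" by simp
    then obtain w' where w': "w' \<in> B.V" "v = \<iota> c1 \<rhd> w'" using less.hyps[OF _ c1(1) v(1) hv] by blast
    have "x = \<iota> \<pi> \<rhd> v"
      using w(2) v bil_act[OF \<pi>F v(1)] B.mult_r[OF Q.P_R Q.P_R v(1)] PP by simp
    also have "\<dots> = \<iota> c \<rhd> w'"
      unfolding w'(2) c1(2) \<iota>_simps
      using B.mult_l[OF R_I[OF \<iota>_Ov[OF \<pi>F]] R_I[OF \<iota>_Ov] w'(1), of c1] c1(1) by simp
    finally show ?thesis using w'(1) by blast
  qed
qed

text \<open>The adjoint for the normalized pairing, that is, the original involution conjugated by
  \<open>\<beta>\<close>. Its values on \<open>OK\<close> and \<open>P\<close> are those in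
  \<open>herm\<close>, which \<open>h_circ\<close> thereby extends to all of
  \<open>Ov\<close>.\<close>

definition circ where "circ a = \<beta>' * (starv a * \<beta>)"

lemma circ: "a \<in> OK \<Longrightarrow> circ a = twist a" "circ P = twist_P" "circ (a + b) = circ a + circ b"
  "circ (a * b) = circ b * circ a" "circ \<beta> = \<beta>" "circ a * \<beta>' = \<beta>' * starv a" "a \<in> Ov \<Longrightarrow> circ a \<in> Ov"
proof -
  have c1: "\<beta>' * (\<beta> * x) = x" for x using \<beta>'(3) by (simp add: mult.assoc[symmetric])
  have c2: "\<beta> * (\<beta>' * x) = x" for x using \<beta>'(2) by (simp add: mult.assoc[symmetric])
  show "a \<in> OK \<Longrightarrow> circ a = twist a" "circ P = twist_P" by (simp_all add: circ_def \<beta> c1)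
  show "circ (a + b) = circ a + circ b" by (simp add: circ_def starv_add distrib_left distrib_right)
  show "circ (a * b) = circ b * circ a" by (simp add: circ_def starv_mult mult.assoc c2)
  show "circ \<beta> = \<beta>" by (simp add: circ_def \<beta>(2) c1)
  show "circ a * \<beta>' = \<beta>' * starv a" by (simp add: circ_def mult.assoc \<beta>'(2))
  show "circ a \<in> Ov" if "a \<in> Ov" unfolding circ_def by (intro Ov_ring(4) starv_Ov that \<beta>(1) \<beta>'(1))
qed

lemma h_circ: assumes a: "a \<in> Ov" and x: "x \<in> B.V" and y: "y \<in> B.V" shows "h (a \<rhd> x) y = h x (circ a \<rhd> y)"
proof -
  have C: "h (p \<rhd> x) y = h x (circ p \<rhd> y)" if "p \<in> OK" "x \<in> B.V" "y \<in> B.V" for p x y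
    using H.h_C[OF that] circ(1)[OF that(1)] by (simp only: twist_eq)
  have PP': "h (P \<rhd> x) y = h x (circ P \<rhd> y)" if "x \<in> B.V" "y \<in> B.V" for x y
  proof -
    have "(- P) \<rhd> y + P \<rhd> y = 0"
      using B.add_l[OF Q.R_uminus[OF Q.P_R] Q.P_R that(2)] B.zero_l[OF that(2)] by simp
    then have neg: "(- P) \<rhd> y = - (P \<rhd> y)" by (simp add: eq_neg_iff_add_eq_0)
    show ?thesis
      unfolding circ(2) twist_P_def
      using H.h_P[OF that] neg H.h_uminus[OF that(1) B.V_l[OF Q.P_R that(2)]] by simp
  qed
  obtain p q where pq: "p \<in> OK" "q \<in> OK" "a = p + q * P" using a unfolding Ov_eq by blast
  have V: "P \<rhd> x \<in> B.V" "circ q \<rhd> y \<in> B.V" "circ p \<rhd> y \<in> B.V" "circ P \<rhd> circ q \<rhd> y \<in> B.V"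
    using x y circ(7) Ov_OK pq P_Ov by (auto intro!: B.V_l simp: R_eq)
  have Rs: "circ p \<in> Q.R" "circ P \<in> Q.R" "circ q \<in> Q.R" "circ P * circ q \<in> Q.R"
    using circ(7) Ov_OK pq P_Ov Ov_ring(4) by (auto simp: R_eq)
  have "h (a \<rhd> x) y = h (p \<rhd> x) y + h (q \<rhd> P \<rhd> x) y"
    unfolding pq(3) B.l_split[OF pq(1,2) x]
    using H.h_add_l[OF _ _ y] x V(1) pq Ov_OK by (simp add: B.V_l R_eq)
  also have "\<dots> = h x (circ p \<rhd> y) + h x (circ P \<rhd> circ q \<rhd> y)"
    using C[OF pq(1) x y] C[OF pq(2) V(1) y] PP'[OF x V(2)] by simp
  also have "\<dots> = h x (circ a \<rhd> y)"
    unfolding pq(3) circ(3,4) B.add_l[OF Rs(1,4) y] B.mult_l[OF Rs(2,3) y]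
    using H.h_add[OF x V(3,4)] by simp
  finally show ?thesis .
qed

text \<open>\<open>circ \<beta> = \<beta>\<close> gives hermitian symmetry, and
  \<open>circ a * \<beta>' = \<beta>' * starv a\<close> restores the involution. That a fraction of
  \<open>x\<close> by \<open>c\<close> lies in the dual lattice means that \<open>x\<close> pairs
  into \<open>\<iota> c * Ov\<close>, so \<open>divisible\<close> makes it integral.\<close>

lemma untwisted_perfect: "php (\<lambda>x y. h x (\<beta>' \<rhd> y))"
proof -
  let ?h = "\<lambda>x y. h x (\<beta>' \<rhd> y)"
  have add1: "?h (x + y) z = ?h x z + ?h y z" and add2: "?h z (x + y) = ?h z x + ?h z y"
    if "x \<in> B.V" "y \<in> B.V" "z \<in> B.V" for x y z
    using that H.h_add_l[OF that(1,2) \<beta>_act(2)[OF that(3)]]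
      H.h_add[OF that(3) \<beta>_act(2)[OF that(1)] \<beta>_act(2)[OF that(2)]] B.l_add[OF R_I[OF \<beta>'(1)] that(1,2)] by auto
  have sesq: "?h (x \<lhd> a) (y \<lhd> b) = cj a * ?h x y * b" if "x \<in> B.V" "y \<in> B.V" "a \<in> Ov" "b \<in> Ov" for x y a b
    using that B.l_r[OF R_I[OF \<beta>'(1)] R_I[OF that(4)] that(2)]
    by (simp add: H.h_l[OF R_I] H.h_r[OF R_I] B.V_r R_eq \<beta>_act mult.assoc)
  have sc: "?h (\<iota> c \<rhd> x) y = \<iota> c * ?h x y \<and> ?h x (\<iota> c \<rhd> y) = \<iota> c * ?h x y"
    if "c \<in> OF" "x \<in> B.V" "y \<in> B.V" for c x y
    using sesq[OF that(2,3) \<iota>_Ov[OF that(1)] Ov_ring(1)] sesq[OF that(2,3) Ov_ring(1) \<iota>_Ov[OF that(1)]]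
      bil_act[OF that(1)] that B.one_r cj_1 cj_\<iota> central[of c "?h x y"] by simp
  have herm_sym: "?h x y = cj (?h y x)" if "x \<in> B.V" "y \<in> B.V" for x y
  proof -
    have "?h y x = h (\<beta> \<rhd> \<beta>' \<rhd> y) (\<beta>' \<rhd> x)" using \<beta>_act(3)[OF that(2)] by simp
    also have "\<dots> = h (\<beta>' \<rhd> y) (\<beta> \<rhd> \<beta>' \<rhd> x)"
      using h_circ[OF \<beta>(1) \<beta>_act(2)[OF that(2)] \<beta>_act(2)[OF that(1)]] circ(5) by simp
    also have "\<dots> = h (\<beta>' \<rhd> y) x" using \<beta>_act(3)[OF that(1)] by simp
    finally show ?thesis using H.h_cj[OF that(1) \<beta>_act(2)[OF that(2)]] by simp
  qed
  have star: "?h (a \<rhd> x) y = ?h x (starv a \<rhd> y)" if "x \<in> B.V" "y \<in> B.V" "a \<in> Ov" for x y a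
    using h_circ[OF that(3,1) \<beta>_act(2)[OF that(2)]] B.mult_l[OF R_I[OF circ(7)[OF that(3)]] R_I[OF \<beta>'(1)] that(2)]
      B.mult_l[OF R_I[OF \<beta>'(1)] R_I[OF starv_Ov[OF that(3)]] that(2)] circ(6) by simp
  have ext: "extend_pairing \<iota> ?h (frac x c) (frac y d) = \<iota> (inverse (c * d)) * ?h x y"
    if "x \<in> B.V" "c \<in> OF - {0}" "y \<in> B.V" "d \<in> OF - {0}" for x c y d
    by (rule extend_pairing_frac) (use that sc in auto)
  have nondeg: "X = to_fraction \<iota> OF L 0"
    if X: "X \<in> fraction_module \<iota> OF L" and 0: "\<forall>Y\<in>fraction_module \<iota> OF L. extend_pairing \<iota> ?h X Y = 0" for X
  proof -
    obtain x c where xc: "x \<in> B.V" "c \<in> OF - {0}" "X = frac x c" by (rule fraction_moduleE[OF X])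
    have ic: "inverse c \<noteq> 0" using xc(2) by simp
    have "?h x y = 0" if y: "y \<in> B.V" for y
      using 0 frac_mem[OF y one_OF] ext[OF xc(1,2) y one_OF] xc(3) \<iota>_cancel[OF ic] by auto
    then have "h x y = 0" if y: "y \<in> B.V" for y using \<beta>_act(1,4)[OF y] by metis
    then have "x = 0" using h_nondegenerate xc(1) by blast
    then show ?thesis
      unfolding xc(3) to_fraction_eq using xc(2) one_OF B.l_zero[OF R_I[OF \<iota>_Ov]]
      by (intro frac_eq) (simp add: rel_iff B.V_zero)
  qed
  have "{X \<in> fraction_module \<iota> OF L. \<forall>y\<in>B.V. extend_pairing \<iota> ?h X (to_fraction \<iota> OF L y) \<in> Ov} =
      to_fraction \<iota> OF L ` B.V" (is "?D = _")
  proof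
    show "to_fraction \<iota> OF L ` B.V \<subseteq> ?D"
    proof
      fix X assume "X \<in> to_fraction \<iota> OF L ` B.V"
      then obtain x where x: "x \<in> B.V" "X = frac x 1" by (auto simp: to_fraction_eq)
      have "extend_pairing \<iota> ?h X (to_fraction \<iota> OF L y) \<in> Ov" if y: "y \<in> B.V" for y
        unfolding x(2) to_fraction_eq ext[OF x(1) one_OF y one_OF]
        using H.h_R[OF x(1) \<beta>_act(2)[OF y]] by (simp add: \<iota>_simps R_eq)
      then show "X \<in> ?D" using frac_mem[OF x(1) one_OF] x(2) by blast
    qed
    show "?D \<subseteq> to_fraction \<iota> OF L ` B.V"
    proof
      fix X assume X: "X \<in> ?D"
      then have "X \<in> fraction_module \<iota> OF L" by blast
      then obtain x c where xc: "x \<in> B.V" "c \<in> OF - {0}" "X = frac x c" by (rule fraction_moduleE)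
      have c0: "c \<noteq> 0" using xc(2) by simp
      have "\<exists>r\<in>Ov. h x y = \<iota> c * r" if y: "y \<in> B.V" for y
      proof -
        have "\<iota> (inverse (c * 1)) * ?h x (\<beta> \<rhd> y) \<in> Ov"
          using X \<beta>_act(1)[OF y] ext[OF xc(1,2) \<beta>_act(1)[OF y] one_OF] xc(3) by (auto simp: to_fraction_eq)
        then have "\<iota> (inverse c) * h x y \<in> Ov" using \<beta>_act(4)[OF y] by simp
        moreover have "h x y = \<iota> c * (\<iota> (inverse c) * h x y)"
          using \<iota>_inverse[OF c0] by (simp add: mult.assoc[symmetric])
        ultimately show ?thesis by blast
      qed
      then obtain w where w: "w \<in> B.V" "x = \<iota> c \<rhd> w" using divisible[OF xc(2,1)] by blast
      have "frac x c = frac w 1"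
        by (rule frac_eq) (use xc w one_OF B.one_l in \<open>simp add: rel_iff \<iota>_simps\<close>)
      then show "X \<in> to_fraction \<iota> OF L ` B.V" using w(1) xc(3) by (auto simp: to_fraction_eq)
    qed
  qed
  moreover have "hp ?h"
  proof -
    have "\<forall>x\<in>B.V. \<forall>y\<in>B.V. \<forall>z\<in>B.V. ?h (x + y) z = ?h x z + ?h y z \<and> ?h x (y + z) = ?h x y + ?h x z"
      by (intro ballI conjI) (rule add1, assumption+, rule add2, assumption+)
    moreover have "\<forall>c\<in>OF. \<forall>x\<in>B.V. \<forall>y\<in>B.V. ?h (\<iota> c \<rhd> x) y = \<iota> c * ?h x y \<and> ?h x (\<iota> c \<rhd> y) = \<iota> c * ?h x y"
      by (intro ballI) (rule sc)
    moreover have "\<forall>X\<in>fraction_module \<iota> OF L.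
        (\<forall>Y\<in>fraction_module \<iota> OF L. extend_pairing \<iota> ?h X Y = 0) \<longrightarrow> X = to_fraction \<iota> OF L 0"
      using nondeg by blast
    moreover have "\<forall>x\<in>B.V. \<forall>y\<in>B.V. ?h x y = cj (?h y x)"
      by (intro ballI) (rule herm_sym)
    moreover have "\<forall>x\<in>B.V. \<forall>y\<in>B.V. \<forall>a\<in>Ov. \<forall>b\<in>Ov. ?h (x \<lhd> a) (y \<lhd> b) = cj a * ?h x y * b"
      by (intro ballI) (rule sesq)
    moreover have "\<forall>x\<in>B.V. \<forall>y\<in>B.V. \<forall>a\<in>Ov. ?h (a \<rhd> x) y = ?h x (starv a \<rhd> y)"
      by (intro ballI) (rule star)
    ultimately show ?thesis unfolding hp_iff by (intro conjI)
  qed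
  ultimately show ?thesis by (simp add: perfect_hermitian_pairing_def)
qed

end

lemma perfect_exists: assumes "parity_condition (ord \<gamma>) r1 r2 t1 t2" shows "\<exists>h. php h"
proof -
  obtain g where g: "B.basis std_kind (std_index r1 r2 t1 t2) g B.V" by (rule basis_exists)
  have "if od then r1 = r2 else even r1 \<and> even r2 \<and> t1 = t2"
    using assms unfolding parity_condition_def od_def by simp
  then obtain \<rho> s where "paired_basis OK cj P \<delta> \<omega> L od std_kind (std_index r1 r2 t1 t2) g \<rho> s"
    using B.paired_basis_std[OF g] by blast
  then interpret E: paired_basis OK cj P \<delta> \<omega> L od std_kind "std_index r1 r2 t1 t2" g \<rho> s .
  show ?thesis using untwisted_perfect[OF E.herm E.LP] by blast
qed

end

locale two_lattices =
  A: local_lattice \<iota> wv cj ord Ov K \<sigma> \<pi> P \<gamma> \<gamma>' starv \<delta> \<omega> L r1 r2 t1 t2 +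
  A': local_lattice \<iota> wv cj ord Ov K \<sigma> \<pi> P \<gamma> \<gamma>' starv \<delta> \<omega> L' r1 r2 t1 t2
  for \<iota> :: "'k::field \<Rightarrow> 'a::ring_1" and wv cj ord Ov K \<sigma> \<pi> P \<gamma> \<gamma>' starv \<delta> \<omega>
    and L :: "('a, 'l::ab_group_add) bimodule" and L' :: "('a, 'm::ab_group_add) bimodule" and r1 r2 t1 t2
begin

text \<open>An isometry of the normalized pairings commutes with \<open>\<beta>\<close>, which is
  invertible, so it preserves the original ones.\<close>

lemma perfect_unique: assumes h: "A.php h" and k: "A'.php k" shows "isometric Ov L h L' k"
proof -
  interpret H: herm_pair A.OK cj P \<delta> \<omega> L L' A.od "\<lambda>x y. h x (lact L A.\<beta> y)" "\<lambda>x y. k x (lact L' A.\<beta> y)"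
    by (intro herm_pair.intro A.twisted_herm[OF h] A'.twisted_herm[OF k])
  obtain g where g: "A.B.basis std_kind (std_index r1 r2 t1 t2) g A.B.V" by (rule A.basis_exists)
  obtain g' where g': "A'.B.basis std_kind (std_index r1 r2 t1 t2) g' A'.B.V" by (rule A'.basis_exists)
  have "H.iso A.B.V A'.B.V"
    by (rule H.unique_up_to_isometry[OF g A.twisted_LP[OF h] g' A'.twisted_LP[OF k] refl])
  then obtain f where f: "bij_betw f A.B.V A'.B.V" "\<And>x y. x \<in> A.B.V \<Longrightarrow> y \<in> A.B.V \<Longrightarrow> f (x + y) = f x + f y"
    "\<And>a x. a \<in> A.Q.R \<Longrightarrow> x \<in> A.B.V \<Longrightarrow> f (lact L a x) = lact L' a (f x)"
    "\<And>a x. a \<in> A.Q.R \<Longrightarrow> x \<in> A.B.V \<Longrightarrow> f (ract L x a) = ract L' (f x) a"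
    "\<And>x y. x \<in> A.B.V \<Longrightarrow> y \<in> A.B.V \<Longrightarrow> k (f x) (lact L' A.\<beta> (f y)) = h x (lact L A.\<beta> y)"
    by (rule H.isoE) blast
  have "k (f x) (f y) = h x y" if x: "x \<in> A.B.V" and y: "y \<in> A.B.V" for x y
  proof -
    note y' = A.\<beta>_act(2)[OF y]
    have "f y = lact L' A.\<beta> (f (lact L A.\<beta>' y))"
      using f(3)[OF A.R_I[OF A.\<beta>(1)] y'] A.\<beta>_act(3)[OF y] by simp
    then show ?thesis using f(5)[OF x y'] A.\<beta>_act(3)[OF y] by simp
  qed
  then show ?thesis
    unfolding isometric_def bimodule_iso_def using f by (intro exI[of _ f]) (auto simp: A.R_eq)
qed

end

section \<open>Number fields\<close>

lemma ring_map_field_simps: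
  assumes "ring_map (f :: 'a::field \<Rightarrow> 'b::ring_1)"
  shows "f 0 = 0" "f (x - y) = f x - f y" "f x = 0 \<longleftrightarrow> x = 0" "f (- x) = - f x" "f 1 = 1"
    "f (x + y) = f x + f y" "f (x * y) = f x * f y" "f x = f y \<longleftrightarrow> x = y"
proof -
  have f: "f 1 = 1" "\<And>x y. f (x + y) = f x + f y" "\<And>x y. f (x * y) = f x * f y"
    using assms by (auto simp: ring_map_def)
  show f0: "f 0 = 0" using f(2)[of 0 0] by simp
  show fm: "f (- x) = - f x" for x using f(2)[of x "- x"] f0 by (simp add: eq_neg_iff_add_eq_0 add.commute)
  show fd: "f (x - y) = f x - f y" for x y using f(2)[of x "- y"] fm by simp
  show fz: "f x = 0 \<longleftrightarrow> x = 0" for x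
  proof
    assume "f x = 0"
    then have "x \<noteq> 0 \<Longrightarrow> f 1 = 0" using f(3)[of x "inverse x"] by simp
    then show "x = 0" using f(1) by auto
  qed (simp add: f0)
  show "f x = f y \<longleftrightarrow> x = y" using fz[of "x - y"] fd by auto
qed (use assms in \<open>auto simp: ring_map_def\<close>)

lemma ring_map_of_rat: "ring_map (of_rat :: rat \<Rightarrow> 'f::field_char_0)"
  by (simp add: ring_map_def of_rat_add of_rat_mult)

text \<open>Independence is a property of sets, while a family may repeat values; a repetition gives
  a relation with coefficients 1 and -1.\<close>

lemma finite_dim_dependent:
  assumes X: "alg_basis \<iota> X" and \<iota>: "ring_map (\<iota> :: 'k::field \<Rightarrow> 'a::ring_1)" and m: "m > card X"
  shows "\<exists>c :: nat \<Rightarrow> 'k. (\<exists>i<m. c i \<noteq> 0) \<and> (\<Sum>i<m. \<iota> (c i) * x i) = 0"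
proof (cases "inj_on x {..<m}")
  case False
  then obtain i j where ij: "i < m" "j < m" "i \<noteq> j" "x i = x j" by (auto simp: inj_on_def)
  define c :: "nat \<Rightarrow> 'k" where "c k = (if k = i then 1 else if k = j then - 1 else 0)" for k
  have "(\<Sum>k<m. \<iota> (c k) * x k) = (\<Sum>k<m. (if k = i then x i else 0) - (if k = j then x j else 0))"
    using ij(3) by (intro sum.cong refl) (auto simp: c_def ring_map_field_simps[OF \<iota>])
  also have "\<dots> = 0" using ij by (simp add: sum_subtractf)
  finally have "(\<Sum>k<m. \<iota> (c k) * x k) = 0" .
  moreover have "c i \<noteq> 0" by (simp add: c_def)
  ultimately show ?thesis using ij(1) by blast
next
  case True
  interpret F: finite_dimensional_vector_space "alg_scale \<iota>" X by (rule X)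
  have "F.dependent (x ` {..<m})"
  proof (rule ccontr)
    assume "F.independent (x ` {..<m})"
    then have "card (x ` {..<m}) \<le> F.dim UNIV" by (intro F.independent_card_le_dim) auto
    also have "F.dim UNIV = card X"
      using F.dim_eq_card[OF _ F.independent_Basis] F.span_Basis by simp
    finally show False using m True by (simp add: card_image)
  qed
  then obtain u where u: "\<exists>v\<in>x ` {..<m}. u v \<noteq> 0" "(\<Sum>v\<in>x ` {..<m}. \<iota> (u v) * v) = 0"
    using F.dependent_finite[of "x ` {..<m}"] by auto
  have "(\<Sum>i<m. \<iota> (u (x i)) * x i) = 0"
    using u(2) by (simp add: sum.reindex[OF True])
  moreover have "\<exists>i<m. u (x i) \<noteq> 0" using u(1) by auto
  ultimately show ?thesis by (intro exI[of _ "\<lambda>i. u (x i)"]) blast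
qed

text \<open>A field embedding is a common eigenvector of all multiplications in the space of linear maps
  to the complex numbers; such an eigenvector is found for one basis element after the other.\<close>

lemma eigenvector_step:
  fixes a :: "'f::field_char_0" and Good :: "('f \<Rightarrow> complex) \<Rightarrow> bool"
  assumes closed: "\<And>\<phi> z. Good \<phi> \<Longrightarrow> Good (\<lambda>y. \<phi> (a * y) - z * \<phi> y)"
  shows "Good \<phi> \<Longrightarrow> \<phi> \<noteq> (\<lambda>_. 0) \<Longrightarrow> p \<noteq> 0 \<Longrightarrow> degree p \<le> N \<Longrightarrow>
    (\<And>y. (\<Sum>i\<le>N. coeff p i * \<phi> (a ^ i * y)) = 0) \<Longrightarrow>
    \<exists>\<psi> z. Good \<psi> \<and> \<psi> \<noteq> (\<lambda>_. 0) \<and> (\<forall>y. \<psi> (a * y) = z * \<psi> y)"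
proof (induction N arbitrary: \<phi> p)
  case 0
  then have "coeff p 0 \<noteq> 0" by (metis leading_coeff_0_iff le_zero_eq)
  moreover obtain y where "\<phi> y \<noteq> 0" using 0 by fastforce
  ultimately show ?case using "0.prems"(5)[of y] by simp
next
  case (Suc N)
  show ?case
  proof (cases "degree p \<le> N")
    case True
    then have "coeff p (Suc N) = 0" by (intro coeff_eq_0) simp
    then show ?thesis using Suc.IH[OF Suc.prems(1-3) True] Suc.prems(5) by simp
  next
    case False
    then have "\<not> constant (poly p)" by (simp add: constant_degree)
    then obtain z where "poly p z = 0" using fundamental_theorem_of_algebra by blast
    then obtain q where q: "p = [:- z, 1:] * q" by (auto simp: poly_eq_0_iff_dvd dvd_def)
    then have q0: "q \<noteq> 0" using Suc.prems(3) by auto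
    have dq: "degree q \<le> N" using Suc.prems(4) degree_mult_eq[of "[:- z, 1:]" q] q q0 by simp
    then have qN: "coeff q (Suc N) = 0" by (intro coeff_eq_0) simp
    \<comment> \<open>With a root \<open>z\<close> of \<open>p\<close> split off, either
      \<open>\<psi>\<close> is zero and \<open>\<phi>\<close> is already an eigenvector, or
      \<open>q\<close>, of smaller degree, annihilates \<open>\<psi>\<close>.\<close>
    define \<psi> where "\<psi> = (\<lambda>y. \<phi> (a * y) - z * \<phi> y)"
    have p: "p = pCons 0 q - smult z q" unfolding q by (simp add: algebra_simps)
    have pc: "coeff p 0 = - z * coeff q 0" "coeff p (Suc i) = coeff q i - z * coeff q (Suc i)" for i
      unfolding p by simp_all
    have act: "(\<Sum>i\<le>N. coeff q i * \<psi> (a ^ i * y)) = 0" for y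
    proof -
      have "(\<Sum>i\<le>Suc N. coeff p i * \<phi> (a ^ i * y)) =
          - z * coeff q 0 * \<phi> y + (\<Sum>i\<le>N. (coeff q i - z * coeff q (Suc i)) * \<phi> (a ^ Suc i * y))"
        by (subst sum.atMost_Suc_shift) (simp add: pc)
      also have "(\<Sum>i\<le>N. (coeff q i - z * coeff q (Suc i)) * \<phi> (a ^ Suc i * y)) =
          (\<Sum>i\<le>N. coeff q i * \<phi> (a ^ Suc i * y)) - z * (\<Sum>i\<le>N. coeff q (Suc i) * \<phi> (a ^ Suc i * y))"
        by (simp add: left_diff_distrib sum_subtractf sum_distrib_left mult.assoc)
      also have "(\<Sum>i\<le>N. coeff q (Suc i) * \<phi> (a ^ Suc i * y)) =
          (\<Sum>i\<le>Suc N. coeff q i * \<phi> (a ^ i * y)) - coeff q 0 * \<phi> y"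
        by (simp only: sum.atMost_Suc_shift) simp
      also have "(\<Sum>i\<le>Suc N. coeff q i * \<phi> (a ^ i * y)) = (\<Sum>i\<le>N. coeff q i * \<phi> (a ^ i * y))"
        using qN by simp
      finally have eq: "(\<Sum>i\<le>Suc N. coeff p i * \<phi> (a ^ i * y)) = - z * coeff q 0 * \<phi> y +
        ((\<Sum>i\<le>N. coeff q i * \<phi> (a ^ Suc i * y)) -
          z * ((\<Sum>i\<le>N. coeff q i * \<phi> (a ^ i * y)) - coeff q 0 * \<phi> y))" .
      have "u - z * v = 0" if "l = - z * k * f + (u - z * (v - k * f))" "l = 0" for l k f u v :: complex
        using that by (simp add: algebra_simps)
      from this[OF eq Suc.prems(5)]
      have "(\<Sum>i\<le>N. coeff q i * \<phi> (a ^ Suc i * y)) - z * (\<Sum>i\<le>N. coeff q i * \<phi> (a ^ i * y)) = 0" .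
      then show ?thesis
        by (simp add: \<psi>_def right_diff_distrib sum_subtractf sum_distrib_left ac_simps)
    qed
    show ?thesis
    proof (cases "\<psi> = (\<lambda>_. 0)")
      case True
      have "\<phi> (a * y) - z * \<phi> y = 0" for y using fun_cong[OF True, of y] unfolding \<psi>_def .
      then have "\<phi> (a * y) = z * \<phi> y" for y by simp
      then show ?thesis using Suc.prems(1,2) by blast
    next
      case False
      show ?thesis
        by (rule Suc.IH[OF _ False q0 dq act]) (use closed[OF Suc.prems(1)] \<psi>_def in simp)
    qed
  qed
qed

text \<open>Without embeddings \<open>totally_negative\<close> would hold vacuously, so one has to
  be produced. By commutativity a new eigenvector can be sought among those with the eigenvalues
  already found, and the eigenvalues of a common eigenvector form a ring homomorphism.\<close>

lemma number_field_embedding: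
  assumes "number_field TYPE('f::field_char_0)"
  shows "\<exists>s :: 'f \<Rightarrow> complex. ring_map s"
proof -
  obtain X where X: "alg_basis (of_rat :: rat \<Rightarrow> 'f) X" using assms by (auto simp: number_field_def)
  interpret F: finite_dimensional_vector_space "alg_scale (of_rat :: rat \<Rightarrow> 'f)" X by (rule X)
  define Lin where "Lin \<phi> \<longleftrightarrow> (\<forall>x y. \<phi> (x + y) = \<phi> x + \<phi> y) \<and> (\<forall>c x. \<phi> (of_rat c * x) = of_rat c * \<phi> x)"
    for \<phi> :: "'f \<Rightarrow> complex"
  have Lin_sum: "\<phi> (\<Sum>i\<in>A. of_rat (c i) * w i) = (\<Sum>i\<in>A. of_rat (c i) * \<phi> (w i))"
    if "Lin \<phi>" for \<phi> and A :: "nat set" and c w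
  proof -
    have "\<phi> 0 = 0" using that unfolding Lin_def by (metis add_cancel_right_right add.right_neutral)
    then show ?thesis
      by (induction A rule: infinite_finite_induct) (use that in \<open>auto simp: Lin_def\<close>)
  qed
  have eig: "\<exists>\<phi>. Lin \<phi> \<and> \<phi> \<noteq> (\<lambda>_. 0) \<and> (\<forall>x\<in>A. \<exists>z. \<forall>y. \<phi> (x * y) = z * \<phi> y)" if "finite A" for A
    using that
  proof (induction A rule: finite_induct)
    case empty
    have "X \<noteq> {}"
    proof
      assume "X = {}"
      then have "(1::'f) \<in> F.span {}" using F.span_Basis by auto
      then show False by simp
    qed
    then obtain b where b: "b \<in> X" by blast
    \<comment> \<open>Any nonzero linear functional may start the construction; a coordinate in the
      basis is one.\<close>
    define \<phi> :: "'f \<Rightarrow> complex" where "\<phi> x = of_rat (F.representation X x b)" for x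
    have "Lin \<phi>"
      unfolding Lin_def \<phi>_def using F.independent_Basis F.span_Basis
      by (simp add: F.representation_add F.representation_scale of_rat_add of_rat_mult)
    moreover have "\<phi> b \<noteq> 0" using F.representation_basis[OF F.independent_Basis b] by (simp add: \<phi>_def)
    then have "\<phi> \<noteq> (\<lambda>_. 0)" by auto
    ultimately show ?case by blast
  next
    case (insert a A)
    then obtain \<phi> where \<phi>: "Lin \<phi>" "\<phi> \<noteq> (\<lambda>_. 0)" "\<forall>x\<in>A. \<exists>z. \<forall>y. \<phi> (x * y) = z * \<phi> y" by blast
    then obtain ev where ev: "\<And>x y. x \<in> A \<Longrightarrow> \<phi> (x * y) = ev x * \<phi> y" by metis
    define Good where "Good \<psi> \<longleftrightarrow> Lin \<psi> \<and> (\<forall>x\<in>A. \<forall>y. \<psi> (x * y) = ev x * \<psi> y)" for \<psi>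
    have closed: "Good (\<lambda>y. \<psi> (a * y) - z * \<psi> y)" if "Good \<psi>" for \<psi> z
    proof -
      have "\<psi> (a * (x * y)) = ev x * \<psi> (a * y)" if "x \<in> A" for x y
        using \<open>Good \<psi>\<close> that unfolding Good_def by (metis mult.left_commute)
      moreover have "\<psi> (a * (of_rat c * x)) = of_rat c * \<psi> (a * x)" for c x
        using \<open>Good \<psi>\<close> unfolding Good_def Lin_def by (metis mult.left_commute)
      ultimately show ?thesis
        using that unfolding Good_def Lin_def by (simp add: distrib_left algebra_simps)
    qed
    obtain c :: "nat \<Rightarrow> rat" where c: "\<exists>i<Suc (card X). c i \<noteq> 0" "(\<Sum>i<Suc (card X). of_rat (c i) * a ^ i) = 0"
      using finite_dim_dependent[OF X ring_map_of_rat lessI, of "\<lambda>i. a ^ i"] by blast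
    define p :: "complex poly" where "p = (\<Sum>i<Suc (card X). monom (of_rat (c i)) i)"
    have cp: "coeff p i = (if i < Suc (card X) then of_rat (c i) else 0)" for i
      by (simp add: p_def coeff_sum if_distrib sum.If_cases Int_def cong: if_cong)
    have p0: "p \<noteq> 0" using c(1) cp by (metis coeff_0 of_rat_eq_0_iff)
    have dp: "degree p \<le> card X" by (rule degree_le) (simp add: cp)
    have "(\<Sum>i\<le>card X. coeff p i * \<phi> (a ^ i * y)) = 0" for y
    proof -
      have "(\<Sum>i\<le>card X. coeff p i * \<phi> (a ^ i * y)) = (\<Sum>i<Suc (card X). of_rat (c i) * \<phi> (a ^ i * y))"
        by (simp add: cp lessThan_Suc_atMost)
      also have "\<dots> = \<phi> (\<Sum>i<Suc (card X). of_rat (c i) * (a ^ i * y))" using Lin_sum[OF \<phi>(1)] by metis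
      also have "(\<Sum>i<Suc (card X). of_rat (c i) * (a ^ i * y)) = (\<Sum>i<Suc (card X). of_rat (c i) * a ^ i) * y"
        by (simp add: sum_distrib_right mult.assoc distrib_right)
      also have "\<phi> \<dots> = 0" using c(2) \<phi>(1) unfolding Lin_def by (metis add_cancel_right_right mult_zero_left add.right_neutral)
      finally show ?thesis .
    qed
    moreover have "Good \<phi>" using \<phi>(1) ev by (simp add: Good_def)
    ultimately obtain \<psi> z where "Good \<psi>" "\<psi> \<noteq> (\<lambda>_. 0)" "\<forall>y. \<psi> (a * y) = z * \<psi> y"
      using eigenvector_step[of Good a, OF closed _ \<phi>(2) p0 dp] by blast
    then show ?case unfolding Good_def by blast
  qed
  obtain \<phi> where \<phi>: "Lin \<phi>" "\<phi> \<noteq> (\<lambda>_. 0)" "\<forall>x\<in>X. \<exists>z. \<forall>y. \<phi> (x * y) = z * \<phi> y"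
    using eig[OF F.finite_Basis] by blast
  have ev: "\<exists>z. \<forall>y. \<phi> (x * y) = z * \<phi> y" for x
  proof -
    have "x \<in> F.span X" using F.span_Basis by simp
    then show ?thesis
    proof (induction rule: F.span_induct_alt)
      case base
      have "\<phi> 0 = 0" using \<phi>(1) unfolding Lin_def by (metis add_cancel_right_right add.right_neutral)
      then show ?case by (intro exI[of _ 0]) simp
    next
      case (step c x y)
      then obtain z w where "\<forall>u. \<phi> (x * u) = z * \<phi> u" "\<forall>u. \<phi> (y * u) = w * \<phi> u" using \<phi>(3) by blast
      then have "\<phi> ((of_rat c * x + y) * u) = (of_rat c * z + w) * \<phi> u" for u
        using \<phi>(1) unfolding Lin_def by (simp add: distrib_right mult.assoc)
      then show ?case by blast
    qed
  qed
  then obtain s where s: "\<And>x y. \<phi> (x * y) = s x * \<phi> y" by metis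
  obtain y0 where y0: "\<phi> y0 \<noteq> 0" using \<phi>(2) by fastforce
  have "ring_map s"
    unfolding ring_map_def
  proof (intro conjI allI)
    show "s 1 = 1" using s[of 1 y0] y0 by simp
    fix x y
    have "s (x + y) * \<phi> y0 = (s x + s y) * \<phi> y0"
      using s[of "x + y" y0] s[of x y0] s[of y y0] \<phi>(1) unfolding Lin_def by (simp add: distrib_right)
    then show "s (x + y) = s x + s y" using y0 by simp
    have "s (x * y) * \<phi> y0 = s x * s y * \<phi> y0"
      using s[of "x * y" y0] s[of x "y * y0"] s[of y y0] by (metis mult.assoc)
    then show "s (x * y) = s x * s y" using y0 by simp
  qed
  then show ?thesis by blast
qed

lemma real_embedding:
  assumes "number_field TYPE('f::field_char_0)" "totally_real TYPE('f)"
  shows "\<exists>s :: 'f \<Rightarrow> real. ring_map s"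
proof -
  obtain s :: "'f \<Rightarrow> complex" where s: "ring_map s" using number_field_embedding[OF assms(1)] by blast
  then have real: "s x \<in> \<real>" for x using assms(2) by (auto simp: totally_real_def)
  then have "s x = of_real (Re (s x))" for x by (simp add: complex_is_Real_iff complex_eq_iff)
  then have "ring_map (\<lambda>x. Re (s x))"
    using s real unfolding ring_map_def by (auto simp: complex_is_Real_iff)
  then show ?thesis by blast
qed

context ultrametric_field
begin

lemma wv_of_nat: "wv (of_nat n) \<le> 1"
  by (induction n) (auto simp: wv_0 wv_1 intro: ultra)

lemma wv_of_int: "wv (of_int a) \<le> 1"
  using wv_of_nat[of "nat a"] wv_of_nat[of "nat (- a)"] wv_minus[of "of_int a"]
  by (cases "a \<ge> 0") auto

end

lemma clear_denominators:
  "\<exists>d::int. d > 0 \<and> (\<forall>i<m. \<exists>b::int. (c :: nat \<Rightarrow> rat) i * of_int d = of_int b)"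
proof (induction m)
  case 0
  then show ?case by (intro exI[of _ 1]) simp
next
  case (Suc m)
  then obtain d where d: "d > 0" "\<And>i. i < m \<Longrightarrow> \<exists>b. c i * of_int d = of_int b" by blast
  obtain a b where ab: "b > 0" "c m = of_int a / of_int b"
    by (metis Fract_of_int_quotient Rat_cases)
  have "\<exists>e. c i * of_int (d * b) = of_int e" if i: "i < Suc m" for i
  proof (cases "i = m")
    case True
    then have "c i * of_int (d * b) = of_int (a * d)" using ab by simp
    then show ?thesis by blast
  next
    case False
    then have "i < m" using i by simp
    then obtain e where "c i * of_int d = of_int e" using d(2) by blast
    then have "c i * of_int (d * b) = of_int (e * b)" by (simp add: mult.assoc[symmetric])
    then show ?thesis by blast
  qed
  then show ?case using d(1) ab(1) by (intro exI[of _ "d * b"]) simp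
qed

text \<open>Elements that are linearly independent modulo \<open>p\<close> are linearly independent over the
  rationals, so a maximal family of such elements is finite and spans the residue field.\<close>

lemma (in ultrametric_field) residue_field_finite:
  fixes j :: "'f::field_char_0 \<Rightarrow> 'k"
  assumes nf: "number_field TYPE('f)" and j: "ring_map j"
    and dense: "\<And>y e. e > 0 \<Longrightarrow> \<exists>x. wv (y - j x) < e"
    and p: "prime (p::nat)" "wv (j (of_nat p)) < 1"
  shows "\<exists>T. finite T \<and> (\<forall>x. wv x \<le> 1 \<longrightarrow> (\<exists>t\<in>T. wv (x - t) < 1))"
proof -
  note js = ring_map_field_simps[OF j]
  define v where "v x = wv (j x)" for x
  have j_nat: "j (of_nat n) = of_nat n" for n by (induction n) (simp_all add: js)
  have j_int: "j (of_int a) = of_int a" for a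
    by (cases a rule: int_cases2) (simp_all add: j_nat js)
  have v_int: "v (of_int a) \<le> 1" for a unfolding v_def j_int by (rule wv_of_int)
  have v_mult: "v (x * y) = v x * v y" for x y by (simp add: v_def js wv_mult)
  have v_mult_le: "v (x * y) \<le> 1" if "v x \<le> 1" "v y \<le> 1" for x y
    using wv_mult_le[of "j x" "j y"] that by (simp add: v_def js)
  have v_mult_less: "v (x * y) < 1" if "v x < 1" "v y \<le> 1" for x y
    using wv_mult_less[of "j x" "j y"] that by (simp add: v_def js)
  have v_add: "v (x + y) < 1" if "v x < 1" "v y < 1" for x y
    using wv_add_less[of "j x" 1 "j y"] that by (simp add: v_def js)
  have v_diff: "v (x - y) < 1" if "v x < 1" "v y < 1" for x y
    using wv_diff_less[of "j x" 1 "j y"] that by (simp add: v_def js)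
  have v_0: "v 0 = 0" by (simp add: v_def js wv_0)
  have v_sum: "v (\<Sum>i<n. f i) < 1" if "\<And>i. i < n \<Longrightarrow> v (f i) < 1" for f and n :: nat
    using that by (induction n) (auto simp: v_0 intro: v_add)
  have v_p: "v (of_int a) < 1" if a: "int p dvd a" for a
  proof -
    obtain b where "a = int p * b" using a by (auto simp: dvd_def)
    then show ?thesis using v_mult_less[of "of_nat p" "of_int b"] v_int p(2) by (simp add: v_def)
  qed
  have p0: "p > 1" using p(1) prime_gt_1_nat by blast
  obtain X where X: "alg_basis (of_rat :: rat \<Rightarrow> 'f) X" using nf by (auto simp: number_field_def)
  \<comment> \<open>Integral elements whose integer combinations lie in the maximal ideal only when
    \<open>p\<close> divides all coefficients.\<close>
  define indep where "indep m x \<longleftrightarrow> (\<forall>i<m. v (x i) \<le> 1) \<and>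
    (\<forall>a :: nat \<Rightarrow> int. v (\<Sum>i<m. of_int (a i) * x i) < 1 \<longrightarrow> (\<forall>i<m. int p dvd a i))" for m and x :: "nat \<Rightarrow> 'f"
  have zero: "\<forall>i<m. a i = 0"
    if ind: "indep m x" and s: "(\<Sum>i<m. of_int (a i) * x i) = 0" for m x and a :: "nat \<Rightarrow> int"
    using s
  \<comment> \<open>Descent: an exact relation has all coefficients divisible by \<open>p\<close>,
    and dividing them by \<open>p\<close> leaves a smaller relation unless they are all
    zero.\<close>
  proof (induction "nat (\<Sum>i<m. \<bar>a i\<bar>)" arbitrary: a rule: less_induct)
    case less
    have "\<forall>i<m. int p dvd a i" using ind less.prems v_0 unfolding indep_def by simp
    then have "\<forall>i. \<exists>b. i < m \<longrightarrow> a i = int p * b" by (auto simp: dvd_def)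
    then obtain b where b: "\<And>i. i < m \<Longrightarrow> a i = int p * b i" by metis
    have "(\<Sum>i<m. of_int (a i) * x i) = of_nat p * (\<Sum>i<m. of_int (b i) * x i)"
      unfolding sum_distrib_left by (intro sum.cong refl) (simp add: b)
    then have s': "(\<Sum>i<m. of_int (b i) * x i) = 0" using less.prems p0 by simp
    have abs: "(\<Sum>i<m. \<bar>a i\<bar>) = int p * (\<Sum>i<m. \<bar>b i\<bar>)"
      unfolding sum_distrib_left by (intro sum.cong refl) (simp add: b abs_mult)
    have nn: "(\<Sum>i<m. \<bar>b i\<bar>) \<ge> 0" by (intro sum_nonneg) simp
    show ?case
    proof (cases "(\<Sum>i<m. \<bar>b i\<bar>) = 0")
      case True
      then have "\<forall>i<m. b i = 0" by (simp add: sum_nonneg_eq_0_iff)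
      then show ?thesis using b by simp
    next
      case False
      then have "(\<Sum>i<m. \<bar>b i\<bar>) < (\<Sum>i<m. \<bar>a i\<bar>)"
        unfolding abs using nn p0 mult_strict_right_mono[of 1 "int p" "\<Sum>i<m. \<bar>b i\<bar>"] by linarith
      then have "nat (\<Sum>i<m. \<bar>b i\<bar>) < nat (\<Sum>i<m. \<bar>a i\<bar>)" using nn by linarith
      then show ?thesis using less.hyps s' b by simp
    qed
  qed
  have bound: "m \<le> card X" if ind: "indep m x" for m x
  proof (rule ccontr)
    assume "\<not> m \<le> card X"
    then obtain c :: "nat \<Rightarrow> rat" where c: "\<exists>i<m. c i \<noteq> 0" "(\<Sum>i<m. of_rat (c i) * x i) = 0"
      using finite_dim_dependent[OF X ring_map_of_rat, of m x] by auto
    obtain d where d: "d > 0" "\<forall>i<m. \<exists>b. c i * of_int d = of_int b" using clear_denominators by blast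
    then obtain a where a: "\<And>i. i < m \<Longrightarrow> c i * of_int d = of_int (a i)" by metis
    have "(\<Sum>i<m. of_int (a i) * x i) = (\<Sum>i<m. of_int d * (of_rat (c i) * x i))"
    proof (intro sum.cong refl)
      fix i assume "i \<in> {..<m}"
      then have "(of_int (a i) :: 'f) = of_rat (c i * of_int d)" using a by simp
      then show "of_int (a i) * x i = of_int d * (of_rat (c i) * x i)" by (simp add: of_rat_mult)
    qed
    also have "\<dots> = 0" using c(2) by (simp add: sum_distrib_left[symmetric])
    finally have "\<forall>i<m. a i = 0" using zero[OF ind] by blast
    then have "\<forall>i<m. c i = 0" using a d(1) by force
    then show False using c(1) by blast
  qed
  have "\<exists>m x. indep m x \<and> (\<forall>x'. \<not> indep (Suc m) x')"
  proof (rule ccontr)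
    assume no: "\<not> ?thesis"
    have "\<exists>x. indep m x" for m
    proof (induction m)
      case 0
      show ?case by (simp add: indep_def)
    next
      case (Suc m)
      then show ?case using no by blast
    qed
    then show False using bound[of "Suc (card X)"] by auto
  qed
  then obtain m x where ind: "indep m x" and max: "\<And>x'. \<not> indep (Suc m) x'" by blast
  have xi: "v (x i) \<le> 1" if "i < m" for i using ind that by (simp add: indep_def)
  define T where "T = (\<lambda>f. j (\<Sum>i<m. of_int (f i) * x i)) ` (PiE {..<m} (\<lambda>_. {0..<int p}))"
  have "finite T" unfolding T_def by (intro finite_imageI finite_PiE) auto
  moreover have "\<exists>t\<in>T. wv (z - t) < 1" if z: "wv z \<le> 1" for z
  proof -
    obtain y where y: "wv (z - j y) < 1" using dense[of 1 z] by auto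
    have vy: "v y \<le> 1" using wv_diff[of z "z - j y"] y z by (simp add: v_def)
    define x' where "x' = x(m := y)"
    have "\<forall>i<Suc m. v (x' i) \<le> 1" using xi vy by (auto simp: x'_def less_Suc_eq)
    \<comment> \<open>Maximality makes the family extended by \<open>y\<close> dependent; the
      coefficient of \<open>y\<close> will not be divisible by \<open>p\<close>, since the first
      \<open>m\<close> elements are independent.\<close>
    then obtain a :: "nat \<Rightarrow> int" where a: "v (\<Sum>i<Suc m. of_int (a i) * x' i) < 1" "\<not> (\<forall>i<Suc m. int p dvd a i)"
      using max[of x'] unfolding indep_def by blast
    define S where "S = (\<Sum>i<m. of_int (a i) * x i)"
    have Sa: "v (S + of_int (a m) * y) < 1"
      using a(1) by (simp add: x'_def S_def)
    have "\<not> int p dvd a m"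
    proof
      assume pa: "int p dvd a m"
      have "v (S + of_int (a m) * y - of_int (a m) * y) < 1"
        by (intro v_diff Sa v_mult_less v_p pa vy)
      then have "\<forall>i<m. int p dvd a i" using ind unfolding indep_def S_def by simp
      then show False using a(2) pa by (auto simp: less_Suc_eq)
    qed
    then have "coprime (int p) (a m)" using p(1) by (simp add: prime_imp_coprime)
    then obtain u b where ub: "u * int p + b * a m = 1" using bezout_int[of "int p" "a m"] by auto
    \<comment> \<open>\<open>b\<close> inverts the coefficient of \<open>y\<close> modulo
      \<open>p\<close>, so \<open>y\<close> is congruent to \<open>- b\<close> times the combination
      of the others. Reducing these coefficients modulo \<open>p\<close> leaves finitely many
      possibilities.\<close>
    define f where "f = restrict (\<lambda>i. (- b * a i) mod int p) {..<m}"
    have fT: "f \<in> PiE {..<m} (\<lambda>_. {0..<int p})" using p0 by (auto simp: f_def)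
    define t where "t = (\<Sum>i<m. of_int (f i) * x i)"
    have tT: "j t \<in> T" unfolding T_def t_def using fT by blast
    have one: "(of_int u * of_nat p + of_int b * of_int (a m) :: 'f) = 1"
      using arg_cong[OF ub, of "of_int :: int \<Rightarrow> 'f"] by simp
    have "y = (of_int u * of_nat p + of_int b * of_int (a m)) * y" using one by simp
    then have yt: "y - t = of_nat p * (of_int u * y) + (S + of_int (a m) * y) * of_int b - (of_int b * S + t)"
      by (simp add: algebra_simps)
    have "of_int b * S + t = (\<Sum>i<m. of_int (b * a i + f i) * x i)"
      by (simp add: S_def t_def sum_distrib_left sum.distrib distrib_right mult.assoc)
    moreover have "v (\<Sum>i<m. of_int (b * a i + f i) * x i) < 1"
    proof (intro v_sum v_mult_less v_p xi)
      fix i assume i: "i < m"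
      have "(b * a i + (- b * a i) mod int p) mod int p = 0" by (simp add: mod_simps)
      then show "int p dvd b * a i + f i" using i by (auto simp: f_def)
    qed
    moreover have "v (of_nat p * (of_int u * y)) < 1"
      using p(2) by (intro v_mult_less v_mult_le v_int vy) (simp add: v_def)
    moreover have "v ((S + of_int (a m) * y) * of_int b) < 1" by (intro v_mult_less Sa v_int)
    ultimately have "v (y - t) < 1" unfolding yt by (metis v_add v_diff)
    then have "wv (j y - j t) < 1" by (simp add: v_def js)
    then have "wv (z - j t) < 1" using wv_trans[OF y] by blast
    then show ?thesis using tT by blast
  qed
  ultimately show ?thesis by blast
qed

section \<open>Base change of orders\<close>

locale scalar_subring =
  fixes \<iota> :: "'k::field \<Rightarrow> 'a::ring_1" and S :: "'k set"
  assumes \<iota>: "ring_map \<iota>" and central: "\<And>c x. \<iota> c * x = x * \<iota> c"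
    and S: "1 \<in> S" "0 \<in> S" "- 1 \<in> S" "\<And>x y. x \<in> S \<Longrightarrow> y \<in> S \<Longrightarrow> x + y \<in> S"
      "\<And>x y. x \<in> S \<Longrightarrow> y \<in> S \<Longrightarrow> x * y \<in> S"
begin

lemma span_over_zero: "0 \<in> span_over (alg_scale \<iota>) S Y"
  unfolding span_over_def by (intro CollectI exI[of _ "\<lambda>_. 0"] exI[of _ "{}"]) simp

lemma span_over_single: "s \<in> S \<Longrightarrow> y \<in> Y \<Longrightarrow> \<iota> s * y \<in> span_over (alg_scale \<iota>) S Y"
  unfolding span_over_def by (intro CollectI exI[of _ "\<lambda>_. s"] exI[of _ "{y}"]) simp

lemma span_over_add:
  assumes "x \<in> span_over (alg_scale \<iota>) S Y" "y \<in> span_over (alg_scale \<iota>) S Y"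
  shows "x + y \<in> span_over (alg_scale \<iota>) S Y"
proof -
  obtain c X where X: "finite X" "X \<subseteq> Y" "\<forall>z\<in>X. c z \<in> S" "x = (\<Sum>z\<in>X. \<iota> (c z) * z)"
    using assms(1) unfolding span_over_def by blast
  obtain c' X' where X': "finite X'" "X' \<subseteq> Y" "\<forall>z\<in>X'. c' z \<in> S" "y = (\<Sum>z\<in>X'. \<iota> (c' z) * z)"
    using assms(2) unfolding span_over_def by blast
  define e where "e z = (if z \<in> X then c z else 0)" for z
  define e' where "e' z = (if z \<in> X' then c' z else 0)" for z
  have "x = (\<Sum>z\<in>X \<union> X'. \<iota> (e z) * z)"
    unfolding X(4) by (rule sum.mono_neutral_cong_left) (auto simp: e_def X X' ring_map_field_simps[OF \<iota>])
  moreover have "y = (\<Sum>z\<in>X \<union> X'. \<iota> (e' z) * z)"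
    unfolding X'(4) by (rule sum.mono_neutral_cong_left) (auto simp: e'_def X X' ring_map_field_simps[OF \<iota>])
  ultimately have "x + y = (\<Sum>z\<in>X \<union> X'. \<iota> (e z + e' z) * z)"
    by (simp add: sum.distrib[symmetric] ring_map_field_simps[OF \<iota>] distrib_right)
  moreover have "\<forall>z\<in>X \<union> X'. e z + e' z \<in> S" using X(3) X'(3) S by (auto simp: e_def e'_def)
  ultimately show ?thesis
    unfolding span_over_def using X(1,2) X'(1,2)
    by (intro CollectI exI[of _ "\<lambda>z. e z + e' z"] exI[of _ "X \<union> X'"]) auto
qed

lemma span_over_sum:
  "(\<And>i. i \<in> A \<Longrightarrow> f i \<in> span_over (alg_scale \<iota>) S Y) \<Longrightarrow> sum f A \<in> span_over (alg_scale \<iota>) S Y"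
  by (induction A rule: infinite_finite_induct) (auto simp: span_over_zero span_over_add)

lemma span_over_scale:
  assumes "s \<in> S" "x \<in> span_over (alg_scale \<iota>) S Y" shows "\<iota> s * x \<in> span_over (alg_scale \<iota>) S Y"
proof -
  obtain c X where X: "finite X" "X \<subseteq> Y" "\<forall>z\<in>X. c z \<in> S" "x = (\<Sum>z\<in>X. \<iota> (c z) * z)"
    using assms(2) unfolding span_over_def by blast
  have "\<iota> s * x = (\<Sum>z\<in>X. \<iota> (s * c z) * z)"
    unfolding X(4) sum_distrib_left by (simp add: ring_map_field_simps[OF \<iota>] mult.assoc)
  also have "\<dots> \<in> span_over (alg_scale \<iota>) S Y"
    using X(2,3) assms(1) S(5) by (intro span_over_sum span_over_single) auto
  finally show ?thesis .
qed

lemma span_over_diff: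
  assumes "x \<in> span_over (alg_scale \<iota>) S Y" "y \<in> span_over (alg_scale \<iota>) S Y"
  shows "x - y \<in> span_over (alg_scale \<iota>) S Y"
  using span_over_add[OF assms(1) span_over_scale[OF S(3) assms(2)]] by (simp add: ring_map_field_simps[OF \<iota>])

lemma span_over_mult:
  assumes Y: "\<And>x y. x \<in> Y \<Longrightarrow> y \<in> Y \<Longrightarrow> x * y \<in> Y"
    and "x \<in> span_over (alg_scale \<iota>) S Y" "y \<in> span_over (alg_scale \<iota>) S Y"
  shows "x * y \<in> span_over (alg_scale \<iota>) S Y"
proof -
  obtain c X where X: "finite X" "X \<subseteq> Y" "\<forall>z\<in>X. c z \<in> S" "x = (\<Sum>z\<in>X. \<iota> (c z) * z)"
    using assms(2) unfolding span_over_def by blast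
  obtain c' X' where X': "finite X'" "X' \<subseteq> Y" "\<forall>z\<in>X'. c' z \<in> S" "y = (\<Sum>z\<in>X'. \<iota> (c' z) * z)"
    using assms(3) unfolding span_over_def by blast
  have prod: "\<iota> (c z) * z * (\<iota> (c' w) * w) = \<iota> (c z * c' w) * (z * w)" for z w
    using central[of "c' w" z] by (simp add: ring_map_field_simps[OF \<iota>] mult.assoc) (metis mult.assoc)
  have "x * y = (\<Sum>z\<in>X. \<Sum>w\<in>X'. \<iota> (c z * c' w) * (z * w))"
    unfolding X(4) X'(4) sum_product prod ..
  also have "\<dots> \<in> span_over (alg_scale \<iota>) S Y"
    by (intro span_over_sum span_over_single S(5) Y) (use X(2,3) X'(2,3) in auto)
  finally show ?thesis .
qed

end

lemma order_base_change_ring: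
  assumes nv: "normalized_valuation \<iota> wv ord" and av: "absolute_value wv" and \<iota>: "ring_map \<iota>"
    and j: "ring_map j" and central: "\<And>c x. \<iota> c * x = x * \<iota> c" and R: "is_order \<iota>0 S0 R"
  defines "R' \<equiv> order_base_change \<iota> j (valuation_ring wv) R"
  shows "1 \<in> R'" "x \<in> R' \<Longrightarrow> y \<in> R' \<Longrightarrow> x + y \<in> R'" "x \<in> R' \<Longrightarrow> y \<in> R' \<Longrightarrow> x - y \<in> R'"
    "x \<in> R' \<Longrightarrow> y \<in> R' \<Longrightarrow> x * y \<in> R'"
    "r \<in> R \<Longrightarrow> j r \<in> R'" "c \<in> valuation_ring wv \<Longrightarrow> x \<in> R' \<Longrightarrow> \<iota> c * x \<in> R'"
proof -
  interpret valued_algebra \<iota> wv ord by unfold_locales (use assms in auto)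
  have S: "1 \<in> valuation_ring wv" "0 \<in> valuation_ring wv" "- 1 \<in> valuation_ring wv"
    "\<And>x y. x \<in> valuation_ring wv \<Longrightarrow> y \<in> valuation_ring wv \<Longrightarrow> x + y \<in> valuation_ring wv"
    "\<And>x y. x \<in> valuation_ring wv \<Longrightarrow> y \<in> valuation_ring wv \<Longrightarrow> x * y \<in> valuation_ring wv"
    by (auto simp: valuation_ring_def wv_0 wv_1 wv_minus intro: ultra wv_mult_le)
  interpret A: scalar_subring \<iota> "valuation_ring wv" by unfold_locales (use \<iota> central S in auto)
  have R: "1 \<in> R" "\<And>x y. x \<in> R \<Longrightarrow> y \<in> R \<Longrightarrow> x * y \<in> R" using R by (auto simp: is_order_def)
  have jR: "x * y \<in> j ` R" if "x \<in> j ` R" "y \<in> j ` R" for x y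
  proof -
    obtain a b where "a \<in> R" "b \<in> R" "x = j a" "y = j b" using \<open>x \<in> j ` R\<close> \<open>y \<in> j ` R\<close> by blast
    moreover have "j a * j b = j (a * b)" using j by (simp add: ring_map_def)
    ultimately show ?thesis using R(2) by (simp add: image_eqI)
  qed
  show jr: "j r \<in> R'" if "r \<in> R" for r
    using A.span_over_single[OF S(1), of "j r" "j ` R"] that \<iota> unfolding R'_def order_base_change_def ring_map_def by simp
  show "1 \<in> R'" using jr[OF R(1)] j by (simp add: ring_map_def)
  show "x + y \<in> R'" if "x \<in> R'" "y \<in> R'"
    using that unfolding R'_def order_base_change_def by (rule A.span_over_add)
  show "x - y \<in> R'" if "x \<in> R'" "y \<in> R'"
    using that unfolding R'_def order_base_change_def by (rule A.span_over_diff)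
  show "x * y \<in> R'" if "x \<in> R'" "y \<in> R'"
    using that unfolding R'_def order_base_change_def by (rule A.span_over_mult[rotated]) (rule jR)
  show "\<iota> c * x \<in> R'" if "c \<in> valuation_ring wv" "x \<in> R'"
    using that unfolding R'_def order_base_change_def by (rule A.span_over_scale)
qed

text \<open>The elements that some nonzero scalar brings into the extended order form a vector
  space. It contains the image of \<open>R\<close>, hence that of the original algebra, hence
  everything.\<close>

lemma order_base_change_full:
  fixes \<iota>0 :: "'f::field \<Rightarrow> 'b::ring_1" and \<iota> :: "'k::field \<Rightarrow> 'a::ring_1"
  assumes nv: "normalized_valuation \<iota> wv ord" and av: "absolute_value wv"
    and bc: "base_change \<iota>0 jF \<iota> j" and R: "is_order \<iota>0 S0 R"
  shows "\<exists>c. c \<noteq> 0 \<and> \<iota> c * y \<in> order_base_change \<iota> j (valuation_ring wv) R"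
proof -
  have bc': "ring_map jF" "ring_map \<iota>" "ring_map j" "\<And>c x. \<iota> c * x = x * \<iota> c" "\<And>c. j (\<iota>0 c) = \<iota> (jF c)"
    using bc by (auto simp: base_change_def)
  obtain X where X: "alg_basis \<iota> (j ` X)" using bc by (auto simp: base_change_def)
  interpret valued_algebra \<iota> wv ord by unfold_locales (use nv av bc' in auto)
  note R' = order_base_change_ring[OF nv av bc'(2,3,4) R]
  define R' where "R' = order_base_change \<iota> j (valuation_ring wv) R"
  define W where "W = {y. \<exists>c. c \<noteq> 0 \<and> \<iota> c * y \<in> R'}"
  \<comment> \<open>A multiplier that makes a given scalar integral and is itself integral: 1, or
    the inverse of a non-integral scalar.\<close>
  have scale: "\<exists>e. e \<noteq> 0 \<and> wv e \<le> 1 \<and> wv (e * c) \<le> 1" for c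
  proof (cases "wv c \<le> 1")
    case True
    then show ?thesis by (intro exI[of _ 1]) (simp add: wv_1)
  next
    case False
    then have c0: "c \<noteq> 0" using wv_0 by auto
    have "wv (inverse c) * wv c = 1" using c0 wv_1 wv_mult[of "inverse c" c] by simp
    moreover have "wv (inverse c) * 1 \<le> wv (inverse c) * wv c"
      using False wv_nonneg by (intro mult_left_mono) auto
    ultimately show ?thesis using c0 wv_1 by (intro exI[of _ "inverse c"]) simp
  qed
  have zero: "0 \<in> W" using R'(1) R'(3)[OF R'(1) R'(1)] by (auto simp: W_def R'_def intro: exI[of _ 1])
  have add: "x + y \<in> W" if xy: "x \<in> W" "y \<in> W" for x y
  proof -
    obtain c d where cd: "c \<noteq> 0" "\<iota> c * x \<in> R'" "d \<noteq> 0" "\<iota> d * y \<in> R'" using xy unfolding W_def by blast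
    obtain e where e: "e \<noteq> 0" "wv e \<le> 1" "wv (e * c) \<le> 1" using scale by blast
    obtain f where f: "f \<noteq> 0" "wv f \<le> 1" "wv (f * d) \<le> 1" using scale by blast
    have fe: "wv (f * d * e) \<le> 1" "wv (e * c * f) \<le> 1" using e f wv_mult_le by blast+
    have "\<iota> (f * d * e) * (\<iota> c * x) \<in> R'" "\<iota> (e * c * f) * (\<iota> d * y) \<in> R'"
      by (rule R'(6)[folded R'_def, rotated], use cd fe in \<open>simp_all add: valuation_ring_def\<close>)+
    moreover have "\<iota> (f * d * e) * (\<iota> c * x) = \<iota> (c * d * e * f) * x"
      "\<iota> (e * c * f) * (\<iota> d * y) = \<iota> (c * d * e * f) * y"
      unfolding mult.assoc[symmetric] \<iota>_simps(3)[symmetric] by (simp_all add: ac_simps)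
    ultimately have "\<iota> (c * d * e * f) * (x + y) \<in> R'"
      using R'(2) unfolding R'_def by (simp add: distrib_left)
    moreover have "c * d * e * f \<noteq> 0" using cd e f by simp
    ultimately show ?thesis unfolding W_def by blast
  qed
  have scaleW: "\<iota> c * y \<in> W" if y: "y \<in> W" for c y
  proof -
    obtain d where d: "d \<noteq> 0" "\<iota> d * y \<in> R'" using y unfolding W_def by blast
    obtain e where e: "e \<noteq> 0" "wv e \<le> 1" "wv (e * c) \<le> 1" using scale by blast
    have "\<iota> (e * c) * (\<iota> d * y) \<in> R'"
      by (rule R'(6)[folded R'_def, rotated]) (use d e in \<open>simp_all add: valuation_ring_def\<close>)
    moreover have "\<iota> (e * c) * (\<iota> d * y) = \<iota> (e * d) * (\<iota> c * y)"
      unfolding mult.assoc[symmetric] \<iota>_simps(3)[symmetric] by (simp add: ac_simps)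
    moreover have "e * d \<noteq> 0" using d e by simp
    ultimately show ?thesis unfolding W_def by (intro CollectI exI[of _ "e * d"]) simp
  qed
  have jR: "j r \<in> W" if "r \<in> R" for r
    using R'(5)[OF that] \<iota>_simps(1) unfolding W_def R'_def by (auto intro: exI[of _ 1])
  have jB: "j x \<in> W" for x
  proof -
    have "x \<in> span_over (alg_scale \<iota>0) UNIV R" using R by (auto simp: is_order_def)
    then obtain c Z where Z: "finite Z" "Z \<subseteq> R" "x = (\<Sum>z\<in>Z. \<iota>0 (c z) * z)" unfolding span_over_def by blast
    have j_simps: "j 0 = 0" "\<And>x y. j (x + y) = j x + j y" "\<And>x y. j (x * y) = j x * j y"
      using bc'(3) unfolding ring_map_def by (auto, metis add_cancel_right_right add.right_neutral)
    have js: "j (\<Sum>z\<in>A. \<iota>0 (c z) * z) = (\<Sum>z\<in>A. \<iota> (jF (c z)) * j z)" if "finite A" for A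
      using that by (induction A rule: finite_induct) (simp_all add: j_simps bc'(5))
    have "(\<Sum>z\<in>A. \<iota> (jF (c z)) * j z) \<in> W" if "finite A" "A \<subseteq> R" for A
      using that by (induction A rule: finite_induct) (auto intro!: zero add scaleW jR)
    then show ?thesis using Z js by simp
  qed
  interpret F: finite_dimensional_vector_space "alg_scale \<iota>" "j ` X" by (rule X)
  have "y \<in> F.span (j ` X)" using F.span_Basis by simp
  then have "y \<in> W"
    by (induction rule: F.span_induct_alt) (auto intro!: zero add scaleW jB)
  then show ?thesis unfolding W_def R'_def by blast
qed

text \<open>If \<open>g = \<iota> e\<close>, then \<open>c\<close> is the square of \<open>e\<close>
  and is nonnegative under the embedding that \<open>real_embedding\<close> provides.\<close>

lemma central_square_not_totally_negative:
  assumes F: "number_field TYPE('f::field_char_0)" "totally_real TYPE('f)"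
    and \<iota>: "ring_map (\<iota> :: 'f \<Rightarrow> 'b::ring_1)" and g: "g * g = \<iota> c" "totally_negative c"
  shows "g \<notin> range \<iota>"
proof
  assume "g \<in> range \<iota>"
  then obtain e where "g = \<iota> e" by blast
  then have c: "c = e * e" using g(1) ring_map_field_simps(7,8)[OF \<iota>] by metis
  obtain s :: "'f \<Rightarrow> real" where s: "ring_map s" using real_embedding[OF F] by blast
  have "s c = s e * s e" unfolding c by (rule ring_map_field_simps(7)[OF s])
  then have "s c \<ge> 0" by simp
  moreover have "s c < 0" using g(2) s by (simp add: totally_negative_def)
  ultimately show False by simp
qed

text \<open>The kernel is a two-sided ideal without 1. This keeps \<open>\<gamma>\<close> from
  becoming a scalar after base change.\<close>

lemma simple_ring_map_inj:
  assumes simple: "\<And>I::'b::ring_1 set. two_sided_ideal I \<Longrightarrow> I = {0} \<or> I = UNIV"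
    and j: "ring_map (j :: 'b \<Rightarrow> 'a::ring_1)" and x: "j x = j y"
  shows "x = y"
proof -
  have j': "j 1 = 1" "\<And>x y. j (x + y) = j x + j y" "\<And>x y. j (x * y) = j x * j y"
    using j by (auto simp: ring_map_def)
  have j0: "j 0 = 0" using j'(2)[of 0 0] by simp
  have "two_sided_ideal {z. j z = 0}" by (simp add: two_sided_ideal_def j' j0)
  moreover have "{z. j z = 0} \<noteq> UNIV"
  proof
    assume "{z. j z = 0} = UNIV"
    then have "j 1 = 0" by blast
    then show False using j'(1) by simp
  qed
  ultimately have "{z. j z = 0} = {0}" using simple by blast
  moreover have "j (x - y) = 0" using j'(2)[of "x - y" y] x by simp
  ultimately have "x - y = 0" by blast
  then show ?thesis by simp
qed

text \<open>The characteristic equation reads \<open>\<iota> t * g = \<iota> (c + n)\<close>, and a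
  nonzero trace \<open>t\<close> would make \<open>g\<close> a scalar.\<close>

lemma canonical_involution_trace_zero:
  assumes \<iota>: "ring_map (\<iota> :: 'k::field \<Rightarrow> 'a::ring_1)" and central: "\<And>c x. \<iota> c * x = x * \<iota> c"
    and ci: "canonical_involution \<iota> cj" and g: "g * g \<in> range \<iota>" "g \<notin> range \<iota>"
  shows "cj g = - g"
proof -
  obtain c where c: "g * g = \<iota> c" using g(1) by blast
  obtain t n where t: "g + cj g = \<iota> t" and n: "g * cj g = \<iota> n"
    using ci unfolding canonical_involution_def by (metis rangeE)
  note \<iota>s = ring_map_field_simps[OF \<iota>]
  have "g * g + g * cj g = g * \<iota> t" using t by (metis distrib_left)
  then have e: "\<iota> t * g = \<iota> (c + n)" using c n central[of t g] by (simp add: \<iota>s)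
  have "t = 0"
  proof (rule ccontr)
    assume "t \<noteq> 0"
    then have "g = \<iota> (inverse t) * (\<iota> t * g)"
      by (simp add: mult.assoc[symmetric] \<iota>s(7)[symmetric] \<iota>s(5))
    then have "g = \<iota> (inverse t * (c + n))" unfolding e by (simp add: \<iota>s)
    then show False using g(2) by blast
  qed
  then have "g + cj g = 0" using t by (simp add: \<iota>s)
  then show ?thesis by (simp add: eq_neg_iff_add_eq_0 add.commute)
qed

theorem theorem1p4:
  fixes \<iota> :: "'f::field_char_0 \<Rightarrow> 'b::ring_1"
    and cj star :: "'b \<Rightarrow> 'b" and \<gamma> \<gamma>' :: 'b and \<O> :: "'b set"
    and p :: nat and \<iota>D :: "rat \<Rightarrow> 'd::ring_1" and \<R> :: "'d set"
    and \<iota>DF :: "'f \<Rightarrow> 'df::ring_1" and jD :: "'d \<Rightarrow> 'df"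
    and v :: "'f \<Rightarrow> real" and jF :: "'f \<Rightarrow> 'fv::field" and abs_v :: "'fv \<Rightarrow> real"
    and \<iota>v :: "'fv \<Rightarrow> 'bv::ring_1" and jB :: "'b \<Rightarrow> 'bv" and cjv starv :: "'bv \<Rightarrow> 'bv"
    and OFv :: "'fv set" and Ov :: "'bv set" and ord :: "'bv \<Rightarrow> int"
    and K :: "'bv set" and \<sigma> :: "'bv \<Rightarrow> 'bv" and \<pi> :: 'fv and Pu :: 'bv
    and L :: "('bv, 'l::ab_group_add) bimodule" and r1 r2 t1 t2 :: nat
  assumes F: "number_field TYPE('f)" "totally_real TYPE('f)"
    and B: "quaternion_algebra \<iota>" "totally_indefinite \<iota>" "canonical_involution \<iota> cj"
    and gamma: "\<gamma> * \<gamma>' = 1" "\<gamma>' * \<gamma> = 1" "\<exists>c. \<gamma> * \<gamma> = \<iota> c \<and> totally_negative c"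
    and star: "\<forall>\<alpha>. star \<alpha> = \<gamma> * cj \<alpha> * \<gamma>'" "positive_involution \<iota> star"
    and order: "maximal_order \<iota> ring_of_integers \<O>" "star ` \<O> \<subseteq> \<O>"
    and p: "prime p" "standing_assumption p \<iota>D \<R> \<iota>DF jD"
    and v: "place_above p v" "ramified_at \<iota> v"
    and Fv: "field_completion v jF abs_v" "OFv = valuation_ring abs_v"
    and Bv: "base_change \<iota> jF \<iota>v jB" "Ov = order_base_change \<iota>v jB OFv \<O>"
      "canonical_involution \<iota>v cjv" "\<forall>\<alpha>. starv \<alpha> = jB \<gamma> * cjv \<alpha> * jB \<gamma>'"
      "normalized_valuation \<iota>v abs_v ord"
    and presentation: "local_presentation \<iota>v abs_v Ov K \<sigma> \<pi> Pu"
    and L: "bilattice \<iota>v OFv Ov L"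
      "has_structural_invariant \<iota>v abs_v Ov K \<sigma> \<pi> Pu L (r1, r2, t1, t2)"
  shows "((\<exists>h. perfect_hermitian_pairing \<iota>v OFv Ov cjv starv L h) \<longleftrightarrow>
      parity_condition (ord (jB \<gamma>)) r1 r2 t1 t2) \<and>
    (parity_condition (ord (jB \<gamma>)) r1 r2 t1 t2 \<longrightarrow>
      (\<exists>h. perfect_hermitian_pairing \<iota>v OFv Ov cjv starv L h \<and>
        (\<forall>(L' :: ('bv, 'm::ab_group_add) bimodule) h'.
           bilattice \<iota>v OFv Ov L' \<and>
           has_structural_invariant \<iota>v abs_v Ov K \<sigma> \<pi> Pu L' (r1, r2, t1, t2) \<and>
           perfect_hermitian_pairing \<iota>v OFv Ov cjv starv L' h' \<longrightarrow>
           isometric Ov L h L' h')))"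
proof -
  have quat: "ring_map \<iota>" "{z. \<forall>x. z * x = x * z} = range \<iota>"
    "\<And>I::'b set. two_sided_ideal I \<Longrightarrow> I = {0} \<or> I = UNIV"
    using B(1) by (auto simp: quaternion_algebra_def)
  have comp: "absolute_value abs_v" "ring_map jF" "\<And>x. abs_v (jF x) = v x"
    "\<And>y e. e > 0 \<Longrightarrow> \<exists>x. abs_v (y - jF x) < e"
    "\<And>s. cauchy_seq abs_v s \<Longrightarrow> \<exists>l. null_seq abs_v (\<lambda>n. s n - l)"
    using Fv(1) unfolding field_completion_def by blast+
  have bc: "ring_map \<iota>v" "ring_map jB" "\<And>c x. \<iota>v c * x = x * \<iota>v c" "\<And>c. jB (\<iota> c) = \<iota>v (jF c)"
    using Bv(1) unfolding base_change_def by blast+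
  have ord_R: "is_order \<iota> ring_of_integers \<O>" using order(1) by (simp add: maximal_order_def)
  note Fv(2)[simp]
  note Ov_eq = Bv(2)[unfolded Fv(2)]
  interpret V: valued_algebra \<iota>v abs_v ord
    by unfold_locales (rule bc(1) comp(1) Bv(5))+
  have char_not_2: "(1::'fv) + 1 \<noteq> 0"
  proof
    assume "(1::'fv) + 1 = 0"
    then have "jF (1 + 1) = 0" unfolding ring_map_field_simps(5,6)[OF comp(2)] .
    then show False using ring_map_field_simps(3)[OF comp(2)] by simp
  qed
  have residue: "\<exists>T. finite T \<and> (\<forall>x. abs_v x \<le> 1 \<longrightarrow> (\<exists>t\<in>T. abs_v (x - t) < 1))"
    using v(1) by (intro V.residue_field_finite[OF F(1) comp(2,4) p(1)]) (simp_all add: comp(3) place_above_def)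
  note ring = order_base_change_ring[OF Bv(5) comp(1) bc(1,2,3) ord_R, folded Ov_eq]
  note full = order_base_change_full[OF Bv(5) comp(1) Bv(1) ord_R, folded Ov_eq]
  interpret Q: local_quaternion \<iota>v abs_v cjv ord Ov K \<sigma> \<pi> Pu
    by unfold_locales
      (fact bc(3) comp(5) Bv(3) presentation ring(1) ring(2) ring(3) ring(4) full char_not_2 residue)+
  obtain \<delta> \<omega> where quat_order: "quat_order Q.OK cjv Pu \<delta> \<omega>" using Q.quat_order_exists by blast
  obtain c where c: "\<gamma> * \<gamma> = \<iota> c" "totally_negative c" using gamma(3) by blast
  have jB: "jB 1 = 1" "\<And>x y. jB (x * y) = jB x * jB y" using bc(2) by (auto simp: ring_map_def)
  \<comment> \<open>\<open>\<gamma>\<close> fails to commute with some \<open>x\<close>, and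
    injectivity of \<open>jB\<close> preserves this. So \<open>jB \<gamma>\<close> is not a scalar
    and, its square being one, has trace zero.\<close>
  have "\<gamma> \<notin> range \<iota>" by (rule central_square_not_totally_negative[OF F quat(1) c])
  then obtain x where x: "\<gamma> * x \<noteq> x * \<gamma>" using quat(2) by blast
  have "jB \<gamma> \<notin> range \<iota>v"
  proof
    assume "jB \<gamma> \<in> range \<iota>v"
    then have "jB \<gamma> * jB x = jB x * jB \<gamma>" using bc(3) by auto
    then have "jB (\<gamma> * x) = jB (x * \<gamma>)" by (simp add: jB)
    then show False using simple_ring_map_inj[OF quat(3) bc(2)] x by blast
  qed
  moreover have "jB \<gamma> * jB \<gamma> \<in> range \<iota>v" using c(1) bc(4) by (simp add: jB(2)[symmetric])
  ultimately have anti: "cjv (jB \<gamma>) = - jB \<gamma>"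
    using canonical_involution_trace_zero[OF bc(1,3) Bv(3)] by blast
  have inverse: "jB \<gamma> * jB \<gamma>' = 1" "jB \<gamma>' * jB \<gamma> = 1" using gamma(1,2) jB by metis+
  interpret G: local_gamma \<iota>v abs_v cjv ord Ov K \<sigma> \<pi> Pu "jB \<gamma>" "jB \<gamma>'" starv \<delta> \<omega>
    by (intro local_gamma.intro local_gamma_axioms.intro Q.local_quaternion_axioms
        inverse anti quat_order spec[OF Bv(4)])
  \<comment> \<open>Stated for a variable carrier type, as it is applied to \<open>L\<close> and to
    \<open>L'\<close>, whose carriers may have different types.\<close>
  have lattice: "local_lattice \<iota>v abs_v cjv ord Ov K \<sigma> \<pi> Pu (jB \<gamma>) (jB \<gamma>') starv \<delta> \<omega> M r1 r2 t1 t2"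
    if "bilattice \<iota>v OFv Ov M" "has_structural_invariant \<iota>v abs_v Ov K \<sigma> \<pi> Pu M (r1, r2, t1, t2)"
    for M :: "('bv, 'n::ab_group_add) bimodule"
    using that by (intro local_lattice.intro local_lattice_axioms.intro G.local_gamma_axioms) simp_all
  interpret A: local_lattice \<iota>v abs_v cjv ord Ov K \<sigma> \<pi> Pu "jB \<gamma>" "jB \<gamma>'" starv \<delta> \<omega> L r1 r2 t1 t2
    by (rule lattice[OF L])
  have uniq: "isometric Ov L h L' h'"
    if h: "perfect_hermitian_pairing \<iota>v OFv Ov cjv starv L h"
      and L': "bilattice \<iota>v OFv Ov L'" "has_structural_invariant \<iota>v abs_v Ov K \<sigma> \<pi> Pu L' (r1, r2, t1, t2)"
        "perfect_hermitian_pairing \<iota>v OFv Ov cjv starv L' h'"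
    for h h' and L' :: "('bv, 'm::ab_group_add) bimodule"
  proof -
    interpret T: two_lattices \<iota>v abs_v cjv ord Ov K \<sigma> \<pi> Pu "jB \<gamma>" "jB \<gamma>'" starv \<delta> \<omega> L L' r1 r2 t1 t2
      by (intro two_lattices.intro lattice L L'(1,2))
    show ?thesis using T.perfect_unique h L'(3) by simp
  qed
  have ex: "\<exists>h. perfect_hermitian_pairing \<iota>v OFv Ov cjv starv L h"
    if "parity_condition (ord (jB \<gamma>)) r1 r2 t1 t2"
    using A.perfect_exists[OF that] by simp
  moreover have "parity_condition (ord (jB \<gamma>)) r1 r2 t1 t2"
    if "perfect_hermitian_pairing \<iota>v OFv Ov cjv starv L h" for h
    using A.perfect_parity that by simp
  ultimately show ?thesis using uniq by blast
qed

end
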